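(* Let $p\in[1,\infty)$ and let $f\in\mathscr{H}^p(\mathbb{R}^2)$ be a radially symmetric function such that $$|f(r)|\le \frac{1}{|B_r(0)|}\int_{B_r(0)} f\,dx\qquad\text{for a.e. } r\in(0,\infty).$$ Then $\|\mathrm{D}\phi_1\|_{L^{2p}(\mathbb{R}^2)}^2\le C\,\|f\|_{\mathscr{H}^p(\mathbb{R}^2)}$, where $C$ is a constant independent of $f$. Moreover, if $p>1$, then $\phi_1$ is the unique $2p$-energy minimiser for $f$ on $\mathbb{R}^2$, modulo rotations. If $p=1$, the same statement holds in the class of admissible solutions: $\phi_1$ is, modulo rotations, the unique minimiser of $\int_{\mathbb{R}^2}|\mathrm{D}u|^2dx$ among all admissible solutions $u\in\dot W^{1,2}(\mathbb{R}^2,\mathbb{R}^2)$ of $\mathrm{J}u=f$.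
   Context: $\mathscr{H}^p(\mathbb{R}^2)$ is the real Hardy space, which equals $L^p(\mathbb{R}^2)$ for $p>1$. Write $\mathrm{J}u=\det\mathrm{D}u$ and $|A|=\mathrm{tr}(AA^{T})^{1/2}$. A function $f$ is radially symmetric if $f(x)$ depends only on $r=|x|$; one writes $f=f(r)$. The radial stretching is $$\phi_1(z)=\rho(|z|)\frac{z}{|z|},\qquad \rho(r)=\sqrt{\int_0^r2sf(s)\,ds}$$ (the radicand is non-negative by the hypothesis on $f$). $\dot W^{1,q}(\mathbb{R}^2,\mathbb{R}^2)$ is the homogeneous Sobolev space of maps with weak gradient in $L^q$, whose elements are identified when they differ by an additive constant. A map $u\in\dot W^{1,2p}(\mathbb{R}^2,\mathbb{R}^2)$ is a $2p$-energy minimiser for $f$ if $\mathrm{J}u=f$ a.e. and $\int_{\mathbb{R}^2}|\mathrm{D}u|^{2p}\le\int_{\mathbb{R}^2}|\mathrm{D}v|^{2p}$ for every $v\in\dot W^{1,2p}(\mathbb{R}^2,\mathbb{R}^2)$ with $\mathrm{J}v=f$ a.e. "Modulo rotations" means that $u$ and $Qu$ are identified for $Q\in\mathrm{SO}(2)$. A solution $u\in\dot W^{1,2}(\mathbb{R}^2,\mathbb{R}^2)$ of $\mathrm{J}u=f$ is admissible if it is continuous and satisfies the change of variables formula $\int_{B_r(0)}\mathrm{J}u\,dx=\int_{\mathbb{R}^2}\deg(y,u,B_r(0))\,dy$ for a.e. $r>0$, where $\deg(y,u,B_r(0))$ is the topological degree of $u$ at $y$ with respect to $B_r(0)$. *)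

theory Defs
  imports "HOL-Analysis.Analysis"
begin

section \<open>Smooth functions\<close>

primrec C_diff :: "nat \<Rightarrow> ('a::euclidean_space \<Rightarrow> real) \<Rightarrow> bool" where
  "C_diff 0 \<phi> \<longleftrightarrow> continuous_on UNIV \<phi>"
| "C_diff (Suc k) \<phi> \<longleftrightarrow>
     \<phi> differentiable_on UNIV \<and> (\<forall>b\<in>Basis. C_diff k (\<lambda>x. frechet_derivative \<phi> (at x) b))"

definition smooth :: "('a::euclidean_space \<Rightarrow> real) \<Rightarrow> bool" where
  "smooth \<phi> \<longleftrightarrow> (\<forall>k. C_diff k \<phi>)"

definition support :: "('a::topological_space \<Rightarrow> real) \<Rightarrow> 'a set" where
  "support \<phi> = closure {x. \<phi> x \<noteq> 0}"

definition locally_integrable :: "('a::euclidean_space \<Rightarrow> 'b::euclidean_space) \<Rightarrow> bool" where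
  "locally_integrable f \<longleftrightarrow> (\<forall>K. compact K \<longrightarrow> f absolutely_integrable_on K)"

section \<open>The real Hardy spaces on the plane\<close>

text \<open>The real Hardy space is given by the grand maximal function
  \<open>M f x = sup {\<bar>(f * \<phi>\<^sub>t) x\<bar>}\<close>, where \<open>\<phi>\<^sub>t y = \<phi> (y / t) / t\<^sup>2\<close>, the supremum being over all
  \<open>t > 0\<close> and all smooth \<open>\<phi>\<close> supported in the open unit ball with \<open>\<bar>\<nabla>\<phi>\<bar> \<le> 1\<close>.
  For \<open>p > 1\<close> it is \<open>L\<^sup>p\<close>, with an equivalent norm.\<close>

definition hardy_tests :: "(real^2 \<Rightarrow> real) set" where
  "hardy_tests =
     {\<phi>. smooth \<phi> \<and> support \<phi> \<subseteq> ball 0 1 \<and> (\<forall>x. onorm (frechet_derivative \<phi> (at x)) \<le> 1)}"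

definition grand_maximal :: "(real^2 \<Rightarrow> real) \<Rightarrow> real^2 \<Rightarrow> ennreal" where
  "grand_maximal f x =
     (SUP (\<phi>, t) \<in> hardy_tests \<times> {0<..}.
        ennreal \<bar>LINT y|lebesgue. f y * (\<phi> ((x - y) /\<^sub>R t) / t\<^sup>2)\<bar>)"

definition ennreal_powr :: "ennreal \<Rightarrow> real \<Rightarrow> ennreal" where
  "ennreal_powr a p = (if a = \<infinity> then \<infinity> else ennreal (enn2real a powr p))"

definition hardy_space :: "real \<Rightarrow> (real^2 \<Rightarrow> real) \<Rightarrow> bool" where
  "hardy_space p f \<longleftrightarrow>
     locally_integrable f \<and> (\<integral>\<^sup>+x. ennreal_powr (grand_maximal f x) p \<partial>lebesgue) < \<infinity>"

definition hardy_norm :: "real \<Rightarrow> (real^2 \<Rightarrow> real) \<Rightarrow> real" where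
  "hardy_norm p f = enn2real (\<integral>\<^sup>+x. ennreal_powr (grand_maximal f x) p \<partial>lebesgue) powr (1 / p)"

section \<open>Homogeneous Sobolev maps of the plane\<close>

definition has_weak_gradient :: "(real^2 \<Rightarrow> real^2) \<Rightarrow> (real^2 \<Rightarrow> real^2^2) \<Rightarrow> bool" where
  "has_weak_gradient u G \<longleftrightarrow> locally_integrable u \<and> locally_integrable G \<and>
     (\<forall>\<phi>. smooth \<phi> \<and> compact (support \<phi>) \<longrightarrow>
        (\<forall>i j. (LINT x|lebesgue. u x $ i * frechet_derivative \<phi> (at x) (axis j 1))
             = - (LINT x|lebesgue. G x $ i $ j * \<phi> x)))"

text \<open>A weak gradient is unique up to null sets, so the choice of representative is immaterial.\<close>

definition weak_grad :: "(real^2 \<Rightarrow> real^2) \<Rightarrow> real^2 \<Rightarrow> real^2^2" where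
  "weak_grad u = (SOME G. has_weak_gradient u G)"

definition matrix_norm :: "real^2^2 \<Rightarrow> real" where
  "matrix_norm A = sqrt (trace (A ** transpose A))"

definition homog_sobolev :: "real \<Rightarrow> (real^2 \<Rightarrow> real^2) \<Rightarrow> bool" where
  "homog_sobolev q u \<longleftrightarrow> (\<exists>G. has_weak_gradient u G) \<and>
     integrable lebesgue (\<lambda>x. matrix_norm (weak_grad u x) powr q)"

definition energy :: "real \<Rightarrow> (real^2 \<Rightarrow> real^2) \<Rightarrow> real" where
  "energy q u = (LINT x|lebesgue. matrix_norm (weak_grad u x) powr q)"

definition grad_norm :: "real \<Rightarrow> (real^2 \<Rightarrow> real^2) \<Rightarrow> real" where
  "grad_norm q u = energy q u powr (1 / q)"

definition weak_jacobian :: "(real^2 \<Rightarrow> real^2) \<Rightarrow> real^2 \<Rightarrow> real" where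
  "weak_jacobian u x = det (weak_grad u x)"

definition solves :: "(real^2 \<Rightarrow> real) \<Rightarrow> (real^2 \<Rightarrow> real^2) \<Rightarrow> bool" where
  "solves f u \<longleftrightarrow> (AE x in lebesgue. weak_jacobian u x = f x)"

text \<open>Equality in the homogeneous Sobolev space, i.e. up to null sets and additive constants,
  after identifying \<open>u\<close> with \<open>Q u\<close> for \<open>Q\<close> in \<open>SO(2)\<close>.\<close>

definition eq_mod_rotation :: "(real^2 \<Rightarrow> real^2) \<Rightarrow> (real^2 \<Rightarrow> real^2) \<Rightarrow> bool" where
  "eq_mod_rotation u v \<longleftrightarrow>
     (\<exists>Q c. rotation_matrix Q \<and> (AE x in lebesgue. u x = Q *v v x + c))"

definition energy_minimiser :: "real \<Rightarrow> (real^2 \<Rightarrow> real) \<Rightarrow> (real^2 \<Rightarrow> real^2) \<Rightarrow> bool" where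
  "energy_minimiser q f u \<longleftrightarrow> homog_sobolev q u \<and> solves f u \<and>
     (\<forall>v. homog_sobolev q v \<and> solves f v \<longrightarrow> energy q u \<le> energy q v)"

section \<open>Topological degree and admissible solutions\<close>

text \<open>The degree at \<open>y \<notin> u(\<partial>\<Omega>)\<close> is the signed number of preimages of \<open>y\<close> in \<open>\<Omega>\<close> under any smooth
  \<open>v\<close> with regular value \<open>y\<close> that is closer to \<open>u\<close> on the closure of \<open>\<Omega>\<close> than \<open>y\<close> is to \<open>u(\<partial>\<Omega>)\<close>;
  this does not depend on \<open>v\<close>. It is set to \<open>0\<close> on \<open>u(\<partial>\<Omega>)\<close>, where the degree is undefined.\<close>

definition regular_degree ::
    "real^2 \<Rightarrow> (real^2 \<Rightarrow> real^2) \<Rightarrow> (real^2) set \<Rightarrow> real" where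
  "regular_degree y v \<Omega> = (\<Sum>x | x \<in> \<Omega> \<and> v x = y. sgn (det (jacobian v (at x))))"

definition topological_degree ::
    "real^2 \<Rightarrow> (real^2 \<Rightarrow> real^2) \<Rightarrow> (real^2) set \<Rightarrow> int" where
  "topological_degree y u \<Omega> =
     (if y \<in> u ` frontier \<Omega> then 0
      else THE d. \<exists>v. (\<forall>i. smooth (\<lambda>x. v x $ i))
             \<and> (\<forall>x\<in>closure \<Omega>. norm (v x - u x) < infdist y (u ` frontier \<Omega>))
             \<and> (\<forall>x\<in>\<Omega>. v x = y \<longrightarrow> det (jacobian v (at x)) \<noteq> 0)
             \<and> of_int d = regular_degree y v \<Omega>)"

definition admissible :: "(real^2 \<Rightarrow> real) \<Rightarrow> (real^2 \<Rightarrow> real^2) \<Rightarrow> bool" where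
  "admissible f u \<longleftrightarrow> homog_sobolev 2 u \<and> solves f u \<and> continuous_on UNIV u \<and>
     (AE r in lebesgue. r > 0 \<longrightarrow>
        integrable lebesgue (\<lambda>y. real_of_int (topological_degree y u (ball 0 r))) \<and>
        (LINT x:ball 0 r|lebesgue. weak_jacobian u x)
          = (LINT y|lebesgue. real_of_int (topological_degree y u (ball 0 r))))"

definition admissible_minimiser :: "(real^2 \<Rightarrow> real) \<Rightarrow> (real^2 \<Rightarrow> real^2) \<Rightarrow> bool" where
  "admissible_minimiser f u \<longleftrightarrow> admissible f u \<and>
     (\<forall>v. admissible f v \<longrightarrow> energy 2 u \<le> energy 2 v)"

section \<open>Radial data and the radial stretching\<close>

text \<open>\<open>g\<close> is the profile \<open>r \<mapsto> f(r)\<close> of the radially symmetric function \<open>f\<close>, both being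
  determined up to null sets only.\<close>

definition radial_with_profile :: "(real^2 \<Rightarrow> real) \<Rightarrow> (real \<Rightarrow> real) \<Rightarrow> bool" where
  "radial_with_profile f g \<longleftrightarrow> (AE x in lebesgue. f x = g (norm x))"

definition stretch_radius :: "(real \<Rightarrow> real) \<Rightarrow> real \<Rightarrow> real" where
  "stretch_radius g r = sqrt (LINT s:{0..r}|lebesgue. 2 * s * g s)"

definition radial_stretching :: "(real \<Rightarrow> real) \<Rightarrow> real^2 \<Rightarrow> real^2" where
  "radial_stretching g z = stretch_radius g (norm z) *\<^sub>R (z /\<^sub>R norm z)"

end

theory Submission
 imports Defs "HOL-Complex_Analysis.Winding_Numbers"
begin

text \<open>In polar coordinates the area enclosed by the image of almost every circle is at most half its
 length integral; this is a Wirtinger inequality, first for mollifications and then in the limit. The enclosed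
 area is \<open>pi F r\<close> with \<open>F r\<close> the integral of \<open>2 s g s\<close> over \<open>[0, r]\<close>, for every map with Jacobian \<open>f\<close>.
 Convexity of \<open>t powr p\<close> and the hypothesis \<open>g r <= F r / r^2\<close> turn this into the lower bound
 \<open>E0 = F / r^2 + g^2 / (F / r^2)\<close> for the energy density, which the stretching attains. Equality forces every
 circle to be mapped to a circle with constant speed; a differential equation in \<open>r\<close> shows that
 centre and phase do not depend on \<open>r\<close>. The norm estimate bounds \<open>F r / r^2\<close> by the grand maximal
 function through one explicit bump. For \<open>p = 1\<close> the degree of the stretching is computed as a winding number.\<close>

text \<open>The obstacle is that a map with gradient in L^2 need not be continuous, so its
  restriction to one circle, and the area enclosed there, have no pointwise meaning. Every quantity
  attached to a circle is therefore formed as a function of r that is continuous in L1 under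
  mollification; enclosed area is read as the integral of the Jacobian over the disc, and
  conclusions hold for almost every r. Before a differential equation in r can be integrated, such
  almost everywhere defined functions need absolutely continuous representatives, which are built on
  intervals away from 0. The hypothesis enters as 1 - g^2 / (F / r^2)^2 >= 0: this is the weight
  with which surplus tangential energy on a circle is charged. It also makes F / r^2 decreasing and
  F r^2 increasing, so that F vanishes identically or is positive for all r > 0. For the degree, the
  signed number of preimages is tied to the change of argument along the boundary by the same area
  formula, applied to a map whose modulus is capped at one.\<close>

abbreviation borel_fun :: "('a::topological_space => 'b::topological_space) set" where "borel_fun == borel_measurable borel"
abbreviation contU :: "('a::topological_space => 'b::topological_space) => bool" where "contU == continuous_on UNIV"
abbreviation circ_int :: "(real => real) => real" where "circ_int == integral {0..2*pi}"
abbreviation "nnint == nn_integral"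
abbreviation ind :: "'a set => 'a => 'b::zero_neq_one" where "ind == indicator"
abbreviation "fderiv == frechet_derivative"
lemmas cont_subset = continuous_on_subset and  cont_borel = borel_measurable_continuous_onI and  real_vec_deriv = has_real_derivative_iff_has_vector_derivative and  set_LINT = set_lebesgue_integral_eq_integral and  cont_comp = continuous_on_compose2 and  cont_mult = continuous_on_mult and  cont_const = continuous_on_const and  cont_id = continuous_on_id and  cont_diff = continuous_on_diff and  cont_add = continuous_on_add and  cont_fst = continuous_on_fst and  cont_snd = continuous_on_snd and  FTC = fundamental_theorem_of_calculus and  HK_combine = Henstock_Kurzweil_Integration.integral_combine and  HK_add = Henstock_Kurzweil_Integration.integral_add and  LINT_cong = Bochner_Integration.integral_cong and  LINT_diff = Bochner_Integration.integrable_diff and  deriv_within = has_field_derivative_at_within and  integrable_meas = borel_measurable_integrable and  cont_at_on = continuous_at_imp_continuous_on and  cont_integrable = integrable_continuous_real and  sq_eq = power2_eq_square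

section \<open>Absolutely continuous functions of one variable\<close>

definition AC_on :: "real => real => (real => real) => (real => real) => bool" where
 "AC_on a b F h \<longleftrightarrow> h absolutely_integrable_on {a..b} &
  (\<forall>x y. a <= x & x <= y & y <= b --> F y - F x = integral {x..y} h)"

lemma AC_onD:
 assumes "AC_on a b F h" "a <= x" "x <= y" "y <= b"
 shows "F y - F x = integral {x..y} h"
 using assms by (auto simp: AC_on_def)

lemma AC_on_abs_integrable:
 assumes "AC_on a b F h" "a <= x" "y <= b"
 shows "h absolutely_integrable_on {x..y}"
 by (rule absolutely_integrable_on_subinterval[OF conjunct1[OF assms(1)[unfolded AC_on_def]]])
  (use assms in auto)

lemmas AC_on_integrable = set_LINT(1)[OF AC_on_abs_integrable]

lemma AC_on_subset:
 assumes "AC_on a b F h" "a <= c" "d <= b"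
 shows "AC_on c d F h"
 unfolding AC_on_def
 using AC_on_abs_integrable[OF assms] AC_onD[OF assms(1)] assms(2,3) by simp

lemma AC_on_continuous:
 assumes "AC_on a b F h"
 shows "continuous_on {a..b} F"
proof (cases "a <= b")
 case True
 have h: "h integrable_on {a..b}"
  using AC_on_integrable[OF assms] by simp
 have "continuous_on {a..b} (%x. F a + integral {a..x} h)"
  by (rule cont_add[OF cont_const indefinite_integral_continuous_1[OF h]])
 moreover have "F x = F a + integral {a..x} h" if "x : {a..b}" for x
  using AC_onD[OF assms, of a x] that by simp
 ultimately show ?thesis using continuous_on_eq by (metis (no_types, lifting))
qed auto

text \<open>The left side is subadditive and the right side additive over adjacent intervals, so
  bounds on pieces shorter than \<open>d\<close> add up. The induction is on the number of
  pieces.\<close>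

lemma increment_bound_local_to_global:
 fixes H M :: "real => real"
 assumes d: "d > 0"
  and loc: "!!s t. a <= s ==> s <= t ==> t <= b ==> t - s < d ==> \<bar>H t - H s\<bar> <= M t - M s"
  and "a <= s" "s <= t" "t <= b"
 shows "\<bar>H t - H s\<bar> <= M t - M s"
proof -
 have gen: "a <= s ==> s <= t ==> t <= b ==> t - s < real n * d ==> \<bar>H t - H s\<bar> <= M t - M s" for n s t
 proof (induction n arbitrary: s t)
  case 0 then show ?case by simp
 next
  case (Suc n)
  show ?case
  proof (cases "t - s < d")
  case True then show ?thesis using loc Suc by auto
  next
  case False
  define q where "q = real n * d"
  have q: "real (Suc n) * d = q + d" by (simp add: q_def algebra_simps)
  have "0 <= q" unfolding q_def using d by simp
  obtain m where m: "s <= m" "m <= t" "m - s < q" "t - m < d"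
  proof (rule that[of "max s (t - d + min d (q + d - (t - s)) / 2)"])
  show "s <= max s (t - d + min d (q + d - (t - s)) / 2)" by simp
  show "max s (t - d + min d (q + d - (t - s)) / 2) <= t" using Suc.prems q False \<open>0 <= q\<close> d
  by (auto simp: field_simps min_def)
  show "max s (t - d + min d (q + d - (t - s)) / 2) - s < q" using Suc.prems q False \<open>0 <= q\<close> d
  by (auto simp: field_simps min_def max_def)
  show "t - max s (t - d + min d (q + d - (t - s)) / 2) < d" using Suc.prems q False \<open>0 <= q\<close> d
  by (auto simp: field_simps min_def max_def)
  qed
  have "\<bar>H m - H s\<bar> <= M m - M s" using Suc.IH[of s m] m Suc.prems unfolding q_def by auto
  moreover have "\<bar>H t - H m\<bar> <= M t - M m" using loc[of m t] m Suc.prems by auto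
  ultimately show ?thesis by linarith
  qed
 qed
 obtain n where "t - s < real n * d" using d by (metis reals_Archimedean3)
 thus ?thesis using gen assms by blast
qed

text \<open>On a short interval the mean value theorem gives \<open>S' (F \<tau>)\<close> times the
  integral of \<open>h\<close>, and uniform continuity of \<open>S' \<circ> F\<close> compares this
  with the integral of the product. The error is at most \<open>e\<close> times the integral of
  \<open>\<bar>h\<bar>\<close>, which is additive and therefore survives chaining whatever the
  number of pieces. The domain is an arbitrary interval \<open>I\<close>, so that
  \<open>sqrt\<close> on the open half-line is covered.\<close>

lemma AC_on_compose:
 assumes F: "AC_on a b F h"
  and I: "F ` {a..b} \<subseteq> I" "is_interval I"
  and S: "!!y. y : I ==> (S has_real_derivative S' y) (at y within I)"
  and S': "continuous_on I S'"
 shows "AC_on a b (%t. S (F t)) (%t. S' (F t) * h t)"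
proof -
 have cF: "continuous_on {a..b} F" using AC_on_continuous[OF F] .
 have cSF: "continuous_on {a..b} (%t. S' (F t))"
  using cont_comp[OF S' cF I(1)] .
 have hai: "h absolutely_integrable_on {a..b}" using AC_on_abs_integrable[OF F] by simp
 have ai: "(%t. S' (F t) * h t) absolutely_integrable_on {a..b}"
  using hai
  by (intro absolutely_integrable_bounded_measurable_product_real
  continuous_imp_measurable_on_sets_lebesgue cSF
  compact_imp_bounded compact_continuous_image) auto
 have hi: "h integrable_on {a..b}" and hai': "(%t. \<bar>h t\<bar>) integrable_on {a..b}"
  using hai absolutely_integrable_on_def[where f=h and S="{a..b}"] by simp_all
 have "S (F y) - S (F x) = integral {x..y} (%t. S' (F t) * h t)"
  if xy: "a <= x" "x <= y" "y <= b" for x y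
 proof -
  define J where "J t = integral {a..t} (%t. S' (F t) * h t)" for t
  define A where "A t = integral {a..t} (%t. \<bar>h t\<bar>)" for t
  have Jd: "J t - J s = integral {s..t} (%t. S' (F t) * h t)" if "a <= s" "s <= t" "t <= b" for s t
  proof -
  have "(%t. S' (F t) * h t) integrable_on {a..t}"
  using integrable_on_subinterval[OF set_LINT(1)[OF ai]] that by simp
  from HK_combine[OF that(1,2) this] show ?thesis unfolding J_def by linarith
  qed
  have Ad: "A t - A s = integral {s..t} (%t. \<bar>h t\<bar>)" if "a <= s" "s <= t" "t <= b" for s t
  proof -
  have "(%t. \<bar>h t\<bar>) integrable_on {a..t}"
  using integrable_on_subinterval[OF hai'] that by simp
  from HK_combine[OF that(1,2) this] show ?thesis unfolding A_def by linarith
  qed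
  have key: "\<bar>(S (F y) - J y) - (S (F x) - J x)\<bar> <= e * A y - e * A x" if e: "e > 0" for e
  proof -
  have "uniformly_continuous_on {a..b} (%t. S' (F t))"
  using compact_uniformly_continuous[OF cSF] by auto
  then obtain d where d: "d > 0" "!!t s. t : {a..b} ==> s : {a..b} ==> dist t s < d ==> dist (S' (F t)) (S' (F s)) < e"
  unfolding uniformly_continuous_on_def using e by meson
  have loc: "\<bar>(S (F t) - J t) - (S (F s) - J s)\<bar> <= e * A t - e * A s"
  if st: "a <= s" "s <= t" "t <= b" "t - s < d" for s t
  proof -
  have Fst: "F s : I" "F t : I" using I st by auto
  have "\<exists>\<xi>. \<xi> \<in> closed_segment (F s) (F t) & S (F t) - S (F s) = S' \<xi> * (F t - F s)"
  proof (cases "F s = F t")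
  case True then show ?thesis by (intro exI[of _ "F s"]) auto
  next
  case False
  have sub: "closed_segment (F s) (F t) \<subseteq> I"
  using Fst I(2) by (simp add: closed_segment_subset is_interval_convex_1)
  have seg: "{min (F s) (F t)..max (F s) (F t)} = closed_segment (F s) (F t)"
  by (auto simp: closed_segment_eq_real_ivl)
  have mlt: "min (F s) (F t) < max (F s) (F t)" using False by auto
  obtain z where z: "z : {min (F s) (F t)<..<max (F s) (F t)}"
  "S (max (F s) (F t)) - S (min (F s) (F t)) = (max (F s) (F t) - min (F s) (F t)) * S' z"
  proof -
  have "\<exists>z\<in>{min (F s) (F t)<..<max (F s) (F t)}. S (max (F s) (F t)) - S (min (F s) (F t)) = (%x. (*) (S' z) x) (max (F s) (F t) - min (F s) (F t))"
  proof (rule mvt_simple[OF mlt])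
  fix x assume "min (F s) (F t) <= x" "x <= max (F s) (F t)"
  hence "x : I" using seg sub by auto
  thus "(S has_derivative (*) (S' x)) (at x within {min (F s) (F t)..max (F s) (F t)})"
  using has_derivative_subset[OF S[of x, unfolded has_field_derivative_def]] seg sub by auto
  qed
  then obtain z where "z\<in>{min (F s) (F t)<..<max (F s) (F t)}" "S (max (F s) (F t)) - S (min (F s) (F t)) = S' z * (max (F s) (F t) - min (F s) (F t))"
  by blast
  thus ?thesis using that[of z] by (simp only: mult.commute)
  qed
  show ?thesis
  proof (intro exI[of _ z] conjI)
  show "z : closed_segment (F s) (F t)" using z(1) seg by force
  show "S (F t) - S (F s) = S' z * (F t - F s)"
  proof (cases "F s <= F t")
  case True
  with z(2) show ?thesis by (simp add: min_absorb1 max_absorb2)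
  next
  case False
  hence "min (F s) (F t) = F t" "max (F s) (F t) = F s" by auto
  with z(2) show ?thesis by (simp add: algebra_simps)
  qed
  qed
  qed
  then obtain \<xi> where \<xi>: "\<xi> \<in> closed_segment (F s) (F t)" "S (F t) - S (F s) = S' \<xi> * (F t - F s)" by blast
  \<comment> \<open>The mean value point \<xi> lies between two values of \<open>F\<close>, hence is
    itself the value at some \<tau> of the interval.\<close>
  have "connected (F ` {s..t})" using st
  by (intro connected_continuous_image cont_subset[OF cF]) auto
  hence "is_interval (F ` {s..t})" by (simp add: is_interval_connected_1)
  moreover have "F s : F ` {s..t}" "F t : F ` {s..t}" using st by auto
  ultimately have "\<xi> \<in> F ` {s..t}" using \<xi>(1)
  by (meson closed_segment_subset is_interval_convex subsetD)
  then obtain \<tau> where \<tau>: "\<tau> \<in> {s..t}" "\<xi> = F \<tau>" by auto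
  have hst: "h integrable_on {s..t}" "(%t. \<bar>h t\<bar>) integrable_on {s..t}" "(%t. S' (F t) * h t) integrable_on {s..t}"
  using integrable_on_subinterval[OF hi] integrable_on_subinterval[OF hai']
  integrable_on_subinterval[OF set_LINT(1)[OF ai]] st by simp_all
  have "(S (F t) - J t) - (S (F s) - J s) = S' (F \<tau>) * integral {s..t} h - integral {s..t} (%u. S' (F u) * h u)"
  using \<xi>(2) \<tau> Jd[of s t] st AC_onD[OF F, of s t] by auto
  also have "... = integral {s..t} (%u. S' (F \<tau>) * h u - S' (F u) * h u)"
  using Henstock_Kurzweil_Integration.integral_diff[OF integrable_on_mult_right[OF hst(1), of "S' (F \<tau>)"] hst(3)]
  by simp
  finally have eq: "(S (F t) - J t) - (S (F s) - J s)
  = integral {s..t} (%u. S' (F \<tau>) * h u - S' (F u) * h u)" .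
  have "norm (integral {s..t} (%u. S' (F \<tau>) * h u - S' (F u) * h u)) <= integral {s..t} (%u. e * \<bar>h u\<bar>)"
  proof (rule integral_norm_bound_integral)
  show "(%u. S' (F \<tau>) * h u - S' (F u) * h u) integrable_on {s..t}"
  using integrable_diff[OF integrable_on_mult_right[OF hst(1), of "S' (F \<tau>)"] hst(3)] .
  show "(%u. e * \<bar>h u\<bar>) integrable_on {s..t}"
  using integrable_on_mult_right[OF hst(2), of e] .
  show "norm (S' (F \<tau>) * h u - S' (F u) * h u) <= e * \<bar>h u\<bar>" if "u : {s..t}" for u
  proof -
  have "dist (S' (F \<tau>)) (S' (F u)) < e"
  using d(2)[of \<tau> u] that \<tau> st by (auto simp: dist_real_def)
  hence "\<bar>S' (F \<tau>) - S' (F u)\<bar> * \<bar>h u\<bar> <= e * \<bar>h u\<bar>"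
  by (intro mult_right_mono) (auto simp: dist_real_def)
  thus ?thesis by (simp add: abs_mult[symmetric] left_diff_distrib)
  qed
  qed
  also have "... = e * A t - e * A s" using Ad[of s t] st
  by (simp add: right_diff_distrib[symmetric])
  finally show ?thesis unfolding eq by simp
  qed
  show ?thesis
  using increment_bound_local_to_global[where H="%t. S (F t) - J t" and M="%t. e * A t", OF d(1) loc xy] by simp
  qed
  have "\<bar>(S (F y) - J y) - (S (F x) - J x)\<bar> <= 0"
  proof (rule field_le_epsilon)
  fix e :: real assume "e > 0"
  define K where "K = \<bar>A y - A x\<bar> + 1"
  have K: "K > 0" by (simp add: K_def)
  have "e / K * A y - e / K * A x <= e / K * K"
  unfolding right_diff_distrib[symmetric] using \<open>e > 0\<close> K by (intro mult_left_mono) (auto simp: K_def)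
  hence "e / K * A y - e / K * A x <= e" using K by simp
  thus "\<bar>(S (F y) - J y) - (S (F x) - J x)\<bar> <= 0 + e" using key[of "e/K"] \<open>e>0\<close> K by auto
  qed
  thus ?thesis using Jd[OF xy] by simp
 qed
 thus ?thesis unfolding AC_on_def using ai by auto
qed

lemma AC_on_add:
 assumes "AC_on a b F h" "AC_on a b G k"
 shows "AC_on a b (%t. F t + G t) (%t. h t + k t)"
 unfolding AC_on_def
proof (intro conjI allI impI)
 show "(%t. h t + k t) absolutely_integrable_on {a..b}"
  using set_integral_add(1)[OF assms[THEN AC_on_abs_integrable[OF _ order_refl order_refl]]] .
 fix x y assume xy: "a <= x & x <= y & y <= b"
 have i: "h integrable_on {x..y}" "k integrable_on {x..y}"
  using AC_on_integrable[OF assms(1)] AC_on_integrable[OF assms(2)] xy by simp_all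
 show "F y + G y - (F x + G x) = integral {x..y} (%t. h t + k t)"
  using AC_onD[OF assms(1), of x y] AC_onD[OF assms(2), of x y] xy
  by (simp add: HK_add[OF i])
qed

lemma AC_on_cmult:
 assumes "AC_on a b F h"
 shows "AC_on a b (%t. c * F t) (%t. c * h t)"
 using AC_on_compose[OF assms, of UNIV "%t. c * t" "%_. c"]
 by (auto intro!: derivative_eq_intros)

lemma AC_on_cong:
 assumes "AC_on a b F h" "!!t. a <= t ==> t <= b ==> F t = G t" "!!t. a <= t ==> t <= b ==> h t = k t"
 shows "AC_on a b G k"
proof -
 have "k absolutely_integrable_on {a..b} \<longleftrightarrow> h absolutely_integrable_on {a..b}"
  using assms(3) by (intro set_integrable_cong) auto
 moreover have "integral {x..y} k = integral {x..y} h" if "a <= x" "x <= y" "y <= b" for x y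
  using assms(3) that by (intro integral_cong) auto
 ultimately show ?thesis using assms unfolding AC_on_def by auto
qed

text \<open>Polarisation: the product is a combination of three squares, and squares are
  compositions with a smooth function.\<close>

lemma AC_on_mult:
 assumes "AC_on a b F h" "AC_on a b G k"
 shows "AC_on a b (%t. F t * G t) (%t. h t * G t + F t * k t)"
proof -
 have sq: "AC_on a b (%t. (F t)^2) (%t. 2 * F t * h t)" if "AC_on a b F h" for F h
  by (rule AC_on_compose[OF that, of UNIV "%t. t\<^sup>2" "%t. 2 * t"])
  (auto intro!: derivative_eq_intros continuous_intros)
 have "AC_on a b (%t. (1/2) * ((F t + G t)^2 + ((-1) * (F t)^2 + (-1) * (G t)^2)))
  (%t. (1/2) * (2 * (F t + G t) * (h t + k t) + ((-1) * (2 * F t * h t) + (-1) * (2 * G t * k t))))"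
  by (intro AC_on_cmult AC_on_add sq assms)
 thus ?thesis by (rule AC_on_cong) (auto simp: sq_eq field_simps)
qed

lemma AC_on_C1:
 assumes "!!t. a <= t ==> t <= b ==> (F has_real_derivative h t) (at t)" "continuous_on {a..b} h"
 shows "AC_on a b F h"
 unfolding AC_on_def
proof (intro conjI allI impI)
 show "h absolutely_integrable_on {a..b}" using assms(2) by (rule absolutely_integrable_continuous_real)
 fix x y assume xy: "a <= x & x <= y & y <= b"
 have "(h has_integral F y - F x) {x..y}"
  using assms(1) xy by (intro FTC)
  (auto simp: real_vec_deriv[symmetric] intro: deriv_within)
 thus "F y - F x = integral {x..y} h" by (simp add: integral_unique)
qed

lemma AC_on_nonneg_mono:
 assumes "AC_on a b F h" "AE t in lebesgue. a <= t & t <= b --> 0 <= h t" "a <= x" "x <= y" "y <= b"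
 shows "F x <= F y"
proof -
 have ai: "h absolutely_integrable_on {x..y}"
  using AC_on_abs_integrable[OF assms(1,3,5)] .
 have "F y - F x = (LINT t:{x..y}|lebesgue. h t)"
  using AC_onD[OF assms(1,3-5)] set_LINT(2)[OF ai] by simp
 moreover have "(LINT t:{x..y}|lebesgue. h t) >= 0"
  unfolding set_lebesgue_integral_def using assms(2-)
  by (intro integral_nonneg_AE) (auto simp: indicator_def elim!: eventually_mono)
 ultimately show ?thesis by simp
qed

section \<open>Polar coordinates\<close>

definition pol :: "real => real => real^2" where
 "pol r th = vector [r * cos th, r * sin th]"

text \<open>Since \<open>ennreal\<close> sends negative numbers to 0, this is r dr on the half-line.
  \<open>circm\<close> is the angular measure over one period, and the product of the two is the
  polar form of Lebesgue measure in the plane.\<close>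

definition radm :: "real measure" where "radm = density lborel ennreal"
definition circm :: "real measure" where "circm = density lborel (ind {0..2*pi})"
abbreviation "polm == radm \<Otimes>\<^sub>M circm"

lemma pol_nth [simp]: "pol r th $ 1 = r * cos th" "pol r th $ 2 = r * sin th"
 by (auto simp: pol_def)

lemma sets_radm [simp, measurable_cong]: "sets radm = sets borel" by (simp add: radm_def)
lemma sets_circm [simp, measurable_cong]: "sets circm = sets borel" by (simp add: circm_def)
lemma space_radm [simp]: "space radm = UNIV" by (simp add: radm_def)
lemma space_circm [simp]: "space circm = UNIV" by (simp add: circm_def)

lemma measurable_vector2 [measurable]:
 assumes [measurable]: "f : borel_measurable M" "g : borel_measurable M"
 shows "(%x. vector [f x, g x] :: real^2) : borel_measurable M"
proof -
 have "(%x. vector [f x, g x] :: real^2) = (%x. f x *\<^sub>R axis 1 1 + g x *\<^sub>R axis 2 1)"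
  by (auto simp: vec_eq_iff forall_2 axis_def)
 thus ?thesis by simp
qed

lemma pol_measurable [measurable]: "(%x. pol (fst x) (snd x)) : borel_measurable polm"
 unfolding pol_def case_prod_beta by measurable

lemma borel_measurable_pol [measurable]:
 assumes [measurable]: "f : borel_measurable M" "g : borel_measurable M"
 shows "(%x. pol (f x) (g x)) : borel_measurable M"
 unfolding pol_def by measurable

lemma sigma_finite_radm: "sigma_finite_measure radm"
 unfolding radm_def by (subst sigma_finite_measure.sigma_finite_iff_density_finite[OF sigma_finite_lborel]) auto

lemma emeasure_circm: "emeasure circm UNIV = ennreal (2*pi)"
 unfolding circm_def by (subst emeasure_density) auto

lemma finite_circm: "finite_measure circm"
 by (rule finite_measureI) (auto simp: emeasure_circm)

interpretation radm: sigma_finite_measure radm by (rule sigma_finite_radm)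
interpretation circm: finite_measure circm by (rule finite_circm)
interpretation polm: pair_sigma_finite radm circm ..

text \<open>Moves Lebesgue measure of the plane to a product of lines, so that Tonelli turns the
  change of variables in \<open>distr_pol\<close> into iterated integrals.\<close>

lemma lborel_vector2: "(lborel :: (real^2) measure) = distr (lborel \<Otimes>\<^sub>M lborel) borel (%(a,b). vector [a,b])"
proof (rule lborel_eqI)
 fix l u :: "real^2" assume le: "!!b. b : Basis ==> l \<bullet> b <= u \<bullet> b"
 have le': "l$1 <= u$1" "l$2 <= u$2" using le[of "axis 1 1"] le[of "axis 2 1"]
  by (auto simp: inner_axis Basis_vec_def)
 have "(%(a,b). vector [a,b] :: real^2) -` box l u = {l$1<..<u$1} \<times> {l$2<..<u$2}"
  by (auto simp: mem_box_cart forall_2)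
 hence "emeasure (distr (lborel \<Otimes>\<^sub>M lborel) borel (%(a,b). vector [a,b])) (box l u)
  = emeasure (lborel \<Otimes>\<^sub>M lborel) ({l$1<..<u$1} \<times> {l$2<..<u$2})"
  by (subst emeasure_distr) (auto simp: case_prod_beta space_pair_measure)
 also have "... = ennreal (u$1 - l$1) * ennreal (u$2 - l$2)"
  using le' by (subst lborel.emeasure_pair_measure_Times) auto
 also have "... = (\<Prod>b\<in>Basis. (u - l) \<bullet> b)"
 proof -
  have B: "(Basis :: (real^2) set) = {axis 1 1, axis 2 1}" by (auto simp: Basis_vec_def UNIV_2)
  have n: "axis 1 1 ~= (axis 2 1 :: real^2)" by (simp add: axis_eq_axis)
  have "(\<Prod>b\<in>Basis. (u - l) \<bullet> b) = (u$1 - l$1) * (u$2 - l$2)"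
  unfolding B using n by (subst prod.insert) (auto simp: inner_axis)
  thus ?thesis using le' by (simp add: ennreal_mult)
 qed
 finally show "emeasure (distr (lborel \<Otimes>\<^sub>M lborel) borel (%(a,b). vector [a,b])) (box l u) = (\<Prod>b\<in>Basis. (u - l) \<bullet> b)" .
qed auto

lemma pol_surj: "\<exists>r th. 0 <= r & 0 <= th & th < 2*pi & z = pol r th"
proof (cases "z = 0")
 case True thus ?thesis by (intro exI[of _ 0]) (auto simp: vec_eq_iff forall_2)
next
 case False
 define n where "n = norm z"
 have n: "n > 0" using False by (simp add: n_def)
 have n2: "n\<^sup>2 = (z$1)^2 + (z$2)^2" by (simp add: n_def norm_vec_def L2_set_def UNIV_2)
 have "(z$1/n)^2 + (z$2/n)^2 = ((z$1)^2 + (z$2)^2) / n\<^sup>2" by (simp add: power_divide add_divide_distrib)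
 hence "(z$1/n)^2 + (z$2/n)^2 = 1" using n unfolding n2[symmetric] by simp
 then obtain t where "0 <= t" "t < 2*pi" "z$1/n = cos t" "z$2/n = sin t"
  using sincos_total_2pi by metis
 thus ?thesis using n by (intro exI[of _ n] exI[of _ t]) (auto simp: vec_eq_iff forall_2 field_simps)
qed

lemma norm_pol [simp]: "norm (pol r th) = \<bar>r\<bar>"
proof -
 have "(r * cos th)^2 + (r * sin th)^2 = r\<^sup>2 * ((sin th)^2 + (cos th)^2)"
  unfolding power_mult_distrib by (simp only: algebra_simps)
 thus ?thesis by (simp add: norm_vec_def L2_set_def UNIV_2)
qed

lemma pol_inj:
 assumes "pol r th = pol r' th'" "0 < r" "0 < r'" "0 < th" "th < 2*pi" "0 < th'" "th' < 2*pi"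
 shows "r = r' & th = th'"
proof -
 have r: "r = r'" using arg_cong[OF assms(1), of norm] assms(2,3) unfolding norm_pol by simp
 have "cos th = cos th'" "sin th = sin th'" using arg_cong[OF assms(1), of "%z. z$1"] arg_cong[OF assms(1), of "%z. z$2"] assms r by auto
 then obtain n :: int where n: "th = th' + 2 * pi * n" using sin_cos_eq_iff[of th th'] by auto
 have "\<bar>2 * pi * n\<bar> < 2 * pi * 1" using n assms by auto
 hence "\<bar>real_of_int n\<bar> < 1" using pi_gt_zero by (simp add: abs_mult)
 hence "n = 0" by linarith
 thus ?thesis using n r by auto
qed

text \<open>Agreement on boxes is enough. For \<open>r > 0\<close> and angles in the open period the
  polar map is injective, and the change of variables with determinant \<open>r\<close> computes the
  measure of a box up to one ray, which is negligible.\<close>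

lemma distr_pol: "distr polm borel ((%x. pol (fst x) (snd x))) = (lborel :: (real^2) measure)"
proof (rule lborel_eqI[symmetric])
 fix l u :: "real^2" assume le: "!!b. b : Basis ==> l \<bullet> b <= u \<bullet> b"
 define P where "P w = pol (w$1) (w$2)" for w :: "real^2"
 define S where "S = {w::real^2. 0 < w$1 & 0 < w$2 & w$2 < 2*pi & P w : box l u}"
 define P' where "P' w h = (vector [h$1 * cos (w$2) - w$1 * sin (w$2) * h$2, h$1 * sin (w$2) + w$1 * cos (w$2) * h$2] :: real^2)" for w h :: "real^2"
 have cP: "contU P"
 proof -
  have "P = (%w. (w$1 * cos (w$2)) *\<^sub>R axis 1 1 + (w$1 * sin (w$2)) *\<^sub>R axis 2 1)"
  by (auto simp: P_def vec_eq_iff forall_2 axis_def fun_eq_iff)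
  thus ?thesis by (auto intro!: continuous_intros)
 qed
 have "open S"
 proof -
  have "S = {w. 0 < w$1} \<inter> {w. 0 < w$2} \<inter> {w. w$2 < 2*pi} \<inter> P -` box l u" by (auto simp: S_def)
  thus ?thesis using cP by (auto intro!: open_Int open_Collect_less continuous_intros open_vimage)
 qed
 hence Sm: "S : sets borel" "S : sets lebesgue" by auto
 obtain B where B: "!!x. x : box l u ==> norm x <= B"
  using bounded_box[of l u] by (auto simp: bounded_iff)
 have SB: "w$1 <= B" if "w : S" for w using that B[of "P w"] by (auto simp: S_def P_def)
 have Sbd: "bounded S"
 proof (rule bounded_subset[OF bounded_cbox])
  show "S \<subseteq> cbox 0 (vector [B, 2*pi])" using SB by (auto simp: mem_box_cart forall_2 S_def)
 qed
 have der: "(P has_derivative P' w) (at w within S)" for w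
 proof -
  have e: "P = (%w. (w$1 * cos (w$2)) *\<^sub>R axis 1 1 + (w$1 * sin (w$2)) *\<^sub>R axis 2 1)"
  by (auto simp: P_def vec_eq_iff forall_2 axis_def fun_eq_iff)
  have "bounded_linear (%w::real^2. w$1)" "bounded_linear (%w::real^2. w$2)" by (auto intro: bounded_linear_vec_nth)
  hence d: "((%w::real^2. w$1) has_derivative (%h. h$1)) (at w within S)" "((%w::real^2. w$2) has_derivative (%h. h$2)) (at w within S)"
  by (auto intro: bounded_linear_imp_has_derivative)
  show ?thesis unfolding e
  by (rule has_derivative_eq_rhs)
  (auto intro!: derivative_eq_intros d simp: P'_def vec_eq_iff forall_2 axis_def fun_eq_iff algebra_simps)
 qed
 have det: "det (matrix (P' w)) = w$1" for w
 proof -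
  have "w$1 * (cos (w$2))^2 + w$1 * (sin (w$2))^2 = w$1"
  by (simp add: distrib_left[symmetric])
  thus ?thesis
  by (simp add: matrix_def det_2 P'_def axis_def sq_eq algebra_simps)
 qed
 have inj: "inj_on P S"
 proof (rule inj_onI)
  fix x y assume "x : S" "y : S" "P x = P y"
  thus "x = y" using pol_inj[of "x$1" "x$2" "y$1" "y$2"] by (auto simp: S_def P_def vec_eq_iff forall_2)
 qed
 have Slm: "S : lmeasurable" using Sbd Sm(2) bounded_set_imp_lmeasurable by blast
 have int: "(%w. \<bar>det (matrix (P' w))\<bar>) absolutely_integrable_on S"
 proof -
  have "(%w::real^2. \<bar>w$1\<bar>) absolutely_integrable_on S"
  proof (rule measurable_bounded_by_integrable_imp_absolutely_integrable[where g="%_. B"])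
  show "(%w::real^2. \<bar>w$1\<bar>) : borel_measurable (lebesgue_on S)"
  by (intro continuous_imp_measurable_on_sets_lebesgue continuous_intros Sm)
  show "(%_. B) integrable_on S" using Slm by (simp add: integrable_on_const)
  show "norm \<bar>w$1\<bar> <= B" if "w : S" for w using SB[OF that] that by (auto simp: S_def)
  qed (use Sm in auto)
  thus ?thesis by (simp add: det)
 qed
 have m1: "measure lebesgue (P ` S) = integral S (%w. \<bar>det (matrix (P' w))\<bar>)"
  by (rule measure_differentiable_image_eq[OF Sm(2) der inj set_LINT(1)[OF int]])
 \<comment> \<open>Angles strictly between 0 and \<open>2*pi\<close> miss exactly the half-axis of
   nonnegative first coordinate.\<close>
 have PS: "P ` S = box l u - {z. z$2 = 0 & 0 <= z$1}"
 proof (intro equalityI subsetI)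
  fix z assume "z : P ` S"
  then obtain w where w: "w : S" "z = P w" by auto
  have "\<not> (z$2 = 0 & 0 <= z$1)"
  proof
  assume a: "z$2 = 0 & 0 <= z$1"
  hence s: "sin (w$2) = 0" "0 <= cos (w$2)" using w by (auto simp: S_def P_def zero_le_mult_iff)
  hence "cos (w$2) = 1" using sin_cos_squared_add[of "w$2"] by (auto simp: power2_eq_1_iff)
  hence "\<exists>n::int. w$2 = 2*pi*n" using cos_one_2pi_int by auto
  then obtain n :: int where n: "w$2 = 2*pi*n" by auto
  have "0 < real_of_int n" "real_of_int n < 1" using w n by (auto simp: S_def zero_less_mult_iff)
  hence "0 < n" "n < 1" by simp_all
  thus False by simp
  qed
  thus "z : box l u - {z. z$2 = 0 & 0 <= z$1}" using w by (auto simp: S_def)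
 next
  fix z assume z: "z : box l u - {z. z$2 = 0 & 0 <= z$1}"
  obtain r th where r: "0 <= r" "0 <= th" "th < 2*pi" "z = pol r th" using pol_surj by blast
  have "r ~= 0" "th ~= 0" using z r by (auto simp: zero_le_mult_iff)
  thus "z : P ` S" using r z by (intro image_eqI[of _ _ "vector [r, th]"]) (auto simp: P_def S_def)
 qed
 have neg: "negligible {z::real^2. z$2 = 0 & 0 <= z$1}"
 proof (rule negligible_subset)
  show "negligible {z::real^2. z \<bullet> axis 2 1 = 0}" by (rule negligible_standard_hyperplane) (auto simp: Basis_vec_def)
 qed (auto simp: inner_axis)
 have m2: "emeasure lebesgue (P ` S) = emeasure lborel (box l u)"
 proof -
  have "emeasure lebesgue (P ` S) = emeasure lebesgue (box l u)"
  unfolding PS using neg by (intro emeasure_Diff_null_set) (auto simp: negligible_iff_null_sets)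
  thus ?thesis by simp
 qed
 have fin: "emeasure lebesgue (P ` S) < \<infinity>" unfolding m2 using emeasure_bounded_finite[OF bounded_box] by auto
 have "emeasure lborel (box l u) = ennreal (integral S (%w. \<bar>det (matrix (P' w))\<bar>))"
  using m1 m2 fin emeasure_eq_ennreal_measure[of lebesgue "P ` S"] by auto
 also have "integral S (%w. \<bar>det (matrix (P' w))\<bar>) = (LINT w:S|lebesgue. w$1)"
  unfolding set_LINT(2)[OF int, symmetric] set_lebesgue_integral_def
  by (intro LINT_cong) (auto simp: det indicator_def S_def)
 also have "ennreal ... = (nnint lebesgue (%w. ennreal (ind S w *\<^sub>R w$1)))"
 proof -
  have "integrable lebesgue (%w. ind S w *\<^sub>R \<bar>det (matrix (P' w))\<bar>)" using int by (simp add: set_integrable_def)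
  moreover have "(%w. ind S w *\<^sub>R \<bar>det (matrix (P' w))\<bar>) = (%w. ind S w *\<^sub>R w$1)"
  by (auto simp: det indicator_def S_def)
  ultimately show ?thesis unfolding set_lebesgue_integral_def
  by (intro nn_integral_eq_integral[symmetric]) (auto simp: indicator_def S_def)
 qed
 also have "... = (nnint lborel (%w. ennreal (ind S w *\<^sub>R w$1)))"
  using Sm by (subst nn_integral_completion) auto
 also have "... = (nnint (lborel \<Otimes>\<^sub>M lborel) (%x. ennreal (ind S (vector [fst x, snd x]) *\<^sub>R fst x)))"
  using Sm by (subst lborel_vector2, subst nn_integral_distr) (auto simp: case_prod_beta)
 also have "... = (nnint lborel (%r. nnint lborel (%th. ennreal (ind S (vector [r, th]) *\<^sub>R r))))"
 proof -
  have "(%x. ennreal (ind S (vector [fst x, snd x]) *\<^sub>R fst x)) : borel_measurable (lborel \<Otimes>\<^sub>M lborel)"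
  using Sm by measurable
  from lborel.nn_integral_fst[OF this, symmetric] show ?thesis by simp
 qed
 also have "... = (nnint lborel (%r. ennreal r * (nnint lborel (%th. ind {0..2*pi} th * ind (box l u) (pol r th)))))"
 proof (rule nn_integral_cong)
  fix r :: real
  have "(nnint lborel (%th. ennreal (ind S (vector [r, th]) *\<^sub>R r)))
  = (nnint lborel (%th. ennreal r * (ind {0..2*pi} th * ind (box l u) (pol r th))))"
  proof (rule nn_integral_cong_AE)
  have "AE th in lborel. th ~= 0 & th ~= 2*pi" using AE_lborel_singleton[of 0] AE_lborel_singleton[of "2*pi"] by eventually_elim auto
  thus "AE th in lborel. ennreal (ind S (vector [r, th]) *\<^sub>R r) = ennreal r * (ind {0..2*pi} th * ind (box l u) (pol r th))"
  by eventually_elim (auto simp: S_def P_def indicator_def ennreal_neg)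
  qed
  also have "... = ennreal r * (nnint lborel (%th. ind {0..2*pi} th * ind (box l u) (pol r th)))"
  by (rule nn_integral_cmult) auto
  finally show "(nnint lborel (%th. ennreal (ind S (vector [r, th]) *\<^sub>R r))) = ..." .
 qed
 also have "... = (nnint radm (%r. (nnint circm (%th. ind (box l u) (pol r th)))))"
 proof -
  have [measurable]: "(%r. nnint circm (%th. ind (box l u) (pol r th))) : borel_measurable lborel"
  by measurable
  have "(nnint lborel (%th. ind {0..2*pi} th * ind (box l u) (pol r th))) = (nnint circm (%th. ind (box l u) (pol r th)))" for r
  unfolding circm_def by (subst nn_integral_density) auto
  thus ?thesis unfolding radm_def by (subst nn_integral_density) auto
 qed
 also have "... = (nnint polm (%x. ind (box l u) (pol (fst x) (snd x))))"
 proof -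
  have "(%x. ind (box l u) (pol (fst x) (snd x)) :: ennreal) : borel_measurable polm" by measurable
  from circm.nn_integral_fst[OF this] show ?thesis by simp
 qed
 also have "... = (nnint (distr polm borel ((%x. pol (fst x) (snd x)))) (%z. ind (box l u) z))"
  by (subst nn_integral_distr) auto
 also have "... = emeasure (distr polm borel ((%x. pol (fst x) (snd x)))) (box l u)"
  by (subst nn_integral_indicator) auto
 finally show "emeasure (distr polm borel ((%x. pol (fst x) (snd x)))) (box l u) = (\<Prod>b\<in>Basis. (u - l) \<bullet> b)"
  using le by (simp add: emeasure_lborel_box)
qed auto

lemma nn_integral_polar:
 fixes h :: "real^2 => ennreal"
 assumes [measurable]: "h : borel_fun"
 shows "(nnint lborel (%x. h x)) = (nnint radm (%r. nnint circm (%th. h (pol r th))))"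
proof -
 have "(nnint lborel (%x. h x)) = (nnint polm (%x. h (pol (fst x) (snd x))))"
  unfolding distr_pol[symmetric] by (subst nn_integral_distr) auto
 also have "... = (nnint radm (%r. nnint circm (%th. h (pol r th))))"
  using circm.nn_integral_fst[of "%x. h (pol (fst x) (snd x))" radm] by simp
 finally show ?thesis .
qed

lemma AE_polar:
 assumes "AE x in (lborel :: (real^2) measure). P x"
 shows "AE r in radm. AE th in circm. P (pol r th)"
proof -
 have "AE x in distr polm borel ((%x. pol (fst x) (snd x))). P x" unfolding distr_pol by (rule assms)
 hence "AE x in polm. P (pol (fst x) (snd x))" by (rule AE_distrD[rotated]) measurable
 from polm.AE_pair[OF this] show ?thesis by simp
qed

text \<open>The step back from almost all circles to the plane is Fubini for null sets, hence the
  measurable predicate.\<close>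

lemma AE_polar_iff:
 assumes "Measurable.pred borel P"
 shows "(AE x in (lborel :: (real^2) measure). P x) \<longleftrightarrow> (AE r in radm. AE th in circm. P (pol r th))"
proof -
 note [measurable] = assms
 have "(AE x in (lborel :: (real^2) measure). P x) \<longleftrightarrow> (AE x in polm. P (pol (fst x) (snd x)))"
  unfolding distr_pol[symmetric] by (subst AE_distr_iff) auto
 also have "... \<longleftrightarrow> (AE r in radm. AE th in circm. P (pol r th))"
 proof
  assume "AE x in polm. P (pol (fst x) (snd x))"
  from polm.AE_pair[OF this] show "AE r in radm. AE th in circm. P (pol r th)" by simp
 next
  assume a: "AE r in radm. AE th in circm. P (pol r th)"
  have "Measurable.pred polm (%x. P (pol (fst x) (snd x)))" by measurable
  thus "AE x in polm. P (pol (fst x) (snd x))" using a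
  by (intro polm.AE_pair_measure) (auto simp: pred_def)
 qed
 finally show ?thesis .
qed

lemma AE_radm_iff: "(AE r in radm. P r) \<longleftrightarrow> (AE r in lborel. r > 0 --> P r)"
 unfolding radm_def by (subst AE_density) auto

lemma integrable_polar_iff:
 fixes h :: "real^2 => 'b::{banach,second_countable_topology}"
 assumes [measurable]: "h : borel_fun"
 shows "integrable lborel h \<longleftrightarrow> integrable polm (%x. h (pol (fst x) (snd x)))"
 unfolding distr_pol[symmetric] by (subst integrable_distr_eq) auto

lemma integral_polar:
 fixes h :: "real^2 => real"
 assumes "integrable lborel h"
 shows "(LINT x|lborel. h x) = (LINT r|radm. LINT th|circm. h (pol r th))"
  "integrable radm (%r. LINT th|circm. h (pol r th))"
  "AE r in radm. integrable circm (%th. h (pol r th))"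
proof -
 have [measurable]: "h : borel_fun" using assms by auto
 have i: "integrable polm (%x. h (pol (fst x) (snd x)))" using iffD1[OF integrable_polar_iff assms] by simp
 have "(LINT x|lborel. h x) = (LINT x|polm. h (pol (fst x) (snd x)))"
  unfolding distr_pol[symmetric] by (subst integral_distr) auto
 also have "... = (LINT r|radm. LINT th|circm. h (pol r th))"
  using polm.integral_fst'[OF i] by simp
 finally show "(LINT x|lborel. h x) = (LINT r|radm. LINT th|circm. h (pol r th))" .
 show "integrable radm (%r. LINT th|circm. h (pol r th))"
  using polm.integrable_fst'[OF i] by simp
 show "AE r in radm. integrable circm (%th. h (pol r th))"
  using polm.AE_integrable_fst'[OF i] by simp
qed

section \<open>Smooth functions and bumps\<close>

lemma C_diff_SucI:
 assumes "!!x. (phi has_derivative D x) (at x)" "!!b. b : Basis ==> C_diff k (%x. D x b)"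
 shows "C_diff (Suc k) phi"
proof -
 have "fderiv phi (at x) = D x" for x using frechet_derivative_at[OF assms(1)] by metis
 thus ?thesis using assms by (auto simp: differentiable_on_def differentiable_def intro: has_derivative_at_withinI)
qed

lemma C_diff_SucD:
 assumes "C_diff (Suc k) phi"
 shows "(phi has_derivative fderiv phi (at x)) (at x)"
  "b : Basis ==> C_diff k (%x. fderiv phi (at x) b)"
 using assms by (auto simp: differentiable_on_def frechet_derivative_works)

lemma C_diff_Suc_imp: "C_diff (Suc k) phi ==> C_diff k phi"
proof (induction k arbitrary: phi)
 case 0 thus ?case by (auto intro: differentiable_imp_continuous_on)
next
 case (Suc k)
 show ?case
  by (rule C_diff_SucI[OF C_diff_SucD(1)[OF Suc.prems]]) (use Suc in auto)
qed

lemma C_diff_const: "C_diff k (%_. c)"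
proof (induction k arbitrary: c)
 case (Suc k) show ?case by (rule C_diff_SucI[where D="%_ _. 0"]) (auto simp: Suc)
qed simp

lemma C_diff_add: "C_diff k f ==> C_diff k g ==> C_diff k (%x. f x + g x)"
proof (induction k arbitrary: f g)
 case 0 thus ?case by (auto intro: cont_add)
next
 case (Suc k)
 show ?case
  by (rule C_diff_SucI[OF has_derivative_add[OF C_diff_SucD(1)[OF Suc.prems(1)] C_diff_SucD(1)[OF Suc.prems(2)]]])
  (use Suc in auto)
qed

lemma C_diff_mult: "C_diff k f ==> C_diff k g ==> C_diff k (%x. f x * g x)"
proof (induction k arbitrary: f g)
 case 0 thus ?case by (auto intro: cont_mult)
next
 case (Suc k)
 show ?case
  by (rule C_diff_SucI[OF has_derivative_mult[OF C_diff_SucD(1)[OF Suc.prems(1)] C_diff_SucD(1)[OF Suc.prems(2)]]])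
  (use Suc.prems C_diff_Suc_imp in \<open>auto intro!: C_diff_add Suc.IH\<close>)
qed

lemma C_diff_inner: "C_diff k (%x. x \<bullet> a)"
proof (cases k)
 case (Suc l)
 show ?thesis unfolding Suc
  by (rule C_diff_SucI[where D="%_ h. h \<bullet> a"]) (auto intro!: derivative_eq_intros C_diff_const)
qed (auto intro!: continuous_intros)

lemma C_diff_cmult: "C_diff k f ==> C_diff k (%x. c * f x)"
 by (intro C_diff_mult C_diff_const)

lemma C_diff_sum: "(!!i. i : I ==> C_diff k (f i)) ==> C_diff k (%x. \<Sum>i\<in>I. f i x)"
 by (induction I rule: infinite_finite_induct) (auto intro: C_diff_const C_diff_add)

lemma C_diff_inner_self: "C_diff k (%x. (x - a) \<bullet> (x - a))"
proof -
 have "C_diff k (%x. \<Sum>b\<in>Basis. (x \<bullet> b + - (a \<bullet> b)) * (x \<bullet> b + - (a \<bullet> b)))"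
  by (intro C_diff_sum C_diff_mult C_diff_add C_diff_inner C_diff_const)
 thus ?thesis by (subst euclidean_inner) (simp add: inner_diff_left)
qed

lemma C_diff_imp_continuous: "C_diff k f ==> contU f"
 by (induction k) (use C_diff_Suc_imp in auto)

text \<open>The quotients by \<open>t ^ m\<close> form a family closed under differentiation up to
  linear combinations, so smoothness follows by induction for all \<open>m\<close> at once.\<close>

definition flat :: "nat => real => real" where
 "flat m t = (if t > 0 then exp (- (1/t)) / t ^ m else 0)"

text \<open>One term of the exponential series at \<open>1/t\<close> suffices. The factor
  \<open>t^2\<close> is what makes the difference quotient at 0 tend to 0.\<close>

lemma flat_bound:
 assumes "0 < t"
 shows "\<bar>flat m t\<bar> <= fact (m + 2) * t\<^sup>2"
proof -
 have "(1/t) ^ (m+2) / fact (m+2) <= exp (1/t)"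
 proof -
  have "(\<Sum>n\<in>{m+2}. inverse (fact n) * (1/t) ^ n) <= exp (1/t)"
  unfolding exp_def using assms summable_exp[of "1/t"]
  by (intro sum_le_suminf[THEN order_trans]) (auto simp: scaleR_conv_of_real)
  thus ?thesis by (simp add: field_simps)
 qed
 hence "1 / exp (1/t) <= 1 / ((1/t) ^ (m+2) / fact (m+2))"
  using assms by (intro divide_left_mono) auto
 hence "exp (-(1/t)) <= fact (m+2) * t ^ (m+2)"
  by (simp add: exp_minus field_simps power_divide)
 hence "exp (-(1/t)) / t ^ m <= fact (m+2) * t ^ (m+2) / t ^ m" using assms by (intro divide_right_mono) auto
 also have "... = fact (m+2) * t\<^sup>2" using assms by (simp add: power_add sq_eq)
 finally show ?thesis using assms by (simp add: flat_def)
qed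

lemma flat_deriv: "(flat m has_real_derivative (flat (m+2) t - real m * flat (m+1) t)) (at t)"
proof -
 consider "t > 0" | "t < 0" | "t = 0" by linarith
 thus ?thesis
 proof cases
  case 1
  have inv: "((%t. inverse t) has_real_derivative - (inverse t ^ 2)) (at t)"
  using 1 DERIV_inverse[of t] by (simp add: sq_eq)
  have e: "((%t. exp (- inverse t)) has_real_derivative exp (- inverse t) * inverse t ^ 2) (at t)"
  using DERIV_exp[THEN DERIV_chain2, OF DERIV_minus[OF inv]] by simp
  have p: "((%t. inverse t ^ m) has_real_derivative - real m * inverse t ^ (m+1)) (at t)"
  proof (cases m)
  case (Suc n)
  show ?thesis using DERIV_power[OF inv, of m] unfolding Suc
  by (simp add: power_add sq_eq algebra_simps)
  qed simp
  have "((%t. exp (- inverse t) * inverse t ^ m) has_real_derivative (flat (m+2) t - real m * flat (m+1) t)) (at t)"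
  by (rule DERIV_cong[OF DERIV_mult[OF e p]])
  (use 1 in \<open>simp add: flat_def divide_inverse power_inverse power_add sq_eq algebra_simps\<close>)
  hence "((%t. exp (- (1/t)) / t ^ m) has_real_derivative (flat (m+2) t - real m * flat (m+1) t)) (at t)"
  by (simp add: divide_inverse power_inverse)
  thus ?thesis
  by (rule has_field_derivative_transform_within_open[where S="{0<..}"]) (use 1 in \<open>auto simp: flat_def\<close>)
 next
  case 2
  have "((%t. 0) has_real_derivative 0) (at t)" by simp
  hence "(flat m has_real_derivative 0) (at t)"
  by (rule has_field_derivative_transform_within_open[where S="{..<0}"]) (use 2 in \<open>auto simp: flat_def\<close>)
  thus ?thesis using 2 by (simp add: flat_def)
 next
  case 3
  have "((%h. (flat m h - flat m 0) / h) \<longlongrightarrow> 0) (at 0)"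
  proof (rule Lim_null_comparison)
  show "eventually (%h. norm ((flat m h - flat m 0) / h) <= fact (m+2) * \<bar>h\<bar>) (at 0)"
  proof (rule eventuallyI)
  fix h :: real
  have "\<bar>flat m h\<bar> <= fact (m+2) * h\<^sup>2" using flat_bound[of h m] by (cases "h > 0") (auto simp: flat_def)
  thus "norm ((flat m h - flat m 0) / h) <= fact (m+2) * \<bar>h\<bar>"
  by (cases "h = 0") (auto simp: flat_def field_simps sq_eq abs_mult)
  qed
  show "((%h. fact (m+2) * \<bar>h\<bar>) \<longlongrightarrow> (0::real)) (at 0)" by (auto intro!: tendsto_eq_intros)
  qed
  thus ?thesis using 3 by (simp add: has_field_derivative_iff flat_def)
 qed
qed

lemma C_diff_flat_compose: "(!!j. C_diff j q) ==> C_diff k (%x. flat m (q x))"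
proof (induction k arbitrary: m)
 case 0
 have "contU (flat m)" for m
  by (intro cont_at_on ballI DERIV_isCont[OF flat_deriv])
 hence "contU (flat m \<circ> q)" using 0[of 0] by (intro continuous_on_compose) (auto intro: cont_subset)
 thus ?case by (simp add: o_def)
next
 case (Suc k)
 have d: "((%x. flat m (q x)) has_derivative (%h. (flat (m+2) (q x) - real m * flat (m+1) (q x)) * fderiv q (at x) h)) (at x)" for x
  using has_derivative_compose[OF C_diff_SucD(1)[OF Suc.prems[of "Suc k"]] flat_deriv[unfolded has_field_derivative_def]] by simp
 have "C_diff k (%x. (flat (m+2) (q x) + (- real m) * flat (m+1) (q x)) * fderiv q (at x) b)" if "b : Basis" for b
  by (intro C_diff_mult C_diff_add C_diff_cmult Suc.IH Suc.prems C_diff_SucD(2)[OF Suc.prems that])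
 thus ?case by (intro C_diff_SucI[OF d]) simp
qed

definition bump :: "'a::euclidean_space => real => 'a => real" where
 "bump a s y = flat 0 (1 - ((y - a) \<bullet> (y - a)) / s\<^sup>2)"

lemma C_diff_bump: "C_diff k (bump a s)"
proof -
 have "C_diff j (%y. 1 + (-1/s\<^sup>2) * ((y - a) \<bullet> (y - a)))" for j
  by (intro C_diff_add C_diff_const C_diff_cmult C_diff_inner_self)
 from C_diff_flat_compose[OF this, of k 0] show ?thesis by (simp add: bump_def[abs_def])
qed

lemma smooth_bump: "smooth (bump a s)" by (simp add: smooth_def C_diff_bump)

lemma bump_nonneg: "0 <= bump a s y" by (simp add: bump_def flat_def)

lemma bump_pos_iff: "s > 0 ==> 0 < bump a s y \<longleftrightarrow> dist y a < s"
proof -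
 assume s: "s > 0"
 have "dist y a < s \<longleftrightarrow> (norm (y - a))\<^sup>2 < s\<^sup>2"
  using s power2_less_imp_less[of "norm (y - a)" s] power_strict_mono[of "norm (y - a)" s 2]
  unfolding dist_norm by (intro iffI) simp_all
 thus ?thesis using s by (simp add: bump_def flat_def power2_norm_eq_inner field_simps)
qed

lemma bump_eq_0: "s > 0 ==> dist y a >= s ==> bump a s y = 0"
 using bump_pos_iff[of s a y] bump_nonneg[of a s y] by linarith

lemma support_bump: "s > 0 ==> support (bump a s) \<subseteq> cball a s"
 unfolding support_def using bump_eq_0[of s _ a]
 by (intro closure_minimal) (force simp: dist_commute not_le)+

lemma bump_le_1: "bump a s y <= 1" by (simp add: bump_def flat_def)

lemma continuous_on_bump: "continuous_on A (bump a s)"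
 using C_diff_imp_continuous[OF C_diff_bump] cont_subset by blast

lemma bump_translate: "bump a s y = bump 0 s (y - a)" "bump a s y = bump 0 s (a - y)" "bump 0 s (-y) = bump 0 s y"
 by (auto simp: bump_def inner_diff_left inner_diff_right inner_commute add.commute)

text \<open>The partial derivatives are continuous and vanish off a ball, so the sum of their
  absolute values is bounded; that sum dominates the operator norm.\<close>

lemma C_diff_1_compact_support_Lipschitz:
 fixes phi :: "'a::euclidean_space => real"
 assumes "C_diff 1 phi" "!!x. norm x > R ==> phi x = 0"
 obtains L where "L >= 0" "!!x y. \<bar>phi x - phi y\<bar> <= L * norm (x - y)"
  "!!x. onorm (fderiv phi (at x)) <= L"
proof -
 have C: "C_diff (Suc 0) phi" using assms(1) by simp
 define D where "D x = fderiv phi (at x)" for x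
 have d: "(phi has_derivative D x) (at x)" for x using C_diff_SucD(1)[OF C] by (simp add: D_def)
 have bl: "bounded_linear (D x)" for x using has_derivative_bounded_linear[OF d] .
 have cont: "contU (%x. \<Sum>b\<in>Basis. \<bar>D x b\<bar>)"
 proof (intro continuous_on_sum continuous_on_rabs)
  fix b :: 'a assume "b : Basis"
  thus "contU (%x. D x b)" using C_diff_SucD(2)[OF C] by (simp add: D_def)
 qed
 have "bounded ((%x. \<Sum>b\<in>Basis. \<bar>D x b\<bar>) ` cball 0 R)"
  by (intro compact_imp_bounded compact_continuous_image cont_subset[OF cont]) auto
 then obtain M where M': "\<forall>y\<in>(%x. \<Sum>b\<in>Basis. \<bar>D x b\<bar>) ` cball 0 R. norm y <= M"
  unfolding bounded_iff by blast
 have M: "(\<Sum>b\<in>Basis. \<bar>D x b\<bar>) <= M" if "x : cball 0 R" for x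
  using bspec[OF M' imageI[OF that]] by simp
 have D0: "D x = (%_. 0)" if "norm x > R" for x
 proof -
  have "open {x::'a. R < norm x}" by (auto intro!: open_Collect_less continuous_intros)
  hence "(phi has_derivative (%_. 0)) (at x)"
  by (rule has_derivative_transform_within_open[OF has_derivative_const]) (use that assms(2) in simp_all)
  thus ?thesis by (rule has_derivative_unique[OF d])
 qed
 define L where "L = max M 0"
 have on: "onorm (D x) <= L" for x
 proof (rule onorm_le)
  fix h
  have "D x h = D x (\<Sum>b\<in>Basis. (h \<bullet> b) *\<^sub>R b)" by (simp add: euclidean_representation)
  also have "... = (\<Sum>b\<in>Basis. (h \<bullet> b) * D x b)"
  using bounded_linear.linear[OF bl] by (simp add: linear_sum linear_cmul)
  finally have "\<bar>D x h\<bar> <= (\<Sum>b\<in>Basis. \<bar>(h \<bullet> b) * D x b\<bar>)" by (simp add: sum_abs)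
  also have "... <= (\<Sum>b\<in>Basis. norm h * \<bar>D x b\<bar>)"
  by (intro sum_mono) (auto simp: abs_mult Basis_le_norm intro!: mult_right_mono)
  also have "... = (\<Sum>b\<in>Basis. \<bar>D x b\<bar>) * norm h" by (simp add: sum_distrib_left mult.commute)
  also have "... <= L * norm h"
  proof (rule mult_right_mono)
  show "(\<Sum>b\<in>Basis. \<bar>D x b\<bar>) <= L"
  proof (cases "norm x > R")
  case True show ?thesis unfolding D0[OF True] L_def by simp
  next
  case False thus ?thesis using M[of x] by (simp add: L_def)
  qed
  qed simp
  finally show "norm (D x h) <= L * norm h" by simp
 qed
 have "norm (phi x - phi y) <= L * norm (x - y)" for x y
  by (rule differentiable_bound[OF convex_UNIV d on]) simp_all
 thus ?thesis using that[of L] on by (auto simp: L_def D_def)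
qed

section \<open>Continuity of translations in L^k\<close>

lemma abs_add3_power_le:
 fixes a b c :: real
 shows "\<bar>a + b + c\<bar> ^ k <= 3 ^ k * (\<bar>a\<bar> ^ k + \<bar>b\<bar> ^ k + \<bar>c\<bar> ^ k)"
proof -
 define m where "m = max \<bar>a\<bar> (max \<bar>b\<bar> \<bar>c\<bar>)"
 have "\<bar>a + b + c\<bar> ^ k <= (3 * m) ^ k" by (intro power_mono) (auto simp: m_def)
 also have "... = 3 ^ k * m ^ k" by (simp add: power_mult_distrib)
 also have "m ^ k <= \<bar>a\<bar> ^ k + \<bar>b\<bar> ^ k + \<bar>c\<bar> ^ k"
  unfolding m_def max_def by (auto intro: add_increasing2 add_increasing)
 finally show ?thesis by simp
qed

lemma nn_integral_lborel_translate:
 fixes f :: "'a::euclidean_space => ennreal"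
 assumes [measurable]: "f : borel_fun"
 shows "(nnint lborel (%x. f (x - z))) = (nnint lborel (%x. f x))"
proof -
 have "(nnint lborel (%x. f x)) = (nnint (distr lborel borel ((+) (-z))) (%x. f x))"
  by (simp add: lborel_distr_plus)
 also have "... = (nnint lborel (%x. f (x - z)))" by (subst nn_integral_distr) auto
 finally show ?thesis ..
qed

text \<open>Measured by \<open>nn_integral\<close> and by the k-th power itself, so that neither
  integrability nor a norm has to be set up.\<close>

definition transl_cont :: "nat => ('a::euclidean_space => real) => bool" where
 "transl_cont k u \<longleftrightarrow> (\<forall>e>0. \<exists>d>0. \<forall>z. norm z < d -->
  (nnint lborel (%x. ennreal (\<bar>u (x - z) - u x\<bar> ^ k))) <= ennreal e)"

lemma transl_cont_limit:
 fixes u :: "'a::euclidean_space => real"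
 assumes [measurable]: "u : borel_fun"
  and app: "!!e. e > 0 ==> \<exists>w. w : borel_fun & transl_cont k w &
  (nnint lborel (%x. ennreal (\<bar>u x - w x\<bar> ^ k))) <= ennreal e"
 shows "transl_cont k u"
 unfolding transl_cont_def
proof (intro allI impI)
 fix e :: real assume e: "e > 0"
 \<comment> \<open>Three error terms, each multiplied by the \<open>3 ^ k\<close> of
   \<open>abs_add3_power_le\<close>.\<close>
 define e' where "e' = e / (3 * 3 ^ k)"
 have e': "e' > 0" using e by (simp add: e'_def)
 obtain w where [measurable]: "w : borel_fun" and w: "transl_cont k w"
  "(nnint lborel (%x. ennreal (\<bar>u x - w x\<bar> ^ k))) <= ennreal e'" using app[OF e'] by blast
 obtain d where d: "d > 0" "!!z. norm z < d ==> (nnint lborel (%x. ennreal (\<bar>w (x - z) - w x\<bar> ^ k))) <= ennreal e'"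
  using w(1) e' unfolding transl_cont_def by blast
 show "\<exists>d>0. \<forall>z. norm z < d --> (nnint lborel (%x. ennreal (\<bar>u (x - z) - u x\<bar> ^ k))) <= ennreal e"
 proof (intro exI[of _ d] conjI allI impI d(1))
  fix z :: 'a assume z: "norm z < d"
  have t: "(nnint lborel (%x. ennreal (\<bar>u (x - z) - w (x - z)\<bar> ^ k))) = (nnint lborel (%x. ennreal (\<bar>u x - w x\<bar> ^ k)))"
  by (rule nn_integral_lborel_translate[of "%x. ennreal (\<bar>u x - w x\<bar> ^ k)" z]) simp
  have "(nnint lborel (%x. ennreal (\<bar>u (x - z) - u x\<bar> ^ k)))
  <= (nnint lborel (%x. ennreal (3 ^ k) * (ennreal (\<bar>u (x - z) - w (x - z)\<bar> ^ k) + ennreal (\<bar>w (x - z) - w x\<bar> ^ k) + ennreal (\<bar>u x - w x\<bar> ^ k))))"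
  proof (rule nn_integral_mono)
  fix x
  have "\<bar>u (x - z) - u x\<bar> ^ k <= 3 ^ k * (\<bar>u (x - z) - w (x - z)\<bar> ^ k + \<bar>w (x - z) - w x\<bar> ^ k + \<bar>u x - w x\<bar> ^ k)"
  using abs_add3_power_le[of "u (x - z) - w (x - z)" "w (x - z) - w x" "w x - u x" k]
  by (simp add: abs_minus_commute)
  from ennreal_leI[OF this]
  show "ennreal (\<bar>u (x - z) - u x\<bar> ^ k) <= ennreal (3 ^ k) * (ennreal (\<bar>u (x - z) - w (x - z)\<bar> ^ k) + ennreal (\<bar>w (x - z) - w x\<bar> ^ k) + ennreal (\<bar>u x - w x\<bar> ^ k))"
  by (simp only: ennreal_mult' ennreal_plus zero_le_power abs_ge_zero add_nonneg_nonneg zero_le_numeral)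
  qed
  also have "... = ennreal (3 ^ k) * ((nnint lborel (%x. ennreal (\<bar>u x - w x\<bar> ^ k))) + (nnint lborel (%x. ennreal (\<bar>w (x - z) - w x\<bar> ^ k))) + (nnint lborel (%x. ennreal (\<bar>u x - w x\<bar> ^ k))))"
  by (simp add: nn_integral_cmult nn_integral_add t)
  also have "... <= ennreal (3 ^ k) * (ennreal e' + ennreal e' + ennreal e')"
  using d(2)[OF z] w(2) by (intro mult_left_mono add_mono) auto
  also have "... = ennreal (3 ^ k * (e' + e' + e'))" using e'
  by (simp only: ennreal_mult' ennreal_plus zero_le_power add_nonneg_nonneg zero_le_numeral less_imp_le)
  also have "3 ^ k * (e' + e' + e') = e" by (simp add: e'_def field_simps)
  finally show "(nnint lborel (%x. ennreal (\<bar>u (x - z) - u x\<bar> ^ k))) <= ennreal e" .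
 qed
qed

lemma transl_cont_add:
 fixes u :: "'a::euclidean_space => real"
 assumes [measurable]: "u : borel_fun" "w : borel_fun"
  and u: "transl_cont k u" and w: "transl_cont k w" and k: "k >= 1"
 shows "transl_cont k (%x. u x + w x)"
 unfolding transl_cont_def
proof (intro allI impI)
 fix e :: real assume e: "e > 0"
 define e' where "e' = e / (2 * 3 ^ k)"
 have e': "e' > 0" using e by (simp add: e'_def)
 obtain d where d: "d > 0" "!!z. norm z < d ==> (nnint lborel (%x. ennreal (\<bar>u (x - z) - u x\<bar> ^ k))) <= ennreal e'"
  using u e' unfolding transl_cont_def by blast
 obtain d' where d': "d' > 0" "!!z. norm z < d' ==> (nnint lborel (%x. ennreal (\<bar>w (x - z) - w x\<bar> ^ k))) <= ennreal e'"
  using w e' unfolding transl_cont_def by blast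
 show "\<exists>d>0. \<forall>z. norm z < d --> (nnint lborel (%x. ennreal (\<bar>u (x - z) + w (x - z) - (u x + w x)\<bar> ^ k))) <= ennreal e"
 proof (intro exI[of _ "min d d'"] conjI allI impI)
  fix z :: 'a assume z: "norm z < min d d'"
  have "(nnint lborel (%x. ennreal (\<bar>u (x - z) + w (x - z) - (u x + w x)\<bar> ^ k)))
  <= (nnint lborel (%x. ennreal (3 ^ k) * (ennreal (\<bar>u (x - z) - u x\<bar> ^ k) + ennreal (\<bar>w (x - z) - w x\<bar> ^ k))))"
  proof (rule nn_integral_mono)
  fix x
  have "\<bar>u (x - z) + w (x - z) - (u x + w x)\<bar> ^ k <= 3 ^ k * (\<bar>u (x - z) - u x\<bar> ^ k + \<bar>w (x - z) - w x\<bar> ^ k)"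
  using abs_add3_power_le[of "u (x - z) - u x" "w (x - z) - w x" 0 k] k
  by (simp add: algebra_simps power_0_left)
  from ennreal_leI[OF this]
  show "ennreal (\<bar>u (x - z) + w (x - z) - (u x + w x)\<bar> ^ k) <= ennreal (3 ^ k) * (ennreal (\<bar>u (x - z) - u x\<bar> ^ k) + ennreal (\<bar>w (x - z) - w x\<bar> ^ k))"
  by (simp only: ennreal_mult' ennreal_plus zero_le_power abs_ge_zero add_nonneg_nonneg zero_le_numeral)
  qed
  also have "... = ennreal (3 ^ k) * ((nnint lborel (%x. ennreal (\<bar>u (x - z) - u x\<bar> ^ k))) + (nnint lborel (%x. ennreal (\<bar>w (x - z) - w x\<bar> ^ k))))"
  by (simp add: nn_integral_cmult nn_integral_add)
  also have "... <= ennreal (3 ^ k) * (ennreal e' + ennreal e')"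
  using d(2)[of z] d'(2)[of z] z by (intro mult_left_mono add_mono) auto
  also have "... = ennreal (3 ^ k * (e' + e'))" using e'
  by (simp only: ennreal_mult' ennreal_plus zero_le_power add_nonneg_nonneg zero_le_numeral less_imp_le)
  also have "3 ^ k * (e' + e') = e" by (simp add: e'_def field_simps)
  finally show "(nnint lborel (%x. ennreal (\<bar>u (x - z) + w (x - z) - (u x + w x)\<bar> ^ k))) <= ennreal e" .
 qed (use d d' in auto)
qed

lemma transl_cont_cmult:
 fixes u :: "'a::euclidean_space => real"
 assumes [measurable]: "u : borel_fun" and u: "transl_cont k u"
 shows "transl_cont k (%x. c * u x)"
 unfolding transl_cont_def
proof (intro allI impI)
 fix e :: real assume e: "e > 0"
 define e' where "e' = e / (\<bar>c\<bar> ^ k + 1)"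
 have pos: "\<bar>c\<bar> ^ k + 1 > 0" by (simp add: add_nonneg_pos)
 have e': "e' > 0" using e pos by (simp add: e'_def)
 obtain d where d: "d > 0" "!!z. norm z < d ==> (nnint lborel (%x. ennreal (\<bar>u (x - z) - u x\<bar> ^ k))) <= ennreal e'"
  using u e' unfolding transl_cont_def by blast
 show "\<exists>d>0. \<forall>z. norm z < d --> (nnint lborel (%x. ennreal (\<bar>c * u (x - z) - c * u x\<bar> ^ k))) <= ennreal e"
 proof (intro exI[of _ d] conjI allI impI d(1))
  fix z :: 'a assume z: "norm z < d"
  have "(nnint lborel (%x. ennreal (\<bar>c * u (x - z) - c * u x\<bar> ^ k))) = (nnint lborel (%x. ennreal (\<bar>c\<bar> ^ k) * ennreal (\<bar>u (x - z) - u x\<bar> ^ k)))"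
  by (intro nn_integral_cong) (simp add: right_diff_distrib[symmetric] abs_mult power_mult_distrib ennreal_mult')
  also have "... = ennreal (\<bar>c\<bar> ^ k) * (nnint lborel (%x. ennreal (\<bar>u (x - z) - u x\<bar> ^ k)))"
  by (simp add: nn_integral_cmult)
  also have "... <= ennreal (\<bar>c\<bar> ^ k) * ennreal e'" by (intro mult_left_mono d z) simp
  also have "... = ennreal (\<bar>c\<bar> ^ k * e')" by (simp add: ennreal_mult')
  also have "... <= ennreal e"
  proof (rule ennreal_leI)
  have "\<bar>c\<bar> ^ k * e' <= (\<bar>c\<bar> ^ k + 1) * e'" using e' by (intro mult_right_mono) auto
  also have "... = e" using pos by (simp add: e'_def)
  finally show "\<bar>c\<bar> ^ k * e' <= e" .
  qed
  finally show "(nnint lborel (%x. ennreal (\<bar>c * u (x - z) - c * u x\<bar> ^ k))) <= ennreal e" .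
 qed
qed

text \<open>An open neighbourhood \<open>U\<close> of \<open>K\<close> with small excess contains
  every translate of \<open>K\<close> by less than the distance from \<open>K\<close> to the
  complement of \<open>U\<close>. Translates have equal measure, so the two one-sided differences
  are equally small.\<close>

lemma transl_cont_indicator_compact:
 fixes K :: "'a::euclidean_space set"
 assumes K: "compact K" and k: "k >= 1"
 shows "transl_cont k (ind K)"
 unfolding transl_cont_def
proof (intro allI impI)
 fix e :: real assume e: "e > 0"
 have Kb: "K : sets borel" using K by (simp add: compact_imp_closed)
 have Kfin: "emeasure lborel K < \<infinity>" using K compact_imp_bounded emeasure_bounded_finite by blast
 obtain U where U: "open U" "K \<subseteq> U" "emeasure lborel (U - K) < ennreal (e/2)"
  using outer_regular_lborel[OF Kb, of "e/2"] e by auto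
 have [measurable]: "U : sets borel" "K : sets borel" using U Kb by auto
 obtain d where d: "d > 0" "!!x y. x : K ==> y \<notin> U ==> d <= dist x y"
  using separate_compact_closed[of K "-U"] K U by (metis ComplI Diff_disjoint Diff_eq closed_Compl Diff_eq_empty_iff inf_commute)
 show "\<exists>d>0. \<forall>z. norm z < d --> (nnint lborel (%x. ennreal (\<bar>ind K (x - z) - ind K x\<bar> ^ k))) <= ennreal e"
 proof (intro exI[of _ d] conjI allI impI d(1))
  fix z :: 'a assume z: "norm z < d"
  define Kz where "Kz = (%x. x - z) -` K"
  have [measurable]: "Kz : sets borel"
  proof -
  have "closed Kz" unfolding Kz_def
  by (intro closed_vimage compact_imp_closed K continuous_intros)
  thus ?thesis by simp
  qed
  have mKz: "emeasure lborel Kz = emeasure lborel K"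
  proof -
  have "emeasure lborel Kz = (nnint lborel (%x. ind Kz x))" by simp
  also have "... = (nnint lborel (%x. ind K (x - z)))" by (simp add: Kz_def indicator_def)
  also have "... = (nnint lborel (%x. ind K x))" by (rule nn_integral_lborel_translate) simp
  finally show ?thesis by simp
  qed
  have sub: "Kz \<subseteq> U"
  proof
  fix x assume x: "x : Kz"
  show "x : U"
  proof (rule ccontr)
  assume "x \<notin> U"
  hence "d <= dist (x - z) x" using d(2)[of "x - z" x] x by (simp add: Kz_def)
  thus False using z by (simp add: dist_norm)
  qed
  qed
  have finI: "emeasure lborel (K \<inter> Kz) < \<infinity>"
  using emeasure_mono[of "K \<inter> Kz" K lborel] Kb by (intro le_less_trans[OF _ Kfin]) simp
  have d1: "emeasure lborel (Kz - K) <= ennreal (e/2)"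
  proof -
  have "emeasure lborel (Kz - K) <= emeasure lborel (U - K)" using sub by (intro emeasure_mono) auto
  thus ?thesis using U(3) by simp
  qed
  have d2: "emeasure lborel (K - Kz) <= ennreal (e/2)"
  proof -
  have "emeasure lborel (K - Kz) + emeasure lborel (K \<inter> Kz) = emeasure lborel K"
  by (subst plus_emeasure) (auto intro!: arg_cong[where f="emeasure lborel"])
  moreover have "emeasure lborel (Kz - K) + emeasure lborel (K \<inter> Kz) = emeasure lborel Kz"
  by (subst plus_emeasure) (auto intro!: arg_cong[where f="emeasure lborel"])
  ultimately have "emeasure lborel (K - Kz) = emeasure lborel (Kz - K)"
  using mKz finI ennreal_add_left_cancel[of "emeasure lborel (K \<inter> Kz)" "emeasure lborel (K - Kz)" "emeasure lborel (Kz - K)"]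
  by (auto simp: add.commute)
  thus ?thesis using d1 by simp
  qed
  have "(nnint lborel (%x. ennreal (\<bar>ind K (x - z) - ind K x\<bar> ^ k))) = (nnint lborel (%x. ind (Kz - K) x + ind (K - Kz) x))"
  using k by (intro nn_integral_cong) (auto simp: indicator_def Kz_def power_0_left)
  also have "... = emeasure lborel (Kz - K) + emeasure lborel (K - Kz)"
  by (subst nn_integral_add) auto
  also have "... <= ennreal (e/2) + ennreal (e/2)" by (intro add_mono d1 d2)
  also have "... = ennreal e" using e by (simp flip: ennreal_plus)
  finally show "(nnint lborel (%x. ennreal (\<bar>ind K (x - z) - ind K x\<bar> ^ k))) <= ennreal e" .
 qed
qed

text \<open>Cut off the part outside a large ball, then approximate the rest from inside by a
  compact set.\<close>

lemma transl_cont_indicator: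
 fixes A :: "'a::euclidean_space set"
 assumes [measurable]: "A : sets borel" and fin: "emeasure lborel A < \<infinity>" and k: "k >= 1"
 shows "transl_cont k (ind A)"
proof (rule transl_cont_limit)
 fix e :: real assume e: "e > 0"
 have "(%n. emeasure lborel (A - cball 0 (real n))) \<longlonglongrightarrow> emeasure lborel (\<Inter>n. A - cball 0 (real n))"
 proof (rule Lim_emeasure_decseq)
  show "decseq (%n. A - cball 0 (real n))" by (rule decseq_SucI) auto
  show "emeasure lborel (A - cball 0 (real n)) ~= \<infinity>" for n
  proof -
  have "emeasure lborel (A - cball 0 (real n)) <= emeasure lborel A" by (intro emeasure_mono) auto
  thus ?thesis using fin by (metis infinity_ennreal_def leD)
  qed
 qed auto
 moreover have "(\<Inter>n. A - cball 0 (real n)) = {}"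
 proof (intro equals0I)
  fix x assume x: "x : (\<Inter>n. A - cball 0 (real n))"
  obtain n where "norm x <= real n" using real_arch_simple by blast
  thus False using x by auto
 qed
 ultimately have "(%n. emeasure lborel (A - cball 0 (real n))) \<longlonglongrightarrow> 0" by (simp only: emeasure_empty)
 hence "eventually (%n. emeasure lborel (A - cball 0 (real n)) < ennreal (e/2)) sequentially"
  using e by (intro order_tendstoD) auto
 then obtain n where n: "emeasure lborel (A - cball 0 (real n)) < ennreal (e/2)"
  by (auto simp: eventually_sequentially)
 obtain T :: "'a set" where T: "closed T" "T \<subseteq> A \<inter> cball 0 (real n)" "emeasure lebesgue ((A \<inter> cball 0 (real n)) - T) < ennreal (e/2)"
 proof (rule sets_lebesgue_inner_closed[of "A \<inter> cball 0 (real n)" "e/2"])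
  show "A \<inter> cball 0 (real n) : sets lebesgue" by simp
  show "e / 2 > 0" using e by simp
 qed
 have "bounded T" by (rule bounded_subset[OF bounded_cball[of 0 "real n"]]) (use T(2) in simp)
 hence cT: "compact T" using T(1) by (simp add: compact_eq_bounded_closed)
 have [measurable]: "T : sets borel" using T by auto
 have m: "emeasure lborel (A - T) <= ennreal e"
 proof -
  have "emeasure lborel (A - T) <= emeasure lborel ((A - cball 0 (real n)) \<union> ((A \<inter> cball 0 (real n)) - T))"
  by (intro emeasure_mono) auto
  also have "... <= emeasure lborel (A - cball 0 (real n)) + emeasure lborel ((A \<inter> cball 0 (real n)) - T)"
  by (intro emeasure_subadditive) auto
  also have "emeasure lborel ((A \<inter> cball 0 (real n)) - T) = emeasure lebesgue ((A \<inter> cball 0 (real n)) - T)"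
  by simp
  also have "emeasure lborel (A - cball 0 (real n)) + emeasure lebesgue ((A \<inter> cball 0 (real n)) - T) <= ennreal (e/2) + ennreal (e/2)"
  using n T(3) by (intro add_mono) auto
  also have "... = ennreal e" using e by (simp flip: ennreal_plus)
  finally show ?thesis .
 qed
 have "(nnint lborel (%x. ennreal (\<bar>ind A x - ind T x\<bar> ^ k))) = (nnint lborel (%x. ind (A - T) x))"
  using T(2) k by (intro nn_integral_cong) (auto simp: indicator_def power_0_left)
 hence "(nnint lborel (%x. ennreal (\<bar>ind A x - ind T x\<bar> ^ k))) <= ennreal e" using m by simp
 thus "\<exists>w. w : borel_fun & transl_cont k w & (nnint lborel (%x. ennreal (\<bar>ind A x - w x\<bar> ^ k))) <= ennreal e"
  using transl_cont_indicator_compact[OF cT k] by (intro exI[of _ "ind T"]) auto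
qed auto

lemma transl_cont_sum:
 fixes u :: "'i => 'a::euclidean_space => real"
 assumes "finite I" "!!i. i : I ==> u i : borel_fun" "!!i. i : I ==> transl_cont k (u i)" "k >= 1"
 shows "transl_cont k (%x. \<Sum>i\<in>I. u i x)"
 using assms
proof (induction I)
 case empty
 thus ?case by (auto simp: transl_cont_def power_0_left intro!: exI[of _ 1])
next
 case (insert i I)
 thus ?case by (simp add: transl_cont_add)
qed

text \<open>Simple functions dominated by \<open>2 * \<bar>u\<bar>\<close> converge to
  \<open>u\<close> in the k-th power by dominated convergence, and they are finite combinations of
  indicators of sets of finite measure.\<close>

theorem transl_cont_power_integrable:
 fixes u :: "'a::euclidean_space => real"
 assumes [measurable]: "u : borel_fun" and fin: "(nnint lborel (%x. ennreal (\<bar>u x\<bar> ^ k))) < \<infinity>" and k: "k >= 1"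
 shows "transl_cont k u"
proof (rule transl_cont_limit)
 fix e :: real assume e: "e > 0"
 obtain F where F: "!!i::nat. simple_function lborel (F i)" "!!x. (%i. F i x) \<longlonglongrightarrow> u x" "!!i x. dist (F i x) 0 <= 2 * dist (u x) 0"
  using borel_measurable_implies_sequence_metric[of u lborel 0] by auto
 have Fm [measurable]: "F i : borel_fun" for i using borel_measurable_simple_function[OF F(1)[of i]] by simp
 have Fb: "\<bar>F i x\<bar> <= 2 * \<bar>u x\<bar>" for i x using F(3)[of i x] by (simp add: dist_real_def)
 have fin': "(nnint lborel (%x. ennreal (C * \<bar>u x\<bar> ^ k))) < \<infinity>" if "C >= 0" for C
  using fin that by (subst ennreal_mult) (auto simp: nn_integral_cmult ennreal_mult_less_top)
 have "(%i. nnint lborel (%x. ennreal (\<bar>u x - F i x\<bar> ^ k))) \<longlonglongrightarrow> (nnint (lborel :: 'a measure) (%x. 0))"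
 proof (rule nn_integral_dominated_convergence[where w="%x. ennreal (3 ^ k * \<bar>u x\<bar> ^ k)"])
  show "AE x in lborel. ennreal (\<bar>u x - F i x\<bar> ^ k) <= ennreal (3 ^ k * \<bar>u x\<bar> ^ k)" for i
  proof (rule AE_I2)
  fix x
  have "\<bar>u x - F i x\<bar> ^ k <= (3 * \<bar>u x\<bar>) ^ k" using Fb[of i x] by (intro power_mono) auto
  thus "ennreal (\<bar>u x - F i x\<bar> ^ k) <= ennreal (3 ^ k * \<bar>u x\<bar> ^ k)" by (simp add: power_mult_distrib ennreal_leI)
  qed
  show "AE x in lborel. (%i. ennreal (\<bar>u x - F i x\<bar> ^ k)) \<longlonglongrightarrow> 0"
  proof (rule AE_I2)
  fix x
  have "(%i. \<bar>u x - F i x\<bar> ^ k) \<longlonglongrightarrow> \<bar>u x - u x\<bar> ^ k" by (intro tendsto_intros F)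
  hence "(%i. \<bar>u x - F i x\<bar> ^ k) \<longlonglongrightarrow> 0" using k by (simp add: power_0_left)
  thus "(%i. ennreal (\<bar>u x - F i x\<bar> ^ k)) \<longlonglongrightarrow> 0" using tendsto_ennrealI by fastforce
  qed
  show "(nnint lborel (%x. ennreal (3 ^ k * \<bar>u x\<bar> ^ k))) < \<infinity>" by (rule fin') simp
 qed auto
 hence "eventually (%i. (nnint lborel (%x. ennreal (\<bar>u x - F i x\<bar> ^ k))) < ennreal e) sequentially"
  using e by (intro order_tendstoD) auto
 then obtain i where i: "(nnint lborel (%x. ennreal (\<bar>u x - F i x\<bar> ^ k))) < ennreal e" by (auto simp: eventually_sequentially)
 have finr: "finite (range (F i))" using F(1)[of i] by (simp add: simple_function_def)
 have "transl_cont k (%x. \<Sum>y\<in>range (F i). y * ind (F i -` {y}) x)"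
 proof (rule transl_cont_sum[OF finr _ _ k])
  fix y assume "y : range (F i)"
  have [measurable]: "F i -` {y} : sets borel" using measurable_sets[OF Fm, of "{y}" i] by simp
  show "(%x. y * ind (F i -` {y}) x) : borel_fun" by measurable
  show "transl_cont k (%x. y * ind (F i -` {y}) x)"
  proof (cases "y = 0")
  case True
  thus ?thesis using k by (auto simp: transl_cont_def power_0_left intro!: exI[of _ 1])
  next
  case False
  \<comment> \<open>Chebyshev's inequality: on the level set of a nonzero value \<open>y\<close> the
    function \<open>\<bar>u\<bar>\<close> is at least \<open>\<bar>y\<bar> / 2\<close>, so the level
    set has finite measure.\<close>
  have "ennreal (\<bar>y\<bar> ^ k) * emeasure lborel (F i -` {y}) = (nnint lborel (%x. ennreal (\<bar>y\<bar> ^ k) * ind (F i -` {y}) x))"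
  by (subst nn_integral_cmult_indicator) auto
  also have "... <= (nnint lborel (%x. ennreal (2 ^ k * \<bar>u x\<bar> ^ k)))"
  proof (rule nn_integral_mono)
  fix x
  have "\<bar>F i x\<bar> ^ k <= (2 * \<bar>u x\<bar>) ^ k" using Fb by (intro power_mono) auto
  thus "ennreal (\<bar>y\<bar> ^ k) * ind (F i -` {y}) x <= ennreal (2 ^ k * \<bar>u x\<bar> ^ k)"
  by (auto simp: indicator_def power_mult_distrib intro: ennreal_leI)
  qed
  also have "... < \<infinity>" by (rule fin') simp
  finally have "emeasure lborel (F i -` {y}) < \<infinity>" using False
  by (auto simp: ennreal_mult_less_top)
  thus ?thesis by (intro transl_cont_cmult transl_cont_indicator k) auto
  qed
 qed
 moreover have "(\<Sum>y\<in>range (F i). y * ind (F i -` {y}) x) = F i x" for x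
 proof -
  have "(\<Sum>y\<in>range (F i). y * ind (F i -` {y}) x) = (\<Sum>y\<in>range (F i). if y = F i x then y else 0)"
  by (intro sum.cong) (auto simp: indicator_def)
  also have "... = F i x" using finr by simp
  finally show ?thesis .
 qed
 ultimately have "transl_cont k (F i)" by simp
 thus "\<exists>w. w : borel_fun & transl_cont k w & (nnint lborel (%x. ennreal (\<bar>u x - w x\<bar> ^ k))) <= ennreal e"
  using i Fm by (intro exI[of _ "F i"]) auto
qed auto

section \<open>Mollification and weak derivatives\<close>

lemma cball_borel [measurable]: "cball (a::'a::metric_space) r : sets borel" by simp

text \<open>Borel rather than Lebesgue measurability is required because the functions are later
  restricted to circles, and every section of a Borel function is again measurable. The exponents
  that occur in the estimates are 1 and 2.\<close>

definition loc_pow :: "nat => ('a::euclidean_space => real) => bool" where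
 "loc_pow k u \<longleftrightarrow> u : borel_fun &
  (\<forall>R. (nnint lborel (%x. ennreal (\<bar>u x\<bar> ^ k) * ind (cball 0 R) x)) < \<infinity>)"

lemma loc_pow_borel [dest]: "loc_pow k u ==> u : borel_fun" by (simp add: loc_pow_def)

lemma loc_pow_1_integrable:
 fixes u :: "'a::euclidean_space => real"
 assumes u: "loc_pow 1 u"
 shows "integrable lborel (%y. \<bar>u y\<bar> * ind (cball 0 R) y)"
proof (rule integrableI_nonneg)
 note [measurable] = loc_pow_borel[OF u]
 show "(%y. \<bar>u y\<bar> * ind (cball 0 R) y) : borel_measurable lborel" by measurable
 have "(nnint lborel (%x. ennreal (\<bar>u x\<bar> * ind (cball 0 R) x))) = (nnint lborel (%x. ennreal (\<bar>u x\<bar> ^ 1) * ind (cball 0 R) x))"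
  by (intro nn_integral_cong) (auto simp: indicator_def)
 thus "(nnint lborel (%x. ennreal (\<bar>u x\<bar> * ind (cball 0 R) x))) < \<infinity>" using u by (simp add: loc_pow_def)
qed auto

lemma loc_pow_mult:
 fixes u :: "'a::euclidean_space => real"
 assumes u: "loc_pow 1 u" and [measurable]: "K : borel_fun"
  and "!!y. \<bar>K y\<bar> <= B" "!!y. norm y > R ==> K y = 0"
 shows "integrable lborel (%y. u y * K y)"
proof (rule Bochner_Integration.integrable_bound[OF integrable_mult_right[OF loc_pow_1_integrable[OF u, of R], of B]])
 note [measurable] = loc_pow_borel[OF u]
 show "(%y. u y * K y) : borel_measurable lborel" by measurable
 show "AE y in lborel. norm (u y * K y) <= norm (B * (\<bar>u y\<bar> * ind (cball 0 R) y))"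
 proof (rule AE_I2)
  fix y
  show "norm (u y * K y) <= norm (B * (\<bar>u y\<bar> * ind (cball 0 R) y))"
  proof (cases "norm y > R")
  case True thus ?thesis using assms(4) by simp
  next
  case False
  have "\<bar>K y\<bar> * \<bar>u y\<bar> <= \<bar>B\<bar> * \<bar>u y\<bar>" using assms(3)[of y] by (intro mult_right_mono) auto
  thus ?thesis using False by (simp add: abs_mult mult.commute)
  qed
 qed
qed

definition conv :: "('a::euclidean_space => real) => ('a => real) => 'a => real" where
 "conv K u x = (LINT y|lborel. u y * K (x - y))"

lemma has_derivative_quadratic_boundI:
 fixes f :: "'a::real_normed_vector => real"
 assumes D: "bounded_linear D" and C: "!!h. norm h <= 1 ==> \<bar>f (x + h) - f x - D h\<bar> <= C * (norm h)^2"
 shows "(f has_derivative D) (at x)"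
proof -
 have "((%h. norm (f (x + h) - f x - D h) / norm h) \<longlongrightarrow> 0) (at 0)"
 proof (rule Lim_null_comparison)
  show "eventually (%h. norm (norm (f (x + h) - f x - D h) / norm h) <= C * norm h) (at 0)"
  unfolding eventually_at
  proof (intro exI[of _ 1] conjI ballI impI)
  fix h :: 'a assume "h ~= 0 & dist h 0 < 1"
  hence h: "h ~= 0" "norm h <= 1" by auto
  have "\<bar>f (x + h) - f x - D h\<bar> / norm h <= C * (norm h)^2 / norm h" using C[OF h(2)] by (intro divide_right_mono) auto
  thus "norm (norm (f (x + h) - f x - D h) / norm h) <= C * norm h" using h by (simp add: sq_eq)
  qed simp
  show "((%h. C * norm h) \<longlongrightarrow> 0) (at 0)" by (auto intro!: tendsto_eq_intros)
 qed
 thus ?thesis using D by (simp add: has_derivative_at)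
qed

text \<open>The partial derivatives of the kernel are Lipschitz with compact support, so its
  first-order Taylor remainder is at most a constant times \<open>(norm h)^2\<close>, uniformly in
  the base point. Integrated against \<open>u\<close>, the bound stays quadratic in
  \<open>h\<close>.\<close>

lemma conv_has_derivative:
 fixes K :: "'a::euclidean_space => real"
 assumes K: "C_diff 2 K" "!!z. norm z > R ==> K z = 0" and u: "loc_pow 1 u"
 shows "(conv K u has_derivative (%h. \<Sum>b\<in>Basis. (h \<bullet> b) * conv (%z. fderiv K (at z) b) u x)) (at x)"
proof -
 note [measurable] = loc_pow_borel[OF u]
 define DK where "DK b z = fderiv K (at z) b" for b z
 have C2: "C_diff (Suc 1) K" using K(1) by (simp add: numeral_2_eq_2)
 have dK: "(K has_derivative (%h. fderiv K (at z) h)) (at z)" for z using C_diff_SucD(1)[OF C2] .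
 have DK1: "C_diff 1 (DK b)" if "b : Basis" for b using C_diff_SucD(2)[OF C2 that] by (simp add: DK_def[abs_def])
 have FK0: "fderiv K (at z) = (%_. 0)" if "norm z > R" for z
 proof -
  have "open {x::'a. R < norm x}" by (auto intro!: open_Collect_less continuous_intros)
  hence "(K has_derivative (%_. 0)) (at z)"
  by (rule has_derivative_transform_within_open[OF has_derivative_const]) (use that K(2) in simp_all)
  thus ?thesis by (rule has_derivative_unique[OF dK])
 qed
 have DK0: "DK b z = 0" if "norm z > R" for b z unfolding DK_def FK0[OF that] by simp
 have cK: "contU K" by (rule C_diff_imp_continuous[OF K(1)])
 have cDK: "contU (DK b)" if "b : Basis" for b by (rule C_diff_imp_continuous[OF DK1[OF that]])
 have "\<exists>L. L >= 0 & (\<forall>x y. \<bar>DK b x - DK b y\<bar> <= L * norm (x - y))" if "b : Basis" for b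
  using C_diff_1_compact_support_Lipschitz[OF DK1[OF that] DK0] by metis
 then obtain L where L: "!!b. b : Basis ==> L b >= 0" "!!b x y. b : Basis ==> \<bar>DK b x - DK b y\<bar> <= L b * norm (x - y)"
  by metis
 define M where "M = (\<Sum>b\<in>Basis. L b)"
 have lin: "fderiv K (at z) h = (\<Sum>b\<in>Basis. (h \<bullet> b) * DK b z)" for z h
 proof -
  have "linear (fderiv K (at z))" using has_derivative_linear[OF dK] by simp
  hence "fderiv K (at z) (\<Sum>b\<in>Basis. (h \<bullet> b) *\<^sub>R b) = (\<Sum>b\<in>Basis. (h \<bullet> b) * DK b z)"
  by (simp add: linear_sum linear_cmul DK_def)
  thus ?thesis by (simp only: euclidean_representation)
 qed
 have quad: "\<bar>K (z + h) - K z - (\<Sum>b\<in>Basis. (h \<bullet> b) * DK b z)\<bar> <= M * (norm h)^2" for z h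
 proof -
  have "norm (K (z + h) - K z - fderiv K (at z) ((z + h) - z)) <= norm ((z + h) - z) * (M * norm h)"
  proof (rule differentiable_bound_linearization[where S="cball z (norm h)"])
  show "z + t *\<^sub>R (z + h - z) : cball z (norm h)" if "t : {0..1}" for t
  using that by (simp add: dist_norm mult_left_le_one_le)
  show "(K has_derivative fderiv K (at w)) (at w within cball z (norm h))" for w
  using dK by (rule has_derivative_at_withinI)
  show "onorm (fderiv K (at w) - fderiv K (at z)) <= M * norm h" if w: "w : cball z (norm h)" for w
  proof (rule onorm_le)
  fix k :: 'a
  have "norm ((fderiv K (at w) - fderiv K (at z)) k) = \<bar>\<Sum>b\<in>Basis. (k \<bullet> b) * (DK b w - DK b z)\<bar>"
  by (simp add: lin sum_subtractf right_diff_distrib)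
  also have "... <= (\<Sum>b\<in>Basis. \<bar>(k \<bullet> b) * (DK b w - DK b z)\<bar>)" by (rule sum_abs)
  also have "... <= (\<Sum>b\<in>Basis. norm k * (L b * norm h))"
  proof (rule sum_mono)
  fix b :: 'a assume b: "b : Basis"
  have "\<bar>DK b w - DK b z\<bar> <= L b * norm (w - z)" by (rule L(2)[OF b])
  also have "... <= L b * norm h" using w L(1)[OF b] by (intro mult_left_mono) (auto simp: dist_norm norm_minus_commute)
  finally show "\<bar>(k \<bullet> b) * (DK b w - DK b z)\<bar> <= norm k * (L b * norm h)"
  unfolding abs_mult using Basis_le_norm[OF b] by (intro mult_mono) auto
  qed
  also have "... = M * norm h * norm k" by (simp add: M_def sum_distrib_left sum_distrib_right mult_ac)
  finally show "norm ((fderiv K (at w) - fderiv K (at z)) k) <= M * norm h * norm k" .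
  qed
  qed simp
  thus ?thesis by (simp add: lin sq_eq mult_ac)
 qed
 have bd: "\<exists>B. \<forall>z. \<bar>g z\<bar> <= B" if "contU g" "!!z. norm z > R ==> g z = 0" for g :: "'a => real"
 proof -
  have "bounded (g ` cball 0 R)" by (intro compact_imp_bounded compact_continuous_image cont_subset[OF that(1)]) auto
  then obtain B where B: "\<forall>y\<in>g ` cball 0 R. norm y <= B" unfolding bounded_iff by blast
  have "\<bar>g z\<bar> <= max B 0" for z
  proof (cases "norm z > R")
  case False
  hence "norm (g z) <= B" by (intro bspec[OF B]) auto
  thus ?thesis by simp
  qed (simp add: that(2))
  thus ?thesis by blast
 qed
 have int: "integrable lborel (%y. u y * g (x' - y))" if g: "contU g" "!!z. norm z > R ==> g z = 0" for g x'
 proof -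
  obtain B where B: "!!z. \<bar>g z\<bar> <= B" using bd[OF g] by blast
  have "contU (%y. g (x' - y))" by (intro cont_comp[OF g(1)] continuous_intros) auto
  hence [measurable]: "(%y. g (x' - y)) : borel_fun" by (rule cont_borel)
  show ?thesis
  proof (rule loc_pow_mult[OF u _ B, where R="norm x' + R"])
  show "g (x' - y) = 0" if "norm x' + R < norm y" for y
  by (rule g(2)) (use that norm_triangle_ineq4[of y x'] norm_minus_commute[of y x'] norm_triangle_ineq2[of y x'] in linarith)
  qed simp
 qed
 \<comment> \<open>The ball of radius \<open>norm x + R + 1\<close> contains the supports of both
   kernels for all increments of norm at most 1.\<close>
 define N where "N = (LINT y|lborel. \<bar>u y\<bar> * ind (cball 0 (norm x + R + 1)) y)"
 show ?thesis
 proof (rule has_derivative_quadratic_boundI[where C="M * N"])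
  show "bounded_linear (%h. \<Sum>b\<in>Basis. (h \<bullet> b) * conv (%z. fderiv K (at z) b) u x)"
  by (intro bounded_linear_sum bounded_linear_mult_const bounded_linear_inner_left)
  fix h :: 'a assume h: "norm h <= 1"
  have i1: "integrable lborel (%y. u y * K (x' - y))" for x' by (rule int[OF cK K(2)])
  have i2: "integrable lborel (%y. (h \<bullet> b) * (u y * DK b (x - y)))" if "b : Basis" for b
  using int[OF cDK[OF that] DK0, of x] by simp
  have i3: "integrable lborel (%y. \<Sum>b\<in>Basis. (h \<bullet> b) * (u y * DK b (x - y)))"
  by (intro Bochner_Integration.integrable_sum i2)
  have "(\<Sum>b\<in>Basis. (h \<bullet> b) * conv (%z. fderiv K (at z) b) u x)
  = (LINT y|lborel. (\<Sum>b\<in>Basis. (h \<bullet> b) * (u y * DK b (x - y))))"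
  unfolding conv_def DK_def[symmetric] by (subst Bochner_Integration.integral_sum[OF i2]) auto
  hence "conv K u (x + h) - conv K u x - (\<Sum>b\<in>Basis. (h \<bullet> b) * conv (%z. fderiv K (at z) b) u x)
  = (LINT y|lborel. u y * K (x + h - y) - u y * K (x - y) - (\<Sum>b\<in>Basis. (h \<bullet> b) * (u y * DK b (x - y))))"
  unfolding conv_def by (subst Bochner_Integration.integral_diff[OF LINT_diff[OF i1 i1] i3], subst Bochner_Integration.integral_diff[OF i1 i1]) simp
  also have "\<bar>...\<bar> <= (LINT y|lborel. M * (norm h)^2 * (\<bar>u y\<bar> * ind (cball 0 (norm x + R + 1)) y))"
  proof (rule integral_abs_bound_integral)
  show "integrable lborel (%y. u y * K (x + h - y) - u y * K (x - y) - (\<Sum>b\<in>Basis. (h \<bullet> b) * (u y * DK b (x - y))))"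
  by (intro LINT_diff i1 i3)
  show "integrable lborel (%y. M * (norm h)^2 * (\<bar>u y\<bar> * ind (cball 0 (norm x + R + 1)) y))"
  by (intro integrable_mult_right loc_pow_1_integrable u)
  fix y
  have e: "u y * K (x + h - y) - u y * K (x - y) - (\<Sum>b\<in>Basis. (h \<bullet> b) * (u y * DK b (x - y)))
  = u y * (K ((x - y) + h) - K (x - y) - (\<Sum>b\<in>Basis. (h \<bullet> b) * DK b (x - y)))"
  by (simp add: algebra_simps sum_distrib_left)
  show "\<bar>u y * K (x + h - y) - u y * K (x - y) - (\<Sum>b\<in>Basis. (h \<bullet> b) * (u y * DK b (x - y)))\<bar>
  <= M * (norm h)^2 * (\<bar>u y\<bar> * ind (cball 0 (norm x + R + 1)) y)"
  proof (cases "norm y <= norm x + R + 1")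
  case True
  have "\<bar>u y\<bar> * \<bar>K ((x - y) + h) - K (x - y) - (\<Sum>b\<in>Basis. (h \<bullet> b) * DK b (x - y))\<bar> <= \<bar>u y\<bar> * (M * (norm h)^2)"
  by (intro mult_left_mono quad) simp
  thus ?thesis unfolding e abs_mult using True by (simp add: mult_ac)
  next
  case False
  have "norm (x - y) > R" "norm (x + h - y) > R"
  using False h norm_triangle_ineq2[of y x] norm_triangle_ineq2[of y "x + h"] norm_triangle_ineq[of x h]
  norm_minus_commute[of y x] norm_minus_commute[of y "x+h"] by linarith+
  thus ?thesis using K(2) DK0 False by simp
  qed
  qed
  also have "... = M * N * (norm h)^2" by (simp add: N_def)
  finally show "\<bar>conv K u (x + h) - conv K u x - (\<Sum>b\<in>Basis. (h \<bullet> b) * conv (%z. fderiv K (at z) b) u x)\<bar> <= M * N * (norm h)^2" .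
 qed
qed

definition mollifier :: "nat => 'a::euclidean_space => real" where
 "mollifier n z = bump 0 (1 / real (Suc n)) z / (LINT y|lborel. bump (0::'a) (1 / real (Suc n)) y)"
abbreviation "moll n == conv (mollifier n)"

lemma integrable_bump: "s > 0 ==> integrable lborel (bump a s)"
proof -
 assume s: "s > 0"
 have "integrable lborel (%y. ind (cball a s) y *\<^sub>R bump a s y)"
  by (rule borel_integrable_compact) (auto intro: continuous_on_bump)
 moreover have "(%y. ind (cball a s) y *\<^sub>R bump a s y) = bump a s"
  using s bump_eq_0[of s _ a] by (force simp: indicator_def fun_eq_iff dist_commute)
 ultimately show ?thesis by simp
qed

lemma integral_bump_pos: "s > 0 ==> 0 < (LINT y|lborel. bump a s y)"
proof -
 assume s: "s > 0"
 have "0 <= (LINT y|lborel. bump a s y)" by (intro Bochner_Integration.integral_nonneg bump_nonneg)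
 moreover have "(LINT y|lborel. bump a s y) ~= 0"
 proof
  assume "(LINT y|lborel. bump a s y) = 0"
  hence "AE y in lborel. bump a s y = 0"
  using integral_nonneg_eq_0_iff_AE[OF integrable_bump[OF s, of a]] bump_nonneg by auto
  hence "AE y in lborel. y \<notin> ball a s"
  by eventually_elim (metis bump_pos_iff[OF s, of a] dist_commute less_irrefl mem_ball)
  hence "emeasure lborel (ball a s) = 0" by (subst (asm) AE_iff_measurable[where N="ball a s"]) auto
  hence "negligible (ball a s)" by (simp add: negligible_iff_emeasure0)
  thus False using s open_not_negligible[of "ball a s"] by auto
 qed
 ultimately show ?thesis by linarith
qed

lemma mollifier_nonneg: "0 <= mollifier n z"
 using integral_bump_pos[of "1 / real (Suc n)" "0::'a"] by (simp add: mollifier_def bump_nonneg)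

lemma mollifier_zero: "norm z >= 1 / real (Suc n) ==> mollifier n z = 0"
 using bump_eq_0[of "1 / real (Suc n)" z 0] by (simp add: mollifier_def)

lemma mollifier_zero': "norm z > 1 ==> mollifier n z = 0"
 by (rule mollifier_zero) (rule order_trans[of _ 1], simp_all)

lemma mollifier_translate: "mollifier n (x - y) = (1 / (LINT y|lborel. bump (0::'a::euclidean_space) (1 / real (Suc n)) y)) * bump x (1 / real (Suc n)) (y::'a)"
 using bump_translate(2)[of x "1 / real (Suc n)" y] by (simp add: mollifier_def)

lemma C_diff_mollifier: "C_diff k (mollifier n :: 'a::euclidean_space => real)"
proof -
 have "(mollifier n :: 'a => real) = (%z. (1 / (LINT y|lborel. bump (0::'a) (1 / real (Suc n)) y)) * bump 0 (1 / real (Suc n)) z)"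
  by (simp add: fun_eq_iff mollifier_def)
 thus ?thesis using C_diff_cmult[OF C_diff_bump] by metis
qed

lemma continuous_mollifier: "contU (mollifier n)" by (rule C_diff_imp_continuous[OF C_diff_mollifier])

lemma mollifier_measurable [measurable]: "mollifier n : borel_fun"
 using continuous_mollifier by (rule cont_borel)

lemma integrable_mollifier: "integrable lborel (mollifier n)"
 unfolding mollifier_def[abs_def] by (intro integrable_divide integrable_bump) simp

lemma integral_mollifier: "(LINT z|lborel. mollifier n (z::'a::euclidean_space)) = 1"
 using integral_bump_pos[of "1 / real (Suc n)" "0::'a"] by (simp add: mollifier_def)

lemma mollifier_bounded: "\<exists>B. \<forall>z::'a::euclidean_space. \<bar>mollifier n z\<bar> <= B"
proof (intro exI allI)
 fix z :: 'a
 show "\<bar>mollifier n z\<bar> <= 1 / (LINT y|lborel. bump (0::'a) (1 / real (Suc n)) y)"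
  unfolding abs_of_nonneg[OF mollifier_nonneg] unfolding mollifier_def
  by (intro divide_right_mono bump_le_1 less_imp_le integral_bump_pos) simp
qed

definition has_weak_partial :: "'a::euclidean_space => ('a => real) => ('a => real) => bool" where
 "has_weak_partial b u g \<longleftrightarrow> (\<forall>phi. smooth phi & compact (support phi) -->
  (LINT x|lborel. u x * fderiv phi (at x) b) = - (LINT x|lborel. g x * phi x))"

text \<open>The reflected mollifier centred at \<open>x\<close> is a test function; the sign of the
  reflection cancels the sign in the definition of the weak derivative.\<close>

lemma conv_mollifier_weak_partial:
 assumes "has_weak_partial b u g"
 shows "conv (%z. fderiv (mollifier n) (at z) b) u x = moll n g x"
proof -
 define phi where "phi y = mollifier n (x - y)" for y
 have "smooth phi" unfolding smooth_def
 proof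
  fix k show "C_diff k phi" unfolding phi_def mollifier_translate by (intro C_diff_cmult C_diff_bump)
 qed
 moreover have "compact (support phi)"
 proof -
  have "support phi \<subseteq> cball x 1"
  unfolding support_def phi_def
  proof (rule closure_minimal)
  show "{y. mollifier n (x - y) ~= 0} \<subseteq> cball x 1"
  using mollifier_zero'[of "x - _" n] by (force simp: dist_norm not_le)
  qed simp
  moreover have "closed (support phi)" by (simp add: support_def)
  ultimately show ?thesis using bounded_subset[OF bounded_cball] by (simp add: compact_eq_bounded_closed)
 qed
 ultimately have w: "(LINT y|lborel. u y * fderiv phi (at y) b) = - (LINT y|lborel. g y * phi y)"
  using assms by (simp add: has_weak_partial_def)
 have "fderiv phi (at y) b = - fderiv (mollifier n) (at (x - y)) b" for y
 proof -
  have d: "(mollifier n has_derivative fderiv (mollifier n) (at z)) (at z)" for z :: 'a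
  using C_diff_SucD(1)[OF C_diff_mollifier] .
  have "(phi has_derivative (%h. fderiv (mollifier n) (at (x - y)) (- h))) (at y)"
  unfolding phi_def by (rule has_derivative_compose[OF _ d]) (auto intro!: derivative_eq_intros)
  from frechet_derivative_at[OF this] have "fderiv phi (at y) b = fderiv (mollifier n) (at (x - y)) (- b)" by metis
  also have "... = - fderiv (mollifier n) (at (x - y)) b"
  using linear_neg[OF has_derivative_linear[OF d]] .
  finally show ?thesis .
 qed
 thus ?thesis using w by (simp add: conv_def phi_def)
qed

lemma mollify_has_derivative:
 fixes u :: "'a::euclidean_space => real"
 assumes u: "loc_pow 1 u" and w: "!!b. b : Basis ==> has_weak_partial b u (g b)"
 shows "(moll n u has_derivative (%h. \<Sum>b\<in>Basis. (h \<bullet> b) * moll n (g b) x)) (at x)"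
proof -
 have "(moll n u has_derivative (%h. \<Sum>b\<in>Basis. (h \<bullet> b) * conv (%z. fderiv (mollifier n) (at z) b) u x)) (at x)"
  by (rule conv_has_derivative[OF C_diff_mollifier _ u, where R=1]) (rule mollifier_zero')
 also have "(%h. \<Sum>b\<in>Basis. (h \<bullet> b) * conv (%z. fderiv (mollifier n) (at z) b) u x)
  = (%h. \<Sum>b\<in>Basis. (h \<bullet> b) * moll n (g b) x)"
  by (intro ext sum.cong refl) (simp add: conv_mollifier_weak_partial[OF w])
 finally show ?thesis .
qed

lemma continuous_mollify:
 assumes u: "loc_pow 1 u"
 shows "contU (moll n u)"
proof (rule cont_at_on, rule ballI)
 fix x
 show "isCont (moll n u) x"
  by (rule has_derivative_continuous[OF conv_has_derivative[OF C_diff_mollifier _ u, where R=1]]) (rule mollifier_zero')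
qed

text \<open>Jensen's inequality for the probability density \<open>m\<close>. For the square it is
  the nonnegativity of the variance.\<close>

lemma nn_integral_power_le_weighted:
 fixes a m :: "'a => real"
 assumes am: "integrable M (%z. a z * m z)" and m: "integrable M m" "!!z. 0 <= m z" "(LINT z|M. m z) = 1"
  and [measurable]: "a : borel_measurable M" and k: "k = 1 \<or> k = 2"
 shows "ennreal (\<bar>LINT z|M. a z * m z\<bar> ^ k) <= (nnint M (%z. ennreal (\<bar>a z\<bar> ^ k * m z)))"
proof (cases "k = 1")
 case True
 have "ennreal (norm (LINT z|M. a z * m z)) <= (nnint M (%z. ennreal (norm (a z * m z))))"
  by (rule integral_norm_bound_ennreal[OF am])
 thus ?thesis using m(2) by (simp add: True abs_mult)
next
 case False
 hence k2: "k = 2" using k by simp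
 have [measurable]: "m : borel_measurable M" using m(1) by auto
 show ?thesis
 proof (cases "(nnint M (%z. ennreal (\<bar>a z\<bar> ^ k * m z))) = \<infinity>")
  case False
  hence i: "integrable M (%z. (a z)^2 * m z)"
  using m(2) by (intro integrableI_nonneg) (auto simp: k2 less_top)
  define c where "c = (LINT z|M. a z * m z)"
  have "0 <= (LINT z|M. (a z - c)^2 * m z)" using m(2) by (intro Bochner_Integration.integral_nonneg) auto
  also have "... = (LINT z|M. (a z)^2 * m z - 2 * c * (a z * m z) + c\<^sup>2 * m z)"
  by (intro LINT_cong) (auto simp: sq_eq algebra_simps)
  also have "... = (LINT z|M. (a z)^2 * m z) - 2 * c * c + c\<^sup>2"
  using i am m by (simp add: c_def)
  finally have "c\<^sup>2 <= (LINT z|M. (a z)^2 * m z)" by (simp add: sq_eq)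
  hence "ennreal (c\<^sup>2) <= ennreal (LINT z|M. (a z)^2 * m z)" by (rule ennreal_leI)
  also have "... = (nnint M (%z. ennreal ((a z)^2 * m z)))"
  using m(2) by (intro nn_integral_eq_integral[symmetric] i) auto
  finally show ?thesis by (simp add: k2 c_def)
 qed simp
qed

lemma lborel_reflect: "distr lborel borel (%z. x - z) = (lborel :: 'a::euclidean_space measure)"
 using lborel_affine[of "-1" x] by (simp add: density_1 power_abs)

text \<open>Jensen and Tonelli bound the error by the average of the translation errors over the
  support of the mollifier, and these are small by continuity of translations.\<close>

theorem mollify_tendsto:
 fixes u :: "'a::euclidean_space => real"
 assumes u1: "loc_pow 1 u" and uk: "loc_pow k u" and k: "k = 1 \<or> k = 2"
 shows "(%n. nnint lborel (%x. ennreal (\<bar>moll n u x - u x\<bar> ^ k) * ind (cball 0 R) x)) \<longlonglongrightarrow> 0"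
proof -
 note [measurable] = loc_pow_borel[OF u1]
 \<comment> \<open>Mollifiers live in the unit ball, so values of \<open>u\<close> beyond radius
   \<open>R + 1\<close> do not affect the ball of radius \<open>R\<close>. The truncation makes the
   k-th power globally integrable.\<close>
 define w where "w x = u x * ind (cball 0 (R + 1)) x" for x
 have [measurable]: "w : borel_fun" unfolding w_def by measurable
 have "(nnint lborel (%x. ennreal (\<bar>w x\<bar> ^ k))) = (nnint lborel (%x. ennreal (\<bar>u x\<bar> ^ k) * ind (cball 0 (R + 1)) x))"
  using k by (intro nn_integral_cong) (auto simp: w_def indicator_def power_0_left)
 also have "... < \<infinity>" using uk by (simp add: loc_pow_def)
 finally have T: "transl_cont k w" using k by (intro transl_cont_power_integrable) auto
 have main: "\<exists>N. \<forall>n\<ge>N. (nnint lborel (%x. ennreal (\<bar>moll n u x - u x\<bar> ^ k) * ind (cball 0 R) x)) <= ennreal e"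
  if e: "e > 0" for e
 proof -
  obtain d where d: "d > 0" "!!z. norm z < d ==> (nnint lborel (%x. ennreal (\<bar>w (x - z) - w x\<bar> ^ k))) <= ennreal e"
  using T e unfolding transl_cont_def by blast
  obtain N where N: "1 / real (Suc N) < d" using d(1) nat_approx_posE by blast
  show ?thesis
  proof (intro exI[of _ N] allI impI)
  fix n assume "n >= N"
  hence nd: "1 / real (Suc n) < d" using N by (smt (verit) frac_le of_nat_0_less_iff of_nat_le_iff Suc_le_mono zero_less_Suc)
  obtain B where B: "!!z::'a. \<bar>mollifier n z\<bar> <= B" using mollifier_bounded[of n] by blast
  have pw: "ennreal (\<bar>moll n u x - u x\<bar> ^ k) <= (nnint lborel (%z. ennreal (\<bar>w (x - z) - w x\<bar> ^ k * mollifier n z)))"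
  if x: "x : cball 0 R" for x
  proof -
  have i1: "integrable lborel (%y. u y * mollifier n (x - y))"
  proof (rule loc_pow_mult[OF u1 _ B, where R="norm x + 1"])
  show "mollifier n (x - y) = 0" if "norm x + 1 < norm y" for y
  by (rule mollifier_zero') (use that norm_triangle_ineq2[of y x] norm_minus_commute[of y x] in linarith)
  qed measurable
  have "integrable (distr lborel borel (%z. x - z)) (%y. u y * mollifier n (x - y))"
  unfolding lborel_reflect by (rule i1)
  hence i2: "integrable lborel (%z. u (x - z) * mollifier n z)"
  by (subst (asm) integrable_distr_eq) auto
  have "moll n u x = (LINT y|distr lborel borel (%z. x - z). u y * mollifier n (x - y))"
  by (simp add: conv_def lborel_reflect)
  also have "... = (LINT z|lborel. u (x - z) * mollifier n z)" by (subst integral_distr) auto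
  finally have c: "moll n u x = (LINT z|lborel. u (x - z) * mollifier n z)" .
  have "moll n u x - u x = (LINT z|lborel. u (x - z) * mollifier n z) - (LINT z|(lborel::'a measure). u x * mollifier n z)"
  by (simp add: c integral_mollifier)
  also have "... = (LINT z|lborel. u (x - z) * mollifier n z - u x * mollifier n z)"
  by (intro Bochner_Integration.integral_diff[symmetric] i2 integrable_mult_right integrable_mollifier)
  also have "... = (LINT z|lborel. (u (x - z) - u x) * mollifier n z)" by (simp add: left_diff_distrib)
  finally have e: "moll n u x - u x = (LINT z|lborel. (u (x - z) - u x) * mollifier n z)" .
  have i3: "integrable lborel (%z. (u (x - z) - u x) * mollifier n z)"
  unfolding left_diff_distrib by (intro LINT_diff i2 integrable_mult_right integrable_mollifier)
  have "ennreal (\<bar>moll n u x - u x\<bar> ^ k) <= (nnint lborel (%z. ennreal (\<bar>u (x - z) - u x\<bar> ^ k * mollifier n z)))"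
  unfolding e by (rule nn_integral_power_le_weighted[OF i3 integrable_mollifier mollifier_nonneg integral_mollifier _ k]) measurable
  also have "... = (nnint lborel (%z. ennreal (\<bar>w (x - z) - w x\<bar> ^ k * mollifier n z)))"
  proof (rule nn_integral_cong)
  fix z :: 'a
  show "ennreal (\<bar>u (x - z) - u x\<bar> ^ k * mollifier n z) = ennreal (\<bar>w (x - z) - w x\<bar> ^ k * mollifier n z)"
  proof (cases "norm z > 1")
  case False
  have "norm (x - z) <= R + 1" using False x norm_triangle_ineq4[of x z] by simp
  thus ?thesis using x by (simp add: w_def)
  qed (simp add: mollifier_zero')
  qed
  finally show ?thesis .
  qed
  have "(nnint lborel (%x. ennreal (\<bar>moll n u x - u x\<bar> ^ k) * ind (cball 0 R) x))
  <= (nnint lborel (%x. (nnint lborel (%z. ennreal (\<bar>w (x - z) - w x\<bar> ^ k * mollifier n z)))))"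
  using pw by (intro nn_integral_mono) (auto simp: indicator_def)
  also have "... = (nnint lborel (%z. (nnint lborel (%x. ennreal (\<bar>w (x - z) - w x\<bar> ^ k * mollifier n z)))))"
  by (rule lborel_pair.Fubini') measurable
  also have "... <= (nnint (lborel :: 'a measure) (%z. ennreal e * ennreal (mollifier n z)))"
  proof (rule nn_integral_mono)
  fix z :: 'a
  have "(nnint lborel (%x. ennreal (\<bar>w (x - z) - w x\<bar> ^ k * mollifier n z))) = (nnint lborel (%x. ennreal (\<bar>w (x - z) - w x\<bar> ^ k))) * ennreal (mollifier n z)"
  by (subst nn_integral_multc[symmetric]) (auto simp: ennreal_mult mollifier_nonneg)
  also have "... <= ennreal e * ennreal (mollifier n z)"
  proof (cases "norm z < d")
  case True thus ?thesis by (intro mult_right_mono d) auto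
  next
  case False
  hence "mollifier n z = 0" using nd by (intro mollifier_zero) linarith
  thus ?thesis by simp
  qed
  finally show "(nnint lborel (%x. ennreal (\<bar>w (x - z) - w x\<bar> ^ k * mollifier n z))) <= ennreal e * ennreal (mollifier n z)" .
  qed
  also have "... = ennreal e * (nnint lborel (%z. ennreal (mollifier n (z::'a))))" by (rule nn_integral_cmult) simp
  also have "(nnint lborel (%z. ennreal (mollifier n (z::'a)))) = 1"
  by (subst nn_integral_eq_integral[OF integrable_mollifier]) (auto simp: mollifier_nonneg integral_mollifier)
  finally show "(nnint lborel (%x. ennreal (\<bar>moll n u x - u x\<bar> ^ k) * ind (cball 0 R) x)) <= ennreal e" by simp
  qed
 qed
 show ?thesis
 proof (rule order_tendstoI)
  fix a :: ennreal assume "0 < a"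
  have "\<exists>e>0. ennreal e < a"
  proof (cases a)
  case (real r)
  thus ?thesis using \<open>0 < a\<close> by (intro exI[of _ "r/2"]) (auto intro!: ennreal_lessI)
  qed (auto intro!: exI[of _ 1])
  then obtain e where e: "0 < e" "ennreal e < a" by blast
  from main[OF e(1)] obtain N where "!!n. n >= N ==> (nnint lborel (%x. ennreal (\<bar>moll n u x - u x\<bar> ^ k) * ind (cball 0 R) x)) <= ennreal e" by blast
  thus "eventually (%n. (nnint lborel (%x. ennreal (\<bar>moll n u x - u x\<bar> ^ k) * ind (cball 0 R) x)) < a) sequentially"
  using e(2) by (intro eventually_sequentiallyI) (rule le_less_trans)
 qed simp
qed

text \<open>The zero function has \<open>g\<close> as weak partial derivative, so all mollifications
  of \<open>g\<close> vanish, and they converge to \<open>g\<close> locally in L1.\<close>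

lemma weak_partial_zero_AE:
 fixes g :: "'a::euclidean_space => real"
 assumes g: "loc_pow 1 g" and z: "!!phi. smooth phi ==> compact (support phi) ==> (LINT x|lborel. g x * phi x) = 0"
 shows "AE x in lborel. g x = 0"
proof -
 note [measurable] = loc_pow_borel[OF g]
 have "has_weak_partial b (%_. 0) g" for b using z by (simp add: has_weak_partial_def)
 from conv_mollifier_weak_partial[OF this, symmetric] have c: "moll n g x = 0" for n x
  by (simp add: conv_def)
 have "AE x in lborel. x : cball 0 (real m) --> g x = 0" for m
 proof -
  have "(nnint lborel (%x. ennreal \<bar>g x\<bar> * ind (cball 0 (real m)) x)) = 0"
  using mollify_tendsto[OF g g, of "real m"] unfolding c by (simp add: LIMSEQ_const_iff)
  hence "AE x in lborel. ennreal \<bar>g x\<bar> * ind (cball 0 (real m)) x = 0"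
  by (subst (asm) nn_integral_0_iff_AE) auto
  thus ?thesis by eventually_elim (auto simp: indicator_def split: if_splits)
 qed
 hence "AE x in lborel. \<forall>m. x : cball 0 (real m) --> g x = 0" unfolding AE_all_countable by blast
 thus ?thesis
 proof eventually_elim
  fix x assume a: "\<forall>m. x : cball 0 (real m) --> g x = 0"
  obtain m where "norm x <= real m" using real_arch_simple by blast
  thus "g x = 0" using a by auto
 qed
qed

section \<open>Wirtinger's inequality\<close>

lemma ratio_tendsto_deriv:
 fixes h s :: "real => real"
 assumes "(h has_real_derivative h') (at c)" "(s has_real_derivative s') (at c)" "h c = 0" "s c = 0" "s' ~= 0"
 shows "((%t. h t / s t) \<longlongrightarrow> h' / s') (at c)"
proof -
 have "((%t. ((h t - h c) / (t - c)) / ((s t - s c) / (t - c))) \<longlongrightarrow> h' / s') (at c)"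
  using assms(1,2,5) by (intro tendsto_divide) (auto simp: has_field_derivative_iff)
 moreover have "eventually (%t. ((h t - h c) / (t - c)) / ((s t - s c) / (t - c)) = h t / s t) (at c)"
  using assms(3,4) by (auto simp: eventually_at intro!: exI[of _ 1])
 ultimately show ?thesis by (rule Lim_transform_eventually)
qed

text \<open>The difference of the integrands is \<open>(h' - h cot)^2\<close> plus the derivative of
  \<open>h^2 cot\<close>, and the latter function tends to 0 at both ends because \<open>h\<close>
  does.\<close>

lemma Wirtinger_Dirichlet:
 fixes h h' :: "real => real"
 assumes d: "!!t. (h has_real_derivative h' t) (at t)" and c: "contU h'"
  and z: "h 0 = 0" "h pi = 0"
 shows "integral {0..pi} (%t. (h t)^2) <= integral {0..pi} (%t. (h' t)^2)"
proof -
 have ch: "contU h" using DERIV_isCont[OF d] by (simp add: cont_at_on)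
 define k where "k t = (h' t)^2 - (h t)^2" for t
 have ck: "contU k" unfolding k_def by (intro continuous_intros ch c)
 \<comment> \<open>This is \<open>h^2 cot\<close>, written with the quotient \<open>h / sin\<close>,
   which has limits at 0 and \<open>pi\<close>. Division by zero gives it the value 0 there, which
   is also its limit, so \<open>q\<close> is continuous on the closed interval.\<close>
 define q where "q t = h t / sin t * h t * cos t" for t
 define \<Phi> where "\<Phi> t = integral {0..t} k - q t" for t
 have qlim: "(q \<longlongrightarrow> 0) (at c)" if "c = 0 \<or> c = pi" for c
 proof -
  have r: "((%t. h t / sin t) \<longlongrightarrow> h' c / cos c) (at c)"
  by (rule ratio_tendsto_deriv[OF d DERIV_sin]) (use that z in auto)
  have "(h \<longlongrightarrow> h c) (at c)" "(cos \<longlongrightarrow> cos c) (at c)"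
  using DERIV_isCont[OF d, of c] isCont_cos[of c] by (simp_all add: isCont_def)
  hence "(q \<longlongrightarrow> h' c / cos c * h c * cos c) (at c)"
  unfolding q_def by (intro tendsto_mult r)
  thus ?thesis using that z by auto
 qed
 have q0: "q 0 = 0" "q pi = 0" by (auto simp: q_def)
 have "continuous_on {0..pi} q"
 proof (rule cont_at_on, rule ballI)
  fix t assume t: "t : {0..pi}"
  show "isCont q t"
  proof (cases "t = 0 \<or> t = pi")
  case True thus ?thesis using qlim[OF True] q0 by (auto simp: isCont_def)
  next
  case False
  hence "sin t ~= 0" using t sin_gt_zero[of t] by auto
  thus ?thesis unfolding q_def by (intro continuous_intros DERIV_isCont[OF d])
  qed
 qed
 hence c\<Phi>: "continuous_on {0..pi} \<Phi>"
  unfolding \<Phi>_def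
  by (intro cont_diff indefinite_integral_continuous_1 cont_integrable cont_subset[OF ck]) auto
 have "\<Phi> 0 <= \<Phi> pi"
 proof (rule DERIV_nonneg_imp_increasing_open[OF _ _ c\<Phi>])
  fix t assume t: "0 < t" "t < pi"
  hence s: "sin t > 0" by (rule sin_gt_zero)
  have d1: "((%t. integral {0..t} k) has_real_derivative k t) (at t)"
  proof -
  have "((%t. integral {0..t} k) has_real_derivative k t) (at t within {0..pi})"
  using t by (intro integral_has_real_derivative cont_subset[OF ck]) auto
  moreover have "at t within {0..pi} = at t" using t by (intro at_within_interior) simp
  ultimately show ?thesis by simp
  qed
  have d2: "(q has_real_derivative (2 * h t * h' t * (cos t / sin t) - (h t)^2 * (1 + (cos t / sin t)^2))) (at t)"
  proof -
  have "(q has_real_derivative (((h' t * sin t - h t * cos t) / (sin t * sin t) * h t + h t / sin t * h' t) * cos t + h t / sin t * h t * (- sin t))) (at t)"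
  unfolding q_def using s by (auto intro!: derivative_eq_intros d simp: field_simps)
  also have "(((h' t * sin t - h t * cos t) / (sin t * sin t) * h t + h t / sin t * h' t) * cos t + h t / sin t * h t * (- sin t))
  = (2 * h t * h' t * (cos t / sin t) - (h t)^2 * (1 + (cos t / sin t)^2))"
  proof -
  have "S ~= 0 ==> ((p * S - q * C) / (S * S) * q + q / S * p) * C + q / S * q * (- S)
  = 2 * q * p * (C / S) - q\<^sup>2 * (1 + (C / S)^2)" for S C p q :: real
  by (simp add: field_simps sq_eq)
  thus ?thesis using s by simp
  qed
  finally show ?thesis .
  qed
  have "(\<Phi> has_real_derivative (h' t - h t * (cos t / sin t))\<^sup>2) (at t)"
  unfolding \<Phi>_def
  by (rule DERIV_cong[OF DERIV_diff[OF d1 d2]]) (simp add: k_def sq_eq algebra_simps)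
  thus "\<exists>y. (\<Phi> has_real_derivative y) (at t) & 0 <= y" by (intro exI[of _ "(h' t - h t * (cos t / sin t))^2"]) simp
 qed simp
 hence "0 <= integral {0..pi} k" by (simp add: \<Phi>_def q0)
 also have "... = integral {0..pi} (%t. (h' t)^2) - integral {0..pi} (%t. (h t)^2)"
  unfolding k_def
  by (intro Henstock_Kurzweil_Integration.integral_diff cont_integrable continuous_intros cont_subset[OF c] cont_subset[OF ch]) auto
 finally show ?thesis by simp
qed

lemma integral_shift_real:
 fixes f :: "real => real"
 assumes "contU f"
 shows "integral {a..b} (%t. f (t + c)) = integral {a + c..b + c} f"
proof -
 have "(f has_integral integral {a + c..b + c} f) (cbox (a + c) (b + c))"
  using cont_integrable[OF cont_subset[OF assms]] by (simp add: integrable_integral)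
 from has_integral_affinity[OF this, of 1 c] show ?thesis
  by (simp add: integral_unique image_affinity_atLeastAtMost)
qed

lemma integral_periodic_shift:
 fixes f :: "real => real"
 assumes c: "contU f" and p: "!!t. f (t + 2*pi) = f t" and a: "0 <= a" "a <= 2*pi"
 shows "integral {a..a + 2*pi} f = circ_int f"
proof -
 have i: "f integrable_on {x..y}" for x y by (rule cont_integrable[OF cont_subset[OF c]]) simp
 have "integral {a..2*pi} f + integral {2*pi..a+2*pi} f = integral {a..a+2*pi} f"
  using a by (intro HK_combine i) auto
 moreover have "integral {0..a} f + integral {a..2*pi} f = circ_int f"
  using a by (intro HK_combine i) auto
 moreover have "integral {2*pi..a+2*pi} f = integral {0..a} f"
  using integral_shift_real[OF c, of 0 a "2*pi"] p by simp
 ultimately show ?thesis by linarith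
qed

definition circ_mean :: "(real => real) => real" where
 "circ_mean f = circ_int f / (2*pi)"

lemma integral_periodic_deriv:
 fixes f f' :: "real => real"
 assumes d: "!!t. (f has_real_derivative f' t) (at t)" and p: "!!t. f (t + 2*pi) = f t"
 shows "circ_int f' = 0" "f' integrable_on {0..2*pi}"
proof -
 have "(f' has_integral f (2*pi) - f 0) {0..2*pi}"
  using d by (intro FTC)
  (auto simp: real_vec_deriv[symmetric] intro: deriv_within)
 moreover have "f (2*pi) = f 0" using p[of 0] by simp
 ultimately show "circ_int f' = 0" "f' integrable_on {0..2*pi}" by (auto simp: integral_unique)
qed

text \<open>By the intermediate value theorem some pair of opposite parameters carries equal values
  of \<open>f\<close>. Subtracting that value \<open>A\<close> gives a Dirichlet problem on each of
  the two half-periods, and among all constants the mean minimises the left-hand side.\<close>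

lemma Wirtinger:
 fixes f f' :: "real => real"
 assumes d: "!!t. (f has_real_derivative f' t) (at t)" and c: "contU f'"
  and p: "!!t. f (t + 2*pi) = f t"
 shows "circ_int (%t. (f t - circ_mean f)^2) <= circ_int (%t. (f' t)^2)"
proof -
 have cf: "contU f" using DERIV_isCont[OF d] by (simp add: cont_at_on)
 have p': "f' (t + 2*pi) = f' t" for t
 proof -
  have "((%t. f (t + 2*pi)) has_real_derivative f' (t + 2*pi)) (at t)" using d[of "t + 2*pi"] DERIV_shift by metis
  hence "(f has_real_derivative f' (t + 2*pi)) (at t)" by (simp add: p)
  thus ?thesis using d DERIV_unique by blast
 qed
 have "\<exists>al. 0 <= al & al <= pi & f (al + pi) = f al"
 proof -
  define g where "g t = f (t + pi) - f t" for t
  have cg: "continuous_on {0..pi} g"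
  unfolding g_def by (intro continuous_intros cont_comp[OF cf]) auto
  have "g pi = - g 0" using p[of 0] by (simp add: g_def)
  hence "\<exists>al\<ge>0. al <= pi & g al = 0"
  using IVT'[of g 0 0 pi] IVT2'[of g pi 0 0] cg by (cases "g 0 <= 0") auto
  thus ?thesis by (auto simp: g_def)
 qed
 then obtain al where al: "0 <= al" "al <= pi" "f (al + pi) = f al" by blast
 define A where "A = f al"
 have half: "integral {be..be+pi} (%t. (f t - A)^2) <= integral {be..be+pi} (%t. (f' t)^2)"
  if b: "f be = A" "f (be + pi) = A" for be
 proof -
  have "integral {0..pi} (%t. (f (t + be) - A)^2) <= integral {0..pi} (%t. (f' (t + be))^2)"
  proof (rule Wirtinger_Dirichlet)
  show "((%t. f (t + be) - A) has_real_derivative f' (t + be)) (at t)" for t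
  proof -
  have "((%t. f (t + be)) has_real_derivative f' (t + be)) (at t)" using d[of "t + be"] DERIV_shift by metis
  from DERIV_diff[OF this DERIV_const[of A]] show ?thesis by simp
  qed
  show "contU (%t. f' (t + be))" by (intro cont_comp[OF c] continuous_intros) auto
  qed (use b in \<open>auto simp: add.commute\<close>)
  moreover have "integral {0..pi} (%t. (f (t + be) - A)^2) = integral {0+be..pi+be} (%t. (f t - A)^2)"
  by (rule integral_shift_real[of "%t. (f t - A)^2"]) (intro continuous_intros cf)
  moreover have "integral {0..pi} (%t. (f' (t + be))^2) = integral {0+be..pi+be} (%t. (f' t)^2)"
  by (rule integral_shift_real[of "%t. (f' t)^2"]) (intro continuous_intros c)
  ultimately show ?thesis by (simp add: add.commute)
 qed
 have cA: "contU (%t. (f t - A)^2)" "contU (%t. (f' t)^2)" by (intro continuous_intros cf c)+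
 have split: "circ_int g = integral {al..al+pi} g + integral {al+pi..al+pi+pi} g"
  if "contU g" "!!t. g (t + 2*pi) = g t" for g :: "real => real"
 proof -
  have "integral {al..al+pi} g + integral {al+pi..al+2*pi} g = integral {al..al+2*pi} g"
  by (intro HK_combine cont_integrable[OF cont_subset[OF that(1)]]) auto
  moreover have "integral {al..al+2*pi} g = circ_int g"
  using al by (intro integral_periodic_shift that) auto
  moreover have "al + pi + pi = al + 2*pi" by simp
  ultimately show ?thesis by (simp only:)
 qed
 have "f (al + pi + pi) = A" using p[of al] by (simp add: A_def add.assoc)
 hence "circ_int (%t. (f t - A)^2) <= circ_int (%t. (f' t)^2)"
  using half[of al] half[of "al + pi"] al(3) p p'
  by (subst (1 2) split) (auto simp: A_def[symmetric] cA intro!: add_mono)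
 moreover have "circ_int (%t. (f t - circ_mean f)^2) <= circ_int (%t. (f t - A)^2)"
 proof -
  define m where "m = circ_mean f"
  have i: "f integrable_on {0..2*pi}" "(%t. (f t)^2) integrable_on {0..2*pi}"
  by (intro cont_integrable continuous_intros cont_subset[OF cf]; simp)+
  have m: "circ_int f = 2*pi*m" by (simp add: m_def circ_mean_def)
  have e: "circ_int (%t. (f t - B)^2) = circ_int (%t. (f t)^2) - 2 * B * (2*pi*m) + 2*pi*B\<^sup>2" for B
  proof -
  have "((%t. (f t)^2 - 2 * B * f t + B\<^sup>2) has_integral (circ_int (%t. (f t)^2) - 2 * B * circ_int f + (2*pi) * B\<^sup>2)) {0..2*pi}"
  using has_integral_const_real[of "B\<^sup>2" 0 "2*pi"]
  by (intro has_integral_add has_integral_diff has_integral_mult_right integrable_integral i) simp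
  moreover have "(%t. (f t - B)^2) = (%t. (f t)^2 - 2 * B * f t + B\<^sup>2)" by (simp add: sq_eq algebra_simps)
  ultimately show ?thesis by (simp add: integral_unique m)
  qed
  have "circ_int (%t. (f t - A)^2) - circ_int (%t. (f t - m)^2) = 2*pi*(A - m)^2"
  unfolding e by (simp add: sq_eq algebra_simps)
  moreover have "2*pi*(A - m)^2 >= 0" by simp
  ultimately show ?thesis unfolding m_def by linarith
 qed
 ultimately show ?thesis by linarith
qed

section \<open>Isoperimetric deficit of a closed curve\<close>

locale circle_curve =
 fixes a a' b b' :: "real => real"
 assumes da: "!!t. (a has_real_derivative a' t) (at t)" and db: "!!t. (b has_real_derivative b' t) (at t)"
  and ca: "contU a'" and cb: "contU b'"
  and pa: "!!t. a (t + 2*pi) = a t" and pb: "!!t. b (t + 2*pi) = b t"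
begin

text \<open>The centred curve seen in a frame turning with \<open>t\<close>: \<open>X\<close> and
  \<open>Y\<close> are constant exactly when the curve is a circle, or a point, run uniformly once
  around in the positive sense.\<close>

definition "X t = (a t - circ_mean a) * cos t + (b t - circ_mean b) * sin t"
definition "Y t = - (a t - circ_mean a) * sin t + (b t - circ_mean b) * cos t"
text \<open>\<open>e1\<close> and \<open>e2\<close> vanish when the velocity is the centred position
  turned by a right angle.\<close>

definition "e1 t = a' t + (b t - circ_mean b)"
definition "e2 t = b' t - (a t - circ_mean a)"
text \<open>The integral of the squared speed minus twice the enclosed area, the latter as a line
  integral.\<close>

definition "deficit = circ_int (%t. (a' t)^2 + (b' t)^2) - circ_int (%t. a t * b' t - b t * a' t)"
text \<open>Deviation of the curve from the uniformly run circle whose coefficients are the means of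
  \<open>X\<close> and \<open>Y\<close>.\<close>

definition "U1 t = a t - circ_mean a - (circ_mean X * cos t - circ_mean Y * sin t)"
definition "U2 t = b t - circ_mean b - (circ_mean X * sin t + circ_mean Y * cos t)"

lemma cont: "continuous_on S a" "continuous_on S b" "continuous_on S a'" "continuous_on S b'"
 using DERIV_isCont[OF da] DERIV_isCont[OF db] ca cb
 by (auto simp: cont_at_on intro: cont_subset)

lemma cont_XY: "continuous_on S X" "continuous_on S Y"
 unfolding X_def[abs_def] Y_def[abs_def] by (intro continuous_intros cont)+

lemma integrable_cont: "contU g ==> g integrable_on {0..2*pi}" for g :: "real => real"
 by (rule cont_integrable) (auto intro: cont_subset)

text \<open>Expanding the squares gives \<open>P + Q - 2 * K\<close>, because the terms containing
  the means integrate to 0 by periodicity. Wirtinger gives \<open>Q <= P\<close>, and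
  \<open>P - K\<close> is the deficit.\<close>

lemma deficit_bound_e: "circ_int (%t. (e1 t)^2 + (e2 t)^2) <= 2 * deficit"
proof -
 define ma mb where "ma = circ_mean a" and "mb = circ_mean b"
 define P where "P = circ_int (%t. (a' t)^2 + (b' t)^2)"
 define Q where "Q = circ_int (%t. (a t - ma)^2 + (b t - mb)^2)"
 define K where "K = circ_int (%t. a t * b' t - b t * a' t)"
 have hP: "((%t. (a' t)^2 + (b' t)^2) has_integral P) {0..2*pi}" unfolding P_def
  by (intro integrable_integral integrable_cont continuous_intros cont)
 have hQ: "((%t. (a t - ma)^2 + (b t - mb)^2) has_integral Q) {0..2*pi}" unfolding Q_def
  by (intro integrable_integral integrable_cont continuous_intros cont)
 have hK: "((%t. a t * b' t - b t * a' t) has_integral K) {0..2*pi}" unfolding K_def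
  by (intro integrable_integral integrable_cont continuous_intros cont)
 have h0: "(a' has_integral 0) {0..2*pi}" "(b' has_integral 0) {0..2*pi}"
  using integral_periodic_deriv[OF da pa] integral_periodic_deriv[OF db pb] integrable_integral by metis+
 have "((%t. ((a' t)^2 + (b' t)^2) + ((a t - ma)^2 + (b t - mb)^2) - 2 * (a t * b' t - b t * a' t) - 2 * mb * a' t + 2 * ma * b' t)
  has_integral (P + Q - 2 * K - 2 * mb * 0 + 2 * ma * 0)) {0..2*pi}"
  by (intro has_integral_add has_integral_diff has_integral_mult_right hP hQ hK h0)
 moreover have "(%t. ((a' t)^2 + (b' t)^2) + ((a t - ma)^2 + (b t - mb)^2) - 2 * (a t * b' t - b t * a' t) - 2 * mb * a' t + 2 * ma * b' t)
  = (%t. (e1 t)^2 + (e2 t)^2)"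
  by (auto simp: e1_def e2_def ma_def mb_def sq_eq algebra_simps)
 ultimately have eq: "circ_int (%t. (e1 t)^2 + (e2 t)^2) = P + Q - 2 * K" by (simp add: integral_unique)
 have "Q = circ_int (%t. (a t - ma)^2) + circ_int (%t. (b t - mb)^2)"
  unfolding Q_def by (intro HK_add integrable_cont continuous_intros cont)
 also have "... <= circ_int (%t. (a' t)^2) + circ_int (%t. (b' t)^2)"
  unfolding ma_def mb_def by (intro add_mono Wirtinger da db ca cb pa pb)
 also have "... = P" unfolding P_def
  by (intro HK_add[symmetric] integrable_cont continuous_intros cont)
 finally have "Q <= P" .
 thus ?thesis unfolding eq deficit_def P_def[symmetric] K_def[symmetric] by simp
qed

lemma deficit_nonneg: "0 <= deficit"
proof -
 have "0 <= circ_int (%t. (e1 t)^2 + (e2 t)^2)"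
  unfolding e1_def e2_def by (intro Henstock_Kurzweil_Integration.integral_nonneg integrable_cont continuous_intros cont) auto
 thus ?thesis using deficit_bound_e by linarith
qed

text \<open>A second use of Wirtinger: the derivative of \<open>(X, Y)\<close> is
  \<open>(e1, e2)\<close> in the turning frame, and \<open>(U1, U2)\<close> is the deviation of
  \<open>(X, Y)\<close> from its mean, turned back.\<close>

lemma deficit_bound_U: "circ_int (%t. (U1 t)^2 + (U2 t)^2) <= 2 * deficit"
proof -
 have dX: "(X has_real_derivative (e1 t * cos t + e2 t * sin t)) (at t)" for t
  unfolding X_def[abs_def] e1_def e2_def by (auto intro!: derivative_eq_intros da db simp: algebra_simps)
 have dY: "(Y has_real_derivative (- e1 t * sin t + e2 t * cos t)) (at t)" for t
  unfolding Y_def[abs_def] e1_def e2_def by (auto intro!: derivative_eq_intros da db simp: algebra_simps)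
 have pX: "X (t + 2*pi) = X t" "Y (t + 2*pi) = Y t" for t by (simp_all add: X_def Y_def pa pb)
 have cc: "contU (%t. e1 t * cos t + e2 t * sin t)" "contU (%t. - e1 t * sin t + e2 t * cos t)"
  unfolding e1_def e2_def by (intro continuous_intros cont)+
 have "(%t. (U1 t)^2 + (U2 t)^2) = (%t. (X t - circ_mean X)^2 + (Y t - circ_mean Y)^2)"
 proof
  fix t
  define x y where "x = X t - circ_mean X" and "y = Y t - circ_mean Y"
  have sc: "cos t * cos t + sin t * sin t = 1" using sin_cos_squared_add2[of t] by (simp add: sq_eq)
  have 1: "U1 t = x * cos t - y * sin t"
  proof -
  have "x * cos t - y * sin t = (a t - circ_mean a) * (cos t * cos t + sin t * sin t) - (circ_mean X * cos t - circ_mean Y * sin t)"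
  unfolding x_def y_def X_def Y_def by algebra
  thus ?thesis by (simp only: sc U1_def mult_1_right)
  qed
  have 2: "U2 t = x * sin t + y * cos t"
  proof -
  have "x * sin t + y * cos t = (b t - circ_mean b) * (cos t * cos t + sin t * sin t) - (circ_mean X * sin t + circ_mean Y * cos t)"
  unfolding x_def y_def X_def Y_def by algebra
  thus ?thesis by (simp only: sc U2_def mult_1_right)
  qed
  have "(x * cos t - y * sin t)^2 + (x * sin t + y * cos t)^2 = (x\<^sup>2 + y\<^sup>2) * (cos t * cos t + sin t * sin t)"
  by algebra
  thus "(U1 t)^2 + (U2 t)^2 = (X t - circ_mean X)^2 + (Y t - circ_mean Y)^2"
  unfolding 1 2 x_def[symmetric] y_def[symmetric] by (simp only: sc mult_1_right)
 qed
 hence "circ_int (%t. (U1 t)^2 + (U2 t)^2) = circ_int (%t. (X t - circ_mean X)^2) + circ_int (%t. (Y t - circ_mean Y)^2)"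
  by (simp only:) (intro HK_add integrable_cont continuous_intros cont_XY)
 also have "... <= circ_int (%t. (e1 t * cos t + e2 t * sin t)^2) + circ_int (%t. (- e1 t * sin t + e2 t * cos t)^2)"
  by (intro add_mono Wirtinger dX dY pX cc)
 also have "... = circ_int (%t. (e1 t * cos t + e2 t * sin t)^2 + (- e1 t * sin t + e2 t * cos t)^2)"
  by (intro HK_add[symmetric] integrable_cont continuous_on_power cc)
 also have "... = circ_int (%t. (e1 t)^2 + (e2 t)^2)"
 proof (intro integral_cong)
  fix t :: real
  have sc: "cos t * cos t + sin t * sin t = 1" using sin_cos_squared_add2[of t] by (simp add: sq_eq)
  have "(e1 t * cos t + e2 t * sin t)^2 + (- e1 t * sin t + e2 t * cos t)^2 = ((e1 t)^2 + (e2 t)^2) * (cos t * cos t + sin t * sin t)"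
  by algebra
  thus "(e1 t * cos t + e2 t * sin t)^2 + (- e1 t * sin t + e2 t * cos t)^2 = (e1 t)^2 + (e2 t)^2" by (simp only: sc mult_1_right)
 qed
 also have "... <= 2 * deficit" by (rule deficit_bound_e)
 finally show ?thesis .
qed

text \<open>Sine and cosine have mean 0, so the centre drops out. The coefficients become linear in
  the curve, which lets them pass to limits in L1.\<close>

lemma circ_mean_XY: "circ_mean X = circ_mean (%t. a t * cos t + b t * sin t)" "circ_mean Y = circ_mean (%t. b t * cos t - a t * sin t)"
proof -
 have hc: "(cos has_integral 0) {0..2*pi}" "(sin has_integral 0) {0..2*pi}"
 proof -
  have "(cos has_integral (sin (2*pi) - sin 0)) {0..2*pi}"
  by (intro FTC) (auto simp: real_vec_deriv[symmetric] intro!: derivative_eq_intros)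
  thus "(cos has_integral 0) {0..2*pi}" by simp
  have "(sin has_integral (- cos (2*pi) - (- cos 0))) {0..2*pi}"
  by (intro FTC) (auto simp: real_vec_deriv[symmetric] intro!: derivative_eq_intros)
  thus "(sin has_integral 0) {0..2*pi}" by simp
 qed
 have "((%t. (a t * cos t + b t * sin t) - circ_mean a * cos t - circ_mean b * sin t) has_integral
  (circ_int (%t. a t * cos t + b t * sin t) - circ_mean a * 0 - circ_mean b * 0)) {0..2*pi}"
  by (intro has_integral_diff has_integral_mult_right hc integrable_integral integrable_cont continuous_intros cont)
 moreover have "(%t. (a t * cos t + b t * sin t) - circ_mean a * cos t - circ_mean b * sin t) = X"
  by (auto simp: X_def algebra_simps)
 ultimately show "circ_mean X = circ_mean (%t. a t * cos t + b t * sin t)" by (simp add: circ_mean_def integral_unique)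
 have "((%t. (b t * cos t - a t * sin t) - circ_mean b * cos t + circ_mean a * sin t) has_integral
  (circ_int (%t. b t * cos t - a t * sin t) - circ_mean b * 0 + circ_mean a * 0)) {0..2*pi}"
  by (intro has_integral_diff has_integral_add has_integral_mult_right hc integrable_integral integrable_cont continuous_intros cont)
 moreover have "(%t. (b t * cos t - a t * sin t) - circ_mean b * cos t + circ_mean a * sin t) = Y"
  by (auto simp: Y_def algebra_simps)
 ultimately show "circ_mean Y = circ_mean (%t. b t * cos t - a t * sin t)" by (simp add: circ_mean_def integral_unique)
qed

end

section \<open>Area enclosed by the image of a circle\<close>

definition C1_grad :: "(real^2 => real) => (real^2 => real) => (real^2 => real) => bool" where
 "C1_grad w w1 w2 \<longleftrightarrow> contU w1 & contU w2 &
  (\<forall>x. (w has_derivative (%h. h$1 * w1 x + h$2 * w2 x)) (at x))"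

text \<open>\<open>rad_comp\<close> and \<open>ang_comp\<close> are the derivatives along the radius
  and along the angle. The latter keeps its factor \<open>r\<close>, so no division occurs at the
  origin.\<close>

definition rad_comp :: "(real^2 => real) => (real^2 => real) => real => real => real" where
 "rad_comp w1 w2 r th = cos th * w1 (pol r th) + sin th * w2 (pol r th)"

definition ang_comp :: "(real^2 => real) => (real^2 => real) => real => real => real" where
 "ang_comp w1 w2 r th = r * (cos th * w2 (pol r th) - sin th * w1 (pol r th))"

lemma C1_gradD:
 assumes "C1_grad w w1 w2"
 shows "continuous_on S w1" "continuous_on S w2" "(w has_derivative (%h. h$1 * w1 x + h$2 * w2 x)) (at x)"
  "continuous_on S w"
proof -
 show "continuous_on S w1" "continuous_on S w2" and d: "(w has_derivative (%h. h$1 * w1 x + h$2 * w2 x)) (at x)" for x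
  using assms cont_subset unfolding C1_grad_def by auto
 show "continuous_on S w"
  using has_derivative_continuous[OF d] by (simp add: cont_at_on)
qed

lemma pol_periodic [simp]: "pol r (th + 2*pi) = pol r th" by (simp add: pol_def)

lemma pol_has_derivative_angle: "((%t. pol r t) has_derivative (%h. h *\<^sub>R vector [- r * sin t, r * cos t])) (at t)"
proof -
 have e: "pol r = (%t. (r * cos t) *\<^sub>R axis 1 1 + (r * sin t) *\<^sub>R axis 2 1)"
  by (auto simp: pol_def vec_eq_iff forall_2 axis_def fun_eq_iff)
 show ?thesis unfolding e
  by (rule has_derivative_eq_rhs) (auto intro!: derivative_eq_intros simp: vec_eq_iff forall_2 axis_def fun_eq_iff)
qed

lemma pol_has_derivative_radius: "((%s. pol s t) has_derivative (%h. h *\<^sub>R vector [cos t, sin t])) (at s)"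
proof -
 have e: "(%s. pol s t) = (%s. (s * cos t) *\<^sub>R axis 1 1 + (s * sin t) *\<^sub>R axis 2 1)"
  by (auto simp: pol_def vec_eq_iff forall_2 axis_def fun_eq_iff)
 show ?thesis unfolding e
  by (rule has_derivative_eq_rhs) (auto intro!: derivative_eq_intros simp: vec_eq_iff forall_2 axis_def fun_eq_iff)
qed

lemma C1_grad_angle:
 assumes "C1_grad w w1 w2"
 shows "((%t. w (pol r t)) has_real_derivative ang_comp w1 w2 r t) (at t)"
proof -
 have "((%t. w (pol r t)) has_derivative (%h. (h *\<^sub>R vector [- r * sin t, r * cos t] :: real^2) $ 1 * w1 (pol r t) + (h *\<^sub>R vector [- r * sin t, r * cos t] :: real^2) $ 2 * w2 (pol r t))) (at t)"
  by (rule has_derivative_compose[OF pol_has_derivative_angle C1_gradD(3)[OF assms]])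
 thus ?thesis unfolding has_field_derivative_def
  by (rule has_derivative_eq_rhs) (auto simp: ang_comp_def fun_eq_iff algebra_simps)
qed

lemma C1_grad_radius:
 assumes "C1_grad w w1 w2"
 shows "((%s. w (pol s t)) has_real_derivative rad_comp w1 w2 s t) (at s)"
proof -
 have "((%s. w (pol s t)) has_derivative (%h. (h *\<^sub>R vector [cos t, sin t] :: real^2) $ 1 * w1 (pol s t) + (h *\<^sub>R vector [cos t, sin t] :: real^2) $ 2 * w2 (pol s t))) (at s)"
  by (rule has_derivative_compose[OF pol_has_derivative_radius C1_gradD(3)[OF assms]])
 thus ?thesis unfolding has_field_derivative_def
  by (rule has_derivative_eq_rhs) (auto simp: rad_comp_def fun_eq_iff algebra_simps)
qed

lemma continuous_on_pol [continuous_intros]: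
 fixes f g :: "'a::t2_space => real"
 assumes "continuous_on S f" "continuous_on S g"
 shows "continuous_on S (%x. pol (f x) (g x))"
proof -
 have e: "(%x. pol (f x) (g x)) = (%x. (f x * cos (g x)) *\<^sub>R axis 1 1 + (f x * sin (g x)) *\<^sub>R axis 2 1)"
  by (auto simp: pol_def vec_eq_iff forall_2 axis_def fun_eq_iff)
 show ?thesis unfolding e by (intro continuous_intros assms)
qed

lemma cont_polar:
 fixes f g :: "'a::t2_space => real"
 assumes w: "C1_grad w w1 w2" and "continuous_on S f" "continuous_on S g"
 shows "continuous_on S (%x. w (pol (f x) (g x)))" "continuous_on S (%x. ang_comp w1 w2 (f x) (g x))"
  "continuous_on S (%x. rad_comp w1 w2 (f x) (g x))"
proof -
 note pol = continuous_on_pol[OF assms(2,3)]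
 note c = cont_comp[OF C1_gradD(1)[OF w] pol subset_UNIV]
  cont_comp[OF C1_gradD(2)[OF w] pol subset_UNIV]
 show "continuous_on S (%x. w (pol (f x) (g x)))"
  by (rule cont_comp[OF C1_gradD(4)[OF w] pol subset_UNIV])
 show "continuous_on S (%x. ang_comp w1 w2 (f x) (g x))"
  unfolding ang_comp_def
  by (intro cont_mult cont_diff continuous_on_cos continuous_on_sin assms c)
 show "continuous_on S (%x. rad_comp w1 w2 (f x) (g x))"
  unfolding rad_comp_def
  by (intro cont_mult cont_add continuous_on_cos continuous_on_sin assms c)
qed

text \<open>The line integral on the left contains first derivatives, so for maps that are merely C1
  it cannot be differentiated in \<open>R\<close> under the integral sign. Its increments are first
  integrated by parts in the angle, which leaves differences of values multiplied by angular
  derivatives; the differences are \<open>s - r\<close> times a continuous factor, and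
  Caratheodory's criterion yields the derivative.\<close>

lemma area_formula:
 assumes a: "C1_grad a a1 a2" and b: "C1_grad b b1 b2" and R: "0 <= R"
 shows "circ_int (%t. a (pol R t) * ang_comp b1 b2 R t - b (pol R t) * ang_comp a1 a2 R t)
  = 2 * integral {0..R} (%s. circ_int (%t. rad_comp a1 a2 s t * ang_comp b1 b2 s t - rad_comp b1 b2 s t * ang_comp a1 a2 s t))"
proof -
 define K where "K s = circ_int (%t. a (pol s t) * ang_comp b1 b2 s t - b (pol s t) * ang_comp a1 a2 s t)" for s
 define B where "B s = circ_int (%t. rad_comp a1 a2 s t * ang_comp b1 b2 s t - rad_comp b1 b2 s t * ang_comp a1 a2 s t)" for s
 note cont = cont_polar[OF a] cont_polar[OF b]
 have ic: "g integrable_on {0..2*pi}" if "contU g" for g :: "real => real"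
  by (rule cont_integrable) (rule cont_subset[OF that subset_UNIV])
 \<comment> \<open>Hadamard's lemma in the radius: \<open>Q\<close> averages the radial derivative
   between \<open>r\<close> and \<open>s\<close>.\<close>
 have quot: "\<exists>Q. contU (%x. Q (fst x) (snd x)) & (\<forall>s t. w (pol s t) - w (pol r t) = (s - r) * Q s t) & (\<forall>t. Q r t = rad_comp w1 w2 r t)"
  if w: "C1_grad w w1 w2" for w w1 w2 and r :: real
 proof -
  define Q where "Q s t = integral {0..1} (%y. rad_comp w1 w2 (r + y * (s - r)) t)" for s t
  have "contU (%x. integral (cbox 0 (1::real)) (%y. rad_comp w1 w2 (r + y * (fst x - r)) (snd x)))"
  by (rule integral_continuous_on_param)
  (auto simp: split_beta intro!: cont_polar(3)[OF w] continuous_intros)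
  hence c: "contU (%x. Q (fst x) (snd x))" by (simp add: Q_def)
  have e: "w (pol s t) - w (pol r t) = (s - r) * Q s t" for s t
  proof -
  have "((%y. (s - r) * rad_comp w1 w2 (r + y * (s - r)) t) has_integral (w (pol (r + 1 * (s - r)) t) - w (pol (r + 0 * (s - r)) t))) {0..1}"
  proof (rule FTC)
  fix y :: real
  have "((%y. w (pol (r + y * (s - r)) t)) has_real_derivative (rad_comp w1 w2 (r + y * (s - r)) t * (s - r))) (at y)"
  by (rule DERIV_chain2[OF C1_grad_radius[OF w]]) (auto intro!: derivative_eq_intros)
  thus "((%y. w (pol (r + y * (s - r)) t)) has_vector_derivative ((s - r) * rad_comp w1 w2 (r + y * (s - r)) t)) (at y within {0..1})"
  by (auto simp: real_vec_deriv[symmetric] mult.commute intro: deriv_within)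
  qed simp
  from integral_unique[OF this] have "integral {0..1} (%y. (s - r) * rad_comp w1 w2 (r + y * (s - r)) t) = w (pol s t) - w (pol r t)"
  by simp
  thus ?thesis by (simp add: Q_def)
  qed
  show ?thesis by (intro exI[of _ Q] conjI allI c e) (simp add: Q_def)
 qed
 have dK: "(K has_real_derivative 2 * B r) (at r)" for r
 proof -
  obtain Qa where Qa: "contU (%x. Qa (fst x) (snd x))" "!!s t. a (pol s t) - a (pol r t) = (s - r) * Qa s t" "!!t. Qa r t = rad_comp a1 a2 r t"
  using quot[OF a, of r] by blast
  obtain Qb where Qb: "contU (%x. Qb (fst x) (snd x))" "!!s t. b (pol s t) - b (pol r t) = (s - r) * Qb s t" "!!t. Qb r t = rad_comp b1 b2 r t"
  using quot[OF b, of r] by blast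
  have cQ: "contU (%t. Qa s t)" "contU (%t. Qb s t)" for s
  proof -
  have p: "contU (%t::real. (s, t))" by (intro continuous_on_Pair cont_const cont_id)
  show "contU (%t. Qa s t)"
  using cont_comp[of UNIV "%x. Qa (fst x) (snd x)" UNIV "%t. (s, t)", OF Qa(1) p subset_UNIV] by simp
  show "contU (%t. Qb s t)"
  using cont_comp[of UNIV "%x. Qb (fst x) (snd x)" UNIV "%t. (s, t)", OF Qb(1) p subset_UNIV] by simp
  qed
  define M where "M s = circ_int (%t. Qa s t * (ang_comp b1 b2 s t + ang_comp b1 b2 r t) - Qb s t * (ang_comp a1 a2 s t + ang_comp a1 a2 r t))" for s
  have cM: "contU M"
  proof -
  have "contU (%s. integral (cbox 0 (2*pi)) (%t. Qa s t * (ang_comp b1 b2 s t + ang_comp b1 b2 r t) - Qb s t * (ang_comp a1 a2 s t + ang_comp a1 a2 r t)))"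
  by (rule integral_continuous_on_param)
  (auto simp: split_beta intro!: continuous_intros cont cont_subset[OF Qa(1)] cont_subset[OF Qb(1)])
  thus ?thesis by (simp add: M_def[abs_def])
  qed
  have KM: "K s - K r = M s * (s - r)" for s
  proof -
  define A al B be A' al' B' be' where "A = (%t. a (pol s t))" and "al = (%t. a (pol r t))" and "B = (%t. b (pol s t))" and "be = (%t. b (pol r t))"
  and "A' = ang_comp a1 a2 s" and "al' = ang_comp a1 a2 r" and "B' = ang_comp b1 b2 s" and "be' = ang_comp b1 b2 r"
  note defs = this
  have d: "(A has_real_derivative A' t) (at t)" "(al has_real_derivative al' t) (at t)" "(B has_real_derivative B' t) (at t)" "(be has_real_derivative be' t) (at t)" for t
  unfolding defs by (rule C1_grad_angle[OF a] C1_grad_angle[OF b])+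
  have c: "contU A" "contU al" "contU B" "contU be"
  "contU A'" "contU al'" "contU B'" "contU be'"
  unfolding defs by (intro cont cont_const cont_id)+
  have z: "((%t. A' t * be t + A t * be' t) has_integral 0) {0..2*pi}" "((%t. al' t * B t + al t * B' t) has_integral 0) {0..2*pi}"
  proof -
  have "((%t. A' t * be t + A t * be' t) has_integral (A (2*pi) * be (2*pi) - A 0 * be 0)) {0..2*pi}"
  by (intro FTC)
  (auto simp: real_vec_deriv[symmetric] intro!: deriv_within DERIV_cong[OF DERIV_mult[OF d(1) d(4)]])
  thus "((%t. A' t * be t + A t * be' t) has_integral 0) {0..2*pi}" using pol_periodic[of _ 0] by (simp add: defs)
  have "((%t. al' t * B t + al t * B' t) has_integral (al (2*pi) * B (2*pi) - al 0 * B 0)) {0..2*pi}"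
  by (intro FTC)
  (auto simp: real_vec_deriv[symmetric] intro!: deriv_within DERIV_cong[OF DERIV_mult[OF d(2) d(3)]])
  thus "((%t. al' t * B t + al t * B' t) has_integral 0) {0..2*pi}" using pol_periodic[of _ 0] by (simp add: defs)
  qed
  have K1: "((%t. A t * B' t - B t * A' t) has_integral K s) {0..2*pi}"
  proof -
  have e: "K s = circ_int (%t. A t * B' t - B t * A' t)" unfolding K_def defs ..
  show ?thesis unfolding e
  by (intro integrable_integral ic cont_diff cont_mult c)
  qed
  have K2: "((%t. al t * be' t - be t * al' t) has_integral K r) {0..2*pi}"
  proof -
  have e: "K r = circ_int (%t. al t * be' t - be t * al' t)" unfolding K_def defs ..
  show ?thesis unfolding e
  by (intro integrable_integral ic cont_diff cont_mult c)
  qed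
  \<comment> \<open>The added terms are the derivatives of \<open>A * be\<close> and
    \<open>al * B\<close>, whose integrals over a period are 0. With them the integrand factors into
    differences.\<close>
  have "((%t. (A t * B' t - B t * A' t) - (al t * be' t - be t * al' t) + (A' t * be t + A t * be' t) - (al' t * B t + al t * B' t)) has_integral (K s - K r + 0 - 0)) {0..2*pi}"
  by (intro has_integral_add has_integral_diff K1 K2 z)
  moreover have "(A t * B' t - B t * A' t) - (al t * be' t - be t * al' t) + (A' t * be t + A t * be' t) - (al' t * B t + al t * B' t)
  = (Qa s t * (B' t + be' t) - Qb s t * (A' t + al' t)) * (s - r)" for t
  proof -
  have "(A t * B' t - B t * A' t) - (al t * be' t - be t * al' t) + (A' t * be t + A t * be' t) - (al' t * B t + al t * B' t)
  = (A t - al t) * (B' t + be' t) - (B t - be t) * (A' t + al' t)" by (simp add: algebra_simps)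
  also have "... = ((s - r) * Qa s t) * (B' t + be' t) - ((s - r) * Qb s t) * (A' t + al' t)"
  unfolding A_def al_def B_def be_def Qa(2) Qb(2) ..
  finally show ?thesis by (simp add: algebra_simps)
  qed
  ultimately have "((%t. (Qa s t * (B' t + be' t) - Qb s t * (A' t + al' t)) * (s - r)) has_integral (K s - K r)) {0..2*pi}" by simp
  moreover have "((%t. (Qa s t * (B' t + be' t) - Qb s t * (A' t + al' t)) * (s - r)) has_integral (M s * (s - r))) {0..2*pi}"
  unfolding M_def A'_def[symmetric] al'_def[symmetric] B'_def[symmetric] be'_def[symmetric]
  by (intro has_integral_mult_left integrable_integral ic cont_diff cont_mult cont_add c cQ)
  ultimately show ?thesis by (rule has_integral_unique)
  qed
  have "M r = 2 * B r"
  proof -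
  have "M r = circ_int (%t. 2 * (rad_comp a1 a2 r t * ang_comp b1 b2 r t - rad_comp b1 b2 r t * ang_comp a1 a2 r t))"
  unfolding M_def Qa(3) Qb(3) by (intro integral_cong) (simp add: algebra_simps)
  also have "... = 2 * B r" unfolding B_def by (rule integral_mult_right)
  finally show ?thesis .
  qed
  thus ?thesis unfolding CARAT_DERIV
  using KM cM by (intro exI[of _ M]) (auto simp: continuous_on_eq_continuous_at)
 qed
 have cB: "contU B"
 proof -
  have "contU (%s. integral (cbox 0 (2*pi)) (%t. rad_comp a1 a2 s t * ang_comp b1 b2 s t - rad_comp b1 b2 s t * ang_comp a1 a2 s t))"
  by (rule integral_continuous_on_param) (auto simp: split_beta intro!: continuous_intros cont)
  thus ?thesis by (simp add: B_def[abs_def])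
 qed
 have "((%s. 2 * B s) has_integral (K R - K 0)) {0..R}"
  using R dK by (intro FTC)
  (auto simp: real_vec_deriv[symmetric] intro: deriv_within)
 moreover have "K 0 = 0" by (simp add: K_def ang_comp_def)
 ultimately have "K R = integral {0..R} (%s. 2 * B s)" by (metis integral_unique diff_zero)
 also have "... = 2 * integral {0..R} B" by (rule integral_mult_right)
 finally show ?thesis unfolding K_def B_def .
qed

section \<open>Convergence in L1\<close>

definition L1conv :: "'a measure => (nat => 'a => real) => ('a => real) => bool" where
 "L1conv M f F \<longleftrightarrow> (\<forall>n. integrable M (f n)) & integrable M F & (%n. LINT x|M. \<bar>f n x - F x\<bar>) \<longlonglongrightarrow> 0"

lemma L1convD:
 assumes "L1conv M f F"
 shows "integrable M (f n)" "integrable M F" "(%n. LINT x|M. \<bar>f n x - F x\<bar>) \<longlonglongrightarrow> 0"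
 using assms by (auto simp: L1conv_def)

lemma L1convI_bound:
 assumes "!!n. integrable M (f n)" "integrable M F" "e \<longlonglongrightarrow> 0" "!!n. (LINT x|M. \<bar>f n x - F x\<bar>) <= e n"
 shows "L1conv M f F"
 unfolding L1conv_def
proof (intro conjI allI assms(1,2))
 show "(%n. LINT x|M. \<bar>f n x - F x\<bar>) \<longlonglongrightarrow> 0"
  by (rule tendsto_sandwich[OF _ _ tendsto_const assms(3)]) (auto intro!: always_eventually assms(4))
qed

lemma L1conv_add:
 assumes f: "L1conv M f F" and g: "L1conv M g G"
 shows "L1conv M (%n x. f n x + g n x) (%x. F x + G x)"
proof (rule L1convI_bound)
 show "(%n. (LINT x|M. \<bar>f n x - F x\<bar>) + (LINT x|M. \<bar>g n x - G x\<bar>)) \<longlonglongrightarrow> 0"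
  using tendsto_add[OF L1convD(3)[OF f] L1convD(3)[OF g]] by simp
 fix n
 note i = L1convD(1)[OF f, of n] L1convD(2)[OF f] L1convD(1)[OF g, of n] L1convD(2)[OF g]
 have "(LINT x|M. \<bar>f n x + g n x - (F x + G x)\<bar>) <= (LINT x|M. \<bar>f n x - F x\<bar> + \<bar>g n x - G x\<bar>)"
  using i by (intro integral_mono) auto
 also have "... = (LINT x|M. \<bar>f n x - F x\<bar>) + (LINT x|M. \<bar>g n x - G x\<bar>)"
  using i by (intro Bochner_Integration.integral_add) auto
 finally show "(LINT x|M. \<bar>f n x + g n x - (F x + G x)\<bar>) <= (LINT x|M. \<bar>f n x - F x\<bar>) + (LINT x|M. \<bar>g n x - G x\<bar>)" .
qed (use L1convD[OF f] L1convD[OF g] in auto)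

lemma L1conv_mult_bounded:
 assumes f: "L1conv M f F" and [measurable]: "k : borel_measurable M" and B: "AE x in M. \<bar>k x\<bar> <= B"
 shows "L1conv M (%n x. f n x * k x) (%x. F x * k x)"
proof (rule L1convI_bound)
 note i = L1convD(1)[OF f] L1convD(2)[OF f]
 have int: "integrable M (%x. h x * k x)" if h: "integrable M h" for h
 proof (rule Bochner_Integration.integrable_bound[OF integrable_mult_right[OF h, of B]])
  show "AE x in M. norm (h x * k x) <= norm (B * h x)"
  using B
  proof eventually_elim
  fix x assume "\<bar>k x\<bar> <= B"
  hence "\<bar>h x\<bar> * \<bar>k x\<bar> <= \<bar>h x\<bar> * \<bar>B\<bar>" by (intro mult_left_mono) auto
  thus "norm (h x * k x) <= norm (B * h x)" by (simp add: abs_mult mult.commute)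
  qed
 qed (use h in measurable)
 show "!!n. integrable M (%x. f n x * k x)" "integrable M (%x. F x * k x)" by (intro int i)+
 show "(%n. B * (LINT x|M. \<bar>f n x - F x\<bar>)) \<longlonglongrightarrow> 0"
  using tendsto_mult_right_zero[OF L1convD(3)[OF f]] .
 fix n
 have "(LINT x|M. \<bar>f n x * k x - F x * k x\<bar>) <= (LINT x|M. B * \<bar>f n x - F x\<bar>)"
 proof (rule integral_mono_AE)
  show "integrable M (%x. \<bar>f n x * k x - F x * k x\<bar>)" by (intro integrable_abs LINT_diff int i)
  show "integrable M (%x. B * \<bar>f n x - F x\<bar>)" by (intro integrable_mult_right integrable_abs LINT_diff i)
  show "AE x in M. \<bar>f n x * k x - F x * k x\<bar> <= B * \<bar>f n x - F x\<bar>"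
  using B
  proof eventually_elim
  fix x assume B: "\<bar>k x\<bar> <= B"
  have "\<bar>f n x * k x - F x * k x\<bar> = \<bar>k x\<bar> * \<bar>f n x - F x\<bar>" by (simp add: abs_mult[symmetric] algebra_simps)
  also have "... <= B * \<bar>f n x - F x\<bar>" by (intro mult_right_mono B) simp
  finally show "\<bar>f n x * k x - F x * k x\<bar> <= B * \<bar>f n x - F x\<bar>" .
  qed
 qed
 thus "(LINT x|M. \<bar>f n x * k x - F x * k x\<bar>) <= B * (LINT x|M. \<bar>f n x - F x\<bar>)" by simp
qed

lemma L1conv_cmult: "L1conv M f F ==> L1conv M (%n x. c * f n x) (%x. c * F x)"
 using L1conv_mult_bounded[of M f F "%_. c" "\<bar>c\<bar>"] by (simp add: mult.commute)

lemma L1conv_diff: "L1conv M f F ==> L1conv M g G ==> L1conv M (%n x. f n x - g n x) (%x. F x - G x)"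
 using L1conv_add[of M f F, OF _ L1conv_cmult[of M g G "-1"]] by simp

lemma L1conv_integral:
 assumes f: "L1conv M f F"
 shows "(%n. LINT x|M. f n x) \<longlonglongrightarrow> (LINT x|M. F x)"
proof -
 have "(%n. (LINT x|M. f n x) - (LINT x|M. F x)) \<longlonglongrightarrow> 0"
 proof (rule Lim_null_comparison[OF always_eventually L1convD(3)[OF f]], rule allI)
  fix n
  note i = L1convD(1)[OF f, of n] L1convD(2)[OF f]
  have "(LINT x|M. f n x) - (LINT x|M. F x) = (LINT x|M. f n x - F x)" using i by simp
  thus "norm ((LINT x|M. f n x) - (LINT x|M. F x)) <= (LINT x|M. \<bar>f n x - F x\<bar>)" by simp
 qed
 thus ?thesis by (simp add: LIM_zero_iff)
qed

lemma L1conv_unique: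
 assumes f: "L1conv M f F" and g: "L1conv M f G"
 shows "AE x in M. F x = G x"
proof -
 have "L1conv M (%n x. f n x - f n x) (%x. F x - G x)" by (rule L1conv_diff[OF f g])
 from L1convD(3)[OF this] have "(LINT x|M. \<bar>F x - G x\<bar>) = 0" by (simp add: LIMSEQ_const_iff abs_minus_commute)
 hence "AE x in M. \<bar>F x - G x\<bar> = 0"
  using L1convD(2)[OF f] L1convD(2)[OF g] by (subst (asm) integral_nonneg_eq_0_iff_AE) auto
 thus ?thesis by eventually_elim simp
qed

text \<open>From \<open>\<bar>y\<bar> <= e + y^2 / e\<close>: the first term is small because the
  measure is finite, the second because the integrals of the squares tend to 0.\<close>

lemma (in finite_measure) L1conv_zero_square:
 assumes i: "!!n. integrable M (%x. (f n x)^2)" and [measurable]: "!!n. f n : borel_measurable M"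
  and l: "(%n. LINT x|M. (f n x)^2) \<longlonglongrightarrow> 0"
 shows "L1conv M f (%_. 0)"
proof -
 have pt: "\<bar>y\<bar> <= e + y\<^sup>2 / e" if "e > 0" for y e :: real
 proof -
  have "0 <= (\<bar>y\<bar> - e)\<^sup>2 + e * \<bar>y\<bar>" using that by simp
  hence "e * \<bar>y\<bar> <= e * e + y\<^sup>2" by (simp add: sq_eq algebra_simps)
  hence "e * \<bar>y\<bar> / e <= (e * e + y\<^sup>2) / e" using that by (intro divide_right_mono) auto
  thus ?thesis using that by (simp add: add_divide_distrib)
 qed
 have int: "integrable M (f n)" for n
  by (rule Bochner_Integration.integrable_bound[where f="%x. 1 + (f n x)^2"])
  (use pt[of 1] in \<open>auto intro!: Bochner_Integration.integrable_add i AE_I2\<close>)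
 have "(%n. LINT x|M. \<bar>f n x\<bar>) \<longlonglongrightarrow> 0"
 proof (rule LIMSEQ_I)
  fix r :: real assume r: "r > 0"
  define e where "e = r / (2 * (measure M (space M) + 1))"
  have mp: "measure M (space M) + 1 > 0" by (simp add: add_nonneg_pos)
  have e: "e > 0" using r mp by (simp add: e_def)
  obtain N where N: "!!n. n >= N ==> \<bar>LINT x|M. (f n x)^2\<bar> < e * (r/2)"
  using LIMSEQ_D[OF l, of "e * (r/2)"] e r by auto
  show "\<exists>N. \<forall>n\<ge>N. norm ((LINT x|M. \<bar>f n x\<bar>) - 0) < r"
  proof (intro exI[of _ N] allI impI)
  fix n assume n: "n >= N"
  have "(LINT x|M. \<bar>f n x\<bar>) <= (LINT x|M. e + (f n x)^2 / e)"
  using pt[OF e] int i by (intro integral_mono) auto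
  also have "... = measure M (space M) * e + (LINT x|M. (f n x)^2) / e" using i[of n] by simp
  also have "... < r/2 + r/2"
  proof (rule add_le_less_mono)
  have "measure M (space M) * e <= (measure M (space M) + 1) * e" using e by (intro mult_right_mono) auto
  also have "... = r/2" using mp unfolding e_def by (simp only: times_divide_eq_right) (simp add: field_simps)
  finally show "measure M (space M) * e <= r/2" .
  show "(LINT x|M. (f n x)^2) / e < r/2" using N[OF n] e by (simp add: field_simps)
  qed
  finally show "norm ((LINT x|M. \<bar>f n x\<bar>) - 0) < r" by simp
  qed
 qed
 thus ?thesis using int by (simp add: L1conv_def)
qed

text \<open>Young's inequality with a free parameter \<open>e\<close>: the limit functions
  contribute a multiple of \<open>e\<close>, the errors a quantity that tends to 0 for each fixed
  \<open>e\<close>.\<close>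

lemma L1conv_mult_L2:
 assumes [measurable]: "!!n. f n : borel_measurable M" "!!n. g n : borel_measurable M" "F : borel_measurable M" "G : borel_measurable M"
  and iF: "integrable M (%x. (F x)^2)" and iG: "integrable M (%x. (G x)^2)"
  and ifF: "!!n. integrable M (%x. (f n x - F x)^2)" and igG: "!!n. integrable M (%x. (g n x - G x)^2)"
  and lf: "(%n. LINT x|M. (f n x - F x)^2) \<longlonglongrightarrow> 0" and lg: "(%n. LINT x|M. (g n x - G x)^2) \<longlonglongrightarrow> 0"
 shows "L1conv M (%n x. f n x * g n x) (%x. F x * G x)"
proof -
 have xy: "\<bar>x * y\<bar> <= e * x\<^sup>2 + y\<^sup>2 / e" if "e > 0" for x y e :: real
 proof -
  have "0 <= (e * \<bar>x\<bar> - \<bar>y\<bar>)\<^sup>2 + e * \<bar>x\<bar> * \<bar>y\<bar>" using that by simp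
  hence "e * \<bar>x * y\<bar> <= e * e * x\<^sup>2 + y\<^sup>2" by (simp add: sq_eq abs_mult algebra_simps)
  hence "e * \<bar>x * y\<bar> / e <= (e * e * x\<^sup>2 + y\<^sup>2) / e" using that by (intro divide_right_mono) auto
  thus ?thesis using that by (simp add: add_divide_distrib)
 qed
 have pt: "\<bar>p * q - P * Q\<bar> <= e * (P\<^sup>2 + Q\<^sup>2) + (1 + 1 / e) * ((p - P)^2 + (q - Q)^2)" if e: "e > 0" for p q P Q e :: real
 proof -
  have "p * q - P * Q = (p - P) * (q - Q) + P * (q - Q) + Q * (p - P)" by (simp add: algebra_simps)
  hence "\<bar>p * q - P * Q\<bar> <= \<bar>(p - P) * (q - Q)\<bar> + \<bar>P * (q - Q)\<bar> + \<bar>Q * (p - P)\<bar>" by linarith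
  also have "... <= (1 * (p - P)^2 + (q - Q)^2 / 1) + (e * P\<^sup>2 + (q - Q)^2 / e) + (e * Q\<^sup>2 + (p - P)^2 / e)"
  by (intro add_mono xy e) simp
  also have "... = e * (P\<^sup>2 + Q\<^sup>2) + (1 + 1 / e) * ((p - P)^2 + (q - Q)^2)"
  by (simp add: algebra_simps add_divide_distrib)
  finally show ?thesis .
 qed
 have iFG: "integrable M (%x. F x * G x)"
  by (rule Bochner_Integration.integrable_bound[where f="%x. 1 * (F x)^2 + (G x)^2 / 1"])
  (use xy[of 1] iF iG in \<open>auto intro!: AE_I2\<close>)
 have id: "integrable M (%x. f n x * g n x - F x * G x)" for n
  by (rule Bochner_Integration.integrable_bound[where f="%x. 1 * ((F x)^2 + (G x)^2) + (1 + 1 / 1) * ((f n x - F x)^2 + (g n x - G x)^2)"])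
  (use pt[of 1] iF iG ifF igG in \<open>auto intro!: AE_I2 order_trans[OF pt[of 1]]\<close>)
 have ifg: "integrable M (%x. f n x * g n x)" for n
  using Bochner_Integration.integrable_add[OF id[of n] iFG] by simp
 define S where "S = (LINT x|M. (F x)^2) + (LINT x|M. (G x)^2)"
 define D where "D n = (LINT x|M. (f n x - F x)^2) + (LINT x|M. (g n x - G x)^2)" for n
 have lD: "D \<longlonglongrightarrow> 0" unfolding D_def using tendsto_add[OF lf lg] by simp
 have S0: "S >= 0" unfolding S_def by (intro add_nonneg_nonneg Bochner_Integration.integral_nonneg) auto
 have bd: "(LINT x|M. \<bar>f n x * g n x - F x * G x\<bar>) <= e * S + (1 + 1/e) * D n" if "e > 0" for e n
 proof -
  have "(LINT x|M. \<bar>f n x * g n x - F x * G x\<bar>) <= (LINT x|M. e * ((F x)^2 + (G x)^2) + (1 + 1 / e) * ((f n x - F x)^2 + (g n x - G x)^2))"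
  by (intro integral_mono pt that integrable_abs id Bochner_Integration.integrable_add integrable_mult_right iF iG ifF igG)
  also have "... = e * S + (1 + 1/e) * D n"
  unfolding S_def D_def using iF iG ifF igG by simp
  finally show ?thesis .
 qed
 have "(%n. LINT x|M. \<bar>f n x * g n x - F x * G x\<bar>) \<longlonglongrightarrow> 0"
 proof (rule LIMSEQ_I)
  fix r :: real assume r: "r > 0"
  define e where "e = r / (2 * (S + 1))"
  have e: "e > 0" using r S0 by (simp add: e_def)
  have "(%n. (1 + 1/e) * D n) \<longlonglongrightarrow> 0" by (rule tendsto_mult_right_zero[OF lD])
  then obtain N where N: "!!n. n >= N ==> \<bar>(1 + 1/e) * D n\<bar> < r/2" using LIMSEQ_D[of "%n. (1 + 1/e) * D n" 0 "r/2"] r by auto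
  show "\<exists>N. \<forall>n\<ge>N. norm ((LINT x|M. \<bar>f n x * g n x - F x * G x\<bar>) - 0) < r"
  proof (intro exI[of _ N] allI impI)
  fix n assume n: "n >= N"
  have "e * S <= e * (S + 1)" using e by (intro mult_left_mono) auto
  also have "... = r/2" using S0 unfolding e_def by (simp add: field_simps)
  finally have "e * S + (1 + 1/e) * D n < r" using N[OF n] by linarith
  hence "(LINT x|M. \<bar>f n x * g n x - F x * G x\<bar>) < r" using bd[OF e, of n] by linarith
  thus "norm ((LINT x|M. \<bar>f n x * g n x - F x * G x\<bar>) - 0) < r" by simp
  qed
 qed
 thus ?thesis using iFG ifg by (simp add: L1conv_def)
qed

text \<open>Integrating out one variable is a contraction of L1. This is how convergence on a disc
  becomes convergence of functions of the radius.\<close>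

lemma (in pair_sigma_finite) L1conv_fst:
 assumes f: "L1conv (M1 \<Otimes>\<^sub>M M2) f F"
 shows "L1conv M1 (%n x. LINT y|M2. f n (x, y)) (%x. LINT y|M2. F (x, y))"
proof (rule L1convI_bound[OF _ _ L1convD(3)[OF f]])
 note i = L1convD(1)[OF f] L1convD(2)[OF f]
 show i1: "integrable M1 (%x. LINT y|M2. f n (x, y))" for n by (rule integrable_fst'[OF i(1)])
 show i2: "integrable M1 (%x. LINT y|M2. F (x, y))" by (rule integrable_fst'[OF i(2)])
 fix n
 have id: "integrable (M1 \<Otimes>\<^sub>M M2) (%z. \<bar>f n z - F z\<bar>)" using i by auto
 have "(LINT x|M1. \<bar>(LINT y|M2. f n (x, y)) - (LINT y|M2. F (x, y))\<bar>) <= (LINT x|M1. LINT y|M2. \<bar>f n (x, y) - F (x, y)\<bar>)"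
 proof (rule integral_mono_AE)
  show "integrable M1 (%x. \<bar>(LINT y|M2. f n (x, y)) - (LINT y|M2. F (x, y))\<bar>)" using i1 i2 by auto
  show "integrable M1 (%x. LINT y|M2. \<bar>f n (x, y) - F (x, y)\<bar>)" by (rule integrable_fst'[OF id])
  show "AE x in M1. \<bar>(LINT y|M2. f n (x, y)) - (LINT y|M2. F (x, y))\<bar> <= (LINT y|M2. \<bar>f n (x, y) - F (x, y)\<bar>)"
  using AE_integrable_fst'[OF i(1)[of n]] AE_integrable_fst'[OF i(2)]
  proof eventually_elim
  fix x assume a: "integrable M2 (%y. f n (x, y))" "integrable M2 (%y. F (x, y))"
  have "(LINT y|M2. f n (x, y)) - (LINT y|M2. F (x, y)) = (LINT y|M2. f n (x, y) - F (x, y))" using a by simp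
  thus "\<bar>(LINT y|M2. f n (x, y)) - (LINT y|M2. F (x, y))\<bar> <= (LINT y|M2. \<bar>f n (x, y) - F (x, y)\<bar>)" by simp
  qed
 qed
 also have "... = (LINT z|(M1 \<Otimes>\<^sub>M M2). \<bar>f n z - F z\<bar>)" by (rule integral_fst'[OF id])
 finally show "(LINT x|M1. \<bar>(LINT y|M2. f n (x, y)) - (LINT y|M2. F (x, y))\<bar>) <= (LINT z|(M1 \<Otimes>\<^sub>M M2). \<bar>f n z - F z\<bar>)" .
qed

lemma integrable_lift_fst:
 assumes M1: "sigma_finite_measure M1" and M2: "finite_measure M2" and h: "integrable M1 (h :: 'a => real)"
 shows "integrable (M1 \<Otimes>\<^sub>M M2) (%z. h (fst z))" "(LINT z|(M1 \<Otimes>\<^sub>M M2). h (fst z)) = measure M2 (space M2) * (LINT x|M1. h x)"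
proof -
 interpret M1: sigma_finite_measure M1 by fact
 interpret M2: finite_measure M2 by fact
 interpret pair_sigma_finite M1 M2 ..
 have [measurable]: "h : borel_measurable M1" using h by auto
 show i: "integrable (M1 \<Otimes>\<^sub>M M2) (%z. h (fst z))"
  by (rule Fubini_integrable) (use h in \<open>auto intro!: integrable_mult_left integrable_abs\<close>)
 show "(LINT z|(M1 \<Otimes>\<^sub>M M2). h (fst z)) = measure M2 (space M2) * (LINT x|M1. h x)"
  using integral_fst'[OF i] by simp
qed

lemma L1conv_lift_fst:
 assumes M1: "sigma_finite_measure M1" and M2: "finite_measure M2" and f: "L1conv M1 f F"
 shows "L1conv (M1 \<Otimes>\<^sub>M M2) (%n z. f n (fst z)) (%z. F (fst z))"
proof (rule L1convI_bound)
 note i = L1convD(1)[OF f] L1convD(2)[OF f]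
 show "integrable (M1 \<Otimes>\<^sub>M M2) (%z. f n (fst z))" for n by (rule integrable_lift_fst[OF M1 M2 i(1)])
 show "integrable (M1 \<Otimes>\<^sub>M M2) (%z. F (fst z))" by (rule integrable_lift_fst[OF M1 M2 i(2)])
 show "(%n. measure M2 (space M2) * (LINT x|M1. \<bar>f n x - F x\<bar>)) \<longlonglongrightarrow> 0"
  by (rule tendsto_mult_right_zero[OF L1convD(3)[OF f]])
 show "(LINT z|(M1 \<Otimes>\<^sub>M M2). \<bar>f n (fst z) - F (fst z)\<bar>) <= measure M2 (space M2) * (LINT x|M1. \<bar>f n x - F x\<bar>)" for n
  using integrable_lift_fst(2)[OF M1 M2, of "%x. \<bar>f n x - F x\<bar>"] i by auto
qed

lemma L1conv_AE_subseq:
 assumes f: "L1conv M f F"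
 obtains r :: "nat => nat" where "strict_mono r" "AE x in M. (%n. f (r n) x) \<longlonglongrightarrow> F x"
proof -
 have "(%n. (LINT x|M. norm (f n x - F x))) \<longlonglongrightarrow> 0" using L1convD(3)[OF f] by simp
 from tendsto_L1_AE_subseq[OF _ this] L1convD(1,2)[OF f]
 obtain r where r: "strict_mono r" "AE x in M. (%n. f (r n) x - F x) \<longlonglongrightarrow> 0" by auto
 have "AE x in M. (%n. f (r n) x) \<longlonglongrightarrow> F x" using r(2) by eventually_elim (simp add: LIM_zero_iff)
 thus ?thesis using that r(1) by blast
qed

section \<open>Polar coordinates on discs\<close>

definition radR :: "real => real measure" where
 "radR R = density lborel (%r. ennreal r * ind {..R} r)"
abbreviation "polR R == radR R \<Otimes>\<^sub>M circm"

lemma sets_radR [simp, measurable_cong]: "sets (radR R) = sets borel" by (simp add: radR_def)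
lemma space_radR [simp]: "space (radR R) = UNIV" by (simp add: radR_def)

lemma finite_radR: "finite_measure (radR R)"
proof (rule finite_measureI)
 have "emeasure (radR R) (space (radR R)) = (nnint lborel (%r. ennreal r * ind {..R} r))"
  by (simp add: radR_def emeasure_density)
 also have "... <= (nnint lborel (%r. ennreal \<bar>R\<bar> * ind {0..R} r))"
  by (intro nn_integral_mono) (auto simp: indicator_def ennreal_neg intro!: ennreal_leI)
 also have "... < \<infinity>"
  using emeasure_bounded_finite[of "{0..R}"] by (subst nn_integral_cmult_indicator) (auto simp: ennreal_mult_less_top)
 finally show "emeasure (radR R) (space (radR R)) ~= \<infinity>" by simp
qed

interpretation radR: finite_measure "radR R" for R by (rule finite_radR)
interpretation polR: pair_sigma_finite "radR R" circm for R ..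

lemma finite_polR: "finite_measure (polR R)"
 by (intro finite_measure_pair_measure finite_radR finite_circm)

definition lborelR :: "real => (real^2) measure" where
 "lborelR R = density lborel (ind (cball 0 R))"

lemma sets_lborelR [simp, measurable_cong]: "sets (lborelR R) = sets borel" by (simp add: lborelR_def)
lemma space_lborelR [simp]: "space (lborelR R) = UNIV" by (simp add: lborelR_def)

lemma distr_polR: "distr (polR R) borel (%x. pol (fst x) (snd x)) = lborelR R"
proof (rule measure_eqI)
 fix A assume "A : sets (distr (polR R) borel (%x. pol (fst x) (snd x)))"
 hence A [measurable]: "A : sets borel" by simp
 have [measurable]: "cball (0::real^2) R : sets borel" by simp
 have "emeasure (distr (polR R) borel (%x. pol (fst x) (snd x))) A
  = (nnint (polR R) (%x. ind A (pol (fst x) (snd x))))"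
  by (subst nn_integral_indicator[symmetric], simp, subst nn_integral_distr) auto
 also have "... = (nnint (radR R) (%r. nnint circm (%th. ind A (pol r th))))"
  using circm.nn_integral_fst[of "%x. ind A (pol (fst x) (snd x))" "radR R"] by simp
 also have "... = (nnint lborel (%r. ennreal r * ind {..R} r * (nnint circm (%th. ind A (pol r th)))))"
 proof -
  have [measurable]: "(%r. nnint circm (%th. ind A (pol r th))) : borel_measurable lborel" by measurable
  show ?thesis unfolding radR_def by (subst nn_integral_density) auto
 qed
 also have "... = (nnint lborel (%r. ennreal r * (nnint circm (%th. ind A (pol r th) * ind (cball 0 R) (pol r th)))))"
  by (intro nn_integral_cong) (auto simp: indicator_def ennreal_neg)
 also have "... = (nnint radm (%r. (nnint circm (%th. ind A (pol r th) * ind (cball 0 R) (pol r th)))))"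
 proof -
  have [measurable]: "(%r. nnint circm (%th. ind A (pol r th) * ind (cball 0 R) (pol r th))) : borel_measurable lborel" by measurable
  show ?thesis unfolding radm_def by (subst nn_integral_density) auto
 qed
 also have "... = (nnint lborel (%x. ind A x * ind (cball 0 R) x))"
  by (rule nn_integral_polar[symmetric]) measurable
 also have "... = emeasure (lborelR R) A"
  unfolding lborelR_def by (subst emeasure_density) (auto simp: mult.commute)
 finally show "emeasure (distr (polR R) borel (%x. pol (fst x) (snd x))) A = emeasure (lborelR R) A" .
qed simp

lemma L1conv_polar:
 assumes f: "L1conv (lborelR R) f F"
 shows "L1conv (polR R) (%n x. f n (pol (fst x) (snd x))) (%x. F (pol (fst x) (snd x)))"
proof -
 note i = L1convD[OF f]
 have m [measurable]: "f n : borel_fun" "F : borel_fun" for n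
  using i(1)[of n] i(2) by auto
 have pm: "(%x. pol (fst x) (snd x)) : measurable (polR R) borel" by measurable
 show ?thesis unfolding L1conv_def
 proof (intro conjI allI)
  show "integrable (polR R) (%x. f n (pol (fst x) (snd x)))" for n
  using i(1)[of n] unfolding distr_polR[symmetric] by (subst (asm) integrable_distr_eq[OF pm]) auto
  show "integrable (polR R) (%x. F (pol (fst x) (snd x)))"
  using i(2) unfolding distr_polR[symmetric] by (subst (asm) integrable_distr_eq[OF pm]) auto
  have "(LINT x|lborelR R. \<bar>f n x - F x\<bar>) = (LINT x|(polR R). \<bar>f n (pol (fst x) (snd x)) - F (pol (fst x) (snd x))\<bar>)" for n
  unfolding distr_polR[symmetric] by (subst integral_distr[OF pm]) auto
  thus "(%n. LINT x|(polR R). \<bar>f n (pol (fst x) (snd x)) - F (pol (fst x) (snd x))\<bar>) \<longlonglongrightarrow> 0"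
  using i(3) by simp
 qed
qed

lemma integral_circm:
 fixes f :: "real => real"
 assumes "contU f"
 shows "integrable circm f" "(LINT th|circm. f th) = circ_int f"
proof -
 have c: "continuous_on {0..2*pi} f" by (rule cont_subset[OF assms subset_UNIV])
 have [measurable]: "f : borel_fun" by (rule cont_borel[OF assms])
 have s: "set_integrable lborel {0..2*pi} f" by (rule borel_integrable_atLeastAtMost') (rule c)
 have d: "circm = density lborel (%x. ennreal (ind {0..2*pi} x))"
  unfolding circm_def by (intro arg_cong2[where f=density] refl ext) (simp split: split_indicator)
 show "integrable circm f" unfolding d
  using s by (subst integrable_density) (auto simp: set_integrable_def)
 have "(LINT th|circm. f th) = (LINT th:{0..2*pi}|lborel. f th)"
  unfolding d by (subst integral_density) (auto simp: set_lebesgue_integral_def)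
 thus "(LINT th|circm. f th) = circ_int f"
  using set_borel_integral_eq_integral(2)[OF s] by simp
qed

lemma integral_radR:
 fixes f :: "real => real"
 assumes [measurable]: "f : borel_fun"
 shows "integrable (radR R) f \<longleftrightarrow> set_integrable lborel {0..R} (%s. s * f s)"
  "(LINT s|radR R. f s) = (LINT s:{0..R}|lborel. s * f s)"
proof -
 have d: "radR R = density lborel (%s. ennreal (s * ind {0..R} s))"
  unfolding radR_def by (intro arg_cong2[where f=density] refl ext) (auto simp: ennreal_neg split: split_indicator)
 have nn: "AE s in lborel. 0 <= s * ind {0..R} s" by (auto simp: indicator_def)
 show "integrable (radR R) f \<longleftrightarrow> set_integrable lborel {0..R} (%s. s * f s)"
  unfolding d using nn by (subst integrable_density) (auto simp: set_integrable_def mult_ac)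
 show "(LINT s|radR R. f s) = (LINT s:{0..R}|lborel. s * f s)"
  unfolding d using nn by (subst integral_density) (auto simp: set_lebesgue_integral_def mult_ac)
qed

lemma AE_radR_iff: "(AE r in radR R. P r) \<longleftrightarrow> (AE r in lborel. 0 < r & r <= R --> P r)"
 unfolding radR_def by (subst AE_density) (auto simp: indicator_def zero_less_mult_iff split: if_splits)

lemma AE_radm_radR: "(!!n::nat. AE r in radR (real n). P r) ==> AE r in radm. P r"
proof -
 assume "!!n::nat. AE r in radR (real n). P r"
 hence "AE r in lborel. \<forall>n::nat. 0 < r & r <= real n --> P r" unfolding AE_radR_iff AE_all_countable by blast
 thus ?thesis unfolding AE_radm_iff
 proof eventually_elim
  fix r assume "\<forall>n::nat. 0 < r & r <= real n --> P r"
  thus "0 < r --> P r" using real_arch_simple[of r] by blast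
 qed
qed

lemma AE_radm_imp_radR: "AE r in radm. P r ==> AE r in radR R. P r"
 unfolding AE_radm_iff AE_radR_iff by (erule eventually_mono) auto

lemma AE_polR_bounds: "AE z in radR R \<Otimes>\<^sub>M circm. 0 < fst z & fst z <= R"
proof (rule polR.AE_pair_measure)
 have "Measurable.pred (polR R) (%z. 0 < fst z & fst z <= R)" by measurable
 thus "{z : space (polR R). 0 < fst z & fst z <= R} : sets (polR R)" by (simp only: pred_def)
qed (auto simp: AE_radR_iff)

lemma integrable_lborelR:
 fixes f :: "real^2 => real"
 assumes [measurable]: "f : borel_fun"
 shows "integrable (lborelR R) f \<longleftrightarrow> integrable lborel (%x. f x * ind (cball 0 R) x)"
  "(LINT x|lborelR R. f x) = (LINT x|lborel. f x * ind (cball 0 R) x)"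
proof -
 have d: "lborelR R = density lborel (%x. ennreal (ind (cball 0 R) x))"
  unfolding lborelR_def by (intro arg_cong2[where f=density] refl ext) (simp split: split_indicator)
 show "integrable (lborelR R) f \<longleftrightarrow> integrable lborel (%x. f x * ind (cball 0 R) x)"
  unfolding d by (subst integrable_density) (auto simp: mult.commute)
 show "(LINT x|lborelR R. f x) = (LINT x|lborel. f x * ind (cball 0 R) x)"
  unfolding d by (subst integral_density) (auto simp: mult.commute)
qed

lemma nn_integral_lborelR:
 assumes [measurable]: "f : borel_fun"
 shows "(nnint (lborelR R) (%x. f x)) = (nnint lborel (%x. f x * ind (cball 0 R) x))"
 unfolding lborelR_def by (subst nn_integral_density) (auto simp: mult.commute)

lemma integrable_lborelR_continuous:
 fixes f :: "real^2 => real"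
 assumes c: "contU f"
 shows "integrable (lborelR R) f"
proof -
 have [measurable]: "f : borel_fun" by (rule cont_borel[OF c])
 have "integrable lborel (%x. ind (cball 0 R) x *\<^sub>R f x)"
  by (rule borel_integrable_compact) (auto intro: cont_subset[OF c])
 thus ?thesis by (subst integrable_lborelR) (auto simp: mult.commute)
qed

lemma L1conv_mollify:
 fixes u :: "real^2 => real"
 assumes u: "loc_pow 1 u"
 shows "L1conv (lborelR R) (%n. moll n u) u"
proof -
 note [measurable] = loc_pow_borel[OF u]
 have [measurable]: "moll n u : borel_fun" for n
  by (rule cont_borel[OF continuous_mollify[OF u]])
 have iu: "integrable (lborelR R) u"
 proof (rule integrableI_bounded)
  show "u : borel_measurable (lborelR R)" by measurable
  show "(nnint (lborelR R) (%x. ennreal (norm (u x)))) < \<infinity>"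
  using u by (subst nn_integral_lborelR) (auto simp: loc_pow_def)
 qed
 have ic: "integrable (lborelR R) (moll n u)" for n
  by (rule integrable_lborelR_continuous[OF continuous_mollify[OF u]])
 have eq: "ennreal (LINT x|lborelR R. \<bar>moll n u x - u x\<bar>) = (nnint lborel (%x. ennreal (\<bar>moll n u x - u x\<bar> ^ 1) * ind (cball 0 R) x))" for n
 proof -
  have "ennreal (LINT x|lborelR R. \<bar>moll n u x - u x\<bar>) = (nnint (lborelR R) (%x. ennreal \<bar>moll n u x - u x\<bar>))"
  by (intro nn_integral_eq_integral[symmetric] integrable_abs LINT_diff ic iu) auto
  also have "... = (nnint lborel (%x. ennreal (\<bar>moll n u x - u x\<bar> ^ 1) * ind (cball 0 R) x))"
  by (subst nn_integral_lborelR) auto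
  finally show ?thesis .
 qed
 have "(%n. ennreal (LINT x|lborelR R. \<bar>moll n u x - u x\<bar>)) \<longlonglongrightarrow> ennreal 0"
  unfolding eq using mollify_tendsto[OF u u, of R] by simp
 hence "(%n. LINT x|lborelR R. \<bar>moll n u x - u x\<bar>) \<longlonglongrightarrow> 0"
  by (subst (asm) tendsto_ennreal_iff) (auto intro!: always_eventually)
 thus ?thesis using iu ic by (simp add: L1conv_def)
qed

lemma L2conv_mollify:
 fixes u :: "real^2 => real"
 assumes u: "loc_pow 1 u" and u2: "loc_pow 2 u"
 shows "integrable (lborelR R) (%x. (u x)^2)"
  "integrable (lborelR R) (%x. (moll n u x - u x)^2)"
  "(%n. LINT x|lborelR R. (moll n u x - u x)^2) \<longlonglongrightarrow> 0"
proof -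
 note [measurable] = loc_pow_borel[OF u]
 have [measurable]: "moll n u : borel_fun" for n
  by (rule cont_borel[OF continuous_mollify[OF u]])
 show iu: "integrable (lborelR R) (%x. (u x)^2)"
 proof (rule integrableI_nonneg)
  have "(nnint (lborelR R) (%x. ennreal ((u x)^2))) = (nnint lborel (%x. ennreal (\<bar>u x\<bar> ^ 2) * ind (cball 0 R) x))"
  by (subst nn_integral_lborelR) auto
  thus "(nnint (lborelR R) (%x. ennreal ((u x)^2))) < \<infinity>" using u2 by (simp add: loc_pow_def)
 qed auto
 show ic: "integrable (lborelR R) (%x. (moll n u x - u x)^2)" for n
 proof (rule Bochner_Integration.integrable_bound[where f="%x. 2 * (moll n u x)^2 + 2 * (u x)^2"])
  have "integrable (lborelR R) (%x. (moll n u x)^2)"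
  by (intro integrable_lborelR_continuous continuous_on_power continuous_mollify u)
  thus "integrable (lborelR R) (%x. 2 * (moll n u x)^2 + 2 * (u x)^2)" using iu by simp
  have "(p - q)^2 <= 2 * p\<^sup>2 + 2 * q\<^sup>2" for p q :: real
  proof -
  have "0 <= (p + q)\<^sup>2" by simp
  thus ?thesis by (simp add: sq_eq algebra_simps)
  qed
  thus "AE x in lborelR R. norm ((moll n u x - u x)^2) <= norm (2 * (moll n u x)^2 + 2 * (u x)^2)"
  by (intro AE_I2) simp
 qed measurable
 have eq: "ennreal (LINT x|lborelR R. (moll n u x - u x)^2) = (nnint lborel (%x. ennreal (\<bar>moll n u x - u x\<bar> ^ 2) * ind (cball 0 R) x))" for n
 proof -
  have "ennreal (LINT x|lborelR R. (moll n u x - u x)^2) = (nnint (lborelR R) (%x. ennreal ((moll n u x - u x)^2)))"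
  by (intro nn_integral_eq_integral[symmetric] ic) auto
  also have "... = (nnint lborel (%x. ennreal (\<bar>moll n u x - u x\<bar> ^ 2) * ind (cball 0 R) x))"
  by (subst nn_integral_lborelR) auto
  finally show ?thesis .
 qed
 have "(%n. ennreal (LINT x|lborelR R. (moll n u x - u x)^2)) \<longlonglongrightarrow> ennreal 0"
  unfolding eq using mollify_tendsto[OF u u2, of R] by simp
 thus "(%n. LINT x|lborelR R. (moll n u x - u x)^2) \<longlonglongrightarrow> 0"
  by (subst (asm) tendsto_ennreal_iff) (auto intro!: always_eventually)
qed

text \<open>L1 limits are determined almost everywhere only, so the conclusion provides an
  absolutely continuous representative \<open>C\<close>. A subsequence of \<open>cn\<close>
  converges at almost every point; one such point fixes the constant of integration, and the
  increments pass to the limit.\<close>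

lemma indef_integral_limit:
 assumes c: "L1conv (radR R) cn c" and h: "L1conv (radR R) hn h"
  and inc: "!!n r s. 0 < r ==> r <= s ==> s <= R ==> cn n s - cn n r = integral {r..s} (hn n)"
  and ab: "0 < al" "al <= be" "be <= R"
 obtains C where "AC_on al be C h" "AE r in lborel. al <= r & r <= be --> C r = c r"
proof -
 have hm [measurable]: "h : borel_fun" "hn n : borel_fun" for n
  using L1convD(1)[OF h, of n] L1convD(2)[OF h] by auto
 \<comment> \<open>The measure \<open>radR R\<close> has density \<open>t\<close>. The weight
   \<open>1 / t\<close> undoes it, and is bounded by \<open>1 / al\<close> because the interval
   stays away from 0.\<close>
 have seg: "set_integrable lborel {r..s} k & (LINT t|radR R. k t * (ind {r..s} t / t)) = integral {r..s} k"
  if k: "integrable (radR R) k" "k : borel_fun" and rs: "al <= r" "s <= be" for k :: "real => real" and r s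
 proof -
  note [measurable] = k(2)
  have e: "ind {0..R} t * (t * (k t * (ind {r..s} t / t))) = ind {r..s} t * k t" for t
  using rs ab by (auto simp: indicator_def)
  have "L1conv (radR R) (%n. k) k" using k by (simp add: L1conv_def)
  hence "L1conv (radR R) (%n t. k t * (ind {r..s} t / t)) (%t. k t * (ind {r..s} t / t))"
  proof (rule L1conv_mult_bounded[where B="1/al"])
  show "AE t in radR R. \<bar>ind {r..s} t / t\<bar> <= 1 / al"
  using rs ab by (intro AE_I2) (auto simp: indicator_def field_simps)
  qed measurable
  hence i: "integrable (radR R) (%t. k t * (ind {r..s} t / t))" by (rule L1convD(2))
  hence "set_integrable lborel {0..R} (%t. t * (k t * (ind {r..s} t / t)))" by (subst (asm) integral_radR(1)) auto
  hence s: "set_integrable lborel {r..s} k" unfolding set_integrable_def by (simp only: e real_scaleR_def)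
  have "(LINT t|radR R. k t * (ind {r..s} t / t)) = (LINT t:{r..s}|lborel. k t)"
  by (subst integral_radR(2)) (simp_all only: set_lebesgue_integral_def e real_scaleR_def, measurable)
  also have "... = integral {r..s} k" by (rule set_borel_integral_eq_integral(2)[OF s])
  finally show ?thesis using s by simp
 qed
 have lim: "(%n. integral {r..s} (hn n)) \<longlonglongrightarrow> integral {r..s} h" if rs: "al <= r" "s <= be" for r s
 proof -
  have "L1conv (radR R) (%n t. hn n t * (ind {r..s} t / t)) (%t. h t * (ind {r..s} t / t))"
  proof (rule L1conv_mult_bounded[OF h, where B="1/al"])
  show "AE t in radR R. \<bar>ind {r..s} t / t\<bar> <= 1 / al"
  using rs ab by (intro AE_I2) (auto simp: indicator_def field_simps)
  qed measurable
  from L1conv_integral[OF this] show ?thesis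
  using seg[OF L1convD(1)[OF h] hm(2) rs] seg[OF L1convD(2)[OF h] hm(1) rs] by simp
 qed
 obtain sg :: "nat => nat" where sg: "strict_mono sg" "AE r in radR R. (%n. cn (sg n) r) \<longlonglongrightarrow> c r"
  using L1conv_AE_subseq[OF c] by blast
 have ae: "AE r in lborel. al <= r & r <= be --> (%n. cn (sg n) r) \<longlonglongrightarrow> c r"
  using sg(2) unfolding AE_radR_iff by eventually_elim (use ab in auto)
 have hi: "h absolutely_integrable_on {al..be}"
  using seg[OF L1convD(2)[OF h] hm(1), of al be] unfolding set_integrable_def
  by (auto intro!: integrable_completion[THEN iffD2])
 have hint: "h integrable_on {x..y}" if "al <= x" "y <= be" for x y
  using that by (intro integrable_on_subinterval[OF set_LINT(1)[OF hi]]) auto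
 define C0 where "C0 r = integral {al..r} h" for r
 have C0: "C0 s - C0 r = integral {r..s} h" if "al <= r" "r <= s" "s <= be" for r s
  using HK_combine[OF that(1,2) hint[of al s]] that by (simp add: C0_def)
 show ?thesis
 proof (cases "\<exists>r0. al <= r0 & r0 <= be & (%n. cn (sg n) r0) \<longlonglongrightarrow> c r0")
  case True
  then obtain r0 where r0: "al <= r0" "r0 <= be" "(%n. cn (sg n) r0) \<longlonglongrightarrow> c r0" by blast
  define C where "C r = c r0 - C0 r0 + C0 r" for r
  have "AC_on al be C h"
  unfolding AC_on_def using hi C0 by (auto simp: C_def)
  moreover have "AE r in lborel. al <= r & r <= be --> C r = c r"
  using ae
  proof eventually_elim
  fix r assume a: "al <= r & r <= be --> (%n. cn (sg n) r) \<longlonglongrightarrow> c r"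
  show "al <= r & r <= be --> C r = c r"
  proof
  assume r: "al <= r & r <= be"
  have l1: "(%n. cn (sg n) r - cn (sg n) r0) \<longlonglongrightarrow> c r - c r0" by (intro tendsto_diff r0) (use a r in blast)
  have l2: "(%n. cn (sg n) r - cn (sg n) r0) \<longlonglongrightarrow> C0 r - C0 r0"
  proof (cases "r0 <= r")
  case True
  have "(%n. integral {r0..r} (hn (sg n))) \<longlonglongrightarrow> integral {r0..r} h"
  using LIMSEQ_subseq_LIMSEQ[OF lim[of r0 r] sg(1)] r0 r by (simp add: o_def)
  thus ?thesis using inc[of r0 r] C0[of r0 r] r r0 True ab by simp
  next
  case False
  have "(%n. - integral {r..r0} (hn (sg n))) \<longlonglongrightarrow> - integral {r..r0} h"
  using LIMSEQ_subseq_LIMSEQ[OF lim[of r r0] sg(1)] r0 r by (intro tendsto_minus) (simp add: o_def)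
  moreover have "- integral {r..r0} (hn (sg n)) = cn (sg n) r - cn (sg n) r0" for n
  using inc[of r r0 "sg n"] r r0 False ab by simp
  moreover have "- integral {r..r0} h = C0 r - C0 r0" using C0[of r r0] r r0 False by simp
  ultimately show ?thesis by simp
  qed
  have "c r - c r0 = C0 r - C0 r0" by (rule LIMSEQ_unique[OF l1 l2])
  thus "C r = c r" by (simp add: C_def)
  qed
  qed
  ultimately show ?thesis by (rule that)
 next
  \<comment> \<open>Without a point of convergence the interval is null, so any primitive of
    \<open>h\<close> will do.\<close>
  case False
  have "AC_on al be C0 h" unfolding AC_on_def using hi C0 by auto
  moreover have "AE r in lborel. al <= r & r <= be --> C0 r = c r"
  using ae by eventually_elim (use False in blast)
  ultimately show ?thesis by (rule that)
 qed
qed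

section \<open>Sobolev maps on almost every circle\<close>

locale weak_map =
 fixes a b a1 a2 b1 b2 :: "real^2 => real"
 assumes la: "loc_pow 1 a" and lb: "loc_pow 1 b"
  and l1: "loc_pow 1 a1" "loc_pow 1 a2" "loc_pow 1 b1" "loc_pow 1 b2"
  and l2: "loc_pow 2 a1" "loc_pow 2 a2" "loc_pow 2 b1" "loc_pow 2 b2"
  and wa: "has_weak_partial (axis 1 1) a a1" "has_weak_partial (axis 2 1) a a2"
  and wb: "has_weak_partial (axis 1 1) b b1" "has_weak_partial (axis 2 1) b b2"
begin

abbreviation "An n \<equiv> moll n a"
abbreviation "Bn n \<equiv> moll n b"
abbreviation "A1n n \<equiv> moll n a1"
abbreviation "A2n n \<equiv> moll n a2"
abbreviation "B1n n \<equiv> moll n b1"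
abbreviation "B2n n \<equiv> moll n b2"

lemmas [measurable] = loc_pow_borel[OF la] loc_pow_borel[OF lb] loc_pow_borel[OF l1(1)] loc_pow_borel[OF l1(2)]
 loc_pow_borel[OF l1(3)] loc_pow_borel[OF l1(4)]

lemma C1_grad_mollify:
 assumes u: "loc_pow 1 u" and v: "loc_pow 1 u1" "loc_pow 1 u2"
  and w: "has_weak_partial (axis 1 1) u u1" "has_weak_partial (axis 2 1) u u2"
 shows "C1_grad (moll n u) (moll n u1) (moll n u2)"
 unfolding C1_grad_def
proof (intro conjI allI continuous_mollify v)
 fix x :: "real^2"
 have B: "(Basis :: (real^2) set) = {axis 1 1, axis 2 1}" by (auto simp: Basis_vec_def UNIV_2)
 have ne: "axis 1 1 ~= (axis 2 1 :: real^2)" by (simp add: axis_eq_axis)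
 define g where "g b = (if b = axis 1 (1::real) then u1 else u2)" for b :: "real^2"
 have "(moll n u has_derivative (%h. \<Sum>b\<in>Basis. (h \<bullet> b) * moll n (g b) x)) (at x)"
  by (rule mollify_has_derivative[OF u]) (use w ne in \<open>auto simp: B g_def\<close>)
 also have "(%h. \<Sum>b\<in>Basis. (h \<bullet> b) * moll n (g b) x) = (%h. h $ 1 * moll n u1 x + h $ 2 * moll n u2 x)"
 proof
  fix h :: "real^2"
  have "g (axis 1 1) = u1" "g (axis 2 1) = u2" using ne by (auto simp: g_def)
  thus "(\<Sum>b\<in>Basis. (h \<bullet> b) * moll n (g b) x) = h $ 1 * moll n u1 x + h $ 2 * moll n u2 x"
  unfolding B using ne by (subst sum.insert) (auto simp: inner_axis)
 qed
 finally show "(moll n u has_derivative (%h. h $ 1 * moll n u1 x + h $ 2 * moll n u2 x)) (at x)" .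
qed

lemmas C1A = C1_grad_mollify[OF la l1(1,2) wa]
lemmas C1B = C1_grad_mollify[OF lb l1(3,4) wb]

lemma L1_product:
 assumes "loc_pow 1 u" "loc_pow 2 u" "loc_pow 1 v" "loc_pow 2 v"
 shows "L1conv (lborelR R) (%n x. moll n u x * moll n v x) (%x. u x * v x)"
proof -
 have [measurable]: "u : borel_fun" "v : borel_fun" using assms by auto
 have [measurable]: "moll n u : borel_fun" "moll n v : borel_fun" for n
  using continuous_mollify assms cont_borel by metis+
 show ?thesis by (rule L1conv_mult_L2; (rule L2conv_mollify assms)?; (rule assms)?; measurable)
qed

definition "jac x = a1 x * b2 x - a2 x * b1 x"
definition "jacn n x = A1n n x * B2n n x - A2n n x * B1n n x"

lemma jac_measurable [measurable]: "jac : borel_fun" unfolding jac_def by measurable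

text \<open>The Jacobian is quadratic in the gradient, so convergence of the gradients in L2 is just
  enough. This carries the enclosed area from the mollified maps to the limit.\<close>

lemma L1_jac: "L1conv (lborelR R) jacn jac"
 unfolding jac_def[abs_def] jacn_def[abs_def] by (intro L1conv_diff L1_product l1 l2)

lemma jac_integrable: "integrable (lborelR R) jac" by (rule L1convD(2)[OF L1_jac])

definition "Ta r t = ang_comp a1 a2 r t"
definition "Tb r t = ang_comp b1 b2 r t"
definition "Na r t = rad_comp a1 a2 r t"
definition "Nb r t = rad_comp b1 b2 r t"

definition "tang2 r = (LINT t|circm. (Ta r t)^2 + (Tb r t)^2)"
definition "tang2n n r = (LINT t|circm. (ang_comp (A1n n) (A2n n) r t)^2 + (ang_comp (B1n n) (B2n n) r t)^2)"
text \<open>For a smooth map this is the area enclosed by the image of the circle, by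
  \<open>area_formula\<close>. As an integral over the disc it makes sense without a trace on the
  circle.\<close>

definition "area r = (LINT x|lborelR r. jac x)"
definition "arean n r = (LINT x|lborelR r. jacn n x)"
text \<open>The limit form of \<open>circle_curve.deficit\<close>, whose line integral is twice the
  area.\<close>

definition "defi r = tang2 r - 2 * area r"
definition "defin n r = tang2n n r - 2 * arean n r"

text \<open>Weights such as \<open>r * cos t\<close> are bounded only on the radii that
  \<open>radR R\<close> charges.\<close>

lemma L1conv_cong_fst_bounded:
 assumes "L1conv (polR R) f F" "k : borel_measurable (polR R)"
  and "!!r t. 0 < r ==> r <= R ==> \<bar>k (r, t)\<bar> <= B"
 shows "L1conv (polR R) (%n z. f n z * k z) (%z. F z * k z)"
proof (rule L1conv_mult_bounded[OF assms(1,2)])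
 show "AE z in radR R \<Otimes>\<^sub>M circm. \<bar>k z\<bar> <= B"
  using AE_polR_bounds[of R] by eventually_elim (use assms(3) in \<open>auto simp: split_beta\<close>)
qed

lemma L1_ang:
 assumes u: "loc_pow 1 u1" "loc_pow 1 u2"
 shows "L1conv (polR R) (%n z. ang_comp (moll n u1) (moll n u2) (fst z) (snd z)) (%z. ang_comp u1 u2 (fst z) (snd z))"
proof -
 have b: "\<bar>r * c\<bar> <= R" if "0 < r" "r <= R" "\<bar>c\<bar> <= 1" for r c :: real
  using mult_mono[of "\<bar>r\<bar>" "\<bar>R\<bar>" "\<bar>c\<bar>" 1] that by (simp add: abs_mult)
 have "L1conv (polR R) (%n z. moll n u2 (pol (fst z) (snd z)) * (fst z * cos (snd z)) - moll n u1 (pol (fst z) (snd z)) * (fst z * sin (snd z)))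
  (%z. u2 (pol (fst z) (snd z)) * (fst z * cos (snd z)) - u1 (pol (fst z) (snd z)) * (fst z * sin (snd z)))"
  by (intro L1conv_diff L1conv_cong_fst_bounded[where B=R] L1conv_polar L1conv_mollify u) (auto intro!: b)
 thus ?thesis by (simp add: ang_comp_def algebra_simps)
qed

lemma L1_rad:
 assumes u: "loc_pow 1 u1" "loc_pow 1 u2"
 shows "L1conv (polR R) (%n z. rad_comp (moll n u1) (moll n u2) (fst z) (snd z)) (%z. rad_comp u1 u2 (fst z) (snd z))"
proof -
 have "L1conv (polR R) (%n z. moll n u1 (pol (fst z) (snd z)) * cos (snd z) + moll n u2 (pol (fst z) (snd z)) * sin (snd z))
  (%z. u1 (pol (fst z) (snd z)) * cos (snd z) + u2 (pol (fst z) (snd z)) * sin (snd z))"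
  by (intro L1conv_add L1conv_cong_fst_bounded[where B=1] L1conv_polar L1conv_mollify u) auto
 thus ?thesis by (simp add: rad_comp_def mult.commute)
qed

text \<open>Expanding the square leaves products of two gradient components, which converge in L1 on
  the disc, with weights that are bounded by \<open>2 * R^2\<close>.\<close>

lemma L1_ang_square:
 assumes u: "loc_pow 1 u1" "loc_pow 2 u1" "loc_pow 1 u2" "loc_pow 2 u2"
 shows "L1conv (polR R) (%n z. (ang_comp (moll n u1) (moll n u2) (fst z) (snd z))^2) (%z. (ang_comp u1 u2 (fst z) (snd z))^2)"
proof -
 have b: "\<bar>c * r\<^sup>2\<bar> <= 2 * R\<^sup>2" if "0 < r" "r <= R" "\<bar>c\<bar> <= 2" for r c :: real
  using mult_mono[of "\<bar>c\<bar>" 2 "r\<^sup>2" "R\<^sup>2"] power_mono[of r R 2] that by (simp add: abs_mult)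
 have c: "\<bar>(cos t)\<^sup>2\<bar> <= 2" "\<bar>(sin t)\<^sup>2\<bar> <= 2" "\<bar>- 2 * cos t * sin t\<bar> <= 2" for t :: real
 proof -
  have "(cos t)^2 <= 1" "(sin t)^2 <= 1" using sin_cos_squared_add[of t] zero_le_power2[of "sin t"] zero_le_power2[of "cos t"] by linarith+
  thus "\<bar>(cos t)\<^sup>2\<bar> <= 2" "\<bar>(sin t)\<^sup>2\<bar> <= 2" by auto
  have "- 2 * cos t * sin t = - sin (2 * t)" by (simp add: sin_double)
  moreover have "\<bar>sin (2 * t)\<bar> <= 1" by simp
  ultimately show "\<bar>- 2 * cos t * sin t\<bar> <= 2" by linarith
 qed
 let ?p = "%z. pol (fst z) (snd z)"
 have "L1conv (polR R)
  (%n z. (moll n u2 (?p z) * moll n u2 (?p z)) * ((cos (snd z))^2 * (fst z)^2)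
  + (moll n u1 (?p z) * moll n u2 (?p z)) * ((- 2 * cos (snd z) * sin (snd z)) * (fst z)^2)
  + (moll n u1 (?p z) * moll n u1 (?p z)) * ((sin (snd z))^2 * (fst z)^2))
  (%z. (u2 (?p z) * u2 (?p z)) * ((cos (snd z))^2 * (fst z)^2)
  + (u1 (?p z) * u2 (?p z)) * ((- 2 * cos (snd z) * sin (snd z)) * (fst z)^2)
  + (u1 (?p z) * u1 (?p z)) * ((sin (snd z))^2 * (fst z)^2))"
 proof (intro L1conv_add L1conv_cong_fst_bounded[where B="2 * R\<^sup>2"])
  show "L1conv (polR R) (%n z. moll n u2 (?p z) * moll n u2 (?p z)) (%z. u2 (?p z) * u2 (?p z))"
  "L1conv (polR R) (%n z. moll n u1 (?p z) * moll n u2 (?p z)) (%z. u1 (?p z) * u2 (?p z))"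
  "L1conv (polR R) (%n z. moll n u1 (?p z) * moll n u1 (?p z)) (%z. u1 (?p z) * u1 (?p z))"
  using L1conv_polar[OF L1_product[OF u(3,4) u(3,4)]] L1conv_polar[OF L1_product[OF u(1,2) u(3,4)]] L1conv_polar[OF L1_product[OF u(1,2) u(1,2)]] .
 qed (use b c in \<open>simp_all only: fst_conv snd_conv\<close>, measurable)
 moreover have "(q2 * q2) * ((cos t)^2 * r\<^sup>2) + (q1 * q2) * ((- 2 * cos t * sin t) * r\<^sup>2) + (q1 * q1) * ((sin t)^2 * r\<^sup>2)
  = (r * (cos t * q2 - sin t * q1))^2" for q1 q2 t r :: real
  by (simp add: sq_eq algebra_simps)
 ultimately show ?thesis by (simp only: ang_comp_def)
qed

lemma L1_tang2: "L1conv (radR R) tang2n tang2"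
proof -
 have "L1conv (polR R) (%n z. (ang_comp (A1n n) (A2n n) (fst z) (snd z))^2 + (ang_comp (B1n n) (B2n n) (fst z) (snd z))^2)
  (%z. (ang_comp a1 a2 (fst z) (snd z))^2 + (ang_comp b1 b2 (fst z) (snd z))^2)"
  by (intro L1conv_add L1_ang_square l1 l2)
 from polR.L1conv_fst[OF this] show ?thesis
  by (simp add: tang2_def[abs_def] tang2n_def[abs_def] Ta_def Tb_def)
qed

text \<open>The error at radius \<open>r\<close> is at most the L1 error of the Jacobian on the disc
  of radius \<open>R\<close>, a bound free of \<open>r\<close>, and \<open>radR R\<close> is a
  finite measure.\<close>

lemma L1_area: "L1conv (radR R) arean area"
proof -
 have m: "(%r. LINT x|lborelR r. h x) : borel_fun" if [measurable]: "h : borel_fun" for h :: "real^2 => real"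
 proof -
  have "(%r. LINT x|lborel. h x * ind {z::real \<times> (real^2). norm (snd z) <= fst z} (r, x)) : borel_fun"
  by measurable
  moreover have "(LINT x|lborelR r. h x) = (LINT x|lborel. h x * ind {z::real \<times> (real^2). norm (snd z) <= fst z} (r, x))" for r
  by (subst integrable_lborelR(2)) (auto simp: indicator_def)
  ultimately show ?thesis by simp
 qed
 have cA: "contU (jacn n)" for n
  unfolding jacn_def[abs_def] by (intro continuous_intros continuous_mollify l1)
 have [measurable]: "jacn n : borel_fun" for n by (rule cont_borel[OF cA])
 have [measurable]: "arean n : borel_fun" "area : borel_fun" for n
  unfolding arean_def[abs_def] area_def[abs_def] by (rule m; measurable)+
 have mono: "(LINT x|lborelR r. \<bar>h x\<bar>) <= (LINT x|lborelR R. \<bar>h x\<bar>)"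
  if h: "!!R. integrable (lborelR R) h" "h : borel_fun" and r: "r <= R" for h :: "real^2 => real" and r R
 proof -
  have [measurable]: "h : borel_fun" by fact
  have i: "integrable lborel (%x. \<bar>h x\<bar> * ind (cball 0 R) x)" for R
  using integrable_abs[OF h(1)[of R]] by (subst (asm) integrable_lborelR(1)) auto
  show ?thesis
  by (subst (1 2) integrable_lborelR(2)) (use i r in \<open>auto intro!: integral_mono simp: indicator_def\<close>)
 qed
 have int: "integrable (lborelR R) (jacn n)" "integrable (lborelR R) jac" for n R
  using L1convD(1)[OF L1_jac] L1convD(2)[OF L1_jac] by auto
 have bdd: "integrable (radR R) h" if "h : borel_fun" "!!r. r <= R ==> \<bar>h r\<bar> <= B" for h :: "real => real" and B
 proof (rule radR.integrable_const_bound[where B=B])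
  show "AE x in radR R. norm (h x) <= B" using that(2) unfolding AE_radR_iff by auto
 qed (use that in auto)
 have ib: "integrable (radR R) (%r. LINT x|lborelR r. h x)" if h: "!!R. integrable (lborelR R) h" "h : borel_fun" for h :: "real^2 => real"
  by (rule bdd[OF m[OF h(2)], where B="LINT x|lborelR R. \<bar>h x\<bar>"])
  (use integral_abs_bound mono[OF h] order_trans in blast)
 show ?thesis
 proof (rule L1convI_bound)
  show "integrable (radR R) (arean n)" for n unfolding arean_def[abs_def] by (rule ib) (rule int, measurable)
  show "integrable (radR R) area" unfolding area_def[abs_def] by (rule ib) (rule int, measurable)
  show "(%n. measure (radR R) UNIV * (LINT x|lborelR R. \<bar>jacn n x - jac x\<bar>)) \<longlonglongrightarrow> 0"
  by (rule tendsto_mult_right_zero[OF L1convD(3)[OF L1_jac]])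
  fix n
  have "(LINT r|radR R. \<bar>arean n r - area r\<bar>) <= (LINT r|radR R. (LINT x|lborelR R. \<bar>jacn n x - jac x\<bar>))"
  proof (rule integral_mono_AE)
  show "integrable (radR R) (%r. \<bar>arean n r - area r\<bar>)"
  using \<open>!!n. integrable (radR R) (arean n)\<close> \<open>integrable (radR R) area\<close> by auto
  show "AE r in radR R. \<bar>arean n r - area r\<bar> <= (LINT x|lborelR R. \<bar>jacn n x - jac x\<bar>)"
  unfolding AE_radR_iff
  proof (intro AE_I2 impI)
  fix r assume r: "0 < r & r <= R"
  have "arean n r - area r = (LINT x|lborelR r. jacn n x - jac x)" unfolding arean_def area_def using int by simp
  also have "\<bar>...\<bar> <= (LINT x|lborelR r. \<bar>jacn n x - jac x\<bar>)" by (rule integral_abs_bound)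
  also have "... <= (LINT x|lborelR R. \<bar>jacn n x - jac x\<bar>)"
  by (rule mono) (use int r in auto)
  finally show "\<bar>arean n r - area r\<bar> <= (LINT x|lborelR R. \<bar>jacn n x - jac x\<bar>)" .
  qed
  qed auto
  thus "(LINT r|radR R. \<bar>arean n r - area r\<bar>) <= measure (radR R) UNIV * (LINT x|lborelR R. \<bar>jacn n x - jac x\<bar>)" by simp
 qed
qed

lemma L1_defi: "L1conv (radR R) defin defi"
 unfolding defin_def[abs_def] defi_def[abs_def] by (intro L1conv_diff L1conv_cmult L1_tang2 L1_area)

lemma circle_curve_mollified: "circle_curve (%t. An n (pol r t)) (ang_comp (A1n n) (A2n n) r) (%t. Bn n (pol r t)) (ang_comp (B1n n) (B2n n) r)"
 by unfold_locales (auto intro: C1_grad_angle[OF C1A] C1_grad_angle[OF C1B]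
  cont_polar(2)[OF C1A cont_const cont_id] cont_polar(2)[OF C1B cont_const cont_id])

lemma arean_polar:
 assumes r: "0 <= r"
 shows "arean n r = integral {0..r} (%s. circ_int (%t. rad_comp (A1n n) (A2n n) s t * ang_comp (B1n n) (B2n n) s t - rad_comp (B1n n) (B2n n) s t * ang_comp (A1n n) (A2n n) s t))"
proof -
 note c = cont_polar[OF C1A] cont_polar[OF C1B]
 have cj: "contU (jacn n)"
  unfolding jacn_def[abs_def] by (intro continuous_intros continuous_mollify l1)
 have ct: "contU (%t. jacn n (pol s t))" for s
  by (rule cont_comp[OF cj continuous_on_pol[OF cont_const cont_id] subset_UNIV])
 have [measurable]: "jacn n : borel_fun" by (rule cont_borel[OF cj])
 have pm: "(%x. pol (fst x) (snd x)) : measurable (radR r \<Otimes>\<^sub>M circm) borel" by measurable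
 have i: "integrable (radR r \<Otimes>\<^sub>M circm) (%z. jacn n (pol (fst z) (snd z)))"
  using integrable_lborelR_continuous[OF cj, of r] unfolding distr_polR[symmetric] by (subst (asm) integrable_distr_eq[OF pm]) auto
 have "arean n r = (LINT z|(radR r \<Otimes>\<^sub>M circm). jacn n (pol (fst z) (snd z)))"
  unfolding arean_def distr_polR[symmetric] by (subst integral_distr[OF pm]) auto
 also have "... = (LINT s|radR r. LINT t|circm. jacn n (pol s t))" using polR.integral_fst'[OF i] by simp
 also have "... = (LINT s:{0..r}|lborel. s * (LINT t|circm. jacn n (pol s t)))"
  by (subst integral_radR(2)) auto
 also have "... = (LINT s:{0..r}|lborel. circ_int (%t. s * jacn n (pol s t)))"
  by (simp add: integral_circm(2)[OF ct])
 also have "... = integral {0..r} (%s. circ_int (%t. s * jacn n (pol s t)))"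
 proof (rule set_borel_integral_eq_integral(2))
  have "contU (%s. integral (cbox 0 (2*pi)) (%t. s * jacn n (pol s t)))"
  proof (rule integral_continuous_on_param)
  have "continuous_on (UNIV \<times> cbox 0 (2*pi)) (%x. jacn n (pol (fst x) (snd x)))"
  by (rule cont_comp[OF cj continuous_on_pol subset_UNIV]) (auto intro!: continuous_intros)
  thus "continuous_on (UNIV \<times> cbox 0 (2*pi)) (%(s, t). s * jacn n (pol s t))"
  by (auto simp: split_beta intro!: cont_mult cont_fst cont_id)
  qed
  hence "continuous_on {0..r} (%s. circ_int (%t. s * jacn n (pol s t)))"
  using cont_subset[OF _ subset_UNIV] by simp
  thus "set_integrable lborel {0..r} (%s. circ_int (%t. s * jacn n (pol s t)))"
  by (rule borel_integrable_atLeastAtMost')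
 qed
 also have "... = integral {0..r} (%s. circ_int (%t. rad_comp (A1n n) (A2n n) s t * ang_comp (B1n n) (B2n n) s t - rad_comp (B1n n) (B2n n) s t * ang_comp (A1n n) (A2n n) s t))"
 proof (intro integral_cong)
  fix s t :: real
  have cs: "cos t * cos t + sin t * sin t = 1" using sin_cos_squared_add2[of t] by (simp add: sq_eq)
  have "(c * p1 + d * p2) * (s * (c * q2 - d * q1)) - (c * q1 + d * q2) * (s * (c * p2 - d * p1)) = s * (p1 * q2 - p2 * q1) * (c * c + d * d)" for c d p1 p2 q1 q2 :: real
  by (simp add: algebra_simps)
  thus "s * jacn n (pol s t) = rad_comp (A1n n) (A2n n) s t * ang_comp (B1n n) (B2n n) s t - rad_comp (B1n n) (B2n n) s t * ang_comp (A1n n) (A2n n) s t"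
  unfolding rad_comp_def ang_comp_def jacn_def by (simp only: cs mult_1_right)
 qed
 finally show ?thesis .
qed

text \<open>For mollified maps \<open>area_formula\<close> identifies the disc integral of the
  Jacobian with the line integral in the deficit of a curve.\<close>

lemma defin_eq_deficit:
 assumes r: "0 <= r"
 shows "defin n r = circle_curve.deficit (%t. An n (pol r t)) (ang_comp (A1n n) (A2n n) r) (%t. Bn n (pol r t)) (ang_comp (B1n n) (B2n n) r)"
proof -
 note c = cont_polar(2)[OF C1A cont_const cont_id] cont_polar(2)[OF C1B cont_const cont_id]
 have "tang2n n r = circ_int (%t. (ang_comp (A1n n) (A2n n) r t)^2 + (ang_comp (B1n n) (B2n n) r t)^2)"
  unfolding tang2n_def by (intro integral_circm(2) cont_add continuous_on_power c)
 moreover have "2 * arean n r = circ_int (%t. An n (pol r t) * ang_comp (B1n n) (B2n n) r t - Bn n (pol r t) * ang_comp (A1n n) (A2n n) r t)"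
  unfolding arean_polar[OF r] by (rule area_formula[OF C1A C1B r, symmetric])
 ultimately show ?thesis unfolding defin_def circle_curve.deficit_def[OF circle_curve_mollified] by simp
qed

text \<open>Inherited from the mollified maps: L1 convergence gives a subsequence converging at
  almost every radius, and the sign survives.\<close>

theorem defi_nonneg: "AE r in radm. 0 <= defi r"
proof (rule AE_radm_radR)
 fix m :: nat
 obtain sg :: "nat => nat" where s: "strict_mono sg" "AE r in radR (real m). (%n. defin (sg n) r) \<longlonglongrightarrow> defi r"
  using L1conv_AE_subseq[OF L1_defi] by blast
 have "AE r in radR (real m). 0 < r" unfolding AE_radR_iff by simp
 with s(2) show "AE r in radR (real m). 0 <= defi r"
 proof eventually_elim
  fix r assume l: "(%n. defin (sg n) r) \<longlonglongrightarrow> defi r" and r: "0 < r"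
  show "0 <= defi r"
  by (rule LIMSEQ_le_const[OF l]) (use defin_eq_deficit[of r] circle_curve.deficit_nonneg[OF circle_curve_mollified] r in auto)
 qed
qed

end

section \<open>Circles of deficit zero\<close>

definition cmean :: "(real => real) => real" where
 "cmean f = (LINT t|circm. f t) / (2*pi)"

lemma circ_mean_eq_cmean: "contU f ==> circ_mean f = cmean f"
 by (simp add: circ_mean_def cmean_def integral_circm)

lemma L1conv_cmean:
 assumes "L1conv (polR R) (%n z. f n (fst z) (snd z)) (%z. F (fst z) (snd z))"
 shows "L1conv (radR R) (%n r. cmean (f n r)) (%r. cmean (F r))"
  "L1conv (polR R) (%n z. cmean (f n (fst z))) (%z. cmean (F (fst z)))"
proof -
 have "L1conv (radR R) (%n r. LINT t|circm. f n r t) (%r. LINT t|circm. F r t)"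
  using polR.L1conv_fst[OF assms] by simp
 from L1conv_cmult[OF this, of "1 / (2*pi)"] show c: "L1conv (radR R) (%n r. cmean (f n r)) (%r. cmean (F r))"
  by (simp add: cmean_def)
 show "L1conv (polR R) (%n z. cmean (f n (fst z))) (%z. cmean (F (fst z)))"
  using L1conv_lift_fst[OF radR.sigma_finite_measure_axioms finite_circm c] .
qed

text \<open>The bounds on single circles integrate to an L2 bound on the disc that tends to 0, so
  the L1 limit \<open>V\<close> must be 0.\<close>

lemma L1conv_zero_of_circle_bound:
 fixes U :: "nat => real => real => real"
 assumes U: "L1conv (polR R) (%n z. U n (fst z) (snd z)) (%z. V (fst z) (snd z))"
  and c: "!!n r. contU (U n r)"
  and D: "L1conv (radR R) D (%_. 0)"
  and bd: "!!n r. 0 < r ==> circ_int (%t. (U n r t)^2) <= 2 * D n r"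
 shows "AE r in radR R. AE t in circm. V r t = 0"
proof -
 interpret fm: finite_measure "radR R \<Otimes>\<^sub>M circm" by (rule finite_polR)
 have [measurable]: "(%z. U n (fst z) (snd z)) : borel_measurable (polR R)" for n
  using L1convD(1)[OF U, of n] by auto
 have nnD: "AE r in radR R. 0 <= D n r" for n
  unfolding AE_radR_iff
 proof (intro AE_I2 impI)
  fix r assume "0 < r & r <= R"
  moreover have "0 <= circ_int (%t. (U n r t)^2)"
  by (intro Henstock_Kurzweil_Integration.integral_nonneg cont_integrable continuous_on_power cont_subset[OF c]) auto
  ultimately show "0 <= D n r" using bd[of r n] by linarith
 qed
 have nb: "(nnint (polR R) (%z. ennreal ((U n (fst z) (snd z))^2))) <= ennreal (2 * (LINT r|radR R. D n r))" for n
 proof -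
  have "(nnint (polR R) (%z. ennreal ((U n (fst z) (snd z))^2))) = (nnint (radR R) (%r. nnint circm (%t. ennreal ((U n r t)^2))))"
  using circm.nn_integral_fst[of "%z. ennreal ((U n (fst z) (snd z))^2)" "radR R"] by simp
  also have "... <= (nnint (radR R) (%r. ennreal (2 * D n r)))"
  proof (rule nn_integral_mono_AE)
  have "AE r in radR R. 0 < r" unfolding AE_radR_iff by simp
  thus "AE r in radR R. (nnint circm (%t. ennreal ((U n r t)^2))) <= ennreal (2 * D n r)"
  proof eventually_elim
  fix r :: real assume r: "0 < r"
  have "(nnint circm (%t. ennreal ((U n r t)^2))) = ennreal (LINT t|circm. (U n r t)^2)"
  by (intro nn_integral_eq_integral integral_circm continuous_on_power c) auto
  also have "(LINT t|circm. (U n r t)^2) = circ_int (%t. (U n r t)^2)"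
  by (intro integral_circm continuous_on_power c)
  finally show "(nnint circm (%t. ennreal ((U n r t)^2))) <= ennreal (2 * D n r)" using bd[OF r] by (simp add: ennreal_leI)
  qed
  qed
  also have "... = ennreal (LINT r|radR R. 2 * D n r)"
  by (rule nn_integral_eq_integral) (use L1convD(1)[OF D] nnD[of n] in \<open>auto elim: eventually_mono\<close>)
  finally show ?thesis by simp
 qed
 have i: "integrable (polR R) (%z. (U n (fst z) (snd z))^2)" for n
  by (rule integrableI_nonneg) (use nb[of n] in \<open>auto intro: le_less_trans\<close>)
 have Dpos: "0 <= (LINT r|radR R. D n r)" for n by (intro integral_nonneg_AE nnD)
 have le: "(LINT z|(polR R). (U n (fst z) (snd z))^2) <= 2 * (LINT r|radR R. D n r)" for n
 proof -
  have "ennreal (LINT z|(polR R). (U n (fst z) (snd z))^2) = (nnint (polR R) (%z. ennreal ((U n (fst z) (snd z))^2)))"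
  by (intro nn_integral_eq_integral[symmetric] i) auto
  also note nb[of n]
  finally show ?thesis using Dpos[of n] by (subst (asm) ennreal_le_iff) auto
 qed
 have "(%n. 2 * (LINT r|radR R. D n r)) \<longlonglongrightarrow> 0"
  using tendsto_mult_right_zero[OF L1conv_integral[OF D, simplified]] .
 hence "(%n. LINT z|(polR R). (U n (fst z) (snd z))^2) \<longlonglongrightarrow> 0"
  by (rule tendsto_sandwich[OF _ _ tendsto_const, rotated 2]) (auto intro!: always_eventually le)
 hence "L1conv (polR R) (%n z. U n (fst z) (snd z)) (%_. 0)"
  by (intro fm.L1conv_zero_square i) auto
 from L1conv_unique[OF U this] have "AE z in radR R \<Otimes>\<^sub>M circm. V (fst z) (snd z) = 0" .
 from polR.AE_pair[OF this] show ?thesis by simp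
qed

context weak_map
begin

definition "ma r = cmean (%t. a (pol r t))"
definition "mb r = cmean (%t. b (pol r t))"
definition "cx r = cmean (%t. a (pol r t) * cos t + b (pol r t) * sin t)"
definition "cy r = cmean (%t. b (pol r t) * cos t - a (pol r t) * sin t)"

lemma L1_pol:
 assumes "loc_pow 1 u"
 shows "L1conv (polR R) (%n z. moll n u (pol (fst z) (snd z))) (%z. u (pol (fst z) (snd z)))"
 by (intro L1conv_polar L1conv_mollify assms)

lemma L1_means:
 "L1conv (radR R) (%n r. cmean (%t. An n (pol r t))) ma"
 "L1conv (radR R) (%n r. cmean (%t. Bn n (pol r t))) mb"
 "L1conv (radR R) (%n r. cmean (%t. An n (pol r t) * cos t + Bn n (pol r t) * sin t)) cx"
 "L1conv (radR R) (%n r. cmean (%t. Bn n (pol r t) * cos t - An n (pol r t) * sin t)) cy"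
 unfolding ma_def[abs_def] mb_def[abs_def] cx_def[abs_def] cy_def[abs_def]
 by (intro L1conv_cmean(1) L1conv_add L1conv_diff L1_pol la lb L1conv_cong_fst_bounded[where B=1]; simp)+

lemma L1_means_lifted:
 "L1conv (polR R) (%n z. cmean (%t. An n (pol (fst z) t))) (%z. ma (fst z))"
 "L1conv (polR R) (%n z. cmean (%t. Bn n (pol (fst z) t))) (%z. mb (fst z))"
 "L1conv (polR R) (%n z. cmean (%t. An n (pol (fst z) t) * cos t + Bn n (pol (fst z) t) * sin t)) (%z. cx (fst z))"
 "L1conv (polR R) (%n z. cmean (%t. Bn n (pol (fst z) t) * cos t - An n (pol (fst z) t) * sin t)) (%z. cy (fst z))"
 using L1conv_lift_fst[OF radR.sigma_finite_measure_axioms finite_circm L1_means(1)[of R]]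
  L1conv_lift_fst[OF radR.sigma_finite_measure_axioms finite_circm L1_means(2)[of R]]
  L1conv_lift_fst[OF radR.sigma_finite_measure_axioms finite_circm L1_means(3)[of R]]
  L1conv_lift_fst[OF radR.sigma_finite_measure_axioms finite_circm L1_means(4)[of R]] .

lemma cont_circle:
 "contU (%t. An n (pol r t))" "contU (%t. Bn n (pol r t))"
 "contU (ang_comp (A1n n) (A2n n) r)" "contU (ang_comp (B1n n) (B2n n) r)"
 "contU (rad_comp (A1n n) (A2n n) r)" "contU (rad_comp (B1n n) (B2n n) r)"
 using cont_polar[OF C1A cont_const cont_id, of UNIV n r]
  cont_polar[OF C1B cont_const cont_id, of UNIV n r] by simp_all

text \<open>For the mollified curves \<open>U1\<close>, \<open>U2\<close>, \<open>e1\<close> and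
  \<open>e2\<close> are controlled by the deficits, which tend to 0 in L1. The same expressions
  converge in L1 to their counterparts for the limit map, so these counterparts vanish.\<close>

theorem defi_zero_imp:
 assumes z: "AE r in radm. defi r = 0"
 shows "AE r in radm. AE t in circm. a (pol r t) = ma r + (cx r * cos t - cy r * sin t) &
  b (pol r t) = mb r + (cx r * sin t + cy r * cos t) &
  Ta r t = - (b (pol r t) - mb r) & Tb r t = a (pol r t) - ma r"
proof (rule AE_radm_radR)
 fix m :: nat
 let ?R = "real m"
 have D: "L1conv (radR ?R) defin (%_. 0)"
 proof -
  have "AE r in radR ?R. defi r = 0" by (rule AE_radm_imp_radR[OF z])
  hence e: "AE r in radR ?R. \<bar>defin n r - 0\<bar> = \<bar>defin n r - defi r\<bar>" for n by eventually_elim simp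
  have [measurable]: "defi : borel_measurable (radR ?R)" "defin n : borel_measurable (radR ?R)" for n
  using L1convD(1)[OF L1_defi] L1convD(2)[OF L1_defi] by auto
  have "(LINT r|radR ?R. \<bar>defin n r - 0\<bar>) = (LINT r|radR ?R. \<bar>defin n r - defi r\<bar>)" for n
  by (intro integral_cong_AE e) auto
  thus ?thesis using L1convD[OF L1_defi] by (simp add: L1conv_def)
 qed
 note cc = circle_curve_mollified
 define MA where "MA n r = cmean (%t. An n (pol r t))" for n r
 define MB where "MB n r = cmean (%t. Bn n (pol r t))" for n r
 define CX where "CX n r = cmean (%t. An n (pol r t) * cos t + Bn n (pol r t) * sin t)" for n r
 define CY where "CY n r = cmean (%t. Bn n (pol r t) * cos t - An n (pol r t) * sin t)" for n r
 have means: "circ_mean (%t. An n (pol r t)) = MA n r" "circ_mean (%t. Bn n (pol r t)) = MB n r"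
  "circ_mean (%t. An n (pol r t) * cos t + Bn n (pol r t) * sin t) = CX n r"
  "circ_mean (%t. Bn n (pol r t) * cos t - An n (pol r t) * sin t) = CY n r" for n r
  unfolding MA_def MB_def CX_def CY_def
  by (intro circ_mean_eq_cmean cont_add cont_diff cont_mult cont_circle continuous_on_cos continuous_on_sin cont_id)+
 define U1 where "U1 n r t = An n (pol r t) - MA n r - (CX n r * cos t - CY n r * sin t)" for n r t
 define U2 where "U2 n r t = Bn n (pol r t) - MB n r - (CX n r * sin t + CY n r * cos t)" for n r t
 define E1 where "E1 n r t = ang_comp (A1n n) (A2n n) r t + (Bn n (pol r t) - MB n r)" for n r t
 define E2 where "E2 n r t = ang_comp (B1n n) (B2n n) r t - (An n (pol r t) - MA n r)" for n r t
 have cU: "contU (U1 n r)" "contU (U2 n r)" "contU (E1 n r)" "contU (E2 n r)" for n r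
  unfolding U1_def[abs_def] U2_def[abs_def] E1_def[abs_def] E2_def[abs_def]
  by (intro cont_add cont_diff cont_mult cont_circle continuous_on_cos continuous_on_sin cont_id cont_const)+
 have split: "circ_int (%t. (f t)^2) <= d & circ_int (%t. (g t)^2) <= d"
  if c: "contU f" "contU g" and i: "circ_int (%t. (f t)^2 + (g t)^2) <= d" for f g :: "real => real" and d
 proof -
  have ii: "(%t. (f t)^2) integrable_on {0..2*pi}" "(%t. (g t)^2) integrable_on {0..2*pi}"
  by (intro cont_integrable continuous_on_power cont_subset[OF c(1)] cont_subset[OF c(2)]; simp)+
  have "0 <= circ_int (%t. (f t)^2)" "0 <= circ_int (%t. (g t)^2)"
  by (intro Henstock_Kurzweil_Integration.integral_nonneg ii; simp)+
  thus ?thesis using i HK_add[OF ii] by linarith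
 qed
 have bU: "circ_int (%t. (U1 n r t)^2 + (U2 n r t)^2) <= 2 * defin n r" if "0 < r" for n r
  using circle_curve.deficit_bound_U[OF cc, of n r] defin_eq_deficit[of r n] that
  unfolding circle_curve.U1_def[OF cc] circle_curve.U2_def[OF cc] circle_curve.circ_mean_XY[OF cc] means U1_def U2_def by simp
 have bE: "circ_int (%t. (E1 n r t)^2 + (E2 n r t)^2) <= 2 * defin n r" if "0 < r" for n r
  using circle_curve.deficit_bound_e[OF cc, of n r] defin_eq_deficit[of r n] that
  unfolding circle_curve.e1_def[OF cc] circle_curve.e2_def[OF cc] means E1_def E2_def by simp
 note lifted = L1_means_lifted[of ?R, folded MA_def MB_def CX_def CY_def]
 have cs: "L1conv (polR ?R) f F ==> L1conv (polR ?R) (%n z. f n z * cos (snd z)) (%z. F z * cos (snd z))"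
  "L1conv (polR ?R) f F ==> L1conv (polR ?R) (%n z. f n z * sin (snd z)) (%z. F z * sin (snd z))" for f F
  by (rule L1conv_cong_fst_bounded[where B=1]; simp)+
 have V1: "AE r in radR ?R. AE t in circm. a (pol r t) - ma r - (cx r * cos t - cy r * sin t) = 0"
 proof (rule L1conv_zero_of_circle_bound[where U=U1, OF _ cU(1) D])
  show "L1conv (polR ?R) (%n z. U1 n (fst z) (snd z)) (%z. a (pol (fst z) (snd z)) - ma (fst z) - (cx (fst z) * cos (snd z) - cy (fst z) * sin (snd z)))"
  unfolding U1_def by (intro L1conv_diff cs lifted L1_pol la)
 qed (rule conjunct1[OF split[OF cU(1,2) bU]])
 have V2: "AE r in radR ?R. AE t in circm. b (pol r t) - mb r - (cx r * sin t + cy r * cos t) = 0"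
 proof (rule L1conv_zero_of_circle_bound[where U=U2, OF _ cU(2) D])
  show "L1conv (polR ?R) (%n z. U2 n (fst z) (snd z)) (%z. b (pol (fst z) (snd z)) - mb (fst z) - (cx (fst z) * sin (snd z) + cy (fst z) * cos (snd z)))"
  unfolding U2_def by (intro L1conv_diff L1conv_add cs lifted L1_pol lb)
 qed (rule conjunct2[OF split[OF cU(1,2) bU]])
 have V3: "AE r in radR ?R. AE t in circm. Ta r t + (b (pol r t) - mb r) = 0"
 proof (rule L1conv_zero_of_circle_bound[where U=E1, OF _ cU(3) D])
  show "L1conv (polR ?R) (%n z. E1 n (fst z) (snd z)) (%z. Ta (fst z) (snd z) + (b (pol (fst z) (snd z)) - mb (fst z)))"
  unfolding E1_def Ta_def by (intro L1conv_diff L1conv_add lifted L1_pol lb L1_ang l1)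
 qed (rule conjunct1[OF split[OF cU(3,4) bE]])
 have V4: "AE r in radR ?R. AE t in circm. Tb r t - (a (pol r t) - ma r) = 0"
 proof (rule L1conv_zero_of_circle_bound[where U=E2, OF _ cU(4) D])
  show "L1conv (polR ?R) (%n z. E2 n (fst z) (snd z)) (%z. Tb (fst z) (snd z) - (a (pol (fst z) (snd z)) - ma (fst z)))"
  unfolding E2_def Tb_def by (intro L1conv_diff lifted L1_pol la L1_ang l1)
 qed (rule conjunct2[OF split[OF cU(3,4) bE]])
 show "AE r in radR ?R. AE t in circm. a (pol r t) = ma r + (cx r * cos t - cy r * sin t) &
  b (pol r t) = mb r + (cx r * sin t + cy r * cos t) &
  Ta r t = - (b (pol r t) - mb r) & Tb r t = a (pol r t) - ma r"
  using V1 V2 V3 V4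
 proof eventually_elim
  fix r
  assume "AE t in circm. a (pol r t) - ma r - (cx r * cos t - cy r * sin t) = 0"
  "AE t in circm. b (pol r t) - mb r - (cx r * sin t + cy r * cos t) = 0"
  "AE t in circm. Ta r t + (b (pol r t) - mb r) = 0" "AE t in circm. Tb r t - (a (pol r t) - ma r) = 0"
  thus "AE t in circm. a (pol r t) = ma r + (cx r * cos t - cy r * sin t) &
  b (pol r t) = mb r + (cx r * sin t + cy r * cos t) &
  Ta r t = - (b (pol r t) - mb r) & Tb r t = a (pol r t) - ma r"
  by eventually_elim auto
 qed
qed

text \<open>The fundamental theorem of calculus along each ray, averaged over the angle after
  exchanging the order of integration.\<close>

lemma cmean_increment:
 assumes w: "C1_grad w w1 w2" and k: "contU k" and rs: "r <= s"
 shows "cmean (%t. w (pol s t) * k t) - cmean (%t. w (pol r t) * k t) = integral {r..s} (%q. cmean (%t. rad_comp w1 w2 q t * k t))"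
proof -
 have cw: "contU (%t. w (pol q t) * k t)" "contU (%t. rad_comp w1 w2 q t * k t)" for q
  by (intro cont_mult k cont_polar[OF w] cont_const cont_id)+
 have i: "(%t. w (pol q t) * k t) integrable_on {0..2*pi}" for q
  by (rule cont_integrable[OF cont_subset[OF cw(1) subset_UNIV]])
 have "circ_int (%t. w (pol s t) * k t) - circ_int (%t. w (pol r t) * k t)
  = circ_int (%t. w (pol s t) * k t - w (pol r t) * k t)"
  by (rule Henstock_Kurzweil_Integration.integral_diff[symmetric, OF i i])
 also have "... = circ_int (%t. integral {r..s} (%q. rad_comp w1 w2 q t * k t))"
 proof (intro integral_cong)
  fix t :: real
  have "((%q. rad_comp w1 w2 q t * k t) has_integral (w (pol s t) * k t - w (pol r t) * k t)) {r..s}"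
  by (intro FTC rs)
  (auto simp: real_vec_deriv[symmetric] intro!: deriv_within DERIV_cmult_right C1_grad_radius[OF w])
  thus "w (pol s t) * k t - w (pol r t) * k t = integral {r..s} (%q. rad_comp w1 w2 q t * k t)" by (rule integral_unique[symmetric])
 qed
 also have "... = integral {r..s} (%q. circ_int (%t. rad_comp w1 w2 q t * k t))"
 proof -
  have "continuous_on (cbox (0, r) (2*pi, s)) (%x. rad_comp w1 w2 (snd x) (fst x) * k (fst x))"
  by (intro cont_mult cont_polar[OF w] cont_comp[OF k] cont_fst cont_snd cont_id) auto
  hence "continuous_on (cbox (0, r) (2*pi, s)) (%(t, q). rad_comp w1 w2 q t * k t)" by (simp add: split_beta)
  from integral_swap_continuous[OF this] show ?thesis by simp
 qed
 also have "... = integral {r..s} (%q. 2*pi * cmean (%t. rad_comp w1 w2 q t * k t))"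
  by (simp add: cmean_def integral_circm(2)[OF cw(2)])
 also have "... = 2*pi * integral {r..s} (%q. cmean (%t. rad_comp w1 w2 q t * k t))" by (rule integral_mult_right)
 finally have "(circ_int (%t. w (pol s t) * k t) - circ_int (%t. w (pol r t) * k t)) / (2*pi) = integral {r..s} (%q. cmean (%t. rad_comp w1 w2 q t * k t))"
  by simp
 thus ?thesis by (simp only: cmean_def integral_circm(2)[OF cw(1)] diff_divide_distrib)
qed

text \<open>For a mollified map the mean over circles has the mean radial derivative as its
  derivative in \<open>r\<close>. Both converge in L1, and \<open>indef_integral_limit\<close>
  supplies the representative; the weight \<open>r\<close> of polar coordinates confines this to
  intervals away from 0.\<close>

lemma means_indef_integral:
 assumes ab: "0 < al" "al <= be"
 shows "\<exists>C. AC_on al be C (%r. cmean (Na r)) & (AE r in lborel. al <= r & r <= be --> C r = ma r)"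
  "\<exists>C. AC_on al be C (%r. cmean (Nb r)) & (AE r in lborel. al <= r & r <= be --> C r = mb r)"
  "\<exists>C. AC_on al be C (%r. cmean (%t. Na r t * cos t + Nb r t * sin t)) & (AE r in lborel. al <= r & r <= be --> C r = cx r)"
  "\<exists>C. AC_on al be C (%r. cmean (%t. Nb r t * cos t - Na r t * sin t)) & (AE r in lborel. al <= r & r <= be --> C r = cy r)"
proof -
 have cs: "L1conv (polR R) f F ==> L1conv (polR R) (%n z. f n z * cos (snd z)) (%z. F z * cos (snd z))"
  "L1conv (polR R) f F ==> L1conv (polR R) (%n z. f n z * sin (snd z)) (%z. F z * sin (snd z))" for f F R
  by (rule L1conv_cong_fst_bounded[where B=1]; simp)+
 have cN: "L1conv (radR be) (%n r. cmean (rad_comp (A1n n) (A2n n) r)) (%r. cmean (Na r))"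
  "L1conv (radR be) (%n r. cmean (rad_comp (B1n n) (B2n n) r)) (%r. cmean (Nb r))"
  "L1conv (radR be) (%n r. cmean (%t. rad_comp (A1n n) (A2n n) r t * cos t + rad_comp (B1n n) (B2n n) r t * sin t)) (%r. cmean (%t. Na r t * cos t + Nb r t * sin t))"
  "L1conv (radR be) (%n r. cmean (%t. rad_comp (B1n n) (B2n n) r t * cos t - rad_comp (A1n n) (A2n n) r t * sin t)) (%r. cmean (%t. Nb r t * cos t - Na r t * sin t))"
  unfolding Na_def[abs_def] Nb_def[abs_def]
  by (intro L1conv_cmean(1) L1conv_add L1conv_diff cs L1_rad l1)+
 have lin: "cmean (%t. f t + g t) = cmean f + cmean g" "cmean (%t. f t - g t) = cmean f - cmean g"
  if "contU f" "contU g" for f g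
  using integral_circm(1)[OF that(1)] integral_circm(1)[OF that(2)]
  by (simp_all add: cmean_def add_divide_distrib diff_divide_distrib)
 have hint: "(%q. cmean (%t. rad_comp w1 w2 q t * k t)) integrable_on {r..s}" if w: "C1_grad w w1 w2" and k: "contU k" for w w1 w2 k r s
 proof -
  have cw: "contU (%t. rad_comp w1 w2 q t * k t)" for q
  by (intro cont_mult k cont_polar[OF w] cont_const cont_id)
  have "contU (%q. integral (cbox 0 (2*pi)) (%t. rad_comp w1 w2 q t * k t))"
  proof (rule integral_continuous_on_param)
  have "continuous_on (UNIV \<times> cbox 0 (2*pi)) (%x. rad_comp w1 w2 (fst x) (snd x) * k (snd x))"
  by (intro cont_mult cont_polar[OF w] cont_comp[OF k] cont_fst cont_snd cont_id) auto
  thus "continuous_on (UNIV \<times> cbox 0 (2*pi)) (%(q, t). rad_comp w1 w2 q t * k t)" by (simp add: split_beta)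
  qed
  hence "contU (%q. circ_int (%t. rad_comp w1 w2 q t * k t) / (2*pi))"
  by (intro continuous_on_divide cont_const) auto
  hence "contU (%q. cmean (%t. rad_comp w1 w2 q t * k t))" by (simp add: cmean_def integral_circm(2)[OF cw])
  thus ?thesis by (rule cont_integrable[OF cont_subset[OF _ subset_UNIV]])
 qed
 have k: "contU (cos :: real => real)" "contU (sin :: real => real)" "contU (%_::real. 1::real)"
  by (intro continuous_on_cos continuous_on_sin cont_id cont_const)+
 have cont2: "contU (%t. w (pol r t) * k t)" "contU (%t. rad_comp w1 w2 r t * k t)"
  if "C1_grad w w1 w2" "contU k" for w w1 w2 k r
  by (intro cont_mult cont_polar[OF that(1)] that(2) cont_const cont_id)+
 have eA: "cmean (%t. An n (pol s t)) - cmean (%t. An n (pol r t)) = integral {r..s} (%q. cmean (rad_comp (A1n n) (A2n n) q))"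
  "cmean (%t. Bn n (pol s t)) - cmean (%t. Bn n (pol r t)) = integral {r..s} (%q. cmean (rad_comp (B1n n) (B2n n) q))" if "r <= s" for n r s
  using cmean_increment[OF C1A k(3) that, of n] cmean_increment[OF C1B k(3) that, of n] by simp_all
 have eX: "cmean (%t. An n (pol s t) * cos t + Bn n (pol s t) * sin t) - cmean (%t. An n (pol r t) * cos t + Bn n (pol r t) * sin t)
  = integral {r..s} (%q. cmean (%t. rad_comp (A1n n) (A2n n) q t * cos t + rad_comp (B1n n) (B2n n) q t * sin t))"
  "cmean (%t. Bn n (pol s t) * cos t - An n (pol s t) * sin t) - cmean (%t. Bn n (pol r t) * cos t - An n (pol r t) * sin t)
  = integral {r..s} (%q. cmean (%t. rad_comp (B1n n) (B2n n) q t * cos t - rad_comp (A1n n) (A2n n) q t * sin t))" if "r <= s" for n r s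
  unfolding lin[OF cont2(1)[OF C1A k(1)] cont2(1)[OF C1B k(2)]] lin[OF cont2(2)[OF C1A k(1)] cont2(2)[OF C1B k(2)]]
  lin[OF cont2(1)[OF C1B k(1)] cont2(1)[OF C1A k(2)]] lin[OF cont2(2)[OF C1B k(1)] cont2(2)[OF C1A k(2)]]
  HK_add[OF hint[OF C1A k(1)] hint[OF C1B k(2)]]
  Henstock_Kurzweil_Integration.integral_diff[OF hint[OF C1B k(1)] hint[OF C1A k(2)]]
  using cmean_increment[OF C1A k(1) that, of n] cmean_increment[OF C1B k(1) that, of n]
  cmean_increment[OF C1A k(2) that, of n] cmean_increment[OF C1B k(2) that, of n] by linarith+
 have fin: "\<exists>C. AC_on al be C h & (AE r in lborel. al <= r & r <= be --> C r = c r)"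
  if f1: "L1conv (radR be) cn c" and f2: "L1conv (radR be) hn h" and f3: "!!n r s. r <= s ==> cn n s - cn n r = integral {r..s} (hn n)"
  for cn hn :: "nat => real => real" and c h
 proof -
  obtain C where "AC_on al be C h" "AE r in lborel. al <= r & r <= be --> C r = c r"
  using indef_integral_limit[OF f1 f2 f3 ab order_refl] by blast
  thus ?thesis by (intro exI[of _ C] conjI)
 qed
 show "\<exists>C. AC_on al be C (%r. cmean (Na r)) & (AE r in lborel. al <= r & r <= be --> C r = ma r)"
  by (rule fin[OF L1_means(1) cN(1)]) (rule eA(1))
 show "\<exists>C. AC_on al be C (%r. cmean (Nb r)) & (AE r in lborel. al <= r & r <= be --> C r = mb r)"
  by (rule fin[OF L1_means(2) cN(2)]) (rule eA(2))
 show "\<exists>C. AC_on al be C (%r. cmean (%t. Na r t * cos t + Nb r t * sin t)) & (AE r in lborel. al <= r & r <= be --> C r = cx r)"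
  by (rule fin[OF L1_means(3) cN(3)]) (rule eX(1))
 show "\<exists>C. AC_on al be C (%r. cmean (%t. Nb r t * cos t - Na r t * sin t)) & (AE r in lborel. al <= r & r <= be --> C r = cy r)"
  by (rule fin[OF L1_means(4) cN(4)]) (rule eX(2))
qed

end

section \<open>Almost everywhere identities on the half-line\<close>

lemma AC_on_cong_AE:
 assumes F: "AC_on a b F h" and e: "AE t in lborel. a <= t & t <= b --> h t = k t"
 shows "AC_on a b F k"
proof -
 have "AE t in lebesgue. t : {a..b} --> h t = k t" using AE_completion[OF e] by simp
 then obtain N where N: "N : null_sets lebesgue" "{t. \<not> (t : {a..b} --> h t = k t)} \<subseteq> N"
  by (auto elim!: AE_E3 simp: eventually_ae_filter)
 have neg: "negligible N" using N(1) by (simp add: negligible_iff_null_sets)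
 have e': "k t = h t" if "a <= x" "y <= b" "t : {x..y} - N" for x y t
 proof (rule ccontr)
  assume "k t ~= h t"
  hence "t : N" using that by (intro subsetD[OF N(2)]) auto
  thus False using that by simp
 qed
 have "k absolutely_integrable_on {a..b}"
  by (rule absolutely_integrable_spike[OF AC_on_abs_integrable[OF F order_refl order_refl] neg]) (rule e'[OF order_refl order_refl])
 moreover have "integral {x..y} h = integral {x..y} k" if "a <= x" "y <= b" for x y
  by (rule integral_spike[OF neg]) (rule e'[OF that])
 ultimately show ?thesis using AC_onD[OF F] unfolding AC_on_def by auto
qed

lemma AC_on_zero_const:
 assumes F: "AC_on a b F h" and e: "AE t in lborel. a <= t & t <= b --> h t = 0" and t: "a <= t" "t <= b"
 shows "F t = F a"
 using AC_onD[OF AC_on_cong_AE[OF F, of "%_. 0"] order_refl t] e by simp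

lemma AE_lborel_intervalE:
 fixes al be :: real
 assumes "AE r in lborel. al <= r & r <= be --> P r" "al < be"
 obtains r where "al <= r" "r <= be" "P r"
proof -
 have "\<not> (AE r in lborel. \<not> (al <= r & r <= be))"
 proof
  assume "AE r in lborel. \<not> (al <= r & r <= be)"
  hence "emeasure lborel {al..be} = 0" by (subst (asm) AE_iff_measurable[where N="{al..be}"]) auto
  thus False using assms(2) by simp
 qed
 moreover have "AE r in lborel. \<not> (al <= r & r <= be)" if "\<not> (\<exists>r. al <= r & r <= be & P r)"
  using assms(1) by eventually_elim (use that in auto)
 ultimately show ?thesis using that by blast
qed

text \<open>The intervals from \<open>1 / (n + 2)\<close> to \<open>n + 2\<close> all contain
  \<open>[1, 2]\<close>, so their constants coincide, and together they exhaust the positive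
  half-line.\<close>

lemma AE_const_glue:
 fixes f :: "real => real"
 assumes "!!al be. 0 < al ==> al <= be ==> \<exists>ka. AE r in lborel. al <= r & r <= be --> f r = ka"
 shows "\<exists>ka. AE r in radm. f r = ka"
proof -
 obtain ka where k: "AE r in lborel. 1 <= r & r <= 2 --> f r = ka" using assms[of 1 2] by auto
 have "AE r in lborel. 1 / real (n + 2) <= r & r <= real (n + 2) --> f r = ka" for n
 proof -
  have le1: "1 / real (n + 2) <= 1" by simp
  have "\<exists>ka. AE r in lborel. 1 / real (n + 2) <= r & r <= real (n + 2) --> f r = ka"
  by (rule assms) (simp, rule order_trans[OF le1], simp)
  then obtain ka' where k': "AE r in lborel. 1 / real (n + 2) <= r & r <= real (n + 2) --> f r = ka'" by blast
  have "AE r in lborel. 1 <= r & r <= 2 --> f r = ka & f r = ka'"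
  using k k'
  proof eventually_elim
  fix r assume a: "1 <= r & r <= 2 --> f r = ka" "1 / real (n + 2) <= r & r <= real (n + 2) --> f r = ka'"
  show "1 <= r & r <= 2 --> f r = ka & f r = ka'"
  proof
  assume r: "1 <= r & r <= 2"
  hence "1 / real (n + 2) <= r" "r <= real (n + 2)" using le1 by linarith+
  thus "f r = ka & f r = ka'" using a r by blast
  qed
  qed
  then obtain r where "f r = ka & f r = ka'" by (rule AE_lborel_intervalE) auto
  hence "ka' = ka" by simp
  thus ?thesis using k' by (simp only:)
 qed
 hence "AE r in lborel. \<forall>n. 1 / real (n + 2) <= r & r <= real (n + 2) --> f r = ka" unfolding AE_all_countable by blast
 hence "AE r in radm. f r = ka" unfolding AE_radm_iff
 proof eventually_elim
  fix r :: real assume a: "\<forall>n. 1 / real (n + 2) <= r & r <= real (n + 2) --> f r = ka"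
  show "0 < r --> f r = ka"
  proof
  assume r: "0 < r"
  obtain n where n: "max r (1/r) <= real n" using real_arch_simple by blast
  have "1 / r <= real (n + 2)" "r <= real (n + 2)" using n by linarith+
  moreover from this(1) have "1 / real (n + 2) <= r" using r by (simp add: field_simps)
  ultimately show "f r = ka" using a by blast
  qed
 qed
 thus ?thesis by blast
qed

lemma measure_circm: "measure circm UNIV = 2 * pi"
 using emeasure_circm by (simp add: measure_def)

lemma cmean_const [simp]: "cmean (%_. c) = c"
 by (simp add: cmean_def measure_circm)

lemma cmean_trig: "cmean (%t. x * cos t - y * sin t) = 0" "cmean (%t. x * sin t + y * cos t) = 0"
proof -
 have hc: "(cos has_integral 0) {0..2*pi}" "(sin has_integral 0) {0..2*pi}"
 proof -
  have "(cos has_integral (sin (2*pi) - sin 0)) {0..2*pi}"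
  by (intro FTC) (auto simp: real_vec_deriv[symmetric] intro!: derivative_eq_intros)
  thus "(cos has_integral 0) {0..2*pi}" by simp
  have "(sin has_integral (- cos (2*pi) - (- cos 0))) {0..2*pi}"
  by (intro FTC) (auto simp: real_vec_deriv[symmetric] intro!: derivative_eq_intros)
  thus "(sin has_integral 0) {0..2*pi}" by simp
 qed
 have c: "contU (%t. x * cos t - y * sin t)" "contU (%t. x * sin t + y * cos t)"
  by (intro continuous_intros)+
 have "((%t. x * cos t - y * sin t) has_integral (x * 0 - y * 0)) {0..2*pi}"
  by (intro has_integral_diff has_integral_mult_right hc)
 thus "cmean (%t. x * cos t - y * sin t) = 0" using integral_circm(2)[OF c(1)] by (simp add: cmean_def integral_unique)
 have "((%t. x * sin t + y * cos t) has_integral (x * 0 + y * 0)) {0..2*pi}"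
  by (intro has_integral_add has_integral_mult_right hc)
 thus "cmean (%t. x * sin t + y * cos t) = 0" using integral_circm(2)[OF c(2)] by (simp add: cmean_def integral_unique)
qed

lemma cmean_cmult: "cmean (%t. c * f t) = c * cmean f" by (simp add: cmean_def)

lemma cmean_cong_AE:
 assumes "AE t in circm. f t = g t" "f : borel_fun" "g : borel_fun"
 shows "cmean f = cmean g"
 unfolding cmean_def using assms by (intro arg_cong2[where f="(/)"] integral_cong_AE) auto

section \<open>The profile \<open>g\<close> and its weighted primitive \<open>F\<close>\<close>

locale radial_profile =
 fixes g :: "real => real" and F :: "real => real"
 assumes gm [measurable]: "g : borel_fun"
  and F_int: "!!R. AC_on 0 R F (%s. 2 * s * g s)"
  and F_0: "F 0 = 0"
  and g_le: "AE r in radm. \<bar>g r\<bar> <= F r / r\<^sup>2"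
begin

lemma g_le': "AE r in lborel. 0 < r --> \<bar>g r\<bar> <= F r / r\<^sup>2" using g_le by (simp add: AE_radm_iff)

lemma F_cont: "continuous_on {0..} F"
proof (rule continuous_on_eq_continuous_within[THEN iffD2], rule ballI)
 fix x :: real assume x: "x : {0..}"
 have "continuous (at x within {0..x + 1}) F"
  using AC_on_continuous[OF F_int[of "x + 1"]] x by (simp add: continuous_on_eq_continuous_within)
 moreover have "at x within {0..x + 1} = at x within {0..}"
  by (rule at_within_nhd[of _ "{..<x + 1}"]) auto
 ultimately show "continuous (at x within {0..}) F" by (simp add: continuous_within)
qed

text \<open>The bound on \<open>g\<close> yields this at almost every radius, and continuity of
  \<open>F\<close> rules out exceptional ones.\<close>

lemma F_nonneg: "0 <= r ==> 0 <= F r"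
proof (rule ccontr)
 assume r: "0 <= r" and neg: "\<not> 0 <= F r"
 hence r0: "0 < r" using F_0 by (cases "r = 0") auto
 have "continuous (at r within {0..}) F" using F_cont r by (simp add: continuous_on_eq_continuous_within)
 then obtain d where d: "d > 0" "!!x. x >= 0 ==> dist x r < d ==> dist (F x) (F r) < - F r"
  using neg unfolding continuous_within_eps_delta by (auto dest!: spec[of _ "- F r"])
 have "AE x in lborel. r <= x & x <= r + d/2 --> 0 <= F x"
  using g_le'
 proof eventually_elim
  fix x assume a: "0 < x --> \<bar>g x\<bar> <= F x / x\<^sup>2"
  show "r <= x & x <= r + d/2 --> 0 <= F x"
  proof
  assume "r <= x & x <= r + d/2"
  hence "0 < x" using r0 by linarith
  hence "0 <= F x / x\<^sup>2" using a abs_ge_zero order_trans by blast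
  thus "0 <= F x" using \<open>0 < x\<close> by (simp add: zero_le_divide_iff)
  qed
 qed
 then obtain x where x: "r <= x" "x <= r + d/2" "0 <= F x" by (rule AE_lborel_intervalE) (use d in auto)
 hence "dist (F x) (F r) < - F r" using d r by (intro d(2)) (auto simp: dist_real_def)
 thus False using x by (simp add: dist_real_def)
qed

lemma F_power_indef:
 assumes "0 < al" "al <= be"
 shows "AC_on al be (%r. F r * (1 / r\<^sup>2)) (%r. 2 * r * g r * (1 / r\<^sup>2) + F r * (- 2 / r ^ 3))"
  "AC_on al be (%r. F r * r\<^sup>2) (%r. 2 * r * g r * r\<^sup>2 + F r * (2 * r))"
proof -
 have F: "AC_on al be F (%s. 2 * s * g s)" by (rule AC_on_subset[OF F_int[of be]]) (use assms in auto)
 show "AC_on al be (%r. F r * (1 / r\<^sup>2)) (%r. 2 * r * g r * (1 / r\<^sup>2) + F r * (- 2 / r ^ 3))"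
 proof (rule AC_on_mult[OF F AC_on_C1])
  show "((%r. 1 / r\<^sup>2) has_real_derivative - 2 / t ^ 3) (at t)" if "al <= t" "t <= be" for t
  using that assms by (auto intro!: derivative_eq_intros simp: field_simps sq_eq power3_eq_cube)
  show "continuous_on {al..be} (%r. - 2 / r ^ 3)" using assms by (intro continuous_intros) auto
 qed
 show "AC_on al be (%r. F r * r\<^sup>2) (%r. 2 * r * g r * r\<^sup>2 + F r * (2 * r))"
  by (rule AC_on_mult[OF F AC_on_C1]) (auto intro!: derivative_eq_intros continuous_intros)
qed

text \<open>The derivative of \<open>F / r^2\<close> is
  \<open>(2 / r) * (g - F / r^2)\<close>.\<close>

lemma F_over_square_antimono:
 assumes "0 < s" "s <= r"
 shows "F r / r\<^sup>2 <= F s / s\<^sup>2"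
proof -
 have "AC_on s r (%r. - 1 * (F r * (1 / r\<^sup>2))) (%r. - 1 * (2 * r * g r * (1 / r\<^sup>2) + F r * (- 2 / r ^ 3)))"
  by (rule AC_on_cmult[OF F_power_indef(1)[OF assms]])
 hence "- 1 * (F s * (1 / s\<^sup>2)) <= - 1 * (F r * (1 / r\<^sup>2))"
 proof (rule AC_on_nonneg_mono)
  show "AE t in lebesgue. s <= t & t <= r --> 0 <= - 1 * (2 * t * g t * (1 / t\<^sup>2) + F t * (- 2 / t ^ 3))"
  proof (rule AE_completion)
  show "AE t in lborel. s <= t & t <= r --> 0 <= - 1 * (2 * t * g t * (1 / t\<^sup>2) + F t * (- 2 / t ^ 3))"
  using g_le'
  proof eventually_elim
  fix t assume a: "0 < t --> \<bar>g t\<bar> <= F t / t\<^sup>2"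
  show "s <= t & t <= r --> 0 <= - 1 * (2 * t * g t * (1 / t\<^sup>2) + F t * (- 2 / t ^ 3))"
  proof
  assume "s <= t & t <= r"
  hence t: "0 < t" using assms by linarith
  have "0 <= (2 / t) * (F t / t\<^sup>2 - g t)" using a t by (intro mult_nonneg_nonneg) auto
  also have "... = - 1 * (2 * t * g t * (1 / t\<^sup>2) + F t * (- 2 / t ^ 3))" using t
  by (simp add: field_simps sq_eq power3_eq_cube)
  finally show "0 <= - 1 * (2 * t * g t * (1 / t\<^sup>2) + F t * (- 2 / t ^ 3))" .
  qed
  qed
  qed
 qed (use assms in auto)
 thus ?thesis by simp
qed

text \<open>The derivative of \<open>F * r^2\<close> is
  \<open>2 * r^3 * (g + F / r^2)\<close>.\<close>

lemma F_times_square_mono: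
 assumes "0 < s" "s <= r"
 shows "F s * s\<^sup>2 <= F r * r\<^sup>2"
proof (rule AC_on_nonneg_mono[OF F_power_indef(2)[OF assms]])
 show "AE t in lebesgue. s <= t & t <= r --> 0 <= 2 * t * g t * t\<^sup>2 + F t * (2 * t)"
 proof (rule AE_completion)
  show "AE t in lborel. s <= t & t <= r --> 0 <= 2 * t * g t * t\<^sup>2 + F t * (2 * t)"
  using g_le'
  proof eventually_elim
  fix t assume a: "0 < t --> \<bar>g t\<bar> <= F t / t\<^sup>2"
  show "s <= t & t <= r --> 0 <= 2 * t * g t * t\<^sup>2 + F t * (2 * t)"
  proof
  assume "s <= t & t <= r"
  hence t: "0 < t" using assms by linarith
  have "0 <= (2 * t * t\<^sup>2) * (F t / t\<^sup>2 + g t)" using a t by (intro mult_nonneg_nonneg) auto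
  also have "... = 2 * t * g t * t\<^sup>2 + F t * (2 * t)" using t by (simp add: field_simps sq_eq)
  finally show "0 <= 2 * t * g t * t\<^sup>2 + F t * (2 * t)" .
  qed
  qed
 qed
qed (use assms in auto)

text \<open>A zero of \<open>F\<close> spreads outwards because \<open>F / r^2\<close> decreases,
  and inwards because \<open>F * r^2\<close> increases. The dichotomy makes division by
  \<open>rho\<close> safe on the whole open half-line in the second case.\<close>

lemma F_zero_or_pos: "(\<forall>r\<ge>0. F r = 0) \<or> (\<forall>r>0. F r > 0)"
proof (rule disjCI)
 assume "\<not> (\<forall>r>0. F r > 0)"
 then obtain r0 where r0: "r0 > 0" "\<not> 0 < F r0" by blast
 hence r0: "r0 > 0" "F r0 = 0" using F_nonneg[of r0] by simp_all
 show "\<forall>r\<ge>0. F r = 0"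
 proof (intro allI impI)
  fix r :: real assume r: "0 <= r"
  show "F r = 0"
  proof (cases "r = 0")
  case False
  hence rp: "0 < r" using r by simp
  have "F r <= 0"
  proof (cases "r <= r0")
  case True
  have "F r * r\<^sup>2 <= 0" using F_times_square_mono[OF rp True] r0 by simp
  thus ?thesis using rp by (simp add: mult_le_0_iff)
  next
  case False
  have "F r / r\<^sup>2 <= 0" using F_over_square_antimono[of r0 r] r0 False by simp
  thus ?thesis using rp by (simp add: divide_le_0_iff)
  qed
  thus ?thesis using F_nonneg[OF r] by simp
  qed (simp add: F_0)
 qed
qed

definition "rho r = sqrt (F r)"

text \<open>\<open>sqrt\<close> is differentiable on the open half-line only, hence the positivity
  of \<open>F\<close> and the distance from 0.\<close>

lemma rho_indef:
 assumes pos: "\<forall>r>0. F r > 0" and ab: "0 < al" "al <= be"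
 shows "AC_on al be rho (%r. r * g r / rho r)"
  "AC_on al be (%r. 1 / rho r) (%r. - (r * g r / F r) * (1 / rho r))"
proof -
 have F: "AC_on al be F (%s. 2 * s * g s)" by (rule AC_on_subset[OF F_int[of be]]) (use ab in auto)
 have im: "F ` {al..be} \<subseteq> {0<..}" using pos ab by auto
 have iv: "is_interval {(0::real)<..}" by (simp add: is_interval_1)
 have "AC_on al be (%t. sqrt (F t)) (%t. (inverse (sqrt (F t)) / 2) * (2 * t * g t))"
 proof (rule AC_on_compose[OF F im iv])
  show "(sqrt has_real_derivative inverse (sqrt y) / 2) (at y within {0<..})" if "y : {0<..}" for y
  using DERIV_real_sqrt[of y] that by (simp add: deriv_within)
  show "continuous_on {0<..} (%y. inverse (sqrt y) / 2)"
  by (intro continuous_on_divide continuous_on_inverse continuous_on_real_sqrt cont_id cont_const) auto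
 qed
 thus "AC_on al be rho (%r. r * g r / rho r)"
  by (rule AC_on_cong) (auto simp: rho_def field_simps)
 have "AC_on al be (%t. inverse (sqrt (F t))) (%t. (- (inverse (sqrt (F t)) / 2) * (inverse (F t))) * (2 * t * g t))"
 proof (rule AC_on_compose[OF F im iv])
  fix y :: real assume y: "y : {0<..}"
  have d: "((%y. inverse (sqrt y)) has_real_derivative (- (inverse (sqrt y) * (inverse (sqrt y) / 2) * inverse (sqrt y)))) (at y)"
  by (rule DERIV_inverse'[OF DERIV_real_sqrt]) (use y in auto)
  have "inverse (sqrt y) * inverse (sqrt y) = inverse y" using y by (simp flip: inverse_mult_distrib)
  hence e: "- (inverse (sqrt y) * (inverse (sqrt y) / 2) * inverse (sqrt y)) = - (inverse (sqrt y) / 2) * inverse y" by (simp add: mult_ac)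
  show "((%y. inverse (sqrt y)) has_real_derivative - (inverse (sqrt y) / 2) * inverse y) (at y within {0<..})"
  by (rule deriv_within[OF DERIV_cong[OF d e]])
 next
  show "continuous_on {0<..} (%y. - (inverse (sqrt y) / 2) * inverse y)"
  by (intro cont_mult continuous_on_minus continuous_on_divide continuous_on_inverse continuous_on_real_sqrt cont_id cont_const) auto
 qed
 thus "AC_on al be (%r. 1 / rho r) (%r. - (r * g r / F r) * (1 / rho r))"
  by (rule AC_on_cong) (auto simp: rho_def field_simps)
qed

end

section \<open>Rigidity\<close>

locale weak_radial = weak_map + radial_profile +
 assumes jac_eq: "AE x in lborel. jac x = g (norm x)"
begin

lemma area_eq: "0 <= r ==> area r = pi * F r"
proof -
 assume r: "0 <= r"
 have ae: "AE x in lborelR r. jac x = g (norm x)"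
  unfolding lborelR_def using jac_eq by (subst AE_density) auto
 have i: "integrable (lborelR r) (%x. g (norm x))"
  using integrable_cong_AE[of jac "lborelR r" "%x. g (norm x)"] jac_integrable[of r] ae by auto
 have "area r = (LINT x|lborelR r. g (norm x))" unfolding area_def by (rule integral_cong_AE) (use ae in auto)
 also have "... = (LINT z|(radR r \<Otimes>\<^sub>M circm). g \<bar>fst z\<bar>)"
  unfolding distr_polR[symmetric] by (subst integral_distr) auto
 also have "... = (LINT s|radR r. LINT t|circm. g \<bar>s\<bar>)"
 proof -
  have "integrable (radR r \<Otimes>\<^sub>M circm) (%z. g \<bar>fst z\<bar>)"
  using i unfolding distr_polR[symmetric] by (subst (asm) integrable_distr_eq) auto
  from polR.integral_fst'[OF this] show ?thesis by simp
 qed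
 also have "... = (LINT s|radR r. 2 * pi * g \<bar>s\<bar>)"
  by (simp add: measure_circm)
 also have "... = (LINT s:{0..r}|lborel. pi * (2 * s * g s))"
  by (subst integral_radR(2), measurable, unfold set_lebesgue_integral_def, intro LINT_cong refl, simp split: split_indicator)
 also have "... = pi * (LINT s:{0..r}|lborel. 2 * s * g s)" by simp
 also have "(LINT s:{0..r}|lborel. 2 * s * g s) = integral {0..r} (%s. 2 * s * g s)"
 proof (rule set_borel_integral_eq_integral(2))
  have "(%s. 2 * s * g s) absolutely_integrable_on {0..r}"
  by (rule AC_on_abs_integrable[OF F_int order_refl order_refl])
  thus "set_integrable lborel {0..r} (%s. 2 * s * g s)"
  unfolding set_integrable_def by (subst (asm) integrable_completion) auto
 qed
 also have "... = F r" using AC_onD[OF F_int[of r] order_refl r order_refl] F_0 by simp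
 finally show ?thesis .
qed

lemma measurable_sections [measurable]:
 "(%t. a (pol r t)) : borel_fun" "(%t. b (pol r t)) : borel_fun"
 "Ta r : borel_fun" "Tb r : borel_fun" "Na r : borel_fun" "Nb r : borel_fun"
 unfolding Ta_def[abs_def] Tb_def[abs_def] Na_def[abs_def] Nb_def[abs_def] ang_comp_def[abs_def] rad_comp_def[abs_def] by measurable

text \<open>With zero deficit the squared angular speed is constant on the circle, and its integral
  is twice the area \<open>pi * F r\<close>.\<close>

lemma coefficient_norm:
 assumes z: "AE r in radm. defi r = 0"
 shows "AE r in radm. (cx r)^2 + (cy r)^2 = F r"
proof -
 note V = defi_zero_imp[OF z]
 have pos: "AE r in radm. 0 < r" by (simp add: AE_radm_iff)
 show "AE r in radm. (cx r)^2 + (cy r)^2 = F r"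
  using V z pos
 proof eventually_elim
  fix r assume r: "0 < r" "defi r = 0" and ae: "AE t in circm. a (pol r t) = ma r + (cx r * cos t - cy r * sin t) &
  b (pol r t) = mb r + (cx r * sin t + cy r * cos t) & Ta r t = - (b (pol r t) - mb r) & Tb r t = a (pol r t) - ma r"
  have "tang2 r = (LINT t|circm. (cx r)^2 + (cy r)^2)"
  unfolding tang2_def
  proof (rule integral_cong_AE)
  show "AE t in circm. (Ta r t)^2 + (Tb r t)^2 = (cx r)^2 + (cy r)^2"
  using ae
  proof eventually_elim
  fix t assume e: "a (pol r t) = ma r + (cx r * cos t - cy r * sin t) &
  b (pol r t) = mb r + (cx r * sin t + cy r * cos t) & Ta r t = - (b (pol r t) - mb r) & Tb r t = a (pol r t) - ma r"
  have T: "Ta r t = - (cx r * sin t + cy r * cos t)" "Tb r t = cx r * cos t - cy r * sin t" using e by simp_all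
  have "(Ta r t)^2 + (Tb r t)^2 = (cx r * sin t + cy r * cos t)^2 + (cx r * cos t - cy r * sin t)^2" unfolding T power2_minus ..
  also have "... = ((cx r)^2 + (cy r)^2) * (cos t * cos t + sin t * sin t)" by algebra
  also have "cos t * cos t + sin t * sin t = 1" using sin_cos_squared_add2[of t] by (simp add: sq_eq)
  finally show "(Ta r t)^2 + (Tb r t)^2 = (cx r)^2 + (cy r)^2" by simp
  qed
  qed auto
  also have "... = 2 * pi * ((cx r)^2 + (cy r)^2)" by (simp add: measure_circm)
  finally have "2 * pi * ((cx r)^2 + (cy r)^2) = 2 * (pi * F r)" using r area_eq[of r] by (simp add: defi_def)
  thus "(cx r)^2 + (cy r)^2 = F r" by simp
 qed
qed

text \<open>The factor \<open>r * g r / F r\<close> is the logarithmic derivative of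
  \<open>rho\<close>. Averaging the assumption on the radial derivative shows that the centre has
  derivative 0 and that \<open>cx\<close> and \<open>cy\<close> solve the linear equation that
  \<open>rho\<close> solves, so their quotients by \<open>rho\<close> are constant. That the two
  constants form a unit vector is \<open>coefficient_norm\<close>.\<close>

theorem rigidity:
 assumes z: "AE r in radm. defi r = 0"
  and N: "AE r in radm. AE t in circm. Na r t = (r * g r / F r) * (a (pol r t) - ma r) & Nb r t = (r * g r / F r) * (b (pol r t) - mb r)"
 shows "\<exists>ka \<mu> p q. ka\<^sup>2 + \<mu>\<^sup>2 = 1 & (AE r in radm. AE t in circm.
  a (pol r t) = p + rho r * (ka * cos t - \<mu> * sin t) & b (pol r t) = q + rho r * (ka * sin t + \<mu> * cos t))"
proof -
 note V = defi_zero_imp[OF z]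
 have pos: "AE r in radm. 0 < r" by (simp add: AE_radm_iff)
 note cF = coefficient_norm[OF z]
 have dN: "AE r in radm. cmean (Na r) = 0 & cmean (Nb r) = 0 &
  cmean (%t. Na r t * cos t + Nb r t * sin t) = (r * g r / F r) * cx r &
  cmean (%t. Nb r t * cos t - Na r t * sin t) = (r * g r / F r) * cy r"
  using V N
 proof eventually_elim
  fix r assume ae: "AE t in circm. a (pol r t) = ma r + (cx r * cos t - cy r * sin t) &
  b (pol r t) = mb r + (cx r * sin t + cy r * cos t) & Ta r t = - (b (pol r t) - mb r) & Tb r t = a (pol r t) - ma r"
  "AE t in circm. Na r t = (r * g r / F r) * (a (pol r t) - ma r) & Nb r t = (r * g r / F r) * (b (pol r t) - mb r)"
  define k where "k = r * g r / F r"
  have e: "AE t in circm. Na r t = k * (cx r * cos t - cy r * sin t) & Nb r t = k * (cx r * sin t + cy r * cos t)"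
  using ae unfolding k_def by eventually_elim auto
  have 1: "cmean (Na r) = cmean (%t. k * (cx r * cos t - cy r * sin t))"
  by (rule cmean_cong_AE) (use e in \<open>auto elim: eventually_mono\<close>)
  have 2: "cmean (Nb r) = cmean (%t. k * (cx r * sin t + cy r * cos t))"
  by (rule cmean_cong_AE) (use e in \<open>auto elim: eventually_mono\<close>)
  have 3: "cmean (%t. Na r t * cos t + Nb r t * sin t) = cmean (%t. k * cx r)"
  proof (rule cmean_cong_AE)
  show "AE t in circm. Na r t * cos t + Nb r t * sin t = k * cx r"
  using e
  proof eventually_elim
  fix t assume e: "Na r t = k * (cx r * cos t - cy r * sin t) & Nb r t = k * (cx r * sin t + cy r * cos t)"
  have "Na r t * cos t + Nb r t * sin t = k * cx r * (cos t * cos t + sin t * sin t)" using e by algebra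
  also have "cos t * cos t + sin t * sin t = 1" using sin_cos_squared_add2[of t] by (simp add: sq_eq)
  finally show "Na r t * cos t + Nb r t * sin t = k * cx r" by simp
  qed
  qed auto
  have 4: "cmean (%t. Nb r t * cos t - Na r t * sin t) = cmean (%t. k * cy r)"
  proof (rule cmean_cong_AE)
  show "AE t in circm. Nb r t * cos t - Na r t * sin t = k * cy r"
  using e
  proof eventually_elim
  fix t assume e: "Na r t = k * (cx r * cos t - cy r * sin t) & Nb r t = k * (cx r * sin t + cy r * cos t)"
  have "Nb r t * cos t - Na r t * sin t = k * cy r * (cos t * cos t + sin t * sin t)" using e by algebra
  also have "cos t * cos t + sin t * sin t = 1" using sin_cos_squared_add2[of t] by (simp add: sq_eq)
  finally show "Nb r t * cos t - Na r t * sin t = k * cy r" by simp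
  qed
  qed auto
  show "cmean (Na r) = 0 & cmean (Nb r) = 0 &
  cmean (%t. Na r t * cos t + Nb r t * sin t) = (r * g r / F r) * cx r &
  cmean (%t. Nb r t * cos t - Na r t * sin t) = (r * g r / F r) * cy r"
  unfolding 1 2 3 4 k_def[symmetric] cmean_cmult cmean_trig cmean_const by simp
 qed
 have loc: "AE r in lborel. al <= r & r <= be --> P r" if "AE r in radm. P r" "0 < al" for P al be
  using that(1) unfolding AE_radm_iff by eventually_elim (use that(2) in auto)
 have const: "\<exists>p. AE r in radm. m r = p"
  if ex: "!!al be. 0 < al ==> al <= be ==> \<exists>C. AC_on al be C h & (AE r in lborel. al <= r & r <= be --> C r = m r)"
  and h: "AE r in radm. h r = 0" for m h
 proof (rule AE_const_glue)
  fix al be :: real assume ab: "0 < al" "al <= be"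
  obtain C where C: "AC_on al be C h" "AE r in lborel. al <= r & r <= be --> C r = m r" using ex[OF ab] by blast
  have C0: "C t = C al" if "al <= t" "t <= be" for t by (rule AC_on_zero_const[OF C(1) loc[OF h ab(1)] that])
  have "AE r in lborel. al <= r & r <= be --> m r = C al"
  using C(2) by eventually_elim (metis C0)
  thus "\<exists>ka. AE r in lborel. al <= r & r <= be --> m r = ka" by blast
 qed
 have "AE r in radm. cmean (Na r) = 0" "AE r in radm. cmean (Nb r) = 0" using dN by (auto elim: eventually_mono)
 then obtain p q where pq: "AE r in radm. ma r = p" "AE r in radm. mb r = q"
  using const[OF means_indef_integral(1)] const[OF means_indef_integral(2)] by auto
 have "\<exists>ka \<mu>. ka\<^sup>2 + \<mu>\<^sup>2 = 1 & (AE r in radm. cx r = ka * rho r & cy r = \<mu> * rho r)"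
  using F_zero_or_pos
 proof
  \<comment> \<open>Here \<open>cx\<close>, \<open>cy\<close> and \<open>rho\<close> all vanish, and
    any unit vector serves.\<close>
  assume F0: "\<forall>r\<ge>0. F r = 0"
  have "AE r in radm. cx r = 1 * rho r & cy r = 0 * rho r"
  using cF pos by eventually_elim (use F0 in \<open>auto simp: rho_def sum_power2_eq_zero_iff\<close>)
  thus ?thesis by (intro exI[of _ 1] exI[of _ 0]) simp
 next
  assume Fp: "\<forall>r>0. F r > 0"
  have rpos: "0 < r ==> 0 < rho r" for r using Fp by (simp add: rho_def)
  have ratio: "\<exists>ka. AE r in radm. m r * (1 / rho r) = ka"
  if ex: "!!al be. 0 < al ==> al <= be ==> \<exists>C. AC_on al be C h & (AE r in lborel. al <= r & r <= be --> C r = m r)"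
  and h: "AE r in radm. h r = (r * g r / F r) * m r" for m h
  proof (rule AE_const_glue)
  fix al be :: real assume ab: "0 < al" "al <= be"
  obtain C where C: "AC_on al be C h" "AE r in lborel. al <= r & r <= be --> C r = m r" using ex[OF ab] by blast
  have I: "AC_on al be (%r. C r * (1 / rho r)) (%r. h r * (1 / rho r) + C r * (- (r * g r / F r) * (1 / rho r)))"
  by (rule AC_on_mult[OF C(1) rho_indef(2)[OF Fp ab]])
  have zz: "AE r in lborel. al <= r & r <= be --> h r * (1 / rho r) + C r * (- (r * g r / F r) * (1 / rho r)) = 0"
  using loc[OF h ab(1)] C(2) by eventually_elim (auto simp: algebra_simps)
  have "AE r in lborel. al <= r & r <= be --> m r * (1 / rho r) = C al * (1 / rho al)"
  using C(2)
  proof eventually_elim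
  fix r assume a: "al <= r & r <= be --> C r = m r"
  show "al <= r & r <= be --> m r * (1 / rho r) = C al * (1 / rho al)"
  proof
  assume r: "al <= r & r <= be"
  have "C r * (1 / rho r) = C al * (1 / rho al)" by (rule AC_on_zero_const[OF I zz]) (use r in auto)
  thus "m r * (1 / rho r) = C al * (1 / rho al)" using a r by simp
  qed
  qed
  thus "\<exists>ka. AE r in lborel. al <= r & r <= be --> m r * (1 / rho r) = ka" by blast
  qed
  have "AE r in radm. cmean (%t. Na r t * cos t + Nb r t * sin t) = (r * g r / F r) * cx r"
  "AE r in radm. cmean (%t. Nb r t * cos t - Na r t * sin t) = (r * g r / F r) * cy r" using dN by (auto elim: eventually_mono)
  then obtain ka \<mu> where km: "AE r in radm. cx r * (1 / rho r) = ka" "AE r in radm. cy r * (1 / rho r) = \<mu>"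
  using ratio[OF means_indef_integral(3)] ratio[OF means_indef_integral(4)] by auto
  have c: "AE r in radm. cx r = ka * rho r & cy r = \<mu> * rho r"
  using km pos
  proof eventually_elim
  fix r :: real assume r: "cx r * (1 / rho r) = ka" "cy r * (1 / rho r) = \<mu>" "0 < r"
  show "cx r = ka * rho r & cy r = \<mu> * rho r" using rpos[OF r(3)] unfolding r(1,2)[symmetric] by simp
  qed
  have "AE r in radm. ka\<^sup>2 + \<mu>\<^sup>2 = 1"
  using c cF pos
  proof eventually_elim
  fix r assume r: "0 < r" "cx r = ka * rho r & cy r = \<mu> * rho r" "(cx r)^2 + (cy r)^2 = F r"
  have "F r = (rho r)^2" using Fp r(1) by (simp add: rho_def less_imp_le)
  hence "(ka\<^sup>2 + \<mu>\<^sup>2) * (rho r)^2 = (rho r)^2" using r by (simp add: power_mult_distrib algebra_simps)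
  thus "ka\<^sup>2 + \<mu>\<^sup>2 = 1" using rpos[OF r(1)] by simp
  qed
  from loc[OF this, of 1 2] have "AE r in lborel. 1 <= r & r <= (2::real) --> ka\<^sup>2 + \<mu>\<^sup>2 = 1" by simp
  then have "ka\<^sup>2 + \<mu>\<^sup>2 = 1" by (rule AE_lborel_intervalE) auto
  thus ?thesis using c by blast
 qed
 then obtain ka \<mu> where km: "ka\<^sup>2 + \<mu>\<^sup>2 = 1" "AE r in radm. cx r = ka * rho r & cy r = \<mu> * rho r" by blast
 have "AE r in radm. AE t in circm. a (pol r t) = p + rho r * (ka * cos t - \<mu> * sin t) & b (pol r t) = q + rho r * (ka * sin t + \<mu> * cos t)"
  using V km(2) pq
 proof eventually_elim
  fix r assume ae: "AE t in circm. a (pol r t) = ma r + (cx r * cos t - cy r * sin t) &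
  b (pol r t) = mb r + (cx r * sin t + cy r * cos t) & Ta r t = - (b (pol r t) - mb r) & Tb r t = a (pol r t) - ma r"
  and c: "cx r = ka * rho r & cy r = \<mu> * rho r" "ma r = p" "mb r = q"
  show "AE t in circm. a (pol r t) = p + rho r * (ka * cos t - \<mu> * sin t) & b (pol r t) = q + rho r * (ka * sin t + \<mu> * cos t)"
  using ae by eventually_elim (use c in \<open>auto simp: algebra_simps\<close>)
 qed
 thus ?thesis using km(1) by blast
qed

end

section \<open>Lower bound for the energy\<close>

lemma powr_ge_tangent:
 fixes x e p :: real
 assumes "0 <= x" "0 < e" "1 <= p"
 shows "e powr p + p * e powr (p - 1) * (x - e) <= x powr p"
proof -
 have ep: "e powr p = e * e powr (p - 1)" using assms(2) by (simp add: powr_mult_base)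
 show ?thesis
 proof (cases "x = 0")
  case True
  have "e powr p + p * e powr (p - 1) * (0 - e) = (1 - p) * e powr p" unfolding ep by (simp add: algebra_simps)
  also have "... <= 0" using assms by (intro mult_nonpos_nonneg) auto
  finally show ?thesis using True by simp
 next
  case False
  define w where "w = ln (x / e)"
  have xe: "0 < x / e" using False assms by simp
  have y: "exp w = x / e" using xe by (simp add: w_def)
  \<comment> \<open>Bernoulli's inequality for real exponents, from \<open>1 + s <= exp s\<close> at
    \<open>s = - w\<close> and at \<open>s = (p - 1) * w\<close>.\<close>
  have "1 + - w <= exp (- w)" by (rule exp_ge_add_one_self)
  hence "exp w * (1 - w) <= exp w * exp (- w)" by (intro mult_left_mono) auto
  hence "exp w * (1 - w) <= 1" by (simp flip: exp_add)
  hence "(p - 1) * (exp w - 1) <= (p - 1) * (exp w * w)" using assms(3) by (intro mult_left_mono) (auto simp: algebra_simps)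
  moreover have "exp w * (1 + (p - 1) * w) <= exp w * exp ((p - 1) * w)"
  by (intro mult_left_mono exp_ge_add_one_self) simp
  moreover have "exp w * exp ((p - 1) * w) = exp (p * w)" by (simp flip: exp_add add: algebra_simps)
  ultimately have "1 + p * (exp w - 1) <= exp (p * w)" by (simp add: algebra_simps)
  also have "exp (p * w) = (x / e) powr p" using xe False assms by (auto simp: w_def powr_def)
  finally have "e powr p * (1 + p * (x / e - 1)) <= e powr p * (x / e) powr p" unfolding y by (intro mult_left_mono) auto
  also have "... = x powr p" using assms by (simp add: powr_divide)
  finally show ?thesis using assms(2) unfolding ep by (simp add: algebra_simps)
 qed
qed

text \<open>Here \<open>al\<close> and \<open>be\<close> stand for radial and tangential energy,
  \<open>f\<close> for the Jacobian and \<open>b0\<close> for \<open>F / r^2\<close>. With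
  \<open>q = f^2 / b0^2\<close> the right side minus the left is
  \<open>al + q * be - 2 * q * b0\<close>, which is nonnegative by the inequality of arithmetic and
  geometric means.\<close>

lemma gradient_tangent_inequality:
 fixes al be f b0 :: real
 assumes "0 <= al" "0 <= be" "f\<^sup>2 <= al * be" "0 < b0" "\<bar>f\<bar> <= b0"
 shows "(1 - f\<^sup>2 / b0\<^sup>2) * (be - b0) <= al + be - (b0 + f\<^sup>2 / b0)"
proof -
 define q where "q = f\<^sup>2 / b0\<^sup>2"
 have q: "f\<^sup>2 = q * b0\<^sup>2" "0 <= q" using assms(4) by (auto simp: q_def)
 have "(2 * q * b0)^2 <= (al + be * q)\<^sup>2"
 proof -
  have "(2 * q * b0)^2 = 4 * q * f\<^sup>2" unfolding q(1) by (simp add: sq_eq algebra_simps)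
  also have "... <= 4 * q * (al * be)" using assms(3) q(2) by (intro mult_left_mono) auto
  also have "... = (al + be * q)^2 - (al - be * q)^2" by (simp add: sq_eq algebra_simps)
  also have "... <= (al + be * q)\<^sup>2" by simp
  finally show ?thesis .
 qed
 hence "2 * q * b0 <= al + be * q" by (rule power2_le_imp_le) (use assms q in auto)
 moreover have "f\<^sup>2 / b0 = q * b0" unfolding q(1) using assms(4) by (simp add: sq_eq)
 ultimately show ?thesis unfolding q_def[symmetric] by (simp add: algebra_simps)
qed

context radial_profile
begin

text \<open>The first summand is the square of \<open>rho / r\<close>, the second the square of the
  derivative of \<open>rho\<close>, so this is the squared gradient norm of the stretching. Where
  \<open>F\<close> vanishes both are 0, the second through division by zero.\<close>

definition "E0 r = F r / r\<^sup>2 + (g r)^2 / (F r / r\<^sup>2)"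

lemma F_measurable_pos: "(%r. F (max 0 r)) : borel_fun"
 by (rule cont_borel, rule cont_comp[OF F_cont]) (auto intro!: continuous_intros)

lemma E0_measurable: "(%r. E0 \<bar>r\<bar>) : borel_fun"
proof -
 note [measurable] = F_measurable_pos
 have "(%r. F (max 0 \<bar>r\<bar>) / \<bar>r\<bar>\<^sup>2 + (g \<bar>r\<bar>)^2 / (F (max 0 \<bar>r\<bar>) / \<bar>r\<bar>\<^sup>2)) : borel_fun" by measurable
 thus ?thesis by (simp add: E0_def)
qed

end

context weak_radial
begin

definition "n2 x = (a1 x)^2 + (a2 x)^2 + (b1 x)^2 + (b2 x)^2"

lemma n2_measurable [measurable]: "n2 : borel_fun" unfolding n2_def by measurable

text \<open>Turning the coordinate frame by \<open>t\<close> preserves the length of a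
  gradient.\<close>

lemma n2_polar:
 assumes "0 < r"
 shows "n2 (pol r t) = ((Na r t)^2 + (Nb r t)^2) + ((Ta r t)^2 + (Tb r t)^2) / r\<^sup>2"
proof -
 have cs: "cos t * cos t + sin t * sin t = 1" using sin_cos_squared_add2[of t] by (simp add: sq_eq)
 have "(c * u + d * v)^2 + (c * v - d * u)^2 = (u\<^sup>2 + v\<^sup>2) * (c * c + d * d)" for c d u v :: real by algebra
 hence e: "(cos t * u + sin t * v)^2 + (cos t * v - sin t * u)^2 = u\<^sup>2 + v\<^sup>2" for u v :: real by (simp only: cs mult_1_right)
 have "((Ta r t)^2 + (Tb r t)^2) / r\<^sup>2 = (cos t * a2 (pol r t) - sin t * a1 (pol r t))^2 + (cos t * b2 (pol r t) - sin t * b1 (pol r t))^2"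
  using assms unfolding Ta_def Tb_def ang_comp_def power_mult_distrib by (simp add: add_divide_distrib)
 thus ?thesis
  using e[of "a1 (pol r t)" "a2 (pol r t)"] e[of "b1 (pol r t)" "b2 (pol r t)"] unfolding n2_def Na_def Nb_def rad_comp_def by linarith
qed

lemma jac_polar: "Na r t * Tb r t - Nb r t * Ta r t = r * jac (pol r t)"
proof -
 have cs: "cos t * cos t + sin t * sin t = 1" using sin_cos_squared_add2[of t] by (simp add: sq_eq)
 have "(c * p1 + d * p2) * (s * (c * q2 - d * q1)) - (c * q1 + d * q2) * (s * (c * p2 - d * p1)) = s * (p1 * q2 - p2 * q1) * (c * c + d * d)" for c d s p1 p2 q1 q2 :: real
  by (simp add: algebra_simps)
 thus ?thesis unfolding Na_def Nb_def Ta_def Tb_def rad_comp_def ang_comp_def jac_def by (simp only: cs mult_1_right)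
qed

lemma AE_jac_polar: "AE r in radm. AE t in circm. jac (pol r t) = g r"
proof -
 have "AE r in radm. 0 < r" by (simp add: AE_radm_iff)
 with AE_polar[OF jac_eq] show ?thesis by eventually_elim simp
qed

lemma AE_tang_integrable: "AE r in radm. integrable circm (%t. (Ta r t)^2 + (Tb r t)^2)"
proof (rule AE_radm_radR)
 fix n :: nat
 have "integrable (radR (real n) \<Otimes>\<^sub>M circm) (%z. (ang_comp a1 a2 (fst z) (snd z))^2 + (ang_comp b1 b2 (fst z) (snd z))^2)"
  by (intro Bochner_Integration.integrable_add L1convD(2)[OF L1_ang_square] l1 l2)
 from polR.AE_integrable_fst'[OF this]
 show "AE r in radR (real n). integrable circm (%t. (Ta r t)^2 + (Tb r t)^2)" by (simp add: Ta_def Tb_def)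
qed

context
 fixes p :: real
 assumes p: "1 <= p"
  and ien: "integrable lborel (%x. n2 x powr p)" and iE: "integrable lborel (%x::real^2. E0 (norm x) powr p)"
begin

lemma circle_energy:
 "AE r in radm. 2 * pi * E0 r powr p <= (LINT t|circm. n2 (pol r t) powr p) &
  ((LINT t|circm. n2 (pol r t) powr p) = 2 * pi * E0 r powr p --> defi r = 0 &
  (AE t in circm. n2 (pol r t) - E0 r = (1 - (g r)^2 / (F r / r\<^sup>2)^2) * (((Ta r t)^2 + (Tb r t)^2) / r\<^sup>2 - F r / r\<^sup>2)))"
proof -
 have pos: "AE r in radm. 0 < r" by (simp add: AE_radm_iff)
 show ?thesis
  using pos g_le defi_nonneg AE_jac_polar AE_tang_integrable integral_polar(3)[OF ien]
 proof eventually_elim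
  fix r assume r: "0 < r" and gl: "\<bar>g r\<bar> <= F r / r\<^sup>2" and dn: "0 <= defi r"
  and jae: "AE t in circm. jac (pol r t) = g r" and it: "integrable circm (%t. (Ta r t)^2 + (Tb r t)^2)"
  and ie: "integrable circm (%t. n2 (pol r t) powr p)"
  define b0 where "b0 = F r / r\<^sup>2"
  define al where "al t = (Na r t)^2 + (Nb r t)^2" for t
  define be where "be t = ((Ta r t)^2 + (Tb r t)^2) / r\<^sup>2" for t
  have n2e: "n2 (pol r t) = al t + be t" for t using n2_polar[OF r] by (simp add: al_def be_def)
  have ab0: "0 <= al t" "0 <= be t" for t by (auto simp: al_def be_def)
  have tang: "tang2 r = defi r + 2 * pi * F r" using area_eq[of r] r by (simp add: defi_def)
  have ib: "integrable circm be" unfolding be_def[abs_def] using it by (rule integrable_divide)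
  have ibeta: "(LINT t|circm. be t) = defi r / r\<^sup>2 + 2 * pi * b0"
  proof -
  have "(LINT t|circm. be t) = tang2 r / r\<^sup>2" unfolding be_def tang2_def by simp
  also have "... = defi r / r\<^sup>2 + 2 * pi * b0" unfolding tang b0_def by (simp add: add_divide_distrib)
  finally show ?thesis .
  qed
  have [measurable]: "al \<in> borel_fun" "be \<in> borel_fun"
  unfolding al_def[abs_def] be_def[abs_def] by measurable
  have cs: "AE t in circm. (g r)^2 <= al t * be t"
  using jae
  proof eventually_elim
  fix t assume j: "jac (pol r t) = g r"
  have "(r * g r)^2 = (Na r t * Tb r t - Nb r t * Ta r t)^2" using jac_polar[of r t] j by simp
  also have "... <= (Na r t * Tb r t - Nb r t * Ta r t)\<^sup>2 + (Na r t * Ta r t + Nb r t * Tb r t)^2" by simp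
  also have "... = al t * ((Ta r t)^2 + (Tb r t)^2)" unfolding al_def by algebra
  finally show "(g r)^2 <= al t * be t" using r by (simp add: be_def power_mult_distrib field_simps)
  qed
  show "2 * pi * E0 r powr p <= (LINT t|circm. n2 (pol r t) powr p) &
  ((LINT t|circm. n2 (pol r t) powr p) = 2 * pi * E0 r powr p --> defi r = 0 &
  (AE t in circm. n2 (pol r t) - E0 r = (1 - (g r)^2 / (F r / r\<^sup>2)^2) * (((Ta r t)^2 + (Tb r t)^2) / r\<^sup>2 - F r / r\<^sup>2)))"
  proof (cases "F r = 0")
  case True
  have E: "E0 r = 0" by (simp add: E0_def True)
  have g0: "g r = 0" using gl True by simp
  have nn: "0 <= (LINT t|circm. n2 (pol r t) powr p)" by (intro Bochner_Integration.integral_nonneg) simp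
  have "defi r = 0 & (AE t in circm. n2 (pol r t) - E0 r = (1 - (g r)^2 / (F r / r\<^sup>2)^2) * (((Ta r t)^2 + (Tb r t)^2) / r\<^sup>2 - F r / r\<^sup>2))"
  if eq: "(LINT t|circm. n2 (pol r t) powr p) = 2 * pi * E0 r powr p"
  proof -
  have "(LINT t|circm. n2 (pol r t) powr p) = 0" using eq E by simp
  hence "AE t in circm. n2 (pol r t) powr p = 0" using ie by (subst (asm) integral_nonneg_eq_0_iff_AE) auto
  hence z: "AE t in circm. al t + be t = 0" by eventually_elim (simp add: n2e)
  hence bz: "AE t in circm. be t = 0" by eventually_elim (use ab0 in \<open>smt (verit)\<close>)
  have "(LINT t|circm. be t) = (LINT t|circm. 0)" by (rule integral_cong_AE) (use bz in auto)
  hence "defi r = 0" using ibeta True r by (simp add: b0_def)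
  moreover have "AE t in circm. n2 (pol r t) - E0 r = (1 - (g r)^2 / (F r / r\<^sup>2)^2) * (((Ta r t)^2 + (Tb r t)^2) / r\<^sup>2 - F r / r\<^sup>2)"
  using z bz by eventually_elim (simp add: n2e E g0 True be_def)
  ultimately show ?thesis by simp
  qed
  thus ?thesis using nn E by simp
  next
  case False
  have b0: "0 < b0" using False F_nonneg[of r] r by (simp add: b0_def)
  have gb: "\<bar>g r\<bar> <= b0" using gl by (simp add: b0_def)
  define E where "E = b0 + (g r)^2 / b0"
  have Ee: "E0 r = E" by (simp add: E0_def E_def b0_def)
  have Ep: "0 < E" unfolding E_def using b0 by (simp add: add_pos_nonneg)
  \<comment> \<open>Nonnegative by the bound on \<open>g\<close>, and 0 in the borderline case where
    that bound is an equality.\<close>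
  define \<mu> where "\<mu> = 1 - (g r)^2 / b0\<^sup>2"
  have mu0: "0 <= \<mu>" using gb b0 abs_le_square_iff[of "g r" b0] by (simp add: \<mu>_def)
  define k where "k = p * E powr (p - 1)"
  have k: "0 < k" using p Ep by (simp add: k_def)
  define L where "L t = E powr p + k * (\<mu> * (be t - b0))" for t
  have iL: "integrable circm L" unfolding L_def[abs_def] using ib by auto
  have chain: "AE t in circm. L t <= E powr p + k * (al t + be t - E) & E powr p + k * (al t + be t - E) <= n2 (pol r t) powr p"
  using cs
  proof eventually_elim
  fix t assume c: "(g r)^2 <= al t * be t"
  have "\<mu> * (be t - b0) <= al t + be t - E" unfolding \<mu>_def E_def by (rule gradient_tangent_inequality[OF ab0 c b0 gb])
  hence "k * (\<mu> * (be t - b0)) <= k * (al t + be t - E)" using k by (intro mult_left_mono) auto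
  moreover have "E powr p + k * (al t + be t - E) <= n2 (pol r t) powr p"
  unfolding n2e k_def by (rule powr_ge_tangent) (use ab0 Ep p in auto)
  ultimately show "L t <= E powr p + k * (al t + be t - E) & E powr p + k * (al t + be t - E) <= n2 (pol r t) powr p"
  by (simp add: L_def)
  qed
  have LI: "(LINT t|circm. L t) = 2 * pi * E powr p + k * \<mu> * (defi r / r\<^sup>2)"
  unfolding L_def using ib ibeta by (simp add: measure_circm algebra_simps)
  have Ln: "AE t in circm. L t <= n2 (pol r t) powr p" using chain by eventually_elim linarith
  have le: "(LINT t|circm. L t) <= (LINT t|circm. n2 (pol r t) powr p)" by (rule integral_mono_AE[OF iL ie Ln])
  have kd: "0 <= k * \<mu> * (defi r / r\<^sup>2)" using k mu0 dn r by (intro mult_nonneg_nonneg) auto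
  have "defi r = 0 & (AE t in circm. n2 (pol r t) - E0 r = \<mu> * (be t - b0))"
  if eq: "(LINT t|circm. n2 (pol r t) powr p) = 2 * pi * E0 r powr p"
  proof -
  have z1: "k * \<mu> * (defi r / r\<^sup>2) = 0" "(LINT t|circm. L t) = (LINT t|circm. n2 (pol r t) powr p)"
  using le LI kd eq[unfolded Ee] by linarith+
  have "(LINT t|circm. n2 (pol r t) powr p - L t) = 0" using z1(2) ie iL by simp
  hence "AE t in circm. n2 (pol r t) powr p - L t = 0"
  by (subst (asm) integral_nonneg_eq_0_iff_AE) (use ie iL Ln in auto)
  hence eqt: "AE t in circm. al t + be t - E = \<mu> * (be t - b0)"
  using chain
  proof eventually_elim
  fix t assume e: "n2 (pol r t) powr p - L t = 0" and c: "L t <= E powr p + k * (al t + be t - E) & E powr p + k * (al t + be t - E) <= n2 (pol r t) powr p"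
  have "L t = E powr p + k * (al t + be t - E)" using e c by linarith
  hence "k * (\<mu> * (be t - b0)) = k * (al t + be t - E)" by (simp add: L_def)
  thus "al t + be t - E = \<mu> * (be t - b0)" using k by simp
  qed
  have "defi r = 0"
  proof (cases "\<mu> = 0")
  case False
  thus ?thesis using z1(1) k r by simp
  next
  \<comment> \<open>In the borderline case the deficit has weight 0 in the integral of
    \<open>L\<close>. Instead \<open>al + be = 2 * b0\<close> and \<open>al * be >= b0^2\<close>
    force \<open>be = b0\<close> at almost every angle, and the deficit is again 0.\<close>
  case True
  hence g2: "(g r)^2 = b0\<^sup>2" using b0 by (simp add: \<mu>_def)
  have E2: "E = 2 * b0" unfolding E_def g2 using b0 by (simp add: sq_eq)
  have "AE t in circm. be t = b0"
  using eqt cs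
  proof eventually_elim
  fix t assume e: "al t + be t - E = \<mu> * (be t - b0)" and c: "(g r)^2 <= al t * be t"
  have s: "al t = 2 * b0 - be t" using e True E2 by simp
  have "(be t - b0)^2 = b0\<^sup>2 - al t * be t" unfolding s by (simp add: sq_eq algebra_simps)
  hence "(be t - b0)^2 <= 0" using c g2 by simp
  thus "be t = b0" by simp
  qed
  hence "(LINT t|circm. be t) = (LINT t|circm. b0)" by (intro integral_cong_AE) auto
  hence "defi r / r\<^sup>2 = 0" using ibeta by (simp add: measure_circm)
  thus ?thesis using r by simp
  qed
  thus ?thesis using eqt by (simp add: n2e Ee)
  qed
  moreover have "2 * pi * E0 r powr p <= (LINT t|circm. n2 (pol r t) powr p)" unfolding Ee using le LI kd by linarith
  ultimately show ?thesis unfolding \<mu>_def b0_def be_def by blast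
  qed
 qed
qed

lemma iE_polar: "(LINT x|lborel. E0 (norm (x::real^2)) powr p) = (LINT r|radm. 2 * pi * E0 \<bar>r\<bar> powr p)" "integrable radm (%r. 2 * pi * E0 \<bar>r\<bar> powr p)"
proof -
 have e: "(LINT t|circm. E0 (norm (pol r t)) powr p) = 2 * pi * E0 \<bar>r\<bar> powr p" for r
  by (simp add: measure_circm)
 show "integrable radm (%r. 2 * pi * E0 \<bar>r\<bar> powr p)"
  "(LINT x|lborel. E0 (norm (x::real^2)) powr p) = (LINT r|radm. 2 * pi * E0 \<bar>r\<bar> powr p)"
  using integral_polar(1,2)[OF iE] unfolding e by auto
qed

lemma circle_energy_le: "AE r in radm. 2 * pi * E0 \<bar>r\<bar> powr p <= (LINT t|circm. n2 (pol r t) powr p)"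
proof -
 have "AE r in radm. 0 < r" by (simp add: AE_radm_iff)
 thus ?thesis using circle_energy by eventually_elim auto
qed

theorem minimality: "(LINT x|lborel. E0 (norm (x::real^2)) powr p) <= (LINT x|lborel. n2 x powr p)"
 unfolding iE_polar(1) integral_polar(1)[OF ien]
 by (rule integral_mono_AE[OF iE_polar(2) integral_polar(2)[OF ien]]) (rule circle_energy_le)

text \<open>Equality of the integrals forces equality on almost every circle, hence zero deficit.
  The centred map then has squared length \<open>F r\<close>, the radial derivative has a prescribed
  length, and the Jacobian prescribes the product of the two. This is the equality case of
  Cauchy-Schwarz: the radial derivative is a multiple of the centred map, as \<open>rigidity\<close>
  requires.\<close>

theorem equality_case:
 assumes eq: "(LINT x|lborel. n2 x powr p) = (LINT x|lborel. E0 (norm (x::real^2)) powr p)"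
 shows "\<exists>ka \<mu> c d. ka\<^sup>2 + \<mu>\<^sup>2 = 1 & (AE r in radm. AE t in circm.
  a (pol r t) = c + rho r * (ka * cos t - \<mu> * sin t) & b (pol r t) = d + rho r * (ka * sin t + \<mu> * cos t))"
proof -
 have i: "integrable radm (%r. LINT t|circm. n2 (pol r t) powr p)" by (rule integral_polar(2)[OF ien])
 have "(LINT r|radm. (LINT t|circm. n2 (pol r t) powr p) - 2 * pi * E0 \<bar>r\<bar> powr p) = 0"
  using eq unfolding iE_polar(1) integral_polar(1)[OF ien] by (subst Bochner_Integration.integral_diff[OF i iE_polar(2)]) simp
 hence "AE r in radm. (LINT t|circm. n2 (pol r t) powr p) - 2 * pi * E0 \<bar>r\<bar> powr p = 0"
  by (subst (asm) integral_nonneg_eq_0_iff_AE[OF LINT_diff[OF i iE_polar(2)]])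
  (use circle_energy_le in \<open>auto elim: eventually_mono\<close>)
 moreover have "AE r in radm. 0 < r" by (simp add: AE_radm_iff)
 ultimately have "AE r in radm. (LINT t|circm. n2 (pol r t) powr p) = 2 * pi * E0 r powr p" by eventually_elim auto
 hence D: "AE r in radm. defi r = 0 &
  (AE t in circm. n2 (pol r t) - E0 r = (1 - (g r)^2 / (F r / r\<^sup>2)^2) * (((Ta r t)^2 + (Tb r t)^2) / r\<^sup>2 - F r / r\<^sup>2))"
  using circle_energy by eventually_elim auto
 hence z: "AE r in radm. defi r = 0" by (auto elim: eventually_mono)
 have pos: "AE r in radm. 0 < r" by (simp add: AE_radm_iff)
 have "AE r in radm. AE t in circm. Na r t = (r * g r / F r) * (a (pol r t) - ma r) & Nb r t = (r * g r / F r) * (b (pol r t) - mb r)"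
  using D defi_zero_imp[OF z] coefficient_norm[OF z] pos AE_jac_polar g_le
 proof eventually_elim
  fix r assume r: "0 < r" and cF: "(cx r)^2 + (cy r)^2 = F r" and gl: "\<bar>g r\<bar> <= F r / r\<^sup>2"
  and D: "defi r = 0 & (AE t in circm. n2 (pol r t) - E0 r = (1 - (g r)^2 / (F r / r\<^sup>2)^2) * (((Ta r t)^2 + (Tb r t)^2) / r\<^sup>2 - F r / r\<^sup>2))"
  and V: "AE t in circm. a (pol r t) = ma r + (cx r * cos t - cy r * sin t) & b (pol r t) = mb r + (cx r * sin t + cy r * cos t) &
  Ta r t = - (b (pol r t) - mb r) & Tb r t = a (pol r t) - ma r"
  and jae: "AE t in circm. jac (pol r t) = g r"
  have D2: "AE t in circm. n2 (pol r t) - E0 r = (1 - (g r)^2 / (F r / r\<^sup>2)^2) * (((Ta r t)^2 + (Tb r t)^2) / r\<^sup>2 - F r / r\<^sup>2)" using D by blast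
  show "AE t in circm. Na r t = (r * g r / F r) * (a (pol r t) - ma r) & Nb r t = (r * g r / F r) * (b (pol r t) - mb r)"
  using D2 V jae
  proof eventually_elim
  fix t assume e: "n2 (pol r t) - E0 r = (1 - (g r)^2 / (F r / r\<^sup>2)^2) * (((Ta r t)^2 + (Tb r t)^2) / r\<^sup>2 - F r / r\<^sup>2)"
  and v: "a (pol r t) = ma r + (cx r * cos t - cy r * sin t) & b (pol r t) = mb r + (cx r * sin t + cy r * cos t) &
  Ta r t = - (b (pol r t) - mb r) & Tb r t = a (pol r t) - ma r" and j: "jac (pol r t) = g r"
  define wa wb where "wa = a (pol r t) - ma r" and "wb = b (pol r t) - mb r"
  have T: "Ta r t = - wb" "Tb r t = wa" using v by (auto simp: wa_def wb_def)
  have "wa\<^sup>2 + wb\<^sup>2 = (cx r * cos t - cy r * sin t)^2 + (cx r * sin t + cy r * cos t)^2" using v by (simp add: wa_def wb_def)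
  also have "... = ((cx r)^2 + (cy r)^2) * (cos t * cos t + sin t * sin t)" by algebra
  also have "cos t * cos t + sin t * sin t = 1" using sin_cos_squared_add2[of t] by (simp add: sq_eq)
  finally have w: "wa\<^sup>2 + wb\<^sup>2 = F r" using cF by simp
  hence TF: "(Ta r t)^2 + (Tb r t)^2 = F r" unfolding T by simp
  have N: "(Na r t)^2 + (Nb r t)^2 = (g r)^2 / (F r / r\<^sup>2)"
  using e n2_polar[OF r, of t] unfolding TF E0_def by simp
  have J: "Na r t * wa + Nb r t * wb = r * g r" using jac_polar[of r t] j unfolding T by simp
  show "Na r t = (r * g r / F r) * (a (pol r t) - ma r) & Nb r t = (r * g r / F r) * (b (pol r t) - mb r)"
  proof (cases "F r = 0")
  case True
  hence "(Na r t)^2 + (Nb r t)^2 = 0" using N by simp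
  thus ?thesis using True by (simp add: sum_power2_eq_zero_iff)
  next
  case False
  \<comment> \<open>Lagrange's identity. Both terms on the right are \<open>r^2 * g^2\<close>, so
    the two vectors are parallel.\<close>
  have "(Na r t * wb - Nb r t * wa)^2 = ((Na r t)^2 + (Nb r t)^2) * (wa\<^sup>2 + wb\<^sup>2) - (Na r t * wa + Nb r t * wb)^2" by algebra
  also have "... = 0" unfolding N w J using False r by (simp add: power_mult_distrib)
  finally have O: "Na r t * wb = Nb r t * wa" by simp
  have "Na r t * F r = r * g r * wa" "Nb r t * F r = r * g r * wb"
  unfolding w[symmetric] J[symmetric] using O by algebra+
  thus ?thesis using False unfolding wa_def[symmetric] wb_def[symmetric] by (simp add: field_simps)
  qed
  qed
 qed
 from rigidity[OF z this] show ?thesis .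
qed

end

end

section \<open>The weak gradient of the stretching\<close>

context radial_profile
begin

definition "rho' r = r * g r / rho r"

lemma rho_cont: "continuous_on {0..} rho"
 unfolding rho_def[abs_def] by (intro continuous_on_real_sqrt F_cont)

lemma rho_nonneg: "0 <= r ==> 0 <= rho r" by (simp add: rho_def F_nonneg)

lemma rho_square: "0 <= r ==> (rho r)\<^sup>2 = F r" by (simp add: rho_def F_nonneg)

lemma rho_measurable: "(%r. rho \<bar>r\<bar>) : borel_fun"
proof -
 note [measurable] = F_measurable_pos
 have "(%r. sqrt (F (max 0 \<bar>r\<bar>))) : borel_fun" by measurable
 thus ?thesis by (simp add: rho_def)
qed

lemma rho'_measurable: "(%r. rho' \<bar>r\<bar>) : borel_fun"
proof -
 note [measurable] = rho_measurable
 show ?thesis unfolding rho'_def by measurable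
qed

lemma rho_zero: "rho 0 = 0" by (simp add: rho_def F_0)

text \<open>The hypothesis in terms of the stretching: the rate along the radius never exceeds the
  rate along the circle.\<close>

lemma rho'_bound: "AE r in radm. \<bar>rho' r\<bar> <= rho r / r"
proof -
 have "AE r in radm. 0 < r" by (simp add: AE_radm_iff)
 thus ?thesis using g_le
 proof eventually_elim
  fix r assume r: "0 < r" and gl: "\<bar>g r\<bar> <= F r / r\<^sup>2"
  show "\<bar>rho' r\<bar> <= rho r / r"
  proof (cases "rho r = 0")
  case False
  hence p: "0 < rho r" using rho_nonneg[of r] r by simp
  have "r * \<bar>g r\<bar> <= r * ((rho r)^2 / r\<^sup>2)" using gl r rho_square[of r] by (intro mult_left_mono) auto
  also have "... = rho r / r * rho r" using r by (simp add: sq_eq)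
  finally have "r * \<bar>g r\<bar> / rho r <= rho r / r" using p by (simp add: pos_divide_le_eq)
  thus ?thesis using r p by (simp add: rho'_def abs_mult)
  qed (simp add: rho'_def)
 qed
qed

text \<open>One computation for all four partial derivatives. In the polar frame the tested
  component has weight \<open>k\<close> in the radial direction and \<open>l\<close> in the angular
  one, the gradient entry has weights \<open>k\<close> and \<open>m\<close>, and
  \<open>l' = m - k\<close> ties them together. Integration by parts in the angle removes
  \<open>l\<close>; what remains in the radius is the derivative of \<open>rho * r * H\<close>,
  which vanishes at both ends.\<close>

lemma weak_partial_polar:
 assumes lu: "loc_pow 1 u" and lG: "loc_pow 1 G"
  and ps: "C1_grad ps ps1 ps2" and q: "contU q"
  and supp: "!!x. R <= norm x ==> ps x = 0" "!!x. R <= norm x ==> q x = 0" and R: "0 < R"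
  and trig: "contU k" "contU m" "!!t. (l has_real_derivative m t - k t) (at t)"
  "!!t. l (t + 2*pi) = l t" "!!t. \<bar>k t\<bar> <= 1" "!!t. \<bar>m t\<bar> <= 1"
  and uq: "!!r t. 0 < r ==> r * (u (pol r t) * q (pol r t)) = rho r * r * (k t * rad_comp ps1 ps2 r t) + rho r * (l t * ang_comp ps1 ps2 r t)"
  and Ge: "!!r t. 0 < r ==> G (pol r t) = rho' r * k t + rho r / r * m t"
 shows "(LINT x|lborel. u x * q x) = - (LINT x|lborel. G x * ps x)"
proof -
 note [measurable] = loc_pow_borel[OF lu] loc_pow_borel[OF lG]
 note cps = C1_gradD(4)[OF ps, of UNIV]
 have [measurable]: "q : borel_fun" "ps \<in> borel_fun"
  using cont_borel[OF q] cont_borel[OF cps] by auto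
 have bounded: "\<exists>B. \<forall>x. \<bar>f x\<bar> <= B" if "contU f" "!!x. R <= norm x ==> f x = 0" for f :: "real^2 => real"
 proof -
  have "bounded (f ` cball 0 R)" by (intro compact_imp_bounded compact_continuous_image cont_subset[OF that(1)]) auto
  then obtain B where B: "\<forall>y\<in>f ` cball 0 R. norm y <= B" unfolding bounded_iff by blast
  have "\<bar>f x\<bar> <= max B 0" for x
  proof (cases "R <= norm x")
  case False
  hence "norm (f x) <= B" by (intro bspec[OF B]) auto
  thus ?thesis by simp
  qed (simp add: that(2))
  thus ?thesis by blast
 qed
 obtain Bq Bps where B: "!!x. \<bar>q x\<bar> <= Bq" "!!x. \<bar>ps x\<bar> <= Bps"
  using bounded[OF q supp(2)] bounded[OF cps supp(1)] by blast
 have pos: "AE r in radm. 0 < r" by (simp add: AE_radm_iff)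
 have iu: "integrable lborel (%x. u x * q x)" by (rule loc_pow_mult[OF lu _ B(1), where R=R]) (simp_all add: supp)
 have iG: "integrable lborel (%x. G x * ps x)" by (rule loc_pow_mult[OF lG _ B(2), where R=R]) (simp_all add: supp)
 define H where "H r = circ_int (%t. k t * ps (pol r t))" for r
 define H' where "H' r = circ_int (%t. k t * rad_comp ps1 ps2 r t)" for r
 define M where "M r = circ_int (%t. m t * ps (pol r t))" for r
 have cp: "contU (%t. ps (pol r t))" "contU (ang_comp ps1 ps2 r)" "contU (rad_comp ps1 ps2 r)" for r
  using cont_polar[OF ps cont_const cont_id, of UNIV r] by simp_all
 have cl: "contU l" using DERIV_isCont[OF trig(3)] by (simp add: cont_at_on)
 have ic: "f integrable_on {0..2*pi}" if "contU f" for f :: "real => real"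
  by (rule cont_integrable[OF cont_subset[OF that subset_UNIV]])
 have Hd: "(H has_real_derivative H' r) (at r)" for r
 proof -
  have "((%r. integral (cbox 0 (2*pi)) (%t. k t * ps (pol r t))) has_field_derivative integral (cbox 0 (2*pi)) (%t. k t * rad_comp ps1 ps2 r t)) (at r within UNIV)"
  proof (rule leibniz_rule_field_derivative[where fx="%r t. k t * rad_comp ps1 ps2 r t"])
  show "((%x. k t * ps (pol x t)) has_field_derivative k t * rad_comp ps1 ps2 x t) (at x within UNIV)" for x t
  by (rule DERIV_cmult[OF C1_grad_radius[OF ps]])
  show "(%t. k t * ps (pol x t)) integrable_on cbox 0 (2*pi)" for x using ic[OF cont_mult[OF trig(1) cp(1)]] by simp
  have "continuous_on (UNIV \<times> cbox 0 (2*pi)) (%x. k (snd x) * rad_comp ps1 ps2 (fst x) (snd x))"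
  by (intro cont_mult cont_polar[OF ps] cont_comp[OF trig(1)] cont_fst cont_snd cont_id) auto
  thus "continuous_on (UNIV \<times> cbox 0 (2*pi)) (%(x, t). k t * rad_comp ps1 ps2 x t)" by (simp add: split_beta)
  qed auto
  thus ?thesis by (simp add: H_def[abs_def] H'_def)
 qed
 have cont_param: "contU (%r. circ_int (%t. j t * f r t))"
  if "contU j" "continuous_on (UNIV \<times> cbox 0 (2*pi)) (%x. f (fst x) (snd x))" for j :: "real => real" and f :: "real => real => real"
 proof -
  have "continuous_on (UNIV \<times> cbox 0 (2*pi)) (%x. j (snd x) * f (fst x) (snd x))"
  by (intro cont_mult that(2) cont_comp[OF that(1)] cont_snd cont_id) auto
  hence "continuous_on (UNIV \<times> cbox 0 (2*pi)) (%(r, t). j t * f r t)" by (simp add: split_beta)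
  from integral_continuous_on_param[OF this] show ?thesis by simp
 qed
 have cH: "contU H'" "contU M"
  unfolding H'_def[abs_def] M_def[abs_def]
  by (intro cont_param trig cont_polar[OF ps] cont_fst cont_snd cont_id)+
 have cHH: "contU H" using DERIV_isCont[OF Hd] by (simp add: cont_at_on)
 have L: "circ_int (%t. l t * ang_comp ps1 ps2 r t) = H r - M r" for r
 proof -
  have "circ_int (%t. (m t - k t) * ps (pol r t) + ang_comp ps1 ps2 r t * l t) = 0"
  by (rule integral_periodic_deriv(1)[where f="%t. l t * ps (pol r t)"])
  (simp_all add: DERIV_mult[OF trig(3) C1_grad_angle[OF ps]] trig(4))
  moreover have "((%t. (m t * ps (pol r t) - k t * ps (pol r t)) + l t * ang_comp ps1 ps2 r t) has_integral (M r - H r + circ_int (%t. l t * ang_comp ps1 ps2 r t))) {0..2*pi}"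
  unfolding M_def H_def by (intro has_integral_add has_integral_diff integrable_integral ic cont_mult trig cp cl)
  moreover have "(%t. (m t * ps (pol r t) - k t * ps (pol r t)) + l t * ang_comp ps1 ps2 r t) = (%t. (m t - k t) * ps (pol r t) + ang_comp ps1 ps2 r t * l t)"
  by (simp add: algebra_simps)
  ultimately show ?thesis by (simp add: integral_unique)
 qed
 have HR: "H r = 0" if "R <= r" for r
 proof -
  have "ps (pol r t) = 0" for t using that R by (intro supp(1)) simp
  thus ?thesis by (simp add: H_def)
 qed
 have H'R: "H' r = 0" if "R < r" for r
 proof -
  have "((%_. 0) has_real_derivative 0) (at r)" by simp
  hence "(H has_real_derivative 0) (at r)"
  by (rule has_field_derivative_transform_within_open[where S="{R<..}"]) (use that HR in auto)
  thus ?thesis by (rule DERIV_unique[OF Hd])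
 qed
 define S where "S r = rho r * r * H' r + rho r * H r + r * rho' r * H r" for r
 have sum_eq: "(LINT t|circm. u (pol r t) * q (pol r t)) + (LINT t|circm. G (pol r t) * ps (pol r t)) = S r / r" if r: "0 < r" for r
 proof -
  have e1: "u (pol r t) * q (pol r t) = (rho r * r * (k t * rad_comp ps1 ps2 r t) + rho r * (l t * ang_comp ps1 ps2 r t)) / r" for t
  using uq[OF r, of t] r by (simp add: field_simps)
  have e2: "G (pol r t) * ps (pol r t) = rho' r * (k t * ps (pol r t)) + rho r / r * (m t * ps (pol r t))" for t
  by (simp add: Ge[OF r] algebra_simps)
  have ii: "integrable circm (%t. k t * rad_comp ps1 ps2 r t)" "integrable circm (%t. l t * ang_comp ps1 ps2 r t)"
  "integrable circm (%t. k t * ps (pol r t))" "integrable circm (%t. m t * ps (pol r t))"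
  by (intro integral_circm(1) cont_mult trig cp cl)+
  have "(LINT t|circm. u (pol r t) * q (pol r t)) = (rho r * r * H' r + rho r * (H r - M r)) / r"
  unfolding e1 using ii integral_circm(2)[OF cont_mult[OF trig(1) cp(3)]] integral_circm(2)[OF cont_mult[OF cl cp(2)]]
  by (simp add: L H'_def)
  moreover have "(LINT t|circm. G (pol r t) * ps (pol r t)) = rho' r * H r + rho r / r * M r"
  unfolding e2 using ii integral_circm(2)[OF cont_mult[OF trig(1) cp(1)]] integral_circm(2)[OF cont_mult[OF trig(2) cp(1)]]
  by (simp add: H_def M_def)
  ultimately show ?thesis unfolding S_def using r by (simp add: field_simps)
 qed
 have tot: "(LINT x|lborel. u x * q x) + (LINT x|lborel. G x * ps x) = (LINT r|radm. S \<bar>r\<bar> / \<bar>r\<bar>)"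
  and itot: "integrable radm (%r. S \<bar>r\<bar> / \<bar>r\<bar>)"
 proof -
  have mS [measurable]: "(%r. S \<bar>r\<bar>) : borel_fun"
  proof -
  note [measurable] = rho_measurable rho'_measurable cont_borel[OF cH(1)] cont_borel[OF cHH]
  show ?thesis unfolding S_def by measurable
  qed
  have ae: "AE r in radm. (LINT t|circm. u (pol r t) * q (pol r t)) + (LINT t|circm. G (pol r t) * ps (pol r t)) = S \<bar>r\<bar> / \<bar>r\<bar>"
  using pos by eventually_elim (simp add: sum_eq)
  have i2: "integrable radm (%r. (LINT t|circm. u (pol r t) * q (pol r t)) + (LINT t|circm. G (pol r t) * ps (pol r t)))"
  by (intro Bochner_Integration.integrable_add integral_polar(2)[OF iu] integral_polar(2)[OF iG])
  have "(LINT x|lborel. u x * q x) + (LINT x|lborel. G x * ps x) = (LINT r|radm. (LINT t|circm. u (pol r t) * q (pol r t)) + (LINT t|circm. G (pol r t) * ps (pol r t)))"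
  unfolding integral_polar(1)[OF iu] integral_polar(1)[OF iG]
  by (rule Bochner_Integration.integral_add[symmetric, OF integral_polar(2)[OF iu] integral_polar(2)[OF iG]])
  also have "... = (LINT r|radm. S \<bar>r\<bar> / \<bar>r\<bar>)"
  by (rule integral_cong_AE[OF _ _ ae]) (use i2 in auto)
  finally show "(LINT x|lborel. u x * q x) + (LINT x|lborel. G x * ps x) = (LINT r|radm. S \<bar>r\<bar> / \<bar>r\<bar>)" .
  show "integrable radm (%r. S \<bar>r\<bar> / \<bar>r\<bar>)"
  using integrable_cong_AE[OF _ _ ae] i2 by auto
 qed
 have radmd: "radm = density lborel (%r. ennreal (r * ind {0..} r))"
  unfolding radm_def by (intro arg_cong2[where f=density] refl ext) (auto simp: ennreal_neg split: split_indicator)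
 have mS2: "(%r. S \<bar>r\<bar> / \<bar>r\<bar>) : borel_fun" using itot by auto
 have eS: "r * ind {0..} r * (S \<bar>r\<bar> / \<bar>r\<bar>) = ind {0..} r * S r" for r
  by (cases "r = 0") (auto simp: indicator_def S_def rho_zero)
 have iS: "integrable lborel (%r. ind {0..} r * S r)"
 proof -
  have "integrable lborel (%r. r * ind {0..} r * (S \<bar>r\<bar> / \<bar>r\<bar>))"
  using itot mS2 unfolding radmd by (subst (asm) integrable_density) (auto simp: indicator_def)
  thus ?thesis by (simp only: eS)
 qed
 have sS: "set_integrable lborel {0..R} S"
 proof -
  have "integrable lborel (%r. ind {0..R} r *\<^sub>R (ind {0..} r * S r))" by (rule integrable_mult_indicator[OF _ iS]) simp
  moreover have "(%r. ind {0..R} r *\<^sub>R (ind {0..} r * S r)) = (%r. ind {0..R} r *\<^sub>R S r)" by (auto simp: indicator_def)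
  ultimately show ?thesis by (simp add: set_integrable_def)
 qed
 have "(LINT r|radm. S \<bar>r\<bar> / \<bar>r\<bar>) = (LINT r|lborel. r * ind {0..} r * (S \<bar>r\<bar> / \<bar>r\<bar>))"
  unfolding radmd using mS2 by (subst integral_density) (auto simp: indicator_def)
 also have "... = (LINT r|lborel. ind {0..} r * S r)" by (simp only: eS)
 also have "... = (LINT r:{0..R}|lborel. S r)"
  unfolding set_lebesgue_integral_def
 proof (intro integral_cong_AE)
  show "(%r. ind {0..} r * S r) : borel_measurable lborel" using iS by auto
  show "(%r. ind {0..R} r *\<^sub>R S r) : borel_measurable lborel" using sS unfolding set_integrable_def by auto
  show "AE r in lborel. ind {0..} r * S r = ind {0..R} r *\<^sub>R S r"
  using H'R HR by (intro AE_I2) (auto simp: indicator_def S_def)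
 qed
 also have "... = integral {0..R} S" by (rule set_borel_integral_eq_integral(2)[OF sS])
 also have "... = 0"
  using F_zero_or_pos
 proof
  assume "\<forall>r\<ge>0. F r = 0"
  hence "!!r. r : {0..R} ==> S r = 0" by (auto simp: S_def rho'_def rho_def)
  thus ?thesis using integral_cong[of "{0..R}" S "%_. 0"] by simp
 next
  assume Fp: "\<forall>r>0. F r > 0"
  \<comment> \<open>Absolute continuity of \<open>rho\<close> is available on intervals away from 0,
    so the integral starts at \<open>d\<close>, and \<open>d\<close> then tends to 0.\<close>
  have part: "integral {d..R} S = - (rho d * (d * H d))" if d: "0 < d" "d <= R" for d
  proof -
  have "AC_on d R (%r. rho r * (r * H r)) (%r. r * g r / rho r * (r * H r) + rho r * (1 * H r + H' r * r))"
  proof (rule AC_on_mult[OF rho_indef(1)[OF Fp d] AC_on_C1])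
  show "((%r. r * H r) has_real_derivative 1 * H t + H' t * t) (at t)" for t
  by (rule DERIV_mult[OF DERIV_ident Hd])
  show "continuous_on {d..R} (%r. 1 * H r + H' r * r)"
  by (intro cont_add cont_mult cont_id cont_const cont_subset[OF cHH] cont_subset[OF cH(1)]) auto
  qed
  hence "AC_on d R (%r. rho r * (r * H r)) S"
  by (rule AC_on_cong) (auto simp: S_def rho'_def algebra_simps)
  from AC_onD[OF this order_refl d(2) order_refl] show ?thesis using HR[of R] by simp
  qed
  have lim1: "((%d. integral {d..R} S) \<longlongrightarrow> integral {0..R} S) (at_right 0)"
  proof -
  have "continuous_on {0..R} (%d. integral {d..R} S)" by (rule indefinite_integral_continuous_1'[OF set_borel_integral_eq_integral(1)[OF sS]])
  hence "((%d. integral {d..R} S) \<longlongrightarrow> integral {0..R} S) (at 0 within {0..R})" using R by (auto simp: continuous_on_def)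
  thus ?thesis using R by (simp add: at_within_Icc_at_right)
  qed
  have lim2: "((%d. - (rho d * (d * H d))) \<longlongrightarrow> - (rho 0 * (0 * H 0))) (at_right 0)"
  proof -
  have "continuous_on {0..R} (%d. - (rho d * (d * H d)))"
  by (intro continuous_on_minus cont_mult cont_id cont_subset[OF rho_cont] cont_subset[OF cHH]) auto
  moreover have "0 : {0..R}" using R by simp
  ultimately have "((%d. - (rho d * (d * H d))) \<longlongrightarrow> - (rho 0 * (0 * H 0))) (at 0 within {0..R})"
  unfolding continuous_on_def by (rule bspec)
  thus ?thesis using R by (simp add: at_within_Icc_at_right)
  qed
  have "eventually (%d. - (rho d * (d * H d)) = integral {d..R} S) (at_right 0)"
  unfolding eventually_at_right_field using R by (intro exI[of _ R]) (auto simp: part)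
  from Lim_transform_eventually[OF lim2 this] have "((%d. integral {d..R} S) \<longlongrightarrow> 0) (at_right 0)" by simp
  thus ?thesis using lim1 tendsto_unique trivial_limit_at_right_real by blast
 qed
 finally show ?thesis using tot by simp
qed

end

lemma smooth_C1_grad:
 fixes phi :: "real^2 => real"
 assumes "smooth phi"
 shows "C1_grad phi (%x. fderiv phi (at x) (axis 1 1)) (%x. fderiv phi (at x) (axis 2 1))"
proof -
 have C: "C_diff (Suc 0) phi" using assms by (simp add: smooth_def)
 have B: "axis 1 1 : (Basis :: (real^2) set)" "axis 2 1 : (Basis :: (real^2) set)" by (auto simp: Basis_vec_def)
 have d: "(phi has_derivative fderiv phi (at x)) (at x)" for x by (rule C_diff_SucD(1)[OF C])
 have "fderiv phi (at x) h = h $ 1 * fderiv phi (at x) (axis 1 1) + h $ 2 * fderiv phi (at x) (axis 2 1)" for x h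
 proof -
  have e: "h = h $ 1 *\<^sub>R axis 1 1 + h $ 2 *\<^sub>R axis 2 1" by (auto simp: vec_eq_iff forall_2 axis_def)
  have l: "linear (fderiv phi (at x))" using has_derivative_linear[OF d] .
  have "fderiv phi (at x) h = fderiv phi (at x) (h $ 1 *\<^sub>R axis 1 1 + h $ 2 *\<^sub>R axis 2 1)"
  by (rule arg_cong[OF e])
  thus ?thesis unfolding linear_add[OF l] linear_cmul[OF l] by simp
 qed
 note e = ext[OF this]
 have "(phi has_derivative (%h. h $ 1 * fderiv phi (at x) (axis 1 1) + h $ 2 * fderiv phi (at x) (axis 2 1))) (at x)" for x
  by (rule has_derivative_eq_rhs[OF d e])
 thus ?thesis unfolding C1_grad_def
  using C_diff_SucD(2)[OF C B(1)] C_diff_SucD(2)[OF C B(2)] by simp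
qed

lemma frechet_derivative_outside_support:
 fixes phi :: "'a::euclidean_space => real"
 assumes z: "!!x. R < norm x ==> phi x = 0" and x: "R < norm x"
 shows "fderiv phi (at x) = (%_. 0)"
proof -
 have "open {x::'a. R < norm x}" by (auto intro!: open_Collect_less continuous_intros)
 hence "(phi has_derivative (%_. 0)) (at x)"
  by (rule has_derivative_transform_within_open[OF has_derivative_const]) (use x z in simp_all)
 thus ?thesis by (rule frechet_derivative_at[symmetric])
qed

lemma compact_support_radius:
 fixes phi :: "'a::euclidean_space => real"
 assumes "compact (support phi)"
 shows "\<exists>R>0. \<forall>x. R < norm x --> phi x = 0"
proof -
 obtain B where B: "\<forall>x\<in>support phi. norm x <= B" using compact_imp_bounded[OF assms] unfolding bounded_iff by blast
 have "phi x = 0" if "\<bar>B\<bar> + 1 < norm x" for x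
 proof (rule ccontr)
  assume "phi x ~= 0"
  hence "x : support phi" unfolding support_def by (intro subsetD[OF closure_subset]) simp
  hence "norm x <= B" using B by blast
  thus False using that by linarith
 qed
 thus ?thesis by (intro exI[of _ "\<bar>B\<bar> + 1"]) auto
qed

lemma trig_products_bounded:
 fixes t :: real
 shows "\<bar>cos t * cos t\<bar> <= 1" "\<bar>sin t * sin t\<bar> <= 1" "\<bar>cos t * sin t\<bar> <= 1" "\<bar>- (cos t * sin t)\<bar> <= 1"
proof -
 have m: "\<bar>x * y\<bar> <= 1" if "\<bar>x\<bar> <= 1" "\<bar>y\<bar> <= 1" for x y :: real using mult_mono[OF that] by (simp add: abs_mult)
 show "\<bar>cos t * cos t\<bar> <= 1" "\<bar>sin t * sin t\<bar> <= 1" "\<bar>cos t * sin t\<bar> <= 1" by (rule m; simp)+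
 thus "\<bar>- (cos t * sin t)\<bar> <= 1" by simp
qed

context radial_profile
begin

definition "ph1 x = rho (norm x) * (x $ 1 / norm x)" for x :: "real^2"
definition "ph2 x = rho (norm x) * (x $ 2 / norm x)" for x :: "real^2"
text \<open>The symmetric matrix with the derivative of \<open>rho\<close> as eigenvalue in the
  radial direction and \<open>rho / r\<close> in the tangential one. \<open>G12\<close> is both
  off-diagonal entries.\<close>

definition "G11 x = rho' (norm x) * ((x $ 1 / norm x) * (x $ 1 / norm x)) + rho (norm x) / norm x * ((x $ 2 / norm x) * (x $ 2 / norm x))" for x :: "real^2"
definition "G12 x = rho' (norm x) * ((x $ 1 / norm x) * (x $ 2 / norm x)) + rho (norm x) / norm x * (- ((x $ 1 / norm x) * (x $ 2 / norm x)))" for x :: "real^2"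
definition "G22 x = rho' (norm x) * ((x $ 2 / norm x) * (x $ 2 / norm x)) + rho (norm x) / norm x * ((x $ 1 / norm x) * (x $ 1 / norm x))" for x :: "real^2"

lemma rn_measurable [measurable]: "(%x::real^2. rho (norm x)) : borel_fun" "(%x::real^2. rho' (norm x)) : borel_fun"
 using measurable_compose[of norm borel borel "%r. rho \<bar>r\<bar>" borel, OF _ rho_measurable]
  measurable_compose[of norm borel borel "%r. rho' \<bar>r\<bar>" borel, OF _ rho'_measurable] by simp_all

lemma ph_measurable [measurable]: "ph1 : borel_fun" "ph2 : borel_fun"
 "G11 : borel_fun" "G12 : borel_fun" "G22 : borel_fun"
 unfolding ph1_def[abs_def] ph2_def[abs_def] G11_def[abs_def] G12_def[abs_def] G22_def[abs_def] by measurable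

lemma ph_polar: assumes "0 < r" shows "ph1 (pol r t) = rho r * cos t" "ph2 (pol r t) = rho r * sin t"
 using assms by (auto simp: ph1_def ph2_def)

lemma G_polar:
 assumes "0 < r"
 shows "G11 (pol r t) = rho' r * (cos t * cos t) + rho r / r * (sin t * sin t)"
  "G12 (pol r t) = rho' r * (cos t * sin t) + rho r / r * (- (cos t * sin t))"
  "G22 (pol r t) = rho' r * (sin t * sin t) + rho r / r * (cos t * cos t)"
 using assms by (auto simp: G11_def G12_def G22_def)

text \<open>In the plane \<open>1 / r\<close> is locally integrable, since the polar density cancels
  it.\<close>

lemma loc_pow_1_radial_bound:
 fixes h :: "real^2 => real"
 assumes [measurable]: "h : borel_fun" and b: "AE r in radm. \<forall>t. \<bar>h (pol r t)\<bar> <= C r / r"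
  and C: "!!R. \<exists>B\<ge>0. \<forall>r. 0 < r & r <= R --> C r <= B"
 shows "loc_pow 1 h"
 unfolding loc_pow_def
proof (intro conjI allI)
 fix R :: real
 obtain B where B: "B >= 0" "!!r. 0 < r ==> r <= R ==> C r <= B" using C[of R] by blast
 have pos: "AE r in radm. 0 < r" by (simp add: AE_radm_iff)
 have "(nnint lborel (%x. ennreal (\<bar>h x\<bar> ^ 1) * ind (cball 0 R) x)) = (nnint radm (%r. nnint circm (%t. ennreal \<bar>h (pol r t)\<bar> * ind (cball 0 R) (pol r t))))"
  by (subst nn_integral_polar) auto
 also have "... <= (nnint radm (%r. ennreal (B / r) * ind {..R} r * ennreal (2 * pi)))"
 proof (rule nn_integral_mono_AE, use b pos in eventually_elim)
  fix r assume a: "\<forall>t. \<bar>h (pol r t)\<bar> <= C r / r" and r: "0 < r"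
  have "(nnint circm (%t. ennreal \<bar>h (pol r t)\<bar> * ind (cball 0 R) (pol r t))) <= (nnint circm (%t. ennreal (B / r) * ind {..R} r))"
  proof (rule nn_integral_mono)
  fix t
  show "ennreal \<bar>h (pol r t)\<bar> * ind (cball 0 R) (pol r t) <= ennreal (B / r) * ind {..R} r"
  proof (cases "r <= R")
  case True
  have "C r / r <= B / r" using B(2)[OF r True] r by (intro divide_right_mono) auto
  hence "\<bar>h (pol r t)\<bar> <= B / r" using a order_trans by blast
  thus ?thesis using True r by (auto simp: indicator_def intro: ennreal_leI)
  qed (use r in \<open>simp add: indicator_def\<close>)
  qed
  also have "... = ennreal (B / r) * ind {..R} r * ennreal (2 * pi)" using emeasure_circm by simp
  finally show "(nnint circm (%t. ennreal \<bar>h (pol r t)\<bar> * ind (cball 0 R) (pol r t))) <= ennreal (B / r) * ind {..R} r * ennreal (2 * pi)" .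
 qed
 also have "... = (nnint lborel (%r. ennreal r * (ennreal (B / r) * ind {..R} r * ennreal (2 * pi))))"
  unfolding radm_def by (subst nn_integral_density) auto
 also have "... <= (nnint lborel (%r. ennreal (2 * pi * B) * ind {0..R} r))"
 proof (rule nn_integral_mono)
  fix r :: real
  show "ennreal r * (ennreal (B / r) * ind {..R} r * ennreal (2 * pi)) <= ennreal (2 * pi * B) * ind {0..R} r"
  using B(1) by (cases "0 < r") (auto simp: indicator_def ennreal_neg ennreal_mult[symmetric] mult_ac)
 qed
 also have "... < \<infinity>" using emeasure_bounded_finite[of "{0..R}"] by (subst nn_integral_cmult_indicator) (auto simp: ennreal_mult_less_top)
 finally show "(nnint lborel (%x. ennreal (\<bar>h x\<bar> ^ 1) * ind (cball 0 R) x)) < \<infinity>" .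
qed simp

lemma rho_locally_bounded: "\<exists>B\<ge>0. \<forall>r. 0 < r & r <= R --> rho r <= B"
proof -
 have "bounded (rho ` {0..R})" by (intro compact_imp_bounded compact_continuous_image cont_subset[OF rho_cont]) auto
 then obtain P where P: "\<forall>y\<in>rho ` {0..R}. norm y <= P" unfolding bounded_iff by blast
 have "rho r <= \<bar>P\<bar>" if "0 < r & r <= R" for r using bspec[OF P imageI[of r]] that by simp
 thus ?thesis by (intro exI[of _ "\<bar>P\<bar>"]) auto
qed

lemma ph_loc: "loc_pow 1 ph1" "loc_pow 1 ph2"
proof -
 have pos: "AE r in radm. 0 < r" by (simp add: AE_radm_iff)
 have C: "\<exists>B\<ge>0. \<forall>r. 0 < r & r <= R --> r * rho r <= B" for R
 proof -
  obtain B where B: "B >= 0" "!!r. 0 < r ==> r <= R ==> rho r <= B" using rho_locally_bounded[of R] by blast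
  have "r * rho r <= \<bar>R\<bar> * B" if "0 < r & r <= R" for r
  using that B rho_nonneg[of r] by (intro mult_mono) auto
  thus ?thesis using B(1) by (intro exI[of _ "\<bar>R\<bar> * B"]) auto
 qed
 have b: "\<bar>rho r * cos t\<bar> <= rho r" "\<bar>rho r * sin t\<bar> <= rho r" if "0 < r" for r t
  using rho_nonneg[of r] that mult_left_mono[of "\<bar>cos t\<bar>" 1 "rho r"] mult_left_mono[of "\<bar>sin t\<bar>" 1 "rho r"] by (simp_all add: abs_mult)
 show "loc_pow 1 ph1" by (rule loc_pow_1_radial_bound[where C="%r. r * rho r", OF _ _ C], simp, use pos in eventually_elim) (simp add: ph_polar b)
 show "loc_pow 1 ph2" by (rule loc_pow_1_radial_bound[where C="%r. r * rho r", OF _ _ C], simp, use pos in eventually_elim) (simp add: ph_polar b)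
qed

lemma G_loc: "loc_pow 1 G11" "loc_pow 1 G12" "loc_pow 1 G22"
proof -
 have pos: "AE r in radm. 0 < r" by (simp add: AE_radm_iff)
 have C: "\<exists>B\<ge>0. \<forall>r. 0 < r & r <= R --> 2 * rho r <= B" for R
 proof -
  obtain B where B: "B >= 0" "!!r. 0 < r ==> r <= R ==> rho r <= B" using rho_locally_bounded[of R] by blast
  thus ?thesis by (intro exI[of _ "2 * B"]) auto
 qed
 have b: "\<bar>rho' r * x + rho r / r * y\<bar> <= 2 * rho r / r" if "0 < r" "\<bar>rho' r\<bar> <= rho r / r" "\<bar>x\<bar> <= 1" "\<bar>y\<bar> <= 1" for r x y
 proof -
  have p: "0 <= rho r / r" using rho_nonneg[of r] that by simp
  have "\<bar>rho' r * x\<bar> <= rho r / r * 1" unfolding abs_mult using that p by (intro mult_mono) auto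
  moreover have "\<bar>rho r / r * y\<bar> <= rho r / r * 1" unfolding abs_mult using that p by (intro mult_mono) auto
  ultimately show ?thesis using abs_triangle_ineq[of "rho' r * x" "rho r / r * y"] by simp
 qed
 note one = trig_products_bounded
 show "loc_pow 1 G11" by (rule loc_pow_1_radial_bound[where C="%r. 2 * rho r", OF _ _ C], simp, use pos rho'_bound in eventually_elim) (unfold G_polar, intro allI b one; simp)
 show "loc_pow 1 G12" by (rule loc_pow_1_radial_bound[where C="%r. 2 * rho r", OF _ _ C], simp, use pos rho'_bound in eventually_elim) (unfold G_polar, intro allI b one; simp)
 show "loc_pow 1 G22" by (rule loc_pow_1_radial_bound[where C="%r. 2 * rho r", OF _ _ C], simp, use pos rho'_bound in eventually_elim) (unfold G_polar, intro allI b one; simp)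
qed

text \<open>In each instance of \<open>weak_partial_polar\<close> the weight \<open>k\<close> is an
  entry of the projection onto the radial direction and \<open>m\<close> the same entry of the
  complementary projection.\<close>

lemma ph_weak:
 "has_weak_partial (axis 1 1) ph1 G11" "has_weak_partial (axis 2 1) ph1 G12"
 "has_weak_partial (axis 1 1) ph2 G12" "has_weak_partial (axis 2 1) ph2 G22"
proof -
 note one = trig_products_bounded
 have cont: "contU (%t::real. cos t * cos t)" "contU (%t::real. sin t * sin t)"
  "contU (%t::real. cos t * sin t)" "contU (%t::real. - (cos t * sin t))" by (intro continuous_intros)+
 have key: "(LINT x|lborel. ph1 x * fderiv phi (at x) (axis 1 1)) = - (LINT x|lborel. G11 x * phi x) &
  (LINT x|lborel. ph1 x * fderiv phi (at x) (axis 2 1)) = - (LINT x|lborel. G12 x * phi x) &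
  (LINT x|lborel. ph2 x * fderiv phi (at x) (axis 1 1)) = - (LINT x|lborel. G12 x * phi x) &
  (LINT x|lborel. ph2 x * fderiv phi (at x) (axis 2 1)) = - (LINT x|lborel. G22 x * phi x)"
  if phi: "smooth phi" "compact (support phi)" for phi
 proof -
  define d1 d2 where "d1 x = fderiv phi (at x) (axis 1 1)" and "d2 x = fderiv phi (at x) (axis 2 1)" for x
  have C: "C1_grad phi d1 d2" unfolding d1_def[abs_def] d2_def[abs_def] by (rule smooth_C1_grad[OF phi(1)])
  obtain R0 where R0: "0 < R0" "!!x. R0 < norm x ==> phi x = 0" using compact_support_radius[OF phi(2)] by blast
  define R where "R = R0 + 1"
  have R: "0 < R" using R0 by (simp add: R_def)
  have s: "phi x = 0" "d1 x = 0" "d2 x = 0" if "R <= norm x" for x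
  using frechet_derivative_outside_support[where R=R0 and phi=phi and x=x, OF R0(2)] R0(2)[where x=x] that by (auto simp: R_def d1_def d2_def)
  have c: "contU d1" "contU d2" using C1_gradD[OF C] by auto
  have cs: "cos t * cos t + sin t * sin t = 1" for t :: real using sin_cos_squared_add2[of t] by (simp add: sq_eq)
  \<comment> \<open>Cartesian derivatives recovered from the polar ones, times the angular factor
    \<open>e\<close> of the component, which is \<open>cos t\<close> or
    \<open>sin t\<close>.\<close>
  have al: "r * (rho r * e * q1) = rho r * r * (e * cos t * rad_comp d1 d2 r t) + rho r * (- (e * sin t) * ang_comp d1 d2 r t) &
  r * (rho r * e * q2) = rho r * r * (e * sin t * rad_comp d1 d2 r t) + rho r * (e * cos t * ang_comp d1 d2 r t)"
  if "q1 = d1 (pol r t)" "q2 = d2 (pol r t)" for r t e q1 q2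
  proof -
  have "rho r * r * (e * cos t * (cos t * q1 + sin t * q2)) + rho r * (- (e * sin t) * (r * (cos t * q2 - sin t * q1))) = r * (rho r * e * q1) * (cos t * cos t + sin t * sin t)"
  "rho r * r * (e * sin t * (cos t * q1 + sin t * q2)) + rho r * (e * cos t * (r * (cos t * q2 - sin t * q1))) = r * (rho r * e * q2) * (cos t * cos t + sin t * sin t)"
  by algebra+
  thus ?thesis unfolding rad_comp_def ang_comp_def that cs by simp
  qed
  have dd: "((%t. - (cos t * sin t)) has_real_derivative sin t * sin t - cos t * cos t) (at t)"
  "((%t. cos t * cos t) has_real_derivative - (cos t * sin t) - cos t * sin t) (at t)"
  "((%t. - (sin t * sin t)) has_real_derivative - (cos t * sin t) - cos t * sin t) (at t)"
  "((%t. cos t * sin t) has_real_derivative cos t * cos t - sin t * sin t) (at t)" for t :: real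
  by (auto intro!: derivative_eq_intros)
  have "(LINT x|lborel. ph1 x * d1 x) = - (LINT x|lborel. G11 x * phi x)"
  by (rule weak_partial_polar[OF ph_loc(1) G_loc(1) C c(1) s(1) s(2) R cont(1) cont(2) dd(1) _ one(1) one(2)])
  (use al[OF refl refl, of _ "cos _"] in \<open>simp_all add: ph_polar G_polar\<close>)
  moreover have "(LINT x|lborel. ph1 x * d2 x) = - (LINT x|lborel. G12 x * phi x)"
  by (rule weak_partial_polar[OF ph_loc(1) G_loc(2) C c(2) s(1) s(3) R cont(3) cont(4) dd(2) _ one(3) one(4)])
  (use al[OF refl refl, of _ "cos _"] in \<open>simp_all add: ph_polar G_polar\<close>)
  moreover have "(LINT x|lborel. ph2 x * d1 x) = - (LINT x|lborel. G12 x * phi x)"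
  proof (rule weak_partial_polar[OF ph_loc(2) G_loc(2) C c(1) s(1) s(2) R cont(3) cont(4) dd(3) _ one(3) one(4)])
  fix r t :: real assume r: "0 < r"
  show "r * (ph2 (pol r t) * d1 (pol r t)) = rho r * r * (cos t * sin t * rad_comp d1 d2 r t) + rho r * (- (sin t * sin t) * ang_comp d1 d2 r t)"
  using al[OF refl refl, of r "sin t" t] r by (simp add: ph_polar mult_ac)
  qed (simp_all add: ph_polar G_polar)
  moreover have "(LINT x|lborel. ph2 x * d2 x) = - (LINT x|lborel. G22 x * phi x)"
  proof (rule weak_partial_polar[OF ph_loc(2) G_loc(3) C c(2) s(1) s(3) R cont(2) cont(1) dd(4) _ one(2) one(1)])
  fix r t :: real assume r: "0 < r"
  show "r * (ph2 (pol r t) * d2 (pol r t)) = rho r * r * (sin t * sin t * rad_comp d1 d2 r t) + rho r * (cos t * sin t * ang_comp d1 d2 r t)"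
  using al[OF refl refl, of r "sin t" t] r by (simp add: ph_polar mult_ac)
  qed (simp_all add: ph_polar G_polar)
  ultimately show ?thesis by (simp add: d1_def d2_def)
 qed
 show "has_weak_partial (axis 1 1) ph1 G11" "has_weak_partial (axis 2 1) ph1 G12"
  "has_weak_partial (axis 1 1) ph2 G12" "has_weak_partial (axis 2 1) ph2 G22"
  unfolding has_weak_partial_def by (intro allI impI; elim conjE; simp add: key)+
qed

lemma norm2_components: "x ~= 0 ==> (x $ 1 / norm x)\<^sup>2 + (x $ 2 / norm x)^2 = 1" for x :: "real^2"
proof -
 assume x: "x ~= 0"
 have "(norm x)^2 = (x $ 1)^2 + (x $ 2)^2" by (simp add: norm_vec_def L2_set_def UNIV_2)
 note e = this
 have "(x $ 1 / norm x)^2 + (x $ 2 / norm x)^2 = ((x $ 1)^2 + (x $ 2)^2) / (norm x)^2" by (simp only: power_divide add_divide_distrib)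
 also have "... = 1" unfolding e[symmetric] using x by simp
 finally show ?thesis .
qed

lemma G_norm:
 assumes "x ~= 0"
 shows "(G11 x)^2 + (G12 x)^2 + (G12 x)^2 + (G22 x)^2 = E0 (norm x)"
proof -
 define n where "n = norm x"
 have n: "0 < n" using assms by (simp add: n_def)
 have "(G11 x)^2 + (G12 x)^2 + (G12 x)^2 + (G22 x)^2 = ((rho' n)^2 + (rho n / n)^2) * ((x $ 1 / norm x)^2 + (x $ 2 / norm x)^2)^2"
  unfolding G11_def G12_def G22_def n_def by algebra
 also have "... = (rho' n)^2 + (rho n / n)^2" unfolding norm2_components[OF assms] by simp
 also have "(rho n / n)^2 = F n / n\<^sup>2" using rho_square[of n] n by (simp add: power_divide)
 also have "(rho' n)^2 = (g n)^2 / (F n / n\<^sup>2)" using rho_square[of n] n by (simp add: rho'_def power_divide power_mult_distrib mult.commute)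
 finally show ?thesis by (simp add: E0_def n_def)
qed

text \<open>The product of the two eigenvalues is \<open>g\<close> where \<open>rho\<close> is
  positive. Where \<open>rho\<close> vanishes, the bound on \<open>g\<close> makes \<open>g\<close>
  vanish too.\<close>

lemma G_det:
 assumes "x ~= 0" "\<bar>g (norm x)\<bar> <= F (norm x) / (norm x)^2"
 shows "G11 x * G22 x - G12 x * G12 x = g (norm x)"
proof -
 define n where "n = norm x"
 have n: "0 < n" using assms by (simp add: n_def)
 have "G11 x * G22 x - G12 x * G12 x = (rho' n * (rho n / n)) * ((x $ 1 / norm x)^2 + (x $ 2 / norm x)^2)^2"
  unfolding G11_def G12_def G22_def n_def by algebra
 also have "... = rho' n * (rho n / n)" unfolding norm2_components[OF assms(1)] by simp
 also have "... = g n"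
 proof (cases "rho n = 0")
  case True
  hence "F n = 0" using rho_square[of n] n by simp
  hence "g n = 0" using assms(2) by (simp add: n_def)
  thus ?thesis by (simp add: True)
 next
  case False thus ?thesis using n by (simp add: rho'_def)
 qed
 finally show ?thesis by (simp add: n_def)
qed

lemma AE_g_le_norm: "AE x in (lborel :: (real^2) measure). x ~= 0 & \<bar>g (norm x)\<bar> <= F (norm x) / (norm x)^2"
proof -
 note [measurable] = F_measurable_pos
 have P: "Measurable.pred borel (%x::real^2. x ~= 0 & \<bar>g (norm x)\<bar> <= F (max 0 (norm x)) / (norm x)^2)" by measurable
 have "AE r in radm. 0 < r" by (simp add: AE_radm_iff)
 hence "AE r in radm. AE t in circm. pol r t ~= 0 & \<bar>g (norm (pol r t))\<bar> <= F (max 0 (norm (pol r t))) / (norm (pol r t))^2"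
  using g_le
 proof eventually_elim
  fix r assume r: "0 < r" "\<bar>g r\<bar> <= F r / r\<^sup>2"
  have "pol r t ~= 0" for t using norm_pol[of r t] r(1) by (metis abs_eq_0_iff less_irrefl norm_zero)
  thus "AE t in circm. pol r t ~= 0 & \<bar>g (norm (pol r t))\<bar> <= F (max 0 (norm (pol r t))) / (norm (pol r t))^2" using r by simp
 qed
 from AE_polar_iff[OF P, THEN iffD2, OF this] show ?thesis by simp
qed

text \<open>The bound on \<open>g\<close> says that the radial part of \<open>E0\<close> is at most
  the tangential part.\<close>

lemma E0_le: "\<bar>g r\<bar> <= F r / r\<^sup>2 ==> 0 <= E0 r & E0 r <= 2 * (F r / r\<^sup>2)"
proof -
 assume a: "\<bar>g r\<bar> <= F r / r\<^sup>2"
 have b: "0 <= F r / r\<^sup>2" using a by linarith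
 have "(g r)^2 / (F r / r\<^sup>2) <= F r / r\<^sup>2"
 proof (cases "F r / r\<^sup>2 = 0")
  case False
  hence p: "0 < F r / r\<^sup>2" using b by linarith
  have "(g r)^2 <= (F r / r\<^sup>2)\<^sup>2" using power_mono[OF a abs_ge_zero, of 2] by simp
  thus ?thesis unfolding pos_divide_le_eq[OF p] by (simp only: sq_eq[of "F r / r\<^sup>2"])
 qed (simp only: div_by_0 order_refl)
 moreover have "0 <= (g r)\<^sup>2 / (F r / r\<^sup>2)" by (rule divide_nonneg_nonneg[OF zero_le_power2 b])
 ultimately show ?thesis using b unfolding E0_def by linarith
qed

end

section \<open>The norm estimate\<close>

lemma radial_integral:
 fixes q :: "real => real"
 assumes q [measurable]: "q : borel_fun"
 shows "integrable lborel (%x::real^2. q (norm x)) \<longleftrightarrow> set_integrable lborel {0..} (%s. s * q s)"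
  "integrable lborel (%x::real^2. q (norm x)) ==> (LINT x|lborel. q (norm (x::real^2))) = 2 * pi * (LINT s:{0..}|lborel. s * q s)"
proof -
 have eq: "ennreal s * ennreal \<bar>q s\<bar> = ennreal (norm (ind {0..} s *\<^sub>R (s * q s)))" for s
  by (cases "0 <= s") (auto simp: ennreal_neg ennreal_mult[symmetric] abs_mult)
 have pos: "AE s in radm. 0 < s" by (simp add: AE_radm_iff)
 have "(nnint lborel (%x. ennreal (norm (q (norm (x::real^2)))))) = (nnint radm (%s. nnint circm (%th. ennreal (norm (q (norm (pol s th)))))))"
  by (rule nn_integral_polar) simp
 also have "... = (nnint radm (%s. ennreal \<bar>q s\<bar> * ennreal (2 * pi)))"
  by (rule nn_integral_cong_AE) (use pos in eventually_elim, simp add: emeasure_circm)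
 also have "... = (nnint lborel (%s. ennreal s * (ennreal \<bar>q s\<bar> * ennreal (2 * pi))))"
  unfolding radm_def by (subst nn_integral_density) auto
 also have "... = (nnint lborel (%s. ennreal (norm (ind {0..} s *\<^sub>R (s * q s))) * ennreal (2 * pi)))"
  by (simp only: mult.assoc[symmetric] eq)
 also have "... = (nnint lborel (%s. ennreal (norm (ind {0..} s *\<^sub>R (s * q s))))) * ennreal (2 * pi)"
  by (rule nn_integral_multc) simp
 finally have n: "(nnint lborel (%x. ennreal (norm (q (norm (x::real^2)))))) = (nnint lborel (%s. ennreal (norm (ind {0..} s *\<^sub>R (s * q s))))) * ennreal (2 * pi)" .
 have "!!a::ennreal. a * ennreal (2 * pi) < \<infinity> \<longleftrightarrow> a < \<infinity>"
  by (auto simp: ennreal_mult_less_top)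
 thus "integrable lborel (%x::real^2. q (norm x)) \<longleftrightarrow> set_integrable lborel {0..} (%s. s * q s)"
  unfolding set_integrable_def integrable_iff_bounded n by simp
 assume i: "integrable lborel (%x::real^2. q (norm x))"
 have "(LINT x|lborel. q (norm (x::real^2))) = (LINT s|radm. LINT th|circm. q (norm (pol s th)))" by (rule integral_polar[OF i])
 also have "... = (LINT s|radm. 2 * pi * q s)"
 proof (rule integral_cong_AE)
  show "AE s in radm. (LINT th|circm. q (norm (pol s th))) = 2 * pi * q s"
  using pos by eventually_elim (simp add: emeasure_circm measure_def)
 qed (auto simp: radm_def)
 also have "... = (LINT s|density lborel (%s. ennreal (ind {0..} s * s)). 2 * pi * q s)"
 proof -
  have "radm = density lborel (%s. ennreal (ind {0..} s * s))" unfolding radm_def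
  by (rule density_cong) (auto simp: ennreal_neg indicator_def)
  thus ?thesis by (rule arg_cong)
 qed
 also have "... = (LINT s|lborel. (ind {0..} s * s) *\<^sub>R (2 * pi * q s))"
  by (rule integral_density) (auto simp: indicator_def)
 also have "... = (LINT s|lborel. (2 * pi) * (ind {0..} s *\<^sub>R (s * q s)))"
  by (rule LINT_cong) auto
 finally show "(LINT x|lborel. q (norm (x::real^2))) = 2 * pi * (LINT s:{0..}|lborel. s * q s)"
  unfolding set_lebesgue_integral_def by (simp only: integral_mult_right_zero)
qed

lemma bump_derivative_bounded: "\<exists>L\<ge>1. \<forall>x. onorm (fderiv (bump (0::real^2) 1) (at x)) <= L"
proof -
 have C: "C_diff 1 (bump (0::real^2) 1)" by (rule C_diff_bump)
 have z: "bump (0::real^2) 1 x = 0" if "norm x > 1" for x using bump_eq_0[of 1 x 0] that by simp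
 show ?thesis
 proof (rule C_diff_1_compact_support_Lipschitz[OF C z])
  fix L assume "!!x. onorm (fderiv (bump (0::real^2) 1) (at x)) <= L"
  thus ?thesis by (intro exI[of _ "max 1 L"]) (simp add: le_max_iff_disj)
 qed
qed

text \<open>A gradient bound for the unit bump, taken at least 1 so that it can be divided
  by.\<close>

definition bump_slope :: real where
 "bump_slope = (SOME L. L >= 1 & (\<forall>x. onorm (fderiv (bump (0::real^2) 1) (at x)) <= L))"

lemma bump_slope: "1 <= bump_slope" "onorm (fderiv (bump (0::real^2) 1) (at x)) <= bump_slope"
proof -
 have "bump_slope >= 1 & (\<forall>x. onorm (fderiv (bump (0::real^2) 1) (at x)) <= bump_slope)"
  unfolding bump_slope_def by (rule someI_ex) (use bump_derivative_bounded in blast)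
 thus "1 <= bump_slope" "onorm (fderiv (bump (0::real^2) 1) (at x)) <= bump_slope" by auto
qed

text \<open>The disc about \<open>a\<close> of radius 1/4 stays inside the unit disc, and the chain
  rule costs a factor 4. The position of the centre is the point: at scale
  \<open>t = 4 * norm x\<close> and with \<open>a = x /\<^sub>R t\<close>, the test becomes, in the
  variable of integration, a bump about the origin of radius \<open>norm x\<close>.\<close>

lemma scaled_bump_hardy_test:
 assumes a: "norm a = 1/4"
 shows "(%w::real^2. 1 / (4 * bump_slope) * bump a (1/4) w) : hardy_tests"
proof -
 let ?phi = "%w::real^2. 1 / (4 * bump_slope) * bump a (1/4) w"
 have L: "1 <= bump_slope" by (rule bump_slope)
 have sm: "smooth ?phi" unfolding smooth_def using C_diff_cmult[OF C_diff_bump] by blast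
 have "support ?phi \<subseteq> cball a (1/4)"
 proof -
  have "{x. ?phi x ~= 0} \<subseteq> {x. bump a (1/4) x ~= 0}" by auto
  hence "support ?phi \<subseteq> support (bump a (1/4))" unfolding support_def by (rule closure_mono)
  thus ?thesis using support_bump[of "1/4" a] by simp
 qed
 also have "... \<subseteq> ball 0 1"
 proof
  fix x assume "x : cball a (1/4)"
  hence "norm (x - a) <= 1/4" by (simp add: dist_norm norm_minus_commute)
  moreover have "norm x <= norm (x - a) + norm a" using norm_triangle_ineq[of "x - a" a] by simp
  ultimately show "x : ball 0 1" using a by simp
 qed
 finally have su: "support ?phi \<subseteq> ball 0 1" .
 have "onorm (fderiv ?phi (at x)) <= 1" for x
 proof -
  define D where "D = fderiv (bump (0::real^2) 1) (at (4 *\<^sub>R (x - a)))"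
  have D: "(bump (0::real^2) 1 has_derivative D) (at (4 *\<^sub>R (x - a)))"
  unfolding D_def using C_diff_SucD(1)[of 0 "bump (0::real^2) 1"] C_diff_bump[of "Suc 0" "0::real^2" 1] by simp
  have e: "bump a (1/4) = (%w. bump 0 1 (4 *\<^sub>R (w - a)))"
  by (auto simp: fun_eq_iff bump_def sq_eq mult.commute)
  have "((%w. bump 0 1 (4 *\<^sub>R (w - a))) has_derivative (%h. D (4 *\<^sub>R h))) (at x)"
  by (rule has_derivative_compose[where f="%w. 4 *\<^sub>R (w - a)" and g="bump 0 1" and f'="%h. 4 *\<^sub>R h" and g'=D, OF _ D])
  (auto intro!: derivative_eq_intros)
  hence "(?phi has_derivative (%h. 1 / (4 * bump_slope) * D (4 *\<^sub>R h))) (at x)"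
  unfolding e by (rule has_derivative_mult_right)
  hence f: "fderiv ?phi (at x) = (%h. 1 / (4 * bump_slope) * D (4 *\<^sub>R h))" by (rule frechet_derivative_at[symmetric])
  have bl: "bounded_linear D" by (rule has_derivative_bounded_linear[OF D])
  show ?thesis unfolding f
  proof (rule onorm_le)
  fix h :: "real^2"
  have "norm (D (4 *\<^sub>R h)) <= onorm D * norm (4 *\<^sub>R h)" by (rule onorm[OF bl])
  also have "... <= bump_slope * norm (4 *\<^sub>R h)" using bump_slope(2) by (intro mult_right_mono) (auto simp: D_def)
  finally have "norm (D (4 *\<^sub>R h)) <= 4 * bump_slope * norm h" by simp
  thus "norm (1 / (4 * bump_slope) * D (4 *\<^sub>R h)) <= 1 * norm h"
  using L by (simp add: abs_mult pos_divide_le_eq mult_ac)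
  qed
 qed
 thus ?thesis using sm su by (simp add: hardy_tests_def)
qed

lemma continuous_on_flat: "continuous_on A (flat m)"
 by (rule DERIV_continuous_on) (rule deriv_within[OF flat_deriv])

lemma flat_measurable [measurable]: "flat m : borel_fun"
 by (rule cont_borel[OF continuous_on_flat])

definition flat_area :: real where "flat_area = integral {0..1} (flat 0)"

lemma flat_area_pos: "0 < flat_area"
proof -
 have i: "flat 0 integrable_on {a..b}" for a b by (intro integrable_continuous_interval continuous_on_flat)
 have "integral {1/2..1} (%_::real. exp (-2)) <= integral {1/2..1} (flat 0)"
  by (rule integral_le[OF _ i]) (auto simp: flat_def field_simps)
 also have "... <= flat_area" unfolding flat_area_def
  by (rule integral_subset_le[OF _ i i]) (auto simp: flat_def)
 finally have "1/2 * exp (-2::real) <= flat_area" by simp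
 thus ?thesis using exp_gt_zero[of "-2::real"] by linarith
qed

text \<open>The factor 64 is 4 from the test function times 16 from \<open>t^2 = 16 * r^2\<close>.
  The integral of the unnormalised kernel over the plane is \<open>pi * flat_area * r^2\<close>,
  which accounts for the denominator.\<close>

definition hardy_const :: real where "hardy_const = 64 * bump_slope / (pi * flat_area)"

lemma hardy_const_pos: "0 < hardy_const" using bump_slope(1) flat_area_pos by (simp add: hardy_const_def)

context radial_profile
begin

text \<open>The test kernel \<open>K\<close> is decreasing and \<open>F s - (F r / r\<^sup>2) s\<^sup>2\<close> is nonnegative on \<open>[0, r]\<close>;
 integrating by parts, \<open>2 s g s\<close> may be replaced by \<open>(F r / r\<^sup>2) 2 s\<close>.\<close>

lemma kernel_lower_bound:
 assumes r: "0 < r"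
 shows "F r * flat_area <= integral {0..r} (%s. 2 * s * g s * flat 0 (1 - s\<^sup>2 / r\<^sup>2))"
  "(%s. 2 * s * g s * flat 0 (1 - s\<^sup>2 / r\<^sup>2)) absolutely_integrable_on {0..r}"
proof -
 define c where "c = F r / r\<^sup>2"
 define K K' where "K s = flat 0 (1 - s\<^sup>2 / r\<^sup>2)" and "K' s = - (2 * s / r\<^sup>2) * flat 2 (1 - s\<^sup>2 / r\<^sup>2)" for s
 have fl: "contU (%s. flat m (1 - s\<^sup>2 / r\<^sup>2))" for m
  by (rule cont_comp[OF continuous_on_flat[of UNIV m], where f="%s. 1 - s\<^sup>2 / r\<^sup>2"])
  (use r in \<open>auto intro!: continuous_intros\<close>)
 have dK: "(K has_real_derivative K' s) (at s)" for s
 proof -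
  have d: "((%s. 1 - s\<^sup>2 / r\<^sup>2) has_real_derivative - (2 * s / r\<^sup>2)) (at s)"
  using r by (auto intro!: derivative_eq_intros simp: sq_eq)
  have f: "(flat 0 has_real_derivative flat 2 (1 - s\<^sup>2 / r\<^sup>2)) (at (1 - s\<^sup>2 / r\<^sup>2))"
  using flat_deriv[of 0 "1 - s\<^sup>2 / r\<^sup>2"] by (simp add: numeral_2_eq_2)
  show ?thesis using DERIV_chain2[OF f d] unfolding K_def[abs_def] K'_def by (simp only: mult.commute)
 qed
 have cK: "contU K" "contU K'"
  unfolding K_def[abs_def] K'_def[abs_def] by (rule fl, intro cont_mult fl) (use r in \<open>auto intro!: continuous_intros\<close>)
 have iK: "AC_on 0 r K K'"
  by (rule AC_on_C1[OF dK]) (rule cont_subset[OF cK(2) subset_UNIV])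
 have iE: "AC_on 0 r (%s. F s + (- c) * s\<^sup>2) (%s. 2 * s * g s + (- c) * (2 * s))"
  by (intro AC_on_add F_int AC_on_C1) (use r in \<open>auto intro!: derivative_eq_intros continuous_intros\<close>)
 have iEK: "AC_on 0 r (%s. (F s + (- c) * s\<^sup>2) * K s) (%s. (2 * s * g s + (- c) * (2 * s)) * K s + (F s + (- c) * s\<^sup>2) * K' s)"
  by (rule AC_on_mult[OF iE iK])
 have iFK: "AC_on 0 r (%s. F s * K s) (%s. 2 * s * g s * K s + F s * K' s)"
  by (rule AC_on_mult[OF F_int iK])
 have cF: "continuous_on {0..r} F" by (rule cont_subset[OF F_cont]) auto
 have cK': "continuous_on {0..r} K'" "continuous_on {0..r} K" by (rule cont_subset[OF _ subset_UNIV], rule cK)+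
 have aFK': "(%s. F s * K' s) absolutely_integrable_on {0..r}"
  by (intro absolutely_integrable_continuous_real cont_mult cF cK')
 have "(%s. (2 * s * g s * K s + F s * K' s) - F s * K' s) absolutely_integrable_on {0..r}"
  by (rule set_integral_diff(1)[OF AC_on_abs_integrable[OF iFK order_refl order_refl] aFK'])
 hence agK: "(%s. 2 * s * g s * K s) absolutely_integrable_on {0..r}" by simp
 thus "(%s. 2 * s * g s * flat 0 (1 - s\<^sup>2 / r\<^sup>2)) absolutely_integrable_on {0..r}" by (simp add: K_def)
 have igK: "(%s. 2 * s * g s * K s) integrable_on {0..r}" by (rule set_LINT(1)[OF agK])
 have isK: "(%s. c * (2 * s * K s)) integrable_on {0..r}"
  by (intro integrable_continuous_interval continuous_intros cK')
 have iEK': "(%s. (F s + (- c) * s\<^sup>2) * K' s) integrable_on {0..r}"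
  by (intro integrable_continuous_interval continuous_intros cK' cF)
 have neg: "(F s + (- c) * s\<^sup>2) * K' s <= 0" if "s : {0..r}" for s
 proof (cases "s = 0")
  case False
  hence s: "0 < s" "s <= r" using that by auto
  have "c <= F s / s\<^sup>2" unfolding c_def by (rule F_over_square_antimono[OF s])
  hence "0 <= F s + (- c) * s\<^sup>2" using s by (simp add: pos_le_divide_eq)
  moreover have "K' s <= 0" using s by (simp add: K'_def flat_def)
  ultimately show ?thesis by (rule mult_nonneg_nonpos)
 qed (simp add: K'_def)
 have K0: "K r = 0" using r by (simp add: K_def flat_def)
 \<comment> \<open>The boundary terms vanish, at 0 because \<open>F 0 = 0\<close> and at
   \<open>r\<close> because the kernel does.\<close>
 have "0 = integral {0..r} (%s. (2 * s * g s + (- c) * (2 * s)) * K s + (F s + (- c) * s\<^sup>2) * K' s)"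
  using AC_onD[OF iEK order_refl _ order_refl] r F_0 K0 by simp
 also have "... = integral {0..r} (%s. (2 * s * g s * K s - c * (2 * s * K s)) + (F s + (- c) * s\<^sup>2) * K' s)"
  by (simp add: algebra_simps)
 also have "... = integral {0..r} (%s. 2 * s * g s * K s) - integral {0..r} (%s. c * (2 * s * K s)) + integral {0..r} (%s. (F s + (- c) * s\<^sup>2) * K' s)"
  by (subst integral_add[OF integrable_diff[OF igK isK] iEK']) (simp add: integral_diff[OF igK isK])
 finally have "integral {0..r} (%s. c * (2 * s * K s)) <= integral {0..r} (%s. 2 * s * g s * K s)"
  using integral_le[OF iEK' integrable_0 neg] by simp
 moreover have "integral {0..r} (%s. c * (2 * s * K s)) = F r * flat_area"
 proof -
  have FT: "((%v. integral {0..v} (flat 0)) has_real_derivative flat 0 v) (at v within {0..1})" if "v : {0..1}" for v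
  using integral_has_real_derivative[OF continuous_on_flat that] .
  \<comment> \<open>The substitution \<open>v = 1 - s^2 / r^2\<close>, written as an explicit
    primitive.\<close>
  have "((%s. 2 * s * K s) has_integral (- (r\<^sup>2) * integral {0..1 - r\<^sup>2 / r\<^sup>2} (flat 0) - (- (r\<^sup>2) * integral {0..1 - 0\<^sup>2 / r\<^sup>2} (flat 0)))) {0..r}"
  proof (rule FTC)
  show "0 <= r" using r by simp
  fix s assume s: "s : {0..r}"
  have v: "(%s. 1 - s\<^sup>2 / r\<^sup>2) ` {0..r} \<subseteq> {0..1}" using r by (auto simp: power_mono)
  have d: "((%s. 1 - s\<^sup>2 / r\<^sup>2) has_real_derivative - (2 * s / r\<^sup>2)) (at s within {0..r})"
  using r by (auto intro!: derivative_eq_intros simp: sq_eq)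
  have vs: "1 - s\<^sup>2 / r\<^sup>2 : {0..1}" using v s by (rule image_subset_iff[THEN iffD1, THEN bspec])
  have "((%s. integral {0..1 - s\<^sup>2 / r\<^sup>2} (flat 0)) has_real_derivative flat 0 (1 - s\<^sup>2 / r\<^sup>2) * - (2 * s / r\<^sup>2)) (at s within {0..r})"
  using DERIV_image_chain[OF DERIV_subset[OF FT[OF vs] v] d] by (simp add: o_def)
  from DERIV_cmult[OF this, of "- (r\<^sup>2)"]
  have "((%s. - (r\<^sup>2) * integral {0..1 - s\<^sup>2 / r\<^sup>2} (flat 0)) has_real_derivative 2 * s * K s) (at s within {0..r})"
  using r by (simp add: K_def mult_ac)
  thus "((%s. - (r\<^sup>2) * integral {0..1 - s\<^sup>2 / r\<^sup>2} (flat 0)) has_vector_derivative 2 * s * K s) (at s within {0..r})"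
  by (simp add: real_vec_deriv)
  qed
  hence "integral {0..r} (%s. 2 * s * K s) = r\<^sup>2 * flat_area" using r by (simp add: flat_area_def integral_unique)
  thus ?thesis using r by (simp add: c_def)
 qed
 ultimately show "F r * flat_area <= integral {0..r} (%s. 2 * s * g s * flat 0 (1 - s\<^sup>2 / r\<^sup>2))" by (simp add: K_def)
qed

text \<open>A single test function at a single scale suffices: its kernel is radial about the origin
  and supported in the disc of radius \<open>norm x\<close>, so the polar form of the integral is
  the one in \<open>kernel_lower_bound\<close>.\<close>

lemma F_le_grand_maximal:
 assumes f: "f : borel_measurable lebesgue" "AE x in lebesgue. f x = g (norm x)" and x: "x ~= 0"
 shows "ennreal (F (norm x) / (norm x)^2 / hardy_const) <= grand_maximal f x"
proof -
 define r where "r = norm x"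
 define t where "t = 4 * r"
 have r: "0 < r" "0 < t" using x by (simp_all add: r_def t_def)
 define phi where "phi w = 1 / (4 * bump_slope) * bump (x /\<^sub>R t) (1/4) w" for w :: "real^2"
 have phi: "phi \<in> hardy_tests" unfolding phi_def[abs_def]
  by (rule scaled_bump_hardy_test) (use r in \<open>simp add: t_def r_def[symmetric]\<close>)
 define k where "k y = 1 / (64 * bump_slope * r\<^sup>2) * flat 0 (1 - (norm y)^2 / r\<^sup>2)" for y :: "real^2"
 have k: "phi ((x - y) /\<^sub>R t) / t\<^sup>2 = k y" for y
 proof -
  have "(x - y) /\<^sub>R t - x /\<^sub>R t = - (y /\<^sub>R t)" by (simp add: scaleR_diff_right)
  hence "phi ((x - y) /\<^sub>R t) = 1 / (4 * bump_slope) * flat 0 (1 - ((y /\<^sub>R t) \<bullet> (y /\<^sub>R t)) / (1/4)^2)"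
  unfolding phi_def bump_def by (simp only: inner_minus_left inner_minus_right minus_minus)
  moreover have "((y /\<^sub>R t) \<bullet> (y /\<^sub>R t)) / (1/4)^2 = (norm y)^2 / r\<^sup>2"
  proof -
  have "(y /\<^sub>R t) \<bullet> (y /\<^sub>R t) = (norm y / t)^2"
  unfolding power2_norm_eq_inner[symmetric] norm_scaleR using r by (simp only: abs_inverse abs_of_pos divide_inverse mult.commute)
  also have "... / (1/4)^2 = (norm y / t / (1/4))^2" by (rule power_divide[symmetric])
  also have "norm y / t / (1/4) = norm y / r" by (simp add: t_def)
  finally show ?thesis by (simp only: power_divide)
  qed
  ultimately have "phi ((x - y) /\<^sub>R t) = 1 / (4 * bump_slope) * flat 0 (1 - (norm y)^2 / r\<^sup>2)" by (simp only:)
  thus ?thesis using r by (simp add: k_def t_def power_mult_distrib)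
 qed
 have [measurable]: "k : borel_fun" unfolding k_def[abs_def]
  by measurable
 define h where "h y = g (norm y) * k y" for y :: "real^2"
 have hm [measurable]: "h : borel_fun" unfolding h_def[abs_def] by measurable
 have "(LINT y|lebesgue. f y * (phi ((x - y) /\<^sub>R t) / t\<^sup>2)) = (LINT y|lebesgue. h y)"
  unfolding k
 proof (rule integral_cong_AE)
  show "(%y. f y * k y) : borel_measurable lebesgue"
  by (intro borel_measurable_times f(1) measurable_completion) simp
  show "h : borel_measurable lebesgue" by (intro measurable_completion) simp
  show "AE y in lebesgue. f y * k y = h y" using f(2) by eventually_elim (simp add: h_def)
 qed
 also have "... = (LINT y|lborel. h y)" by (rule integral_completion) simp
 also have "... = pi / (64 * bump_slope * r\<^sup>2) * integral {0..r} (%s. 2 * s * g s * flat 0 (1 - s\<^sup>2 / r\<^sup>2))"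
 proof -
  define q where "q s = g s * (1 / (64 * bump_slope * r\<^sup>2) * flat 0 (1 - s\<^sup>2 / r\<^sup>2))" for s
  have [measurable]: "(%s. flat 0 (1 - s\<^sup>2 / r\<^sup>2)) : borel_fun"
  by measurable
  have [measurable]: "q : borel_fun" unfolding q_def[abs_def] by measurable
  have a: "(%s. 2 * s * g s * flat 0 (1 - s\<^sup>2 / r\<^sup>2)) absolutely_integrable_on {0..r}" by (rule kernel_lower_bound(2)[OF r(1)])
  have sq: "ind {0..r} s * (2 * s * g s * flat 0 (1 - s\<^sup>2 / r\<^sup>2)) = (128 * bump_slope * r\<^sup>2) * (ind {0..} s * (s * q s))" for s
  proof (cases "r < s")
  case True
  hence "1 - s\<^sup>2 / r\<^sup>2 < 0" using r by (simp add: power_strict_mono)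
  thus ?thesis by (simp add: q_def flat_def)
  next
  case False thus ?thesis using r bump_slope(1) by (cases "0 <= s") (auto simp: q_def field_simps)
  qed
  have "set_integrable lborel {0..r} (%s. 2 * s * g s * flat 0 (1 - s\<^sup>2 / r\<^sup>2))"
  using a unfolding set_integrable_def by (subst (asm) integrable_completion) auto
  hence "integrable lborel (%s. (128 * bump_slope * r\<^sup>2) * (ind {0..} s * (s * q s)))"
  unfolding set_integrable_def by (simp only: real_scaleR_def sq)
  hence iq: "integrable lborel (%s. ind {0..} s * (s * q s))" using r bump_slope(1) by simp
  have hq: "h = (%y. q (norm y))" by (simp add: h_def k_def q_def fun_eq_iff)
  have ih: "integrable lborel (%y::real^2. q (norm y))" using iq radial_integral(1)[of q] by (simp add: set_integrable_def)
  have "(LINT y|lborel. h y) = 2 * pi * (LINT s|lborel. ind {0..} s * (s * q s))"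
  unfolding hq using radial_integral(2)[OF _ ih] by (simp add: set_lebesgue_integral_def)
  also have "... = 2 * pi / (128 * bump_slope * r\<^sup>2) * (LINT s|lborel. (128 * bump_slope * r\<^sup>2) * (ind {0..} s * (s * q s)))"
  using r bump_slope(1) by (simp only: integral_mult_right_zero) simp
  also have "(LINT s|lborel. (128 * bump_slope * r\<^sup>2) * (ind {0..} s * (s * q s))) = (LINT s:{0..r}|lborel. 2 * s * g s * flat 0 (1 - s\<^sup>2 / r\<^sup>2))"
  unfolding set_lebesgue_integral_def real_scaleR_def sq ..
  also have "... = (LINT s:{0..r}|lebesgue. 2 * s * g s * flat 0 (1 - s\<^sup>2 / r\<^sup>2))"
  unfolding set_lebesgue_integral_def by (rule integral_completion[symmetric]) measurable
  also have "... = integral {0..r} (%s. 2 * s * g s * flat 0 (1 - s\<^sup>2 / r\<^sup>2))"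
  by (rule set_LINT(2)[OF a])
  finally show ?thesis by simp
 qed
 finally have I: "(LINT y|lebesgue. f y * (phi ((x - y) /\<^sub>R t) / t\<^sup>2)) = pi / (64 * bump_slope * r\<^sup>2) * integral {0..r} (%s. 2 * s * g s * flat 0 (1 - s\<^sup>2 / r\<^sup>2))" .
 have "F r / r\<^sup>2 / hardy_const = pi / (64 * bump_slope * r\<^sup>2) * (F r * flat_area)"
  using r bump_slope(1) flat_area_pos by (simp add: hardy_const_def field_simps)
 also have "... <= (LINT y|lebesgue. f y * (phi ((x - y) /\<^sub>R t) / t\<^sup>2))"
  unfolding I using kernel_lower_bound(1)[OF r(1)] bump_slope(1) by (intro mult_left_mono) auto
 finally have "ennreal (F r / r\<^sup>2 / hardy_const) <= ennreal \<bar>LINT y|lebesgue. f y * (phi ((x - y) /\<^sub>R t) / t\<^sup>2)\<bar>"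
  by (intro ennreal_leI) linarith
 also have "... <= grand_maximal f x" unfolding grand_maximal_def
  by (rule SUP_upper2[of "(phi, t)"]) (use phi r in auto)
 finally show ?thesis by (simp add: r_def)
qed

text \<open>The factor 2 is that of \<open>E0_le\<close>. The rest is
  \<open>F_le_grand_maximal\<close> raised to the power \<open>p\<close> and integrated.\<close>

lemma E0_power_bound:
 assumes f: "f : borel_measurable lebesgue" "AE x in lebesgue. f x = g (norm x)" and p: "1 <= p"
  and H: "(nnint lebesgue (%x. ennreal_powr (grand_maximal f x) p)) < \<infinity>"
 shows "integrable lborel (%x::real^2. E0 (norm x) powr p)"
  "(LINT x|(lborel::(real^2) measure). E0 (norm x) powr p) <= (2 * hardy_const) powr p * enn2real (nnint lebesgue (%x. ennreal_powr (grand_maximal f x) p))"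
proof -
 let ?H = "nnint lebesgue (%x. ennreal_powr (grand_maximal f x) p)"
 have [measurable]: "(%x::real^2. E0 (norm x)) : borel_fun"
  using measurable_compose[of norm borel borel "%r. E0 \<bar>r\<bar>" borel, OF _ E0_measurable] by simp
 define e where "e x = (E0 (norm x) / (2 * hardy_const)) powr p" for x :: "real^2"
 have em [measurable]: "e : borel_fun" unfolding e_def[abs_def] by measurable
 have "(nnint lborel (%x. ennreal (norm (e x)))) = (nnint lebesgue (%x. ennreal (norm (e x))))" by (simp add: nn_integral_completion)
 also have "... <= ?H"
 proof (rule nn_integral_mono_AE)
  have "AE x in (lebesgue :: (real^2) measure). x ~= 0 & \<bar>g (norm x)\<bar> <= F (norm x) / (norm x)^2"
  by (rule AE_completion[OF AE_g_le_norm])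
  thus "AE x in lebesgue. ennreal (norm (e x)) <= ennreal_powr (grand_maximal f x) p"
  proof eventually_elim
  fix x :: "real^2" assume x: "x ~= 0 & \<bar>g (norm x)\<bar> <= F (norm x) / (norm x)^2"
  define M where "M = grand_maximal f x"
  have E: "0 <= E0 (norm x)" "E0 (norm x) <= 2 * (F (norm x) / (norm x)^2)" using E0_le[OF conjunct2[OF x]] by simp_all
  have "E0 (norm x) / (2 * hardy_const) <= F (norm x) / (norm x)^2 / hardy_const"
  using E(2) hardy_const_pos divide_right_mono[OF E(2), of "2 * hardy_const"] by simp
  hence "ennreal (E0 (norm x) / (2 * hardy_const)) <= M"
  unfolding M_def by (rule order_trans[OF ennreal_leI F_le_grand_maximal[OF f conjunct1[OF x]]])
  moreover have nn: "0 <= E0 (norm x) / (2 * hardy_const)" using E hardy_const_pos by simp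
  ultimately have "E0 (norm x) / (2 * hardy_const) <= enn2real M" if "M ~= \<infinity>"
  using enn2real_mono[of "ennreal (E0 (norm x) / (2 * hardy_const))" M] that by (simp only: enn2real_ennreal less_top infinity_ennreal_def)
  hence "e x <= enn2real M powr p" if "M ~= \<infinity>"
  unfolding e_def using nn that p by (intro powr_mono2) auto
  thus "ennreal (norm (e x)) <= ennreal_powr (grand_maximal f x) p"
  unfolding ennreal_powr_def M_def[symmetric] by (auto simp: e_def intro: ennreal_leI)
  qed
 qed
 finally have le: "(nnint lborel (%x. ennreal (norm (e x)))) <= ?H" .
 have ie: "integrable lborel e" using le H by (intro integrableI_bounded) (auto intro: le_less_trans)
 have E: "AE x in (lborel::(real^2) measure). E0 (norm x) powr p = (2 * hardy_const) powr p * e x"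
  using AE_g_le_norm
 proof eventually_elim
  fix x :: "real^2" assume x: "x ~= 0 & \<bar>g (norm x)\<bar> <= F (norm x) / (norm x)^2"
  have "0 <= E0 (norm x)" using E0_le[OF conjunct2[OF x]] by simp
  hence "(2 * hardy_const * (E0 (norm x) / (2 * hardy_const))) powr p = (2 * hardy_const) powr p * e x"
  unfolding e_def using hardy_const_pos by (intro powr_mult)
  thus "E0 (norm x) powr p = (2 * hardy_const) powr p * e x" using hardy_const_pos by simp
 qed
 show "integrable lborel (%x::real^2. E0 (norm x) powr p)"
  using integrable_cong_AE[OF _ _ E] ie by simp
 have "(LINT x|(lborel::(real^2) measure). E0 (norm x) powr p) = (2 * hardy_const) powr p * (LINT x|lborel. e x)"
  using integral_cong_AE[OF _ _ E] by simp
 also have "(LINT x|lborel. e x) <= enn2real ?H"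
 proof -
  have "(LINT x|lborel. e x) = enn2real (nnint lborel (%x. ennreal (norm (e x))))"
  by (subst integral_eq_nn_integral) (auto simp: e_def)
  thus ?thesis using le H by (simp add: enn2real_mono)
 qed
 finally show "(LINT x|(lborel::(real^2) measure). E0 (norm x) powr p) <= (2 * hardy_const) powr p * enn2real ?H"
  by (simp add: mult_left_mono)
qed

end

section \<open>Signed count of the zeros of a planar map\<close>

lemma C1_grad_mult:
 assumes "C1_grad a a1 a2" "C1_grad b b1 b2"
 shows "C1_grad (%x. a x * b x) (%x. a1 x * b x + a x * b1 x) (%x. a2 x * b x + a x * b2 x)"
 unfolding C1_grad_def
proof (intro conjI allI)
 fix x
 show "((%x. a x * b x) has_derivative (%h. h $ 1 * (a1 x * b x + a x * b1 x) + h $ 2 * (a2 x * b x + a x * b2 x))) (at x)"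
  by (rule has_derivative_eq_rhs[OF has_derivative_mult[OF C1_gradD(3)[OF assms(1)] C1_gradD(3)[OF assms(2)]]]) (auto simp: fun_eq_iff algebra_simps)
qed (intro cont_add cont_mult C1_gradD[OF assms(1)] C1_gradD[OF assms(2)])+

lemma C1_grad_add:
 assumes "C1_grad a a1 a2" "C1_grad b b1 b2"
 shows "C1_grad (%x. a x + b x) (%x. a1 x + b1 x) (%x. a2 x + b2 x)"
 unfolding C1_grad_def
proof (intro conjI allI)
 fix x
 show "((%x. a x + b x) has_derivative (%h. h $ 1 * (a1 x + b1 x) + h $ 2 * (a2 x + b2 x))) (at x)"
  by (rule has_derivative_eq_rhs[OF has_derivative_add[OF C1_gradD(3)[OF assms(1)] C1_gradD(3)[OF assms(2)]]]) (auto simp: fun_eq_iff algebra_simps)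
qed (intro cont_add C1_gradD[OF assms(1)] C1_gradD[OF assms(2)])+

lemma C1_grad_compose:
 fixes a a1 a2 :: "real^2 => real" and phi phi' :: "real => real"
 assumes "C1_grad a a1 a2" "!!s. (phi has_real_derivative phi' s) (at s)" "contU phi'"
 shows "C1_grad (%x. phi (a x)) (%x. phi' (a x) * a1 x) (%x. phi' (a x) * a2 x)"
 unfolding C1_grad_def
proof (intro conjI allI)
 fix x
 show "((%x. phi (a x)) has_derivative (%h. h $ 1 * (phi' (a x) * a1 x) + h $ 2 * (phi' (a x) * a2 x))) (at x)"
  by (rule has_derivative_eq_rhs[OF has_derivative_compose[OF C1_gradD(3)[OF assms(1)] assms(2)[unfolded has_field_derivative_def]]]) (auto simp: fun_eq_iff algebra_simps)
 have "contU (%x. phi' (a x))"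
  by (rule cont_comp[where g=phi' and f=a, OF assms(3) C1_gradD(4)[OF assms(1)]]) simp
 thus "contU (%x. phi' (a x) * a1 x)" "contU (%x. phi' (a x) * a2 x)"
  by (intro cont_mult C1_gradD[OF assms(1)]; assumption)+
qed

lemma C1_grad_coordinate: "C1_grad (%x. x $ 1) (%_. 1) (%_. 0)" "C1_grad (%x. x $ 2) (%_. 0) (%_. 1)"
 by (auto simp: C1_grad_def intro!: bounded_linear_imp_has_derivative bounded_linear_vec_nth)

lemma integral_ball_polar:
 fixes h :: "real^2 => real"
 assumes h: "contU h" and R: "0 < R"
 shows "h absolutely_integrable_on (ball 0 R)"
  "integral (ball 0 R) h = integral {0..R} (%s. circ_int (%t. s * h (pol s t)))"
proof -
 have hm [measurable]: "h : borel_fun" by (rule cont_borel[OF h])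
 have 0: "h absolutely_integrable_on (cbox (vec (-R)) (vec R))"
  by (rule absolutely_integrable_continuous[OF cont_subset[OF h]]) simp
 have 1: "ball 0 R \<subseteq> cbox (vec (-R)) (vec R :: real^2)"
 proof
  fix x :: "real^2" assume "x : ball 0 R"
  hence "\<bar>x $ i\<bar> <= R" for i using component_le_norm_cart[of x i] by simp
  thus "x : cbox (vec (-R)) (vec R)" by (auto simp: mem_box_cart abs_le_iff minus_le_iff)
 qed
 show ai: "h absolutely_integrable_on (ball 0 R)" by (rule set_integrable_subset[OF 0 _ 1]) simp
 define k where "k x = ind (ball 0 R) x * h x" for x
 have km [measurable]: "k : borel_fun" unfolding k_def[abs_def] by (intro borel_measurable_times borel_measurable_indicator hm) simp
 have ki: "integrable lborel k"
  using ai unfolding set_integrable_def k_def[abs_def] real_scaleR_def by (subst (asm) integrable_completion) (simp_all add: km[unfolded k_def[abs_def]])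
 have hp: "contU (%t. h (pol s t))" for s
  by (rule cont_comp[where g=h and f="%t. pol s t", OF h continuous_on_pol[OF cont_const cont_id] subset_UNIV])
 have mk: "(%s. LINT t|circm. k (pol s t)) : borel_fun" by measurable
 have mh: "(%s. LINT t|circm. h (pol s t)) : borel_fun" by measurable
 have mi: "(%s. circ_int (%t. h (pol s t))) : borel_fun" using mh unfolding integral_circm(2)[OF hp] .
 have "integral (ball 0 R) h = (LINT x:ball 0 R|lebesgue. h x)" by (rule set_LINT(2)[OF ai, symmetric])
 also have "... = (LINT x|lborel. k x)"
  unfolding set_lebesgue_integral_def real_scaleR_def k_def[abs_def] by (rule integral_completion) (simp add: km[unfolded k_def[abs_def]])
 also have "... = (LINT s|radm. LINT t|circm. k (pol s t))" by (rule integral_polar[OF ki])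
 also have "... = (LINT s|radm. ind {0..R} s * circ_int (%t. h (pol s t)))"
 proof (rule integral_cong_AE)
  show "(%s. LINT t|circm. k (pol s t)) : borel_measurable radm" using mk by (simp add: radm_def)
  have "(%s. ind {0..R} s * circ_int (%t. h (pol s t))) : borel_fun"
  by (intro borel_measurable_times borel_measurable_indicator mi) simp
  thus "(%s. ind {0..R} s * circ_int (%t. h (pol s t))) : borel_measurable radm" by (simp add: radm_def)
  have "AE s in radm. 0 < s" by (simp add: AE_radm_iff)
  moreover have "AE s in radm. s ~= R" using AE_lborel_singleton[of R] by (auto simp: AE_radm_iff)
  ultimately show "AE s in radm. (LINT t|circm. k (pol s t)) = ind {0..R} s * circ_int (%t. h (pol s t))"
  by eventually_elim (auto simp: k_def integral_circm(2)[OF hp] indicator_def)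
 qed
 also have "... = (LINT s|lborel. (ind {0..R} s * s) *\<^sub>R circ_int (%t. h (pol s t)))"
 proof -
  have m2: "(%s. ind {0..R} s * circ_int (%t. h (pol s t))) : borel_measurable lborel"
  using borel_measurable_times[OF borel_measurable_indicator mi, of "{0..R}"] by simp
  have e: "radm = density lborel (%s. ennreal (ind {0..} s * s))" unfolding radm_def
  by (rule density_cong) (auto simp: ennreal_neg indicator_def)
  have "(LINT s|radm. ind {0..R} s * circ_int (%t. h (pol s t))) = (LINT s|lborel. (ind {0..} s * s) *\<^sub>R (ind {0..R} s * circ_int (%t. h (pol s t))))"
  unfolding e by (rule integral_density[OF m2]) (auto simp: indicator_def)
  also have "... = (LINT s|lborel. (ind {0..R} s * s) *\<^sub>R circ_int (%t. h (pol s t)))"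
  by (rule LINT_cong) (auto simp: indicator_def)
  finally show ?thesis .
 qed
 also have "... = (LINT s:{0..R}|lborel. s * circ_int (%t. h (pol s t)))"
  unfolding set_lebesgue_integral_def by (rule LINT_cong) (auto simp: mult_ac)
 also have "... = integral {0..R} (%s. s * circ_int (%t. h (pol s t)))"
 proof (rule set_borel_integral_eq_integral(2))
  have "continuous_on {0..R} (%s. s * circ_int (%t. h (pol s t)))"
  proof (intro cont_mult cont_id)
  have "continuous_on ({0..R} \<times> cbox 0 (2*pi)) (%(s, t). h (pol s t))"
  unfolding case_prod_unfold
  by (rule cont_comp[where g=h, OF h continuous_on_pol[OF cont_fst[OF cont_id] cont_snd[OF cont_id]] subset_UNIV])
  from integral_continuous_on_param[OF this] show "continuous_on {0..R} (%s. circ_int (%t. h (pol s t)))" by simp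
  qed
  thus "set_integrable lborel {0..R} (%s. s * circ_int (%t. h (pol s t)))" by (rule borel_integrable_atLeastAtMost')
 qed
 finally show "integral (ball 0 R) h = integral {0..R} (%s. circ_int (%t. s * h (pol s t)))" by simp
qed

lemma area_formula_ball:
 assumes a: "C1_grad a a1 a2" and b: "C1_grad b b1 b2" and R: "0 < R"
 shows "circ_int (%t. a (pol R t) * ang_comp b1 b2 R t - b (pol R t) * ang_comp a1 a2 R t)
  = 2 * integral (ball 0 R) (%x. a1 x * b2 x - a2 x * b1 x)"
proof -
 have c: "contU (%x. a1 x * b2 x - a2 x * b1 x)"
  by (intro cont_diff cont_mult C1_gradD[OF a] C1_gradD[OF b])
 have "rad_comp a1 a2 s t * ang_comp b1 b2 s t - rad_comp b1 b2 s t * ang_comp a1 a2 s t = s * (a1 (pol s t) * b2 (pol s t) - a2 (pol s t) * b1 (pol s t))" for s t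
 proof -
  have cs: "cos t * cos t + sin t * sin t = 1" using sin_cos_squared_add2[of t] by (simp add: sq_eq)
  have "rad_comp a1 a2 s t * ang_comp b1 b2 s t - rad_comp b1 b2 s t * ang_comp a1 a2 s t
  = s * (a1 (pol s t) * b2 (pol s t) - a2 (pol s t) * b1 (pol s t)) * (cos t * cos t + sin t * sin t)"
  unfolding rad_comp_def ang_comp_def by algebra
  thus ?thesis unfolding cs by simp
 qed
 thus ?thesis unfolding area_formula[OF a b less_imp_le[OF R]] integral_ball_polar(2)[OF c R] by simp
qed

text \<open>The profile of a \<open>C\<^sup>1\<close> map \<open>w \<mapsto> sqrt (cut \<bar>w\<bar>\<^sup>2) w\<close> which is \<open>w / \<bar>w\<bar>\<close> outside the unit disc, so that
 its Jacobian is a bump in the unit disc.\<close>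

definition cut :: "real => real" where "cut s = (if s < 1 then 2 - s else 1 / s)"
definition cut' :: "real => real" where "cut' s = - 1 / (max 1 s)^2"

lemma cut_pos: "0 < cut s" by (auto simp: cut_def)

lemma cut_deriv: "(cut has_real_derivative cut' s) (at s)"
proof -
 consider "s < 1" | "1 < s" | "s = 1" by linarith
 thus ?thesis
 proof cases
  case 1
  have "((%s. 2 - s) has_real_derivative -1) (at s)" by (auto intro!: derivative_eq_intros)
  hence "(cut has_real_derivative -1) (at s)"
  by (rule has_field_derivative_transform_within_open[where S="{..<1}"]) (use 1 in \<open>auto simp: cut_def\<close>)
  thus ?thesis using 1 by (simp add: cut'_def)
 next
  case 2
  have "((%s. 1 / s) has_real_derivative - 1 / s\<^sup>2) (at s)" using 2 by (auto intro!: derivative_eq_intros simp: sq_eq)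
  hence "(cut has_real_derivative - 1 / s\<^sup>2) (at s)"
  by (rule has_field_derivative_transform_within_open[where S="{1<..}"]) (use 2 in \<open>auto simp: cut_def\<close>)
  thus ?thesis using 2 by (simp add: cut'_def max_def)
 next
  case 3
  \<comment> \<open>The two branches meet at 1 with the same value and slope; the quotient from the
    right is off by \<open>(y - 1) / y\<close>.\<close>
  have b: "norm ((cut y - cut 1) / (y - 1) - (-1)) <= \<bar>y - 1\<bar>" if "y ~= 1" for y
  proof (cases "y < 1")
  case True
  hence "(cut y - cut 1) / (y - 1) = -1" by (simp add: cut_def field_simps)
  thus ?thesis by simp
  next
  case False
  hence y: "1 < y" using that by simp
  hence "(cut y - cut 1) / (y - 1) - (-1) = (y - 1) / y" by (simp add: cut_def field_simps)
  thus ?thesis using y by (simp add: pos_divide_le_eq)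
  qed
  have "((%y. (cut y - cut 1) / (y - 1) - (-1)) \<longlongrightarrow> 0) (at 1)"
  proof (rule Lim_null_comparison)
  show "\<forall>\<^sub>F y in at 1. norm ((cut y - cut 1) / (y - 1) - (-1)) <= \<bar>y - 1\<bar>"
  using b by (auto simp: eventually_at_filter)
  have "((%y::real. \<bar>y - 1\<bar>) \<longlongrightarrow> \<bar>1 - 1\<bar>) (at 1)" by (intro tendsto_intros)
  thus "((%y::real. \<bar>y - 1\<bar>) \<longlongrightarrow> 0) (at 1)" by simp
  qed
  hence "((%y. (cut y - cut 1) / (y - 1)) \<longlongrightarrow> -1) (at 1)" by (rule LIM_zero_cancel)
  thus ?thesis using 3 by (simp add: has_field_derivative_iff cut'_def)
 qed
qed

lemma continuous_cut: "continuous_on A cut" "continuous_on A cut'"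
proof -
 show "continuous_on A cut" by (rule DERIV_continuous_on) (rule deriv_within[OF cut_deriv])
 show "continuous_on A cut'" unfolding cut'_def[abs_def] by (intro continuous_intros) (auto simp: max_def)
qed

text \<open>The factor by which capping multiplies the Jacobian, as a function of the squared
  modulus \<open>s\<close>: the derivative of the new squared modulus
  \<open>s * cut s\<close>.\<close>

definition core :: "real => real" where "core s = cut s + s * cut' s"

lemma core_eq: "core s = 2 * max 0 (1 - s)"
 by (auto simp: core_def cut_def cut'_def max_def sq_eq)

lemma continuous_core: "continuous_on A core"
 unfolding core_eq[abs_def] by (intro continuous_intros)

text \<open>The area formula for the capped map. On the boundary \<open>cut s = 1 / s\<close>, so
  its line integrand is the differential of the argument; inside, the Jacobian acquires the factor
  \<open>core\<close>.\<close>

lemma capped_map_area: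
 assumes a: "C1_grad a a1 a2" and b: "C1_grad b b1 b2" and R: "0 < R"
  and far: "!!x. norm x = R ==> 1 <= a x * a x + b x * b x"
 shows "circ_int (%t. (a (pol R t) * ang_comp b1 b2 R t - b (pol R t) * ang_comp a1 a2 R t) / (a (pol R t) * a (pol R t) + b (pol R t) * b (pol R t)))
  = 2 * integral (ball 0 R) (%x. core (a x * a x + b x * b x) * (a1 x * b2 x - a2 x * b1 x))"
proof -
 define S where "S x = a x * a x + b x * b x" for x
 define S1 S2 where "S1 x = (a1 x * a x + a x * a1 x) + (b1 x * b x + b x * b1 x)" and "S2 x = (a2 x * a x + a x * a2 x) + (b2 x * b x + b x * b2 x)" for x
 have S: "C1_grad S S1 S2" unfolding S_def[abs_def] S1_def[abs_def] S2_def[abs_def]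
  by (intro C1_grad_add C1_grad_mult a b)
 \<comment> \<open>\<open>m\<close> is the scalar factor of the capped map. The relations
   \<open>m^2 = cut S\<close> and \<open>2 * m * k = cut' S\<close> eliminate the square roots from
   what follows.\<close>
 define m k where "m x = sqrt (cut (S x))" and "k x = cut' (S x) * inverse (sqrt (cut (S x))) / 2" for x
 have dsq: "((%s. sqrt (cut s)) has_real_derivative cut' s * inverse (sqrt (cut s)) / 2) (at s)" for s
  using DERIV_chain2[OF DERIV_real_sqrt[OF cut_pos[of s]] cut_deriv] by (simp add: mult_ac)
 have csq: "contU (%s. cut' s * inverse (sqrt (cut s)) / 2)"
  using cut_pos by (intro continuous_intros continuous_cut) (auto simp: less_le)
 have m: "C1_grad m (%x. k x * S1 x) (%x. k x * S2 x)"
  unfolding m_def[abs_def] k_def by (rule C1_grad_compose[OF S dsq csq])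
 have m2: "m x * m x = cut (S x)" for x unfolding m_def using cut_pos[of "S x"] by simp
 have mk: "2 * m x * k x = cut' (S x)" for x
  using cut_pos[of "S x"] by (simp add: m_def k_def field_simps)
 have A: "C1_grad (%x. a x * m x) (%x. a1 x * m x + a x * (k x * S1 x)) (%x. a2 x * m x + a x * (k x * S2 x))" by (rule C1_grad_mult[OF a m])
 have B: "C1_grad (%x. b x * m x) (%x. b1 x * m x + b x * (k x * S1 x)) (%x. b2 x * m x + b x * (k x * S2 x))" by (rule C1_grad_mult[OF b m])
 have bd: "a (pol R t) * m (pol R t) * ang_comp (%x. b1 x * m x + b x * (k x * S1 x)) (%x. b2 x * m x + b x * (k x * S2 x)) R t
  - b (pol R t) * m (pol R t) * ang_comp (%x. a1 x * m x + a x * (k x * S1 x)) (%x. a2 x * m x + a x * (k x * S2 x)) R t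
  = (a (pol R t) * ang_comp b1 b2 R t - b (pol R t) * ang_comp a1 a2 R t) / (a (pol R t) * a (pol R t) + b (pol R t) * b (pol R t))" for t
 proof -
  \<comment> \<open>A common scalar factor enters the line integrand by its square only; its
    derivative cancels.\<close>
  have "a (pol R t) * m (pol R t) * ang_comp (%x. b1 x * m x + b x * (k x * S1 x)) (%x. b2 x * m x + b x * (k x * S2 x)) R t
  - b (pol R t) * m (pol R t) * ang_comp (%x. a1 x * m x + a x * (k x * S1 x)) (%x. a2 x * m x + a x * (k x * S2 x)) R t
  = (m (pol R t) * m (pol R t)) * (a (pol R t) * ang_comp b1 b2 R t - b (pol R t) * ang_comp a1 a2 R t)"
  unfolding ang_comp_def by algebra
  also have "... = (a (pol R t) * ang_comp b1 b2 R t - b (pol R t) * ang_comp a1 a2 R t) / S (pol R t)"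
  unfolding m2 using far[of "pol R t"] R by (simp add: cut_def S_def)
  finally show ?thesis unfolding S_def .
 qed
 have jac: "(a1 x * m x + a x * (k x * S1 x)) * (b2 x * m x + b x * (k x * S2 x)) - (a2 x * m x + a x * (k x * S2 x)) * (b1 x * m x + b x * (k x * S1 x))
  = core (S x) * (a1 x * b2 x - a2 x * b1 x)" for x
 proof -
  have "(a1 x * m x + a x * (k x * S1 x)) * (b2 x * m x + b x * (k x * S2 x)) - (a2 x * m x + a x * (k x * S2 x)) * (b1 x * m x + b x * (k x * S1 x))
  = (m x * m x + S x * (2 * m x * k x)) * (a1 x * b2 x - a2 x * b1 x)"
  unfolding S_def S1_def S2_def by algebra
  thus ?thesis unfolding m2 mk core_def .
 qed
 show ?thesis using area_formula_ball[OF A B R] unfolding bd jac S_def .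
qed

text \<open>The case of the identity map, whose argument changes by \<open>2 * pi\<close> around the
  unit circle.\<close>

lemma integral_core: "integral (ball (0::real^2) 1) (%x. core (x $ 1 * x $ 1 + x $ 2 * x $ 2)) = pi"
proof -
 have n: "x $ 1 * x $ 1 + x $ 2 * x $ 2 = norm x * norm x" for x :: "real^2"
  by (simp add: norm_vec_def L2_set_def UNIV_2 sq_eq)
 have e: "(pol 1 t $ 1 * ang_comp (%_. 0) (%_. 1) 1 t - pol 1 t $ 2 * ang_comp (%_. 1) (%_. 0) 1 t) / (pol 1 t $ 1 * pol 1 t $ 1 + pol 1 t $ 2 * pol 1 t $ 2) = 1" for t
  using sin_cos_squared_add2[of t] unfolding n by (simp add: ang_comp_def sq_eq)
 have "circ_int (%t::real. 1) = 2 * integral (ball (0::real^2) 1) (%x. core (x $ 1 * x $ 1 + x $ 2 * x $ 2) * (1 * 1 - 0 * 0))"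
  using capped_map_area[OF C1_grad_coordinate, of 1] unfolding e by (simp add: n)
 thus ?thesis by simp
qed

text \<open>Scalars pass through \<open>real^1\<close>, so that the change of variables for
  vector-valued integrands applies.\<close>

lemma integral_change_of_variables_real:
 fixes f :: "real^2 => real" and g :: "real^2 => real^2"
 assumes S: "S : sets lebesgue" and g: "!!x. x : S ==> (g has_derivative g' x) (at x within S)"
  and inj: "inj_on g S" and f: "f absolutely_integrable_on (g ` S)"
 shows "((%x. \<bar>det (matrix (g' x))\<bar> * f (g x)) has_integral integral (g ` S) f) S"
proof -
 have bv: "bounded_linear (vec :: real => real^1)" by (simp add: linear_conv_bounded_linear[symmetric])
 have vf: "(%y. vec (f y) :: real^1) absolutely_integrable_on (g ` S)"
  using absolutely_integrable_linear[OF f bv] by (simp add: o_def)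
 from has_absolute_integral_change_of_variables[OF S g inj, of "%y. vec (f y) :: real^1" "integral (g ` S) (%y. vec (f y))"] vf
 have c: "(%x. \<bar>det (matrix (g' x))\<bar> *\<^sub>R (vec (f (g x)) :: real^1)) absolutely_integrable_on S"
  "integral S (%x. \<bar>det (matrix (g' x))\<bar> *\<^sub>R (vec (f (g x)) :: real^1)) = integral (g ` S) (%y. vec (f y))" by auto
 have b1: "bounded_linear (%v::real^1. v $ 1)" by (rule bounded_linear_vec_nth)
 have i: "(%x. \<bar>det (matrix (g' x))\<bar> * f (g x)) integrable_on S"
  using set_LINT(1)[OF absolutely_integrable_linear[OF c(1) b1]] by (simp add: o_def)
 have "integral S (%x. \<bar>det (matrix (g' x))\<bar> * f (g x)) = integral S (%x. \<bar>det (matrix (g' x))\<bar> *\<^sub>R (vec (f (g x)) :: real^1)) $ 1"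
  using integral_linear[OF set_LINT(1)[OF c(1)] b1] by (simp add: o_def)
 also have "... = integral (g ` S) (%y. vec (f y) :: real^1) $ 1" by (simp only: c(2))
 also have "... = integral (g ` S) f"
  using integral_linear[OF set_LINT(1)[OF vf] b1] by (simp add: o_def)
 finally show ?thesis using i by (simp add: has_integral_integral[symmetric] has_integral_iff)
qed

locale planar_map =
 fixes a b a1 a2 b1 b2 :: "real^2 => real"
 assumes a: "C1_grad a a1 a2" and b: "C1_grad b b1 b2"
begin

definition w :: "real^2 => real^2" where "w x = vector [a x, b x]"
definition D :: "real^2 => real^2 => real^2" where
 "D x h = vector [h $ 1 * a1 x + h $ 2 * a2 x, h $ 1 * b1 x + h $ 2 * b2 x]"
definition J :: "real^2 => real" where "J x = a1 x * b2 x - a2 x * b1 x"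

lemma w_deriv: "(w has_derivative D x) (at x within A)"
proof (rule has_derivative_at_withinI)
 have e: "w = (%x. a x *\<^sub>R axis 1 1 + b x *\<^sub>R axis 2 1)"
  "D x = (%h. (h $ 1 * a1 x + h $ 2 * a2 x) *\<^sub>R axis 1 1 + (h $ 1 * b1 x + h $ 2 * b2 x) *\<^sub>R axis 2 1)"
  by (auto simp: w_def D_def vec_eq_iff forall_2 axis_def fun_eq_iff)
 show "(w has_derivative D x) (at x)" unfolding e
  by (intro has_derivative_add has_derivative_scaleR_left C1_gradD(3)[OF a] C1_gradD(3)[OF b])
qed

lemma det_D: "det (matrix (D x)) = J x"
 by (simp add: det_2 matrix_def D_def J_def axis_def)

lemma continuous_w: "continuous_on A w"
 by (rule has_derivative_continuous_on[OF w_deriv])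

lemma continuous_J: "continuous_on A J"
 unfolding J_def[abs_def] by (intro cont_diff cont_mult C1_gradD[OF a] C1_gradD[OF b])

lemma w_eq_0_iff: "w x = 0 \<longleftrightarrow> a x = 0 & b x = 0" by (simp add: w_def vec_eq_iff forall_2)

lemma w_square: "a x * a x + b x * b x = (norm (w x))^2"
 by (simp add: norm_vec_def L2_set_def UNIV_2 w_def sq_eq)

text \<open>The inverse of the derivative at \<open>z\<close> is written out by Cramer's rule.
  Continuity of the partial derivatives, through their total oscillation \<open>q\<close>, keeps the
  derivative near \<open>D z\<close> in operator norm.\<close>

lemma locally_injective:
 assumes J: "J z ~= 0" and S: "open S" "z : S"
 obtains r where "0 < r" "ball z r \<subseteq> S" "inj_on w (ball z r)"
proof (rule has_derivative_locally_injective[OF S(2,1)])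
 let ?g = "%y::real^2. vector [(y $ 1 * b2 z - y $ 2 * a2 z) / J z, (y $ 2 * a1 z - y $ 1 * b1 z) / J z] :: real^2"
 have "linear ?g" by (rule linearI) (auto simp: vec_eq_iff forall_2 add_divide_distrib diff_divide_distrib algebra_simps)
 thus "bounded_linear ?g" by (simp add: linear_conv_bounded_linear)
 have "?g (D z h) $ 1 = h $ 1 * J z / J z" "?g (D z h) $ 2 = h $ 2 * J z / J z" for h
  by (simp_all add: D_def J_def algebra_simps)
 thus "?g \<circ> D z = id" using J by (auto simp: fun_eq_iff vec_eq_iff forall_2)
 show "(w has_derivative D x) (at x)" for x by (rule w_deriv)
 fix e :: real assume e: "0 < e"
 define q where "q x = \<bar>a1 x - a1 z\<bar> + \<bar>a2 x - a2 z\<bar> + \<bar>b1 x - b1 z\<bar> + \<bar>b2 x - b2 z\<bar>" for x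
 have cq: "contU q" unfolding q_def[abs_def]
  by (intro cont_add continuous_on_rabs cont_diff cont_const C1_gradD[OF a] C1_gradD[OF b])
 have "open {x. q x < e}" by (rule open_Collect_less[OF cq cont_const])
 moreover have "z : {x. q x < e}" using e by (simp add: q_def)
 ultimately obtain d where d: "d > 0" "ball z d \<subseteq> {x. q x < e}" by (rule openE)
 have "onorm (%v. D x v - D z v) < e" if "dist z x < d" for x
 proof -
  have "onorm (%v. D x v - D z v) <= q x"
  proof (rule onorm_le)
  fix v :: "real^2"
  have v: "\<bar>v $ 1\<bar> <= norm v" "\<bar>v $ 2\<bar> <= norm v" by (rule component_le_norm_cart)+
  have m: "\<bar>c * d + e * f\<bar> <= (\<bar>d\<bar> + \<bar>f\<bar>) * norm v" if "\<bar>c\<bar> <= norm v" "\<bar>e\<bar> <= norm v" for c d e f :: real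
  proof -
  have "\<bar>c * d\<bar> <= norm v * \<bar>d\<bar>" "\<bar>e * f\<bar> <= norm v * \<bar>f\<bar>" unfolding abs_mult by (intro mult_right_mono that abs_ge_zero)+
  thus ?thesis using abs_triangle_ineq[of "c * d" "e * f"] by (simp add: algebra_simps)
  qed
  have "norm (D x v - D z v) <= (\<Sum>i\<in>UNIV. \<bar>(D x v - D z v) $ i\<bar>)" by (rule norm_le_l1_cart)
  also have "... = \<bar>v $ 1 * (a1 x - a1 z) + v $ 2 * (a2 x - a2 z)\<bar> + \<bar>v $ 1 * (b1 x - b1 z) + v $ 2 * (b2 x - b2 z)\<bar>"
  by (simp add: UNIV_2 D_def algebra_simps)
  also have "... <= (\<bar>a1 x - a1 z\<bar> + \<bar>a2 x - a2 z\<bar>) * norm v + (\<bar>b1 x - b1 z\<bar> + \<bar>b2 x - b2 z\<bar>) * norm v"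
  by (intro add_mono m v)
  also have "... = q x * norm v" by (simp add: q_def algebra_simps)
  finally show "norm (D x v - D z v) <= q x * norm v" .
  qed
  also have "... < e" using that d(2) by auto
  finally show ?thesis .
 qed
 thus "\<exists>d>0. \<forall>x. dist z x < d --> onorm (%v. D x v - D z v) < e" using d(1) by blast
qed

text \<open>The total change of argument of the map along the circle of radius
  \<open>R\<close>.\<close>

definition turning :: "real => real" where
 "turning R = circ_int (%t. (a (pol R t) * ang_comp b1 b2 R t - b (pol R t) * ang_comp a1 a2 R t) / (a (pol R t) * a (pol R t) + b (pol R t) * b (pol R t)))"

text \<open>The Jacobian of the capped map is carried by the preimages of the unit disc, each of which contributes \<open>\<plusminus>\<pi>\<close>.\<close>

lemma signed_count_unit:
 assumes R: "0 < R" and Z: "finite Z"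
  and sub: "!!z. z : Z ==> ball z (de z) \<subseteq> ball 0 R"
  and disj: "!!z z'. z : Z ==> z' : Z ==> z ~= z' ==> ball z (de z) \<inter> ball z' (de z') = {}"
  and inj: "!!z. z : Z ==> inj_on w (ball z (de z))"
  and onto: "!!z. z : Z ==> ball 0 1 \<subseteq> w ` ball z (de z)"
  and sgn: "!!z x. z : Z ==> x : ball z (de z) ==> sgn (J x) = sgn (J z)"
  and far: "!!x. x : cball 0 R ==> x \<notin> (\<Union>z\<in>Z. ball z (de z)) ==> 1 <= norm (w x)"
 shows "turning R = 2 * pi * (\<Sum>z\<in>Z. sgn (J z))"
proof -
 define c where "c y = core (y $ 1 * y $ 1 + y $ 2 * y $ 2)" for y :: "real^2"
 have n: "y $ 1 * y $ 1 + y $ 2 * y $ 2 = (norm y)^2" for y :: "real^2"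
  by (simp add: norm_vec_def L2_set_def UNIV_2 sq_eq)
 have cc: "contU c" unfolding c_def[abs_def]
  by (rule cont_comp[where g=core and f="%y::real^2. y $ 1 * y $ 1 + y $ 2 * y $ 2", OF continuous_core[of UNIV]])
  (auto intro!: continuous_intros)
 have c0: "c y = 0" if "1 <= norm y" for y
  using that by (simp add: c_def n core_eq)
 have cw: "c (w x) = core (a x * a x + b x * b x)" for x by (simp add: c_def w_def)
 have c1: "(c has_integral pi) (ball 0 1)" "c absolutely_integrable_on (ball 0 1)"
  using integral_ball_polar(1)[OF cc, of 1] integral_core
  by (auto simp: c_def[abs_def] has_integral_iff dest: set_LINT(1))
 have cU: "c absolutely_integrable_on UNIV"
 proof -
  have "(%x. ind (ball 0 1) x *\<^sub>R c x) = c" using c0 by (auto simp: fun_eq_iff indicator_def)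
  thus ?thesis using c1(2) by (simp add: set_integrable_def)
 qed
 define h where "h x = c (w x) * J x" for x
 have loc: "(h has_integral (sgn (J z) * pi)) (ball z (de z))" if z: "z : Z" for z
 proof -
  have op: "open (w ` ball z (de z))" by (rule invariance_of_domain[OF continuous_w open_ball inj[OF z]])
  have ci: "c absolutely_integrable_on (w ` ball z (de z))"
  by (rule set_integrable_subset[OF cU]) (use op in auto)
  have "(c has_integral pi) (w ` ball z (de z))"
  by (rule has_integral_on_superset[OF c1(1) _ onto[OF z]]) (simp add: c0)
  hence e: "integral (w ` ball z (de z)) c = pi" by (rule integral_unique)
  have "((%x. \<bar>det (matrix (D x))\<bar> * c (w x)) has_integral integral (w ` ball z (de z)) c) (ball z (de z))"
  by (rule integral_change_of_variables_real[OF _ w_deriv inj[OF z] ci]) simp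
  hence "((%x. sgn (J z) * (\<bar>J x\<bar> * c (w x))) has_integral (sgn (J z) * pi)) (ball z (de z))"
  unfolding det_D e by (rule has_integral_mult_right)
  \<comment> \<open>The Jacobian has constant sign on the ball, so this sign undoes the absolute
    value in the change of variables.\<close>
  moreover have "sgn (J z) * (\<bar>J x\<bar> * c (w x)) = h x" if "x : ball z (de z)" for x
  unfolding h_def sgn[OF z that, symmetric] mult.assoc[symmetric] sgn_mult_abs by (rule mult.commute)
  ultimately show ?thesis by (rule has_integral_eq[rotated])
 qed
 have "(h has_integral (\<Sum>z\<in>Z. sgn (J z) * pi)) (\<Union>z\<in>Z. ball z (de z))"
  by (rule has_integral_UN[OF Z loc]) (auto simp: pairwise_def disj)
 hence "((%x. if x : (\<Union>z\<in>Z. ball z (de z)) then h x else 0) has_integral (\<Sum>z\<in>Z. sgn (J z) * pi)) (ball 0 R)"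
  using sub by (subst has_integral_restrict) auto
 hence "(h has_integral (\<Sum>z\<in>Z. sgn (J z) * pi)) (ball 0 R)"
  by (rule has_integral_eq[rotated]) (use far c0 in \<open>auto simp: h_def\<close>)
 hence hi: "integral (ball 0 R) h = (\<Sum>z\<in>Z. sgn (J z)) * pi" by (simp add: integral_unique sum_distrib_right)
 have "turning R = 2 * integral (ball 0 R) (%x. core (a x * a x + b x * b x) * (a1 x * b2 x - a2 x * b1 x))"
  unfolding turning_def
 proof (rule capped_map_area[OF a b R])
  fix x :: "real^2" assume x: "norm x = R"
  have "x \<notin> (\<Union>z\<in>Z. ball z (de z))"
  proof
  assume "x : (\<Union>z\<in>Z. ball z (de z))"
  then obtain z where "z : Z" "x : ball z (de z)" by blast
  hence "x : ball 0 R" using sub by blast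
  thus False using x by simp
  qed
  hence "1 <= norm (w x)" using far[of x] x by simp
  thus "1 <= a x * a x + b x * b x" unfolding w_square by (rule one_le_power)
 qed
 also have "... = 2 * integral (ball 0 R) h" unfolding h_def[abs_def] cw J_def ..
 finally show ?thesis using hi by simp
qed

end

text \<open>Around each zero the map is a diffeomorphism; after rescaling, the images of small discs contain the unit disc.\<close>

lemma (in planar_map) signed_count:
 assumes R: "0 < R" and bd: "!!x. norm x = R ==> w x ~= 0"
  and reg: "!!x. norm x < R ==> w x = 0 ==> J x ~= 0"
 shows "turning R = 2 * pi * (\<Sum>z | z : ball 0 R & w z = 0. sgn (J z))"
proof -
 define Z where "Z = {z. z : ball 0 R & w z = 0}"
 have "\<exists>r. 0 < r & ball z r \<subseteq> ball 0 R \<inter> {x. 0 < J x * J z} & inj_on w (ball z r)" if z: "z : Z" for z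
 proof -
  have Jz: "J z ~= 0" using reg[of z] z by (simp add: Z_def)
  have "open {x. 0 < J x * J z}" by (intro open_Collect_less cont_mult cont_const continuous_J)
  hence o: "open (ball 0 R \<inter> {x. 0 < J x * J z})" by blast
  have "z : ball 0 R \<inter> {x. 0 < J x * J z}" using z Jz by (auto simp: Z_def zero_less_mult_iff linorder_neq_iff)
  from locally_injective[OF Jz o this] show ?thesis by metis
 qed
 then obtain r where r: "!!z. z : Z ==> 0 < r z" "!!z. z : Z ==> ball z (r z) \<subseteq> ball 0 R \<inter> {x. 0 < J x * J z}" "!!z. z : Z ==> inj_on w (ball z (r z))"
  by metis
 \<comment> \<open>Each zero \<open>z\<close> has distance at least \<open>r z\<close> from every
   other one, so balls of half the radius are disjoint.\<close>
 define de where "de z = r z / 2" for z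
 have de: "0 < de z" "ball z (de z) \<subseteq> ball z (r z)" if "z : Z" for z using r(1)[OF that] by (auto simp: de_def intro!: subset_ball)
 have uniq: "z = z'" if "z : Z" "z' : Z" "dist z z' < r z" for z z'
  using inj_onD[OF r(3)[OF that(1)], of z z'] that r(1)[OF that(1)] by (simp add: Z_def)
 have disj: "ball z (de z) \<inter> ball z' (de z') = {}" if z: "z : Z" "z' : Z" "z ~= z'" for z z'
 proof (rule ccontr)
  assume "ball z (de z) \<inter> ball z' (de z') ~= {}"
  then obtain x where "dist z x < r z / 2" "dist z' x < r z' / 2" by (auto simp: de_def)
  hence "dist z z' < r z \<or> dist z' z < r z'" using dist_triangle2[of z z' x] by (simp add: dist_commute) linarith
  thus False using uniq[of z z'] uniq[of z' z] z by auto
 qed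
 have Zc: "compact Z"
 proof -
  have "Z = cball 0 R \<inter> w -` {0}" using bd by (auto simp: Z_def order.order_iff_strict)
  moreover have "closed (w -` {0})" by (rule continuous_closed_vimage) (use continuous_w[of UNIV] in \<open>simp_all add: continuous_on_eq_continuous_at\<close>)
  ultimately show ?thesis by (simp add: compact_Int_closed)
 qed
 have Zf: "finite Z"
 proof -
  have "finite (Z \<inter> Z)"
  proof (rule finite_not_islimpt_in_compact[OF Zc])
  fix z assume z: "z : Z"
  show "\<not> z islimpt Z" unfolding islimpt_approachable
  using uniq[OF z] r(1)[OF z] by (metis dist_commute)
  qed
  thus ?thesis by simp
 qed
 have "\<exists>e>0. ball 0 e \<subseteq> w ` ball z (de z)" if z: "z : Z" for z
 proof -
  have "open (w ` ball z (de z))"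
  by (rule invariance_of_domain[OF continuous_w open_ball inj_on_subset[OF r(3)[OF z] de(2)[OF z]]])
  moreover have "0 : w ` ball z (de z)" using z de(1)[OF z] by (intro image_eqI[of _ _ z]) (auto simp: Z_def)
  ultimately show ?thesis by (rule openE) blast
 qed
 then obtain e where e: "!!z. z : Z ==> 0 < e z" "!!z. z : Z ==> ball 0 (e z) \<subseteq> w ` ball z (de z)" by metis
 define K where "K = cball 0 R - (\<Union>z\<in>Z. ball z (de z))"
 have Kc: "compact K" unfolding K_def by (intro compact_diff compact_cball open_UN) simp
 have "\<exists>m>0. \<forall>x\<in>K. m <= norm (w x)"
 proof (cases "K = {}")
  case False
  have "continuous_on K (%x. norm (w x))" by (intro continuous_on_norm continuous_w)
  from continuous_attains_inf[OF Kc False this] obtain x where x: "x : K" "\<forall>y\<in>K. norm (w x) <= norm (w y)" by blast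
  have "w x ~= 0"
  proof
  assume "w x = 0"
  hence "x : Z" using x(1) bd[of x] by (auto simp: Z_def K_def order.order_iff_strict)
  thus False using x(1) de(1)[of x] by (auto simp: K_def)
  qed
  thus ?thesis using x(2) by (intro exI[of _ "norm (w x)"]) simp
 qed (auto intro: exI[of _ 1])
 then obtain m where m: "0 < m" "!!x. x : K ==> m <= norm (w x)" by blast
 \<comment> \<open>Small enough that the disc of radius \<open>s\<close> lies in every local image
   and that \<open>norm (w x)\<close> is at least \<open>s\<close> off the balls. Division by
   \<open>s\<close> brings both to the normalisation of \<open>signed_count_unit\<close>.\<close>
 define s where "s = Min (insert m (e ` Z))"
 have s: "0 < s" "s <= m" "!!z. z : Z ==> s <= e z" unfolding s_def using Zf m(1) e(1) by (auto simp: Min_gr_iff)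
 have cm: "C1_grad (%x. k x / s) (%x. k1 x / s) (%x. k2 x / s)" if "C1_grad k k1 k2" for k k1 k2
 proof -
  have "((%y. y / s) has_real_derivative 1 / s) (at t)" for t :: real by (rule DERIV_cdivide[OF DERIV_ident])
  from C1_grad_compose[OF that this cont_const] show ?thesis by simp
 qed
 interpret T: planar_map "%x. a x / s" "%x. b x / s" "%x. a1 x / s" "%x. a2 x / s" "%x. b1 x / s" "%x. b2 x / s"
  by unfold_locales (intro cm a b)+
 have Tw: "T.w x = w x /\<^sub>R s" for x unfolding T.w_def w_def by (simp add: vec_eq_iff forall_2 divide_inverse mult.commute)
 have TJ: "T.J x = J x / s\<^sup>2" for x unfolding T.J_def J_def by (simp add: sq_eq diff_divide_distrib)
 have Tsgn: "sgn (T.J x) = sgn (J x)" for x using s(1) by (simp add: TJ sgn_divide)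
 have ac: "ang_comp (%x. k1 x / s) (%x. k2 x / s) R t = ang_comp k1 k2 R t / s" for k1 k2 t
  by (simp add: ang_comp_def diff_divide_distrib right_diff_distrib)
 have "turning R = T.turning R"
 proof -
  have "(x / s * (y / s) - z / s * (v / s)) / (x / s * (x / s) + z / s * (z / s)) = (x * y - z * v) / (x * x + z * z)" for x y z v
  proof -
  have "(x / s * (y / s) - z / s * (v / s)) = (x * y - z * v) / (s * s)" "(x / s * (x / s) + z / s * (z / s)) = (x * x + z * z) / (s * s)"
  by (simp_all add: diff_divide_distrib add_divide_distrib)
  thus ?thesis using s(1) by simp
  qed
  thus ?thesis by (simp only: turning_def T.turning_def ac)
 qed
 also have "... = 2 * pi * (\<Sum>z\<in>Z. sgn (T.J z))"
 proof (rule T.signed_count_unit[OF R Zf, where de=de])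
  fix z assume z: "z : Z"
  show "ball z (de z) \<subseteq> ball 0 R" using de(2)[OF z] r(2)[OF z] by blast
  show "ball z (de z) \<inter> ball z' (de z') = {}" if "z' : Z" "z ~= z'" for z' by (rule disj[OF z that])
  show "inj_on T.w (ball z (de z))"
  using inj_on_subset[OF r(3)[OF z] de(2)[OF z]] s(1) by (auto simp: inj_on_def Tw)
  show "ball 0 1 \<subseteq> T.w ` ball z (de z)"
  proof
  fix y :: "real^2" assume "y : ball 0 1"
  hence "s * norm y < s * 1" using s(1) by (intro mult_strict_left_mono) auto
  moreover have "norm (s *\<^sub>R y) = s * norm y" using s(1) by simp
  ultimately have "norm (s *\<^sub>R y) < e z" using s(3)[OF z] by linarith
  hence "s *\<^sub>R y : ball 0 (e z)" by (simp only: mem_ball_0)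
  hence "s *\<^sub>R y : w ` ball z (de z)" by (rule subsetD[OF e(2)[OF z]])
  then obtain x where "x : ball z (de z)" "s *\<^sub>R y = w x" by blast
  thus "y : T.w ` ball z (de z)" using s(1) by (intro image_eqI[of _ _ x]) (auto simp: Tw dest: sym)
  qed
  show "sgn (T.J x) = sgn (T.J z)" if "x : ball z (de z)" for x
  proof -
  have "0 < J x * J z" using that de(2)[OF z] r(2)[OF z] by blast
  thus ?thesis unfolding Tsgn by (auto simp: zero_less_mult_iff)
  qed
 next
  fix x assume "x : cball 0 R" "x \<notin> (\<Union>z\<in>Z. ball z (de z))"
  hence "s <= norm (w x)" using m(2)[of x] s(2) by (auto simp: K_def)
  thus "1 <= norm (T.w x)" using s(1) by (simp add: Tw field_simps)
 qed
 finally show ?thesis by (simp only: Tsgn Z_def)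
qed

section \<open>Winding numbers and the topological degree\<close>

lemma C1_grad_diff_const: "C1_grad k k1 k2 ==> C1_grad (%x. k x - c) k1 k2"
 unfolding C1_grad_def by (auto intro!: derivative_eq_intros)

context planar_map
begin

definition loop :: "real => real => complex" where
 "loop R t = Complex (a (pol R (2 * pi * t))) (b (pol R (2 * pi * t)))"

text \<open>The imaginary part of the logarithmic derivative of the loop is the integrand of
  \<open>turning\<close>, after reparametrisation by \<open>2 * pi * t\<close>.\<close>

lemma winding_number_loop:
 assumes R: "0 < R" and bd: "!!x. norm x = R ==> w x ~= 0"
 shows "path (loop R)" "pathfinish (loop R) = pathstart (loop R)"
  "turning R = 2 * pi * Re (winding_number (loop R) 0)"
proof -
 define q where "q t = (a (pol R t) * ang_comp b1 b2 R t - b (pol R t) * ang_comp a1 a2 R t) / (a (pol R t) * a (pol R t) + b (pol R t) * b (pol R t))" for t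
 define d where "d t = of_real (ang_comp a1 a2 R (2*pi*t) * (2*pi)) + \<i> * of_real (ang_comp b1 b2 R (2*pi*t) * (2*pi))" for t
 have loop: "loop R = (%t. of_real (a (pol R (2*pi*t))) + \<i> * of_real (b (pol R (2*pi*t))))"
  by (auto simp: loop_def fun_eq_iff complex_eq_iff)
 have l: "((%t. 2 * pi * t) has_real_derivative 2 * pi) (at t)" for t by (auto intro!: derivative_eq_intros)
 have dk: "((%t. k (pol R (2*pi*t))) has_vector_derivative ang_comp k1 k2 R (2*pi*t) * (2*pi)) (at t)" if "C1_grad k k1 k2" for k k1 k2 t
  using DERIV_chain2[OF C1_grad_angle[OF that] l] by (simp only: real_vec_deriv)
 have der: "(loop R has_vector_derivative d t) (at t)" for t
  unfolding loop d_def
  by (intro has_vector_derivative_add bounded_linear.has_vector_derivative[OF bounded_linear_of_real dk[OF a]]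
  bounded_linear.has_vector_derivative[OF bounded_linear_const_mult[OF bounded_linear_of_real] dk[OF b]])
 have lin: "contU (%t::real. 2 * pi * t)" by (intro continuous_intros)
 note ca = cont_polar[OF a cont_const lin, of R] and cb = cont_polar[OF b cont_const lin, of R]
 have cd: "contU d" unfolding d_def[abs_def]
  by (intro cont_add cont_mult continuous_on_of_real cont_const ca(2) cb(2))
 have cl: "contU (loop R)" unfolding loop
  by (intro cont_add cont_mult continuous_on_of_real cont_const ca(1) cb(1))
 show "path (loop R)" unfolding path_def by (rule cont_subset[OF cl]) simp
 show "pathfinish (loop R) = pathstart (loop R)"
  using pol_periodic[of R 0] by (simp add: pathfinish_def pathstart_def loop_def)
 have "loop R C1_differentiable_on {0..1}"
  unfolding C1_differentiable_on_def using der cont_subset[OF cd, of "{0..1}"] by (intro exI[of _ d]) simp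
 hence vp: "valid_path (loop R)" unfolding valid_path_def by (rule C1_differentiable_imp_piecewise)
 have nz: "loop R t ~= 0" for t
 proof
  assume "loop R t = 0"
  hence "w (pol R (2*pi*t)) = 0" by (simp add: w_eq_0_iff loop_def complex_eq_iff)
  thus False using bd[of "pol R (2*pi*t)"] R by simp
 qed
 hence np: "0 \<notin> path_image (loop R)" by (auto simp: path_image_def)
 have im: "Im (1 / (loop R t - 0) * d t) = 2 * pi * q (2 * pi * t)" for t
 proof -
  have "1 / (loop R t - 0) * d t = d t / loop R t" by simp
  thus ?thesis by (simp add: Im_divide d_def loop_def q_def sq_eq algebra_simps)
 qed
 have ci: "continuous_on {0..1} (%t. 1 / (loop R t - 0) * d t)"
  using nz by (intro cont_mult continuous_on_divide cont_diff cont_const cont_subset[OF cl subset_UNIV] cont_subset[OF cd subset_UNIV]) simp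
 have q: "continuous_on {0..2*pi} q"
 proof -
  have id: "continuous_on {0..2*pi} (%t::real. t)" by (rule cont_id)
  note ca = cont_polar[OF a cont_const id, of R] and cb = cont_polar[OF b cont_const id, of R]
  have "a (pol R t) * a (pol R t) + b (pol R t) * b (pol R t) ~= 0" for t
  using bd[of "pol R t"] R unfolding w_square by simp
  thus ?thesis unfolding q_def[abs_def] by (intro continuous_on_divide cont_diff cont_add cont_mult ca cb) blast
 qed
 have "Re (winding_number (loop R) 0) = Im (contour_integral (loop R) (%w. 1 / (w - 0))) / (2 * pi)"
  by (rule Re_winding_number[OF vp np])
 also have "contour_integral (loop R) (%w. 1 / (w - 0)) = integral {0..1} (%t. 1 / (loop R t - 0) * d t)"
  unfolding contour_integral_integral vector_derivative_at[OF der] ..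
 also have "Im ... = integral {0..1} (%t. 2 * pi * q (2 * pi * t))"
  using integral_linear[OF integrable_continuous_interval[OF ci] bounded_linear_Im] by (simp only: o_def im)
 also have "... = circ_int q"
 proof -
  have "((%t. (2 * pi) *\<^sub>R q (2 * pi * t)) has_integral integral {2 * pi * 0..2 * pi * 1} q) {0..1}"
  proof (rule has_integral_substitution[where c=0 and d="2*pi"])
  show "(%t. 2 * pi * t) ` {0..1} \<subseteq> {0..2 * pi}" by (auto simp: mult_le_cancel_left1)
  show "((%t. 2 * pi * t) has_real_derivative 2 * pi) (at x within {0..1})" for x by (rule deriv_within[OF l])
  qed (use q in auto)
  from integral_unique[OF this] show ?thesis by (simp only: real_scaleR_def mult_zero_right mult_1_right)
 qed
 finally show "turning R = 2 * pi * Re (winding_number (loop R) 0)" unfolding turning_def q_def[abs_def] by simp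
qed

lemma det_jacobian_shift: "det (jacobian (%x. w x + c) (at x)) = J x"
proof -
 have "((%x. w x + c) has_derivative D x) (at x)"
  using has_derivative_add[OF w_deriv has_derivative_const[of c]] by simp
 hence "fderiv (%x. w x + c) (at x) = D x" by (rule frechet_derivative_at[symmetric])
 thus ?thesis by (simp add: jacobian_def det_D)
qed

end

lemma norm_Complex_vector: "norm (Complex (z $ 1) (z $ 2)) = norm z" for z :: "real^2"
 by (simp add: norm_vec_def L2_set_def UNIV_2 cmod_def)

text \<open>The zeros of \<open>v - y\<close> are counted by its winding number along the boundary.
  There \<open>v\<close> is closer to the round circle of radius \<open>rho\<close> than
  \<open>y\<close> is, so the winding number is that of the round circle around \<open>y\<close>,
  whatever \<open>v\<close> is.\<close>

lemma regular_degree_near_circle: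
 fixes v :: "real^2 => real^2"
 assumes R: "0 < R" and rho: "0 <= rho" and v: "!!i. smooth (%x. v x $ i)"
  and near: "!!t. norm (v (pol R t) - pol rho t) < norm (pol rho t - y)"
  and reg: "!!x. x : ball 0 R ==> v x = y ==> det (jacobian v (at x)) ~= 0"
  and y: "norm y ~= rho"
 shows "regular_degree y v (ball 0 R) = (if norm y < rho then 1 else 0)"
proof -
 interpret planar_map "%x. v x $ 1 - y $ 1" "%x. v x $ 2 - y $ 2"
  "%x. fderiv (%x. v x $ 1) (at x) (axis 1 1)" "%x. fderiv (%x. v x $ 1) (at x) (axis 2 1)"
  "%x. fderiv (%x. v x $ 2) (at x) (axis 1 1)" "%x. fderiv (%x. v x $ 2) (at x) (axis 2 1)"
  by unfold_locales (intro C1_grad_diff_const smooth_C1_grad v)+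
 have wv: "w x = v x - y" for x by (simp add: w_def vec_eq_iff forall_2)
 have vw: "(%x. w x + y) = v" by (simp add: wv)
 have dJ: "det (jacobian v (at x)) = J x" for x using det_jacobian_shift[of y x] unfolding vw .
 have bd: "w x ~= 0" if "norm x = R" for x
 proof -
  obtain s t where st: "0 <= s" "x = pol s t" using pol_surj[of x] by blast
  hence "s = R" using that by simp
  thus ?thesis using near[of t] st by (auto simp: wv norm_minus_commute)
 qed
 have "turning R = 2 * pi * (\<Sum>z | z : ball 0 R & w z = 0. sgn (J z))"
  by (rule signed_count[OF R bd]) (use reg in \<open>auto simp: wv dJ\<close>)
 moreover have "turning R = 2 * pi * Re (winding_number (loop R) 0)" by (rule winding_number_loop(3)[OF R bd])
 ultimately have "(\<Sum>z | z : ball 0 R & w z = 0. sgn (J z)) = Re (winding_number (loop R) 0)" by simp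
 moreover have "regular_degree y v (ball 0 R) = (\<Sum>z | z : ball 0 R & w z = 0. sgn (J z))"
  unfolding regular_degree_def dJ wv by simp
 moreover have "winding_number (loop R) 0 = winding_number (circlepath (- Complex (y $ 1) (y $ 2)) rho) 0"
 proof (rule winding_number_nearby_loops_eq)
  fix t :: real
  have c: "circlepath (- Complex (y $ 1) (y $ 2)) rho t = Complex ((pol rho (2*pi*t) - y) $ 1) ((pol rho (2*pi*t) - y) $ 2)"
  by (simp add: circlepath complex_eq_iff pol_def Re_exp Im_exp)
  have "loop R t - circlepath (- Complex (y $ 1) (y $ 2)) rho t
  = Complex ((v (pol R (2*pi*t)) - pol rho (2*pi*t)) $ 1) ((v (pol R (2*pi*t)) - pol rho (2*pi*t)) $ 2)"
  unfolding c by (simp add: loop_def complex_eq_iff)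
  thus "norm (loop R t - circlepath (- Complex (y $ 1) (y $ 2)) rho t) < norm (circlepath (- Complex (y $ 1) (y $ 2)) rho t - 0)"
  unfolding c using near[of "2*pi*t"] by (simp only: norm_Complex_vector diff_zero)
 qed (use winding_number_loop(1,2)[OF R bd] in auto)
 moreover have "winding_number (circlepath (- Complex (y $ 1) (y $ 2)) rho) 0 = (if norm y < rho then 1 else 0)"
 proof (cases "norm y < rho")
  case True
  thus ?thesis by (subst winding_number_circlepath) (auto simp: norm_Complex_vector)
 next
  case False
  hence f: "rho < norm y" using y by simp
  have "winding_number (circlepath (- Complex (y $ 1) (y $ 2)) rho) 0 = 0"
  proof (rule winding_number_zero_outside[OF _ convex_cball[of "- Complex (y $ 1) (y $ 2)" rho]])
  show "0 \<notin> cball (- Complex (y $ 1) (y $ 2)) rho" using f by (simp add: dist_norm norm_Complex_vector)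
  show "path_image (circlepath (- Complex (y $ 1) (y $ 2)) rho) \<subseteq> cball (- Complex (y $ 1) (y $ 2)) rho"
  using rho by (simp add: sphere_cball)
  qed auto
  thus ?thesis using False by simp
 qed
 ultimately show ?thesis by simp
qed

lemma real_polynomial_C_diff:
 fixes f :: "'a::euclidean_space => real"
 assumes "real_polynomial_function f"
 shows "C_diff k f"
 using assms
proof (induction rule: real_polynomial_function.induct)
 case (linear f)
 have l: "linear f" using linear by (simp add: linear_conv_bounded_linear)
 have "f = (%x. \<Sum>b\<in>Basis. (x \<bullet> b) * f b)"
 proof
  fix x
  have "f x = f (\<Sum>b\<in>Basis. (x \<bullet> b) *\<^sub>R b)" by (simp only: euclidean_representation)
  also have "... = (\<Sum>b\<in>Basis. (x \<bullet> b) * f b)" by (simp add: linear_sum[OF l] linear_cmul[OF l])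
  finally show "f x = (\<Sum>b\<in>Basis. (x \<bullet> b) * f b)" .
 qed
 thus ?case by (rule ssubst) (intro C_diff_sum C_diff_mult C_diff_inner C_diff_const)
qed (auto intro: C_diff_const C_diff_add C_diff_mult)

text \<open>A polynomial map within \<open>e / 2\<close> of \<open>u\<close>, translated by less
  than \<open>e / 2\<close>: by Sard's theorem some \<open>q\<close> near \<open>y\<close> is not a
  critical value, and adding \<open>y - q\<close> moves it to \<open>y\<close>.\<close>

lemma regular_approximation:
 fixes u :: "real^2 => real^2"
 assumes u: "continuous_on (cball 0 R) u" and e: "0 < e"
 obtains v where "!!i. smooth (%x. v x $ i)" "!!x. x : cball 0 R ==> norm (v x - u x) < e"
  "!!x. v x = y ==> det (jacobian v (at x)) ~= 0"
proof -
 obtain p where p: "polynomial_function p" "\<forall>x\<in>cball 0 R. norm (u x - p x) < e / 2"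
  using Stone_Weierstrass_polynomial_function[OF compact_cball u, of "e/2"] e by auto
 have pc: "C_diff k (%x. p x $ i)" for i k
 proof -
  have "real_polynomial_function ((%x. x $ i) \<circ> p)" using p(1) bounded_linear_vec_nth unfolding polynomial_function_def by blast
  from real_polynomial_C_diff[OF this] show ?thesis by (simp add: o_def)
 qed
 have ps: "smooth (%x. p x $ i)" for i by (simp add: smooth_def pc)
 interpret planar_map "%x. p x $ 1" "%x. p x $ 2"
  "%x. fderiv (%x. p x $ 1) (at x) (axis 1 1)" "%x. fderiv (%x. p x $ 1) (at x) (axis 2 1)"
  "%x. fderiv (%x. p x $ 2) (at x) (axis 1 1)" "%x. fderiv (%x. p x $ 2) (at x) (axis 2 1)"
  by unfold_locales (intro smooth_C1_grad ps)+
 have wp: "w = p" by (simp add: w_def vec_eq_iff forall_2 fun_eq_iff)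
 have "negligible (w ` {x. J x = 0})"
 proof (rule baby_Sard)
  show "(w has_derivative D x) (at x within {x. J x = 0})" for x by (rule w_deriv)
  show "rank (matrix (D x)) < CARD(2)" if "x : {x. J x = 0}" for x
  using that det_D[of x] det_eq_0_rank[of "matrix (D x)"] by simp
 qed simp
 moreover have "\<not> negligible (ball y (e/2))" by (rule open_not_negligible) (use e in auto)
 ultimately have "\<not> ball y (e/2) \<subseteq> w ` {x. J x = 0}" using negligible_subset by blast
 then obtain q where q: "q : ball y (e/2)" "q \<notin> w ` {x. J x = 0}" by blast
 show ?thesis
 proof (rule that[of "%x. w x + (y - q)"])
  show "smooth (%x. (w x + (y - q)) $ i)" for i
  unfolding smooth_def wp vector_add_component by (intro allI C_diff_add C_diff_const pc)
  show "norm (w x + (y - q) - u x) < e" if "x : cball 0 R" for x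
  proof -
  have "norm (w x + (y - q) - u x) <= norm (u x - p x) + norm (y - q)"
  using norm_triangle_ineq[of "p x - u x" "y - q"] unfolding wp by (simp add: norm_minus_commute algebra_simps)
  also have "... < e / 2 + e / 2" using p(2) that q(1) by (intro add_strict_mono) (auto simp: dist_norm)
  finally show ?thesis by simp
  qed
  show "det (jacobian (%x. w x + (y - q)) (at x)) ~= 0" if "w x + (y - q) = y" for x
  proof -
  have "w x = q" using that by (simp add: algebra_simps)
  thus ?thesis unfolding det_jacobian_shift using q(2) by auto
  qed
 qed
qed

text \<open>Every \<open>v\<close> allowed in the definition gives the same count by
  \<open>regular_degree_near_circle\<close>, and one exists by \<open>regular_approximation\<close>,
  so the definite description has a value.\<close>

lemma topological_degree_circle:
 fixes u :: "real^2 => real^2"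
 assumes R: "0 < R" and rho: "0 <= rho" and u: "continuous_on (cball 0 R) u" "!!t. u (pol R t) = pol rho t"
  and y: "norm y ~= rho"
 shows "topological_degree y u (ball 0 R) = (if norm y < rho then 1 else 0)"
proof -
 have fr: "frontier (ball (0::real^2) R) = sphere 0 R" using R by (simp add: frontier_ball)
 have onb: "\<exists>t. x = pol R t" if "x : sphere 0 R" for x
 proof -
  obtain s t where st: "0 <= s" "x = pol s t" using pol_surj[of x] by blast
  hence "s = R" using that by simp
  thus ?thesis using st by blast
 qed
 have out: "y \<notin> u ` frontier (ball 0 R)"
 proof
  assume "y : u ` frontier (ball 0 R)"
  then obtain t where "y = u (pol R t)" unfolding fr using onb by blast
  thus False using y rho by (simp add: u(2))
 qed
 define e where "e = infdist y (u ` frontier (ball 0 R))"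
 \<comment> \<open>\<open>infdist\<close> to the empty set is 0, so the positivity of
   \<open>e\<close> rests on this.\<close>
 have ne: "u ` frontier (ball 0 R) ~= {}" unfolding fr using R norm_pol[of R 0] by (auto simp del: norm_pol intro!: exI[of _ "pol R 0"])
 have "compact (u ` sphere 0 R)" by (rule compact_continuous_image[OF cont_subset[OF u(1)]]) auto
 hence "closed (u ` frontier (ball 0 R))" unfolding fr by (rule compact_imp_closed)
 hence e: "0 < e" unfolding e_def using infdist_pos_not_in_closed ne out by blast
 have ele: "e <= norm (pol rho t - y)" for t
 proof -
  have "u (pol R t) : u ` frontier (ball 0 R)" unfolding fr using R by simp
  from infdist_le[OF this, of y] show ?thesis by (simp add: e_def dist_norm norm_minus_commute u(2))
 qed
 define P where "P d v \<longleftrightarrow> (\<forall>i. smooth (%x. v x $ i)) & (\<forall>x\<in>closure (ball 0 R). norm (v x - u x) < e)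
  & (\<forall>x\<in>ball 0 R. v x = y --> det (jacobian v (at x)) ~= 0) & of_int d = regular_degree y v (ball 0 R)" for d :: int and v :: "real^2 => real^2"
 have cl: "closure (ball (0::real^2) R) = cball 0 R" using R by simp
 have val: "regular_degree y v (ball 0 R) = (if norm y < rho then 1 else 0)"
  if v: "\<forall>i. smooth (%x. v x $ i)" "\<forall>x\<in>cball 0 R. norm (v x - u x) < e" "\<forall>x\<in>ball 0 R. v x = y --> det (jacobian v (at x)) ~= 0" for v
 proof (rule regular_degree_near_circle[OF R rho _ _ _ y])
  show "smooth (%x. v x $ i)" for i using v(1) by blast
  show "norm (v (pol R t) - pol rho t) < norm (pol rho t - y)" for t
  using bspec[OF v(2), of "pol R t"] R ele[of t] by (simp add: u(2))
  show "det (jacobian v (at x)) ~= 0" if "x : ball 0 R" "v x = y" for x using v(3) that by blast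
 qed
 have "(THE d. \<exists>v. P d v) = (if norm y < rho then 1 else 0)"
 proof (rule the_equality)
  obtain v where "!!i. smooth (%x. v x $ i)" "!!x. x : cball 0 R ==> norm (v x - u x) < e"
  "!!x. v x = y ==> det (jacobian v (at x)) ~= 0" using regular_approximation[OF u(1) e, of y] by metis
  hence v: "\<forall>i. smooth (%x. v x $ i)" "\<forall>x\<in>cball 0 R. norm (v x - u x) < e" "\<forall>x\<in>ball 0 R. v x = y --> det (jacobian v (at x)) ~= 0" by auto
  show "\<exists>v. P (if norm y < rho then 1 else 0) v" unfolding P_def cl using v val[OF v] by (intro exI[of _ v]) simp
  fix d assume "\<exists>v. P d v"
  then obtain v where "P d v" by blast
  hence "of_int d = (if norm y < rho then 1 else 0 :: real)" unfolding P_def cl using val[of v] by auto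
  thus "d = (if norm y < rho then 1 else 0)" by (auto split: if_splits)
 qed
 thus ?thesis unfolding topological_degree_def P_def e_def using out by simp
qed

section \<open>Borel representatives and weak gradients\<close>

lemma borel_version:
 fixes h :: "'a::euclidean_space => real"
 assumes h: "locally_integrable h"
 shows "h : borel_measurable lebesgue" "\<exists>h'. loc_pow 1 h' & (AE x in lborel. h x = h' x)"
proof -
 have ci: "integrable lebesgue (%x. ind (cball 0 R) x *\<^sub>R h x)" for R
  using spec[OF h[unfolded locally_integrable_def], of "cball 0 R"] by (simp add: set_integrable_def)
 show hm: "h : borel_measurable lebesgue"
 proof (rule borel_measurable_LIMSEQ_real)
  show "(%x. ind (cball 0 (real n)) x *\<^sub>R h x) : borel_measurable lebesgue" for n by (rule integrable_meas[OF ci])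
  fix x :: 'a
  have "\<forall>\<^sub>F n in sequentially. ind (cball 0 (real n)) x *\<^sub>R h x = h x"
  using eventually_ge_at_top[of "nat \<lceil>norm x\<rceil>"] by eventually_elim (simp add: indicator_def nat_le_iff ceiling_le_iff)
  thus "(%n. ind (cball 0 (real n)) x *\<^sub>R h x) \<longlonglongrightarrow> h x" by (rule tendsto_eventually)
 qed
 obtain h' where h': "h' : borel_measurable lborel" "AE x in lborel. h x = h' x"
  using completion_ex_borel_measurable_real[OF hm] by blast
 have "loc_pow 1 h'" unfolding loc_pow_def
 proof (intro conjI allI)
  show "h' : borel_fun" using h'(1) by simp
  fix R
  have "(nnint lborel (%x. ennreal (\<bar>h' x\<bar> ^ 1) * ind (cball 0 R) x)) = (nnint lebesgue (%x. ennreal (\<bar>h' x\<bar> ^ 1) * ind (cball 0 R) x))"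
  by (simp add: nn_integral_completion)
  also have "... = (nnint lebesgue (%x. ennreal (norm (ind (cball 0 R) x *\<^sub>R h x))))"
  proof (rule nn_integral_cong_AE)
  have "AE x in lebesgue. h x = h' x" by (rule AE_completion[OF h'(2)])
  thus "AE x in lebesgue. ennreal (\<bar>h' x\<bar> ^ 1) * ind (cball 0 R) x = ennreal (norm (ind (cball 0 R) x *\<^sub>R h x))"
  by eventually_elim (auto simp: indicator_def)
  qed
  also have "... < \<infinity>" using ci[of R] unfolding integrable_iff_bounded by blast
  finally show "(nnint lborel (%x. ennreal (\<bar>h' x\<bar> ^ 1) * ind (cball 0 R) x)) < \<infinity>" .
 qed
 thus "\<exists>h'. loc_pow 1 h' & (AE x in lborel. h x = h' x)" using h'(2) by (intro exI[of _ h'] conjI)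
qed

lemma loc_pow_1_abs_integrable:
 fixes h :: "'a::euclidean_space => real"
 assumes h: "loc_pow 1 h" and K: "compact K"
 shows "h absolutely_integrable_on K"
proof -
 obtain R where R: "K \<subseteq> cball 0 R" using compact_imp_bounded[OF K] unfolding bounded_iff by (auto simp: subset_iff)
 have "integrable lborel (%x. h x * ind (cball 0 R) x)"
  by (rule loc_pow_mult[OF h, where B=1 and R=R]) (auto simp: indicator_def cball_borel)
 hence "integrable lebesgue (%x. h x * ind (cball 0 R) x)" by (subst integrable_completion) (auto dest: integrable_meas)
 hence "h absolutely_integrable_on (cball 0 R)" by (simp add: set_integrable_def mult.commute)
 thus ?thesis by (rule set_integrable_subset[OF _ _ R]) (use K in \<open>simp add: compact_imp_closed\<close>)
qed

lemma test_function_bounded: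
 fixes phi :: "real^2 => real"
 assumes "smooth phi" "compact (support phi)"
 shows "phi \<in> borel_fun" "\<exists>B R. (\<forall>y. \<bar>phi y\<bar> <= B) & (\<forall>y. norm y > R --> phi y = 0)"
proof -
 have c: "contU phi" by (rule C1_gradD(4)[OF smooth_C1_grad[OF assms(1)]])
 obtain R where R: "0 < R" "!!x. R < norm x ==> phi x = 0" using compact_support_radius[OF assms(2)] by blast
 have "bounded (phi ` cball 0 R)" by (intro compact_imp_bounded compact_continuous_image cont_subset[OF c]) auto
 then obtain B where B: "\<forall>y\<in>phi ` cball 0 R. norm y <= B" unfolding bounded_iff by blast
 have "\<bar>phi y\<bar> <= \<bar>B\<bar>" for y
 proof (cases "R < norm y")
  case False
  hence "norm (phi y) <= B" by (intro bspec[OF B]) auto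
  thus ?thesis by simp
 qed (simp add: R(2))
 thus "\<exists>B R. (\<forall>y. \<bar>phi y\<bar> <= B) & (\<forall>y. norm y > R --> phi y = 0)"
  using R(2) by (intro exI[of _ "\<bar>B\<bar>"] exI[of _ R]) simp
 show "phi \<in> borel_fun" by (rule cont_borel[OF c])
qed

lemma integral_mult_borel_version:
 fixes h h' k :: "real^2 => real"
 assumes h: "h : borel_measurable lebesgue" and h': "h' : borel_fun" "AE x in lborel. h x = h' x" and k: "k : borel_fun"
 shows "(LINT x|lebesgue. h x * k x) = (LINT x|lborel. h' x * k x)"
proof -
 have "(LINT x|lebesgue. h x * k x) = (LINT x|lebesgue. h' x * k x)"
 proof (rule integral_cong_AE)
  show "(%x. h x * k x) : borel_measurable lebesgue" by (intro borel_measurable_times h measurable_completion) (simp add: k)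
  show "(%x. h' x * k x) : borel_measurable lebesgue" by (intro borel_measurable_times measurable_completion) (simp_all add: k h')
  have "AE x in lebesgue. h x = h' x" by (rule AE_completion[OF h'(2)])
  thus "AE x in lebesgue. h x * k x = h' x * k x" by eventually_elim simp
 qed
 also have "... = (LINT x|lborel. h' x * k x)" by (rule integral_completion) (use h' k in simp)
 finally show ?thesis .
qed

text \<open>The fundamental lemma \<open>weak_partial_zero_AE\<close>, applied to the difference of
  Borel representatives.\<close>

lemma AE_eq_of_tests:
 fixes h1 h2 :: "real^2 => real"
 assumes h: "locally_integrable h1" "locally_integrable h2"
  and eq: "!!phi. smooth phi ==> compact (support phi) ==> (LINT x|lebesgue. h1 x * phi x) = (LINT x|lebesgue. h2 x * phi x)"
 shows "AE x in lborel. h1 x = h2 x"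
proof -
 obtain k1 where k1: "loc_pow 1 k1" "AE x in lborel. h1 x = k1 x"
  using borel_version(2)[OF h(1)] by blast
 obtain k2 where k2: "loc_pow 1 k2" "AE x in lborel. h2 x = k2 x"
  using borel_version(2)[OF h(2)] by blast
 have dl: "loc_pow 1 (%x. k1 x - k2 x)" unfolding loc_pow_def
 proof (intro conjI allI)
  note [measurable] = loc_pow_borel[OF k1(1)] loc_pow_borel[OF k2(1)]
  show "(%x. k1 x - k2 x) : borel_fun" by measurable
  fix R
  have i: "(nnint lborel (%x. ennreal (\<bar>k x\<bar> ^ 1) * ind (cball 0 R) x)) < \<infinity>" if "loc_pow 1 k" for k :: "real^2 => real"
  using that by (simp add: loc_pow_def)
  have "(nnint lborel (%x. ennreal (\<bar>k1 x - k2 x\<bar> ^ 1) * ind (cball 0 R) x))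
  <= (nnint lborel (%x. ennreal (\<bar>k1 x\<bar> ^ 1) * ind (cball 0 R) x + ennreal (\<bar>k2 x\<bar> ^ 1) * ind (cball 0 R) x))"
  by (rule nn_integral_mono) (auto simp: indicator_def ennreal_plus[symmetric] simp del: ennreal_plus intro: ennreal_leI)
  also have "... = (nnint lborel (%x. ennreal (\<bar>k1 x\<bar> ^ 1) * ind (cball 0 R) x)) + (nnint lborel (%x. ennreal (\<bar>k2 x\<bar> ^ 1) * ind (cball 0 R) x))"
  by (rule nn_integral_add) (auto simp: cball_borel)
  also have "... < \<infinity>" using i[OF k1(1)] i[OF k2(1)] by simp
  finally show "(nnint lborel (%x. ennreal (\<bar>k1 x - k2 x\<bar> ^ 1) * ind (cball 0 R) x)) < \<infinity>" .
 qed
 have "AE x in lborel. k1 x - k2 x = 0"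
 proof (rule weak_partial_zero_AE[OF dl])
  fix phi :: "real^2 => real" assume phi: "smooth phi" "compact (support phi)"
  note m = test_function_bounded(1)[OF phi]
  obtain B R where B: "!!y. \<bar>phi y\<bar> <= B" "!!y. norm y > R ==> phi y = 0"
  using test_function_bounded(2)[OF phi] by blast
  have "(LINT x|lborel. (k1 x - k2 x) * phi x) = (LINT x|lborel. k1 x * phi x - k2 x * phi x)" by (simp add: left_diff_distrib)
  also have "... = (LINT x|lborel. k1 x * phi x) - (LINT x|lborel. k2 x * phi x)"
  by (intro Bochner_Integration.integral_diff loc_pow_mult[OF k1(1) m B] loc_pow_mult[OF k2(1) m B])
  also have "... = 0"
  using eq[OF phi] unfolding integral_mult_borel_version[OF borel_version(1)[OF h(1)] loc_pow_borel[OF k1(1)] k1(2) m]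
  integral_mult_borel_version[OF borel_version(1)[OF h(2)] loc_pow_borel[OF k2(1)] k2(2) m] by simp
  finally show "(LINT x|lborel. (k1 x - k2 x) * phi x) = 0" .
 qed
 thus ?thesis using k1(2) k2(2) by eventually_elim simp
qed

lemma locally_integrable_component:
 fixes u :: "real^2 => 'b::euclidean_space ^ 2"
 assumes "locally_integrable u" shows "locally_integrable (%x. u x $ i)"
 unfolding locally_integrable_def
proof (intro allI impI)
 fix K :: "(real^2) set" assume "compact K"
 hence "u absolutely_integrable_on K" using assms by (simp add: locally_integrable_def)
 from absolutely_integrable_linear[OF this bounded_linear_vec_nth[of i]] show "(%x. u x $ i) absolutely_integrable_on K" by (simp add: o_def)
qed

text \<open>Two weak gradients of one map have the same integrals against all test functions. This
  makes the choice by \<open>SOME\<close> harmless.\<close>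

lemma weak_grad_AE_eq:
 assumes G: "has_weak_gradient u G"
 shows "has_weak_gradient u (weak_grad u)" "AE x in lborel. weak_grad u x = G x"
proof -
 show W: "has_weak_gradient u (weak_grad u)" unfolding weak_grad_def by (rule someI[where P="has_weak_gradient u", OF G])
 have c: "AE x in lborel. weak_grad u x $ i $ j = G x $ i $ j" for i j
 proof (rule AE_eq_of_tests)
  have "locally_integrable (weak_grad u)" "locally_integrable G" using W G by (simp_all add: has_weak_gradient_def)
  note l = this
  show "locally_integrable (%x. weak_grad u x $ i $ j)" "locally_integrable (%x. G x $ i $ j)"
  by (rule locally_integrable_component[OF locally_integrable_component[OF l(1)]], rule locally_integrable_component[OF locally_integrable_component[OF l(2)]])
  fix phi :: "real^2 => real" assume phi: "smooth phi" "compact (support phi)"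
  have "(LINT x|lebesgue. u x $ i * fderiv phi (at x) (axis j 1)) = - (LINT x|lebesgue. H x $ i $ j * phi x)" if "has_weak_gradient u H" for H
  using that phi unfolding has_weak_gradient_def by blast
  from this[OF W] this[OF G] show "(LINT x|lebesgue. weak_grad u x $ i $ j * phi x) = (LINT x|lebesgue. G x $ i $ j * phi x)" by simp
 qed
 show "AE x in lborel. weak_grad u x = G x"
  using c[of 1 1] c[of 1 2] c[of 2 1] c[of 2 2] by eventually_elim (simp add: vec_eq_iff forall_2)
qed

abbreviation mat22 :: "real => real => real => real => real^2^2" where
 "mat22 p q r s \<equiv> vector [vector [p, q], vector [r, s]]"

lemma matrix_norm_mat22: "matrix_norm (mat22 p q r s) = sqrt (p\<^sup>2 + q\<^sup>2 + r\<^sup>2 + s\<^sup>2)"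
 by (simp add: matrix_norm_def trace_def matrix_matrix_mult_def transpose_def sum_2 sq_eq)

lemma matrix_norm_powr:
 "matrix_norm (mat22 p q r s) powr (2 * t) = (p\<^sup>2 + q\<^sup>2 + r\<^sup>2 + s\<^sup>2) powr t"
proof -
 define N where "N = p\<^sup>2 + q\<^sup>2 + r\<^sup>2 + s\<^sup>2"
 have "sqrt N = N powr (1/2)" by (rule powr_half_sqrt[symmetric]) (simp add: N_def)
 thus ?thesis unfolding matrix_norm_mat22 N_def[symmetric] by (simp add: powr_powr)
qed

lemma has_weak_gradientI:
 assumes l: "loc_pow 1 a" "loc_pow 1 b" "loc_pow 1 a1" "loc_pow 1 a2" "loc_pow 1 b1" "loc_pow 1 b2"
  and w: "has_weak_partial (axis 1 1) a a1" "has_weak_partial (axis 2 1) a a2" "has_weak_partial (axis 1 1) b b1" "has_weak_partial (axis 2 1) b b2"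
 shows "has_weak_gradient (%x. vector [a x, b x] :: real^2) (%x. mat22 (a1 x) (a2 x) (b1 x) (b2 x))"
proof -
 have sc: "(%x. h x *\<^sub>R c) absolutely_integrable_on K" if "loc_pow 1 h" "compact K" for h :: "real^2 => real" and c :: "'c::euclidean_space" and K
  using absolutely_integrable_linear[OF loc_pow_1_abs_integrable[OF that] bounded_linear_scaleR_left[of c]] by (simp add: o_def)
 have e1: "(%x. vector [a x, b x] :: real^2) = (%x. a x *\<^sub>R axis 1 1 + b x *\<^sub>R axis 2 1)"
  by (auto simp: fun_eq_iff vec_eq_iff forall_2 axis_def)
 have e2: "(%x. mat22 (a1 x) (a2 x) (b1 x) (b2 x)) = (%x. ((a1 x *\<^sub>R axis 1 (axis 1 1) + a2 x *\<^sub>R axis 1 (axis 2 1)) + b1 x *\<^sub>R axis 2 (axis 1 1)) + b2 x *\<^sub>R axis 2 (axis 2 1))"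
  by (auto simp: fun_eq_iff vec_eq_iff forall_2 axis_def)
 have i: "(LINT x|lebesgue. c x * fderiv phi (at x) e) = - (LINT x|lebesgue. d x * phi x)"
  if c: "loc_pow 1 c" "loc_pow 1 d" "has_weak_partial e c d" and phi: "smooth phi" "compact (support phi)" and e: "e : Basis" for c d phi and e :: "real^2"
 proof -
  have m: "phi \<in> borel_fun" by (rule test_function_bounded(1)[OF phi])
  have "C_diff (Suc 0) phi" using phi(1) by (simp add: smooth_def)
  hence "contU (%x. fderiv phi (at x) e)" using C_diff_SucD(2)[of 0 phi e] e by simp
  hence m': "(%x. fderiv phi (at x) e) : borel_fun" by (rule cont_borel)
  have "(LINT x|lebesgue. c x * fderiv phi (at x) e) = (LINT x|lborel. c x * fderiv phi (at x) e)"
  by (rule integral_completion) (use loc_pow_borel[OF c(1)] m' in simp)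
  also have "... = - (LINT x|lborel. d x * phi x)" using c(3) phi by (simp add: has_weak_partial_def)
  also have "(LINT x|lborel. d x * phi x) = (LINT x|lebesgue. d x * phi x)"
  by (rule integral_completion[symmetric]) (use loc_pow_borel[OF c(2)] m in simp)
  finally show ?thesis .
 qed
 have B: "axis 1 1 : (Basis :: (real^2) set)" "axis 2 1 : (Basis :: (real^2) set)" by (auto simp: Basis_vec_def)
 show ?thesis unfolding has_weak_gradient_def
 proof (intro conjI allI impI)
  show "locally_integrable (%x. vector [a x, b x] :: real^2)"
  unfolding locally_integrable_def e1 by (intro allI impI set_integral_add(1) sc l)
  show "locally_integrable (%x. mat22 (a1 x) (a2 x) (b1 x) (b2 x))"
  unfolding locally_integrable_def e2 by (intro allI impI set_integral_add(1) sc l)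
  fix phi :: "real^2 => real" and i' j :: 2 assume phi: "smooth phi & compact (support phi)"
  show "(LINT x|lebesgue. (vector [a x, b x] :: real^2) $ i' * fderiv phi (at x) (axis j 1)) = - (LINT x|lebesgue. mat22 (a1 x) (a2 x) (b1 x) (b2 x) $ i' $ j * phi x)"
  using exhaust_2[of i'] exhaust_2[of j] i[OF l(1,3) w(1) conjunct1[OF phi] conjunct2[OF phi] B(1)] i[OF l(1,4) w(2) conjunct1[OF phi] conjunct2[OF phi] B(2)]
  i[OF l(2,5) w(3) conjunct1[OF phi] conjunct2[OF phi] B(1)] i[OF l(2,6) w(4) conjunct1[OF phi] conjunct2[OF phi] B(2)] by auto
 qed
qed

text \<open>A gradient in L^(2p) is locally in L2, because \<open>N <= 1 + N powr p\<close> for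
  \<open>p >= 1\<close>. The components are replaced by Borel representatives, as
  \<open>weak_map\<close> requires.\<close>

lemma homog_sobolev_weak_map:
 assumes p: "1 <= p" and u: "homog_sobolev (2 * p) u"
 obtains a b a1 a2 b1 b2 where "weak_map a b a1 a2 b1 b2" "AE x in lborel. u x = vector [a x, b x]"
  "AE x in lborel. weak_grad u x = mat22 (a1 x) (a2 x) (b1 x) (b2 x)"
  "integrable lborel (%x. ((a1 x)^2 + (a2 x)^2 + (b1 x)^2 + (b2 x)^2) powr p)"
  "energy (2 * p) u = (LINT x|lborel. ((a1 x)^2 + (a2 x)^2 + (b1 x)^2 + (b2 x)^2) powr p)"
proof -
 obtain G0 where "has_weak_gradient u G0" using u by (auto simp: homog_sobolev_def)
 hence W: "has_weak_gradient u (weak_grad u)" by (rule weak_grad_AE_eq(1))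
 have l0: "locally_integrable u" "locally_integrable (weak_grad u)" using W by (simp_all add: has_weak_gradient_def)
 have li: "locally_integrable (%x. u x $ i)" "locally_integrable (%x. weak_grad u x $ i $ j)" for i j
  by (rule locally_integrable_component[OF l0(1)], rule locally_integrable_component[OF locally_integrable_component[OF l0(2)]])
 have ui: "\<exists>h. loc_pow 1 h & (AE x in lborel. u x $ i = h x)" for i
  by (rule borel_version(2)[OF li(1)])
 have Gi: "\<exists>h. loc_pow 1 h & (AE x in lborel. weak_grad u x $ i $ j = h x)" for i j
  by (rule borel_version(2)[OF li(2)])
 have um: "(%x. u x $ i) : borel_measurable lebesgue" "(%x. weak_grad u x $ i $ j) : borel_measurable lebesgue" for i j
  by (rule borel_version(1)[OF li(1)], rule borel_version(1)[OF li(2)])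
 obtain a where a: "loc_pow 1 a" "AE x in lborel. u x $ 1 = a x" using ui by blast
 obtain b where b: "loc_pow 1 b" "AE x in lborel. u x $ 2 = b x" using ui by blast
 obtain a1 where a1: "loc_pow 1 a1" "AE x in lborel. weak_grad u x $ 1 $ 1 = a1 x" using Gi by blast
 obtain a2 where a2: "loc_pow 1 a2" "AE x in lborel. weak_grad u x $ 1 $ 2 = a2 x" using Gi by blast
 obtain b1 where b1: "loc_pow 1 b1" "AE x in lborel. weak_grad u x $ 2 $ 1 = b1 x" using Gi by blast
 obtain b2 where b2: "loc_pow 1 b2" "AE x in lborel. weak_grad u x $ 2 $ 2 = b2 x" using Gi by blast
 note [measurable] = loc_pow_borel[OF a1(1)] loc_pow_borel[OF a2(1)] loc_pow_borel[OF b1(1)] loc_pow_borel[OF b2(1)]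
 define N where "N x = (a1 x)^2 + (a2 x)^2 + (b1 x)^2 + (b2 x)^2" for x
 have Nm [measurable]: "N : borel_fun" unfolding N_def[abs_def] by measurable
 have ge: "AE x in lborel. weak_grad u x = mat22 (a1 x) (a2 x) (b1 x) (b2 x)"
  using a1(2) a2(2) b1(2) b2(2) by eventually_elim (simp add: vec_eq_iff forall_2)
 have me: "AE x in lebesgue. matrix_norm (weak_grad u x) powr (2 * p) = N x powr p"
  using AE_completion[OF ge] by eventually_elim (simp only: matrix_norm_powr N_def)
 have il: "integrable lebesgue (%x. matrix_norm (weak_grad u x) powr (2 * p))" using u by (simp add: homog_sobolev_def)
 have Nl: "(%x. N x powr p) : borel_measurable lebesgue" by (rule measurable_completion) measurable
 have "integrable lebesgue (%x. N x powr p)"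
  by (rule iffD1[OF integrable_cong_AE[OF integrable_meas[OF il] Nl me] il])
 hence iN: "integrable lborel (%x. N x powr p)" by (subst (asm) integrable_completion) auto
 have en: "energy (2 * p) u = (LINT x|lborel. N x powr p)"
  unfolding energy_def integral_cong_AE[OF integrable_meas[OF il] Nl me] by (rule integral_completion) measurable
 have l2: "loc_pow 2 c" if cm: "c : borel_fun" and c: "!!x. (c x)^2 <= N x" for c
  unfolding loc_pow_def
 proof (intro conjI allI cm)
  fix R
  have "(nnint lborel (%x. ennreal (\<bar>c x\<bar> ^ 2) * ind (cball 0 R) x)) <= (nnint lborel (%x. ind (cball 0 R) x + ennreal (norm (N x powr p))))"
  proof (rule nn_integral_mono)
  fix x
  have N0: "0 <= N x" by (rule order_trans[OF zero_le_power2 c])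
  have "N x <= 1 + N x powr p"
  proof (cases "1 <= N x")
  case True
  have "N x = N x powr 1" using True by simp
  also have "... <= N x powr p" using p True by (intro powr_mono) auto
  finally show ?thesis by simp
  qed (use powr_ge_zero[of "N x" p] in linarith)
  hence "(c x)^2 <= 1 + norm (N x powr p)" using c[of x] by simp
  hence "ennreal ((c x)^2) <= ennreal (1 + norm (N x powr p))" by (rule ennreal_leI)
  also have "... = ennreal 1 + ennreal (norm (N x powr p))" by (rule ennreal_plus) simp_all
  finally show "ennreal (\<bar>c x\<bar> ^ 2) * ind (cball 0 R) x <= ind (cball 0 R) x + ennreal (norm (N x powr p))"
  by (auto simp: indicator_def)
  qed
  also have "... = emeasure lborel (cball (0::real^2) R) + (nnint lborel (%x. ennreal (norm (N x powr p))))"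
  by (subst nn_integral_add) (auto simp: cball_borel)
  also have "... < \<infinity>" using iN emeasure_bounded_finite[OF bounded_cball, of "0::real^2" R] unfolding integrable_iff_bounded by simp
  finally show "(nnint lborel (%x. ennreal (\<bar>c x\<bar> ^ 2) * ind (cball 0 R) x)) < \<infinity>" .
 qed
 have wp: "has_weak_partial (axis j 1) c d"
  if c: "loc_pow 1 c" "AE x in lborel. u x $ i = c x" and d: "loc_pow 1 d" "AE x in lborel. weak_grad u x $ i $ j = d x" for i j c d
  unfolding has_weak_partial_def
 proof (intro allI impI)
  fix phi :: "real^2 => real" assume phi: "smooth phi & compact (support phi)"
  have m: "phi \<in> borel_fun" by (rule test_function_bounded(1)[OF conjunct1[OF phi] conjunct2[OF phi]])
  have "C_diff (Suc 0) phi" using phi by (simp add: smooth_def)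
  moreover have "axis j 1 : (Basis :: (real^2) set)" by (auto simp: Basis_vec_def)
  ultimately have "contU (%x. fderiv phi (at x) (axis j 1))" using C_diff_SucD(2)[of 0 phi "axis j 1"] by simp
  hence m': "(%x. fderiv phi (at x) (axis j 1)) : borel_fun" by (rule cont_borel)
  have "(LINT x|lebesgue. u x $ i * fderiv phi (at x) (axis j 1)) = - (LINT x|lebesgue. weak_grad u x $ i $ j * phi x)"
  using W phi unfolding has_weak_gradient_def by blast
  thus "(LINT x|lborel. c x * fderiv phi (at x) (axis j 1)) = - (LINT x|lborel. d x * phi x)"
  unfolding integral_mult_borel_version[OF um(1) loc_pow_borel[OF c(1)] c(2) m'] integral_mult_borel_version[OF um(2) loc_pow_borel[OF d(1)] d(2) m] .
 qed
 have "weak_map a b a1 a2 b1 b2"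
 proof
  show "loc_pow 1 a" "loc_pow 1 b" "loc_pow 1 a1" "loc_pow 1 a2" "loc_pow 1 b1" "loc_pow 1 b2" by (rule a b a1 a2 b1 b2)+
  show "loc_pow 2 a1" "loc_pow 2 a2" "loc_pow 2 b1" "loc_pow 2 b2" by (rule l2; simp add: N_def)+
  show "has_weak_partial (axis 1 1) a a1" "has_weak_partial (axis 2 1) a a2" "has_weak_partial (axis 1 1) b b1" "has_weak_partial (axis 2 1) b b2"
  by (rule wp[OF a a1] wp[OF a a2] wp[OF b b1] wp[OF b b2])+
 qed
 moreover have "AE x in lborel. u x = vector [a x, b x]" using a(2) b(2) by eventually_elim (simp add: vec_eq_iff forall_2)
 ultimately show ?thesis by (rule that[OF _ _ ge iN[unfolded N_def] en[unfolded N_def]])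
qed

text \<open>The given profile may take arbitrary values on a null set. Averaging a Borel
  representative of \<open>f\<close> over circles produces a Borel profile that agrees with it at
  almost every radius.\<close>

lemma borel_profile:
 assumes f: "locally_integrable f" and fg: "radial_with_profile f g"
 obtains g0 where "g0 : borel_fun" "AE r in radm. g0 r = g r" "AE x in lborel. f x = g0 (norm (x::real^2))"
proof -
 obtain f' where f': "loc_pow 1 f'" "AE x in lborel. f x = f' x" using borel_version(2)[OF f] by blast
 note [measurable] = loc_pow_borel[OF f'(1)]
 have "AE x in lborel. f x = g (norm x)" using fg unfolding radial_with_profile_def AE_completion_iff .
 hence "AE x in lborel. f' x = g (norm x)" using f'(2) by eventually_elim simp
 from AE_polar[OF this] have P: "AE r in radm. AE t in circm. f' (pol r t) = g \<bar>r\<bar>" by simp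
 define g0 where "g0 r = (LINT t|circm. f' (pol r t)) / (2 * pi)" for r
 have g0m: "g0 : borel_fun" unfolding g0_def[abs_def] by measurable
 have pos: "AE s in radm. 0 < s" by (simp add: AE_radm_iff)
 have e: "AE r in radm. g0 r = g r"
  using P pos
 proof eventually_elim
  fix r assume r: "AE t in circm. f' (pol r t) = g \<bar>r\<bar>" "0 < r"
  have "(LINT t|circm. f' (pol r t)) = (LINT t|circm. g r)"
  by (rule integral_cong_AE) (use r in auto)
  thus "g0 r = g r" by (simp add: g0_def measure_def emeasure_circm)
 qed
 have "AE x in lborel. f' x = g0 (norm x)"
 proof (subst AE_polar_iff)
  show "Measurable.pred borel (%x. f' x = g0 (norm x))" using g0m by measurable
  show "AE r in radm. AE t in circm. f' (pol r t) = g0 (norm (pol r t))"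
  using P e pos by eventually_elim simp
 qed
 hence "AE x in lborel. f x = g0 (norm x)" using f'(2) by eventually_elim simp
 thus ?thesis using that g0m e by blast
qed

lemma measure_ball_plane: "0 <= r ==> measure lebesgue (ball (0::real^2) r) = pi * r\<^sup>2"
 by (simp add: content_ball unit_ball_vol_2)

section \<open>The stretching as minimiser\<close>

locale stretching_problem = radial_profile g0 F for g0 F +
 fixes p :: real and f :: "real^2 => real" and g :: "real => real"
 assumes p: "1 <= p" and fm: "f : borel_measurable lebesgue" and fg: "AE x in lebesgue. f x = g0 (norm x)"
  and sr: "!!r. 0 <= r ==> stretch_radius g r = sqrt (F r)"
  and fball: "!!r. 0 < r ==> (LINT x:ball 0 r|lebesgue. f x) = pi * F r"
  and Hfin: "(nnint lebesgue (%x. ennreal_powr (grand_maximal f x) p)) < \<infinity>"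
begin

abbreviation "st == radial_stretching g"

lemma stretching_eq: "st = (%x. vector [ph1 x, ph2 x])"
 by (auto simp: fun_eq_iff vec_eq_iff forall_2 radial_stretching_def sr ph1_def ph2_def rho_def divide_inverse mult_ac)

lemma stretching_gradient: "has_weak_gradient st (%x. mat22 (G11 x) (G12 x) (G12 x) (G22 x))"
 unfolding stretching_eq
 by (rule has_weak_gradientI[OF ph_loc(1,2) G_loc(1,2,2,3) ph_weak])

lemma stretching_weak_grad: "AE x in lborel. weak_grad st x = mat22 (G11 x) (G12 x) (G12 x) (G22 x)"
 by (rule weak_grad_AE_eq(2)[OF stretching_gradient])

lemma E0_integrable: "integrable lborel (%x::real^2. E0 (norm x) powr p)"
 and E0_bound: "(LINT x|(lborel::(real^2) measure). E0 (norm x) powr p) <= (2 * hardy_const) powr p * enn2real (nnint lebesgue (%x. ennreal_powr (grand_maximal f x) p))"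
 by (rule E0_power_bound[OF fm fg p Hfin])+

lemma stretching_integrand: "AE x in lebesgue. E0 (norm x) powr p = matrix_norm (weak_grad st x) powr (2 * p)"
proof -
 have "AE x in lebesgue. weak_grad st x = mat22 (G11 x) (G12 x) (G12 x) (G22 x)"
  by (rule AE_completion[OF stretching_weak_grad])
 moreover have "AE x in lebesgue. x ~= 0 & \<bar>g0 (norm x)\<bar> <= F (norm (x::real^2)) / (norm x)^2" by (rule AE_completion[OF AE_g_le_norm])
 ultimately show ?thesis
 proof eventually_elim
  case (elim x)
  show ?case unfolding elim(1) matrix_norm_powr G_norm[OF conjunct1[OF elim(2)]] ..
 qed
qed

lemma stretching_sobolev: "homog_sobolev (2 * p) st"
 and stretching_energy: "energy (2 * p) st = (LINT x|(lborel::(real^2) measure). E0 (norm x) powr p)"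
proof -
 have l: "integrable lebesgue (%x::real^2. E0 (norm x) powr p)"
  using E0_integrable by (subst integrable_completion) (auto dest: integrable_meas)
 have m: "(%x. matrix_norm (weak_grad st x) powr (2 * p)) : borel_measurable lebesgue"
  by (rule borel_measurable_AE[OF integrable_meas[OF l] stretching_integrand])
 have "integrable lebesgue (%x. matrix_norm (weak_grad st x) powr (2 * p))"
  by (rule iffD1[OF integrable_cong_AE[OF integrable_meas[OF l] m stretching_integrand] l])
 thus "homog_sobolev (2 * p) st" unfolding homog_sobolev_def using stretching_gradient by blast
 have "energy (2 * p) st = (LINT x|lebesgue. E0 (norm (x::real^2)) powr p)"
  unfolding energy_def by (rule integral_cong_AE[OF integrable_meas[OF l] m stretching_integrand, symmetric])
 also have "... = (LINT x|(lborel::(real^2) measure). E0 (norm x) powr p)"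
  by (rule integral_completion) (use integrable_meas[OF E0_integrable] in simp)
 finally show "energy (2 * p) st = (LINT x|(lborel::(real^2) measure). E0 (norm x) powr p)" .
qed

lemma stretching_solves: "solves f st"
proof -
 have "AE x in lebesgue. weak_grad st x = mat22 (G11 x) (G12 x) (G12 x) (G22 x)"
  by (rule AE_completion[OF stretching_weak_grad])
 moreover have "AE x in lebesgue. x ~= 0 & \<bar>g0 (norm x)\<bar> <= F (norm (x::real^2)) / (norm x)^2" by (rule AE_completion[OF AE_g_le_norm])
 ultimately show ?thesis unfolding solves_def weak_jacobian_def using fg
  by eventually_elim (simp add: det_2 G_det)
qed

text \<open>Squaring turns the exponent \<open>1 / (2 * p)\<close> of the norm into
  \<open>1 / p\<close>, under which the constant \<open>(2 * hardy_const) powr p\<close> becomes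
  \<open>2 * hardy_const\<close>.\<close>

lemma stretching_grad_norm: "(grad_norm (2 * p) st)^2 <= 2 * hardy_const * hardy_norm p f"
proof -
 define H where "H = enn2real (nnint lebesgue (%x. ennreal_powr (grand_maximal f x) p))"
 define E where "E = energy (2 * p) st"
 have H0: "0 <= H" by (simp add: H_def)
 have E: "0 <= E" "E <= (2 * hardy_const) powr p * H"
  using E0_bound unfolding E_def stretching_energy H_def by (auto intro: integral_nonneg_AE)
 have "(grad_norm (2 * p) st)^2 = (E powr (1 / (2 * p))) powr 2"
  by (simp add: grad_norm_def E_def)
 also have "... = E powr (1 / p)" using p by (simp add: powr_powr)
 also have "... <= ((2 * hardy_const) powr p * H) powr (1 / p)" using E p by (intro powr_mono2) auto
 also have "... = 2 * hardy_const * H powr (1 / p)"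
  using H0 p hardy_const_pos by (simp add: powr_mult powr_powr)
 finally show ?thesis by (simp add: hardy_norm_def H_def)
qed

text \<open>Borel representatives of a competitor form a \<open>weak_radial\<close> map, so
  \<open>minimality\<close> and \<open>equality_case\<close> apply; the two constants of the latter
  are the entries of the rotation. Comparison with the stretching gives a minimiser the inequality
  that the second part assumes.\<close>

lemma energy_minimal:
 assumes u: "homog_sobolev (2 * p) u" "solves f u"
 shows "energy (2 * p) st <= energy (2 * p) u"
  "energy (2 * p) u <= energy (2 * p) st ==> eq_mod_rotation u st"
proof -
 obtain a b a1 a2 b1 b2 where w: "weak_map a b a1 a2 b1 b2" and uv: "AE x in lborel. u x = vector [a x, b x]"
  and G: "AE x in lborel. weak_grad u x = mat22 (a1 x) (a2 x) (b1 x) (b2 x)"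
  and i: "integrable lborel (%x. ((a1 x)^2 + (a2 x)^2 + (b1 x)^2 + (b2 x)^2) powr p)"
  and e: "energy (2 * p) u = (LINT x|lborel. ((a1 x)^2 + (a2 x)^2 + (b1 x)^2 + (b2 x)^2) powr p)"
  by (rule homog_sobolev_weak_map[OF p u(1)])
 interpret wm: weak_map a b a1 a2 b1 b2 by (rule w)
 have "AE x in lborel. det (weak_grad u x) = f x" using u(2) unfolding solves_def weak_jacobian_def AE_completion_iff .
 moreover have "AE x in lborel. f x = g0 (norm x)" using fg unfolding AE_completion_iff .
 ultimately have j: "AE x in lborel. wm.jac x = g0 (norm x)"
  using G by eventually_elim (simp add: det_2 wm.jac_def)
 interpret wr: weak_radial a b a1 a2 b1 b2 g0 F by unfold_locales (rule j)
 have i': "integrable lborel (%x. wr.n2 x powr p)" using i by (simp add: wr.n2_def)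
 have e': "energy (2 * p) u = (LINT x|lborel. wr.n2 x powr p)" using e by (simp add: wr.n2_def)
 show le: "energy (2 * p) st <= energy (2 * p) u"
  unfolding e' stretching_energy by (rule wr.minimality[OF p i' E0_integrable])
 assume "energy (2 * p) u <= energy (2 * p) st"
 hence "(LINT x|lborel. wr.n2 x powr p) = (LINT x|(lborel::(real^2) measure). E0 (norm x) powr p)"
  using le unfolding e' stretching_energy by simp
 from wr.equality_case[OF p i' E0_integrable this] obtain ka \<mu> c d where k: "ka\<^sup>2 + \<mu>\<^sup>2 = 1"
  and P: "AE r in radm. AE t in circm. a (pol r t) = c + rho r * (ka * cos t - \<mu> * sin t) & b (pol r t) = d + rho r * (ka * sin t + \<mu> * cos t)" by blast
 have pos: "AE s in radm. 0 < s" by (simp add: AE_radm_iff)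
 note [measurable] = loc_pow_borel[OF wm.la] loc_pow_borel[OF wm.lb]
 have "AE x in lborel. a x = c + (ka * ph1 x - \<mu> * ph2 x) & b x = d + (\<mu> * ph1 x + ka * ph2 x)"
 proof (subst AE_polar_iff)
  show "Measurable.pred borel (%x. a x = c + (ka * ph1 x - \<mu> * ph2 x) & b x = d + (\<mu> * ph1 x + ka * ph2 x))" by measurable
  show "AE r in radm. AE t in circm. a (pol r t) = c + (ka * ph1 (pol r t) - \<mu> * ph2 (pol r t)) & b (pol r t) = d + (\<mu> * ph1 (pol r t) + ka * ph2 (pol r t))"
  using P pos
  proof eventually_elim
  fix r assume P: "AE t in circm. a (pol r t) = c + rho r * (ka * cos t - \<mu> * sin t) & b (pol r t) = d + rho r * (ka * sin t + \<mu> * cos t)" and r: "0 < r"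
  show "AE t in circm. a (pol r t) = c + (ka * ph1 (pol r t) - \<mu> * ph2 (pol r t)) & b (pol r t) = d + (\<mu> * ph1 (pol r t) + ka * ph2 (pol r t))"
  using P by eventually_elim (simp add: ph_polar[OF r] algebra_simps)
  qed
 qed
 hence "AE x in lborel. u x = mat22 ka (- \<mu>) \<mu> ka *v st x + vector [c, d]"
  using uv by eventually_elim (simp add: stretching_eq vec_eq_iff forall_2 matrix_vector_mult_def sum_2)
 hence "AE x in lebesgue. u x = mat22 ka (- \<mu>) \<mu> ka *v st x + vector [c, d]" by (rule AE_completion)
 moreover have "rotation_matrix (mat22 ka (- \<mu>) \<mu> ka)"
  using k by (simp add: rotation_matrix_def orthogonal_matrix det_2 vec_eq_iff forall_2 matrix_matrix_mult_def transpose_def sum_2 mat_def sq_eq)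
 ultimately show "eq_mod_rotation u st" unfolding eq_mod_rotation_def by blast
qed

lemma stretching_minimiser:
 "energy_minimiser (2 * p) f st"
 "energy_minimiser (2 * p) f u ==> eq_mod_rotation u st"
proof -
 show "energy_minimiser (2 * p) f st"
  unfolding energy_minimiser_def using stretching_sobolev stretching_solves energy_minimal(1) by simp
 assume u: "energy_minimiser (2 * p) f u"
 show "eq_mod_rotation u st"
  by (rule energy_minimal(2)) (use u stretching_sobolev stretching_solves in \<open>simp_all add: energy_minimiser_def\<close>)
qed

text \<open>Away from 0 by composition; at 0 because \<open>norm (st x)\<close> is at most
  \<open>rho (norm x)\<close>, which tends to 0.\<close>

lemma continuous_stretching: "continuous_on A st"
proof -
 have r: "contU (%x::real^2. rho (norm x))"
  by (rule cont_comp[OF rho_cont]) (auto intro!: continuous_intros)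
 have e: "st x = rho (norm x) *\<^sub>R (x /\<^sub>R norm x)" for x by (simp add: radial_stretching_def sr rho_def)
 have "isCont st x" for x
 proof (cases "x = 0")
  case True
  have "isCont (%x::real^2. rho (norm x)) 0" using r by (simp add: continuous_on_eq_continuous_at)
  hence "((%x::real^2. rho (norm x)) \<longlongrightarrow> 0) (at 0)" using F_0 by (simp add: isCont_def rho_def)
  hence "(st \<longlongrightarrow> 0) (at 0)"
  proof (rule Lim_null_comparison[rotated])
  show "\<forall>\<^sub>F x in at 0. norm (st x) <= rho (norm x)"
  proof (rule always_eventually, rule allI)
  fix x :: "real^2"
  show "norm (st x) <= rho (norm x)" using rho_nonneg[of "norm x"] by (cases "x = 0") (simp_all add: e mult.assoc)
  qed
  qed
  thus ?thesis using True by (simp add: isCont_def e)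
 next
  case False
  have o: "open (- {0::real^2})" by (rule open_Compl[OF closed_singleton])
  have "continuous_on (- {0}) (%x::real^2. rho (norm x) *\<^sub>R (x /\<^sub>R norm x))"
  by (intro continuous_on_scaleR cont_subset[OF r subset_UNIV] continuous_on_inverse continuous_on_norm cont_id) auto
  hence "continuous_on (- {0}) st" unfolding e[abs_def] .
  thus ?thesis using False continuous_on_eq_continuous_at[OF o] by blast
 qed
 thus ?thesis by (simp add: cont_at_on)
qed

lemma stretching_pol: "0 <= r ==> st (pol r t) = pol (rho r) t"
proof (cases "r = 0")
 case True
 thus ?thesis using F_0 by (simp add: radial_stretching_def rho_def pol_def vec_eq_iff forall_2)
next
 case False
 assume "0 <= r"
 hence r: "0 < r" using False by simp
 have "st (pol r t) = rho r *\<^sub>R (pol r t /\<^sub>R r)" using r by (simp add: radial_stretching_def sr rho_def)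
 also have "... = pol (rho r) t" using r by (simp add: pol_def vec_eq_iff forall_2)
 finally show ?thesis .
qed

text \<open>For \<open>norm y = rho r\<close> the point lies on the image of the boundary and the
  degree is 0 by convention, in agreement with the strict inequality.\<close>

lemma stretching_degree:
 assumes r: "0 < r"
 shows "topological_degree y st (ball 0 r) = (if norm y < rho r then 1 else 0)"
proof (cases "norm y = rho r")
 case True
 obtain s t where st: "0 <= s" "y = pol s t" using pol_surj[of y] by blast
 hence "s = rho r" using True by simp
 hence "y = st (pol r t)" using st r by (simp add: stretching_pol)
 moreover have "pol r t : frontier (ball 0 r)" using r by (simp add: frontier_ball)
 ultimately have "y : st ` frontier (ball 0 r)" by blast
 thus ?thesis using True by (simp add: topological_degree_def)
next
 case False
 show ?thesis
  by (rule topological_degree_circle[OF r _ continuous_stretching stretching_pol False]) (use r rho_nonneg[of r] in auto)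
qed

text \<open>Both sides of the change of variables formula are \<open>pi * F r\<close>: the degree is
  the indicator of the disc of radius \<open>rho r\<close>, and the Jacobian is
  \<open>f\<close>.\<close>

lemma stretching_admissible:
 assumes p1: "p = 1"
 shows "admissible f st"
 unfolding admissible_def
proof (intro conjI AE_I2 impI)
 show s: "homog_sobolev 2 st" using stretching_sobolev p1 by simp
 show "solves f st" by (rule stretching_solves)
 show "contU st" by (rule continuous_stretching)
 fix r :: real assume r: "0 < r"
 have d: "(%y. real_of_int (topological_degree y st (ball 0 r))) = ind (ball 0 (rho r))"
  using stretching_degree[OF r] by (auto simp: fun_eq_iff indicator_def)
 have fin: "emeasure lebesgue (ball (0::real^2) (rho r)) < \<infinity>"
  using emeasure_bounded_finite[OF bounded_ball, of "0::real^2" "rho r"] by simp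
 show "integrable lebesgue (%y. real_of_int (topological_degree y st (ball 0 r)))"
  unfolding d by (rule integrable_real_indicator) (use fin in auto)
 have "(LINT y|lebesgue. real_of_int (topological_degree y st (ball 0 r))) = measure lebesgue (ball (0::real^2) (rho r))"
  unfolding d by simp
 also have "... = pi * F r" unfolding measure_ball_plane[OF rho_nonneg[OF less_imp_le[OF r]]] using rho_square[of r] r by simp
 also have "... = (LINT x:ball 0 r|lebesgue. f x)" by (rule fball[OF r, symmetric])
 also have "... = (LINT x:ball 0 r|lebesgue. weak_jacobian st x)"
  unfolding set_lebesgue_integral_def
 proof (rule integral_cong_AE)
  have S: "AE x in lebesgue. f x = weak_jacobian st x"
  using stretching_solves unfolding solves_def by eventually_elim simp
  have jm: "weak_jacobian st : borel_measurable lebesgue"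
  by (rule borel_measurable_AE[OF fm S])
  have b: "ball 0 r : sets (lebesgue :: (real^2) measure)" by simp
  show "(%x. ind (ball 0 r) x *\<^sub>R f x) : borel_measurable lebesgue" by (intro borel_measurable_scaleR borel_measurable_indicator b fm)
  show "(%x. ind (ball 0 r) x *\<^sub>R weak_jacobian st x) : borel_measurable lebesgue" by (intro borel_measurable_scaleR borel_measurable_indicator b jm)
  show "AE x in lebesgue. ind (ball 0 r) x *\<^sub>R f x = ind (ball 0 r) x *\<^sub>R weak_jacobian st x"
  using S by eventually_elim simp
 qed
 finally show "(LINT x:ball 0 r|lebesgue. weak_jacobian st x) = (LINT y|lebesgue. real_of_int (topological_degree y st (ball 0 r)))" by simp
qed

lemma stretching_admissible_minimiser:
 assumes p1: "p = 1"
 shows "admissible_minimiser f st"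
  "admissible_minimiser f u ==> eq_mod_rotation u st"
proof -
 have ad: "homog_sobolev (2 * p) v" "solves f v" if "admissible f v" for v using that p1 by (auto simp: admissible_def)
 have le: "energy 2 st <= energy 2 v" if "admissible f v" for v
  using energy_minimal(1)[OF ad[OF that]] p1 by simp
 show "admissible_minimiser f st"
  unfolding admissible_minimiser_def using stretching_admissible[OF p1] le by blast
 assume u: "admissible_minimiser f u"
 hence a: "admissible f u" and "energy 2 u <= energy 2 st"
  using stretching_admissible[OF p1] unfolding admissible_minimiser_def by blast+
 thus "eq_mod_rotation u st" using energy_minimal(2)[OF ad[OF a]] p1 by simp
qed

end

text \<open>Besides the passage to a Borel profile \<open>g0\<close>, the point is that
  \<open>2 * s * g0 s\<close> is integrable down to 0. This is local integrability of
  \<open>f\<close> in polar coordinates.\<close>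

lemma stretching_problem_exists:
 assumes p: "1 <= p" and f: "hardy_space p f" and fg: "radial_with_profile f g"
  and avg: "AE r in lebesgue. r > 0 -->
  \<bar>g r\<bar> <= (1 / measure lebesgue (ball (0::real^2) r)) * (LINT x:ball 0 r|lebesgue. f x)"
 obtains g0 F where "stretching_problem g0 F p f g"
proof -
 have li: "locally_integrable f" and H: "(nnint lebesgue (%x. ennreal_powr (grand_maximal f x) p)) < \<infinity>" using f by (simp_all add: hardy_space_def)
 obtain g0 where g0m [measurable]: "g0 : borel_fun" and g0: "AE r in radm. g0 r = g r" and f0: "AE x in lborel. f x = g0 (norm x)"
  by (rule borel_profile[OF li fg])
 have fm: "f : borel_measurable lebesgue" by (rule borel_version(1)[OF li])
 define F where "F r = (LINT s:{0..r}|lebesgue. 2 * s * g0 s)" for r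
 have e: "ind {0..} s *\<^sub>R (s * (ind A s * g0 s)) = 1/2 * (ind A s *\<^sub>R (2 * s * g0 s))" if "A \<subseteq> {0..}" for A s
  using that by (auto simp: indicator_def)
 have ball_int: "integrable lborel (%x::real^2. ind {..<r} (norm x) * g0 (norm x))" for r
 proof -
  have "set_integrable lebesgue (cball 0 r) f" using li unfolding locally_integrable_def by simp
  hence "set_integrable lebesgue (ball 0 r) f" by (rule set_integrable_subset) auto
  hence "integrable lebesgue (%x. ind (ball 0 r) x *\<^sub>R f x)" by (simp add: set_integrable_def)
  moreover have m: "(%x::real^2. ind {..<r} (norm x) * g0 (norm x)) : borel_fun" by measurable
  moreover have "AE x in lebesgue. ind (ball 0 r) x *\<^sub>R f x = ind {..<r} (norm x) * g0 (norm x)"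
  using AE_completion[OF f0] by eventually_elim (simp add: indicator_def)
  ultimately have "integrable lebesgue (%x::real^2. ind {..<r} (norm x) * g0 (norm x))"
  by (subst integrable_cong_AE[symmetric, where f="%x. ind (ball 0 r) x *\<^sub>R f x"]) (auto intro: measurable_completion dest: integrable_meas)
  thus ?thesis using m by (subst (asm) integrable_completion) auto
 qed
 have si0: "set_integrable lborel ({0..} \<inter> {..<r}) (%s. 2 * s * g0 s)" for r
 proof -
  have "set_integrable lborel {0..} (%s. s * (ind {..<r} s * g0 s))"
  by (rule iffD1[OF radial_integral(1) ball_int]) measurable
  hence i: "integrable lborel (%s. 2 * (ind {0..} s *\<^sub>R (s * (ind {..<r} s * g0 s))))" unfolding set_integrable_def by simp
  have e2: "2 * (ind {0..} s *\<^sub>R (s * (ind {..<r} s * g0 s))) = ind ({0..} \<inter> {..<r}) s *\<^sub>R (2 * s * g0 s)" for s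
  by (simp add: indicator_def)
  from i show ?thesis unfolding set_integrable_def e2 .
 qed
 have ai: "(%s. 2 * s * g0 s) absolutely_integrable_on {x..y}" if "0 <= x" for x y
 proof -
  have "set_integrable lborel {x..y} (%s. 2 * s * g0 s)" by (rule set_integrable_subset[OF si0[of "y + 1"]]) (use that in auto)
  thus ?thesis unfolding set_integrable_def by (subst integrable_completion) measurable
 qed
 have Fi: "F r = integral {0..r} (%s. 2 * s * g0 s)" for r
  unfolding F_def by (rule set_LINT(2)[OF ai[OF order_refl]])
 have F_int: "AC_on 0 R F (%s. 2 * s * g0 s)" for R
  unfolding AC_on_def
 proof (intro conjI allI impI)
  show "(%s. 2 * s * g0 s) absolutely_integrable_on {0..R}" by (rule ai) simp
  fix x y :: real assume xy: "0 <= x & x <= y & y <= R"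
  have "integral {0..x} (%s. 2 * s * g0 s) + integral {x..y} (%s. 2 * s * g0 s) = integral {0..y} (%s. 2 * s * g0 s)"
  by (rule HK_combine) (use xy set_LINT(1)[OF ai[OF order_refl]] in auto)
  thus "F y - F x = integral {x..y} (%s. 2 * s * g0 s)" by (simp add: Fi)
 qed
 have fball: "(LINT x:ball 0 r|lebesgue. f x) = pi * F r" if r: "0 < r" for r
 proof -
  have "(LINT x:ball 0 r|lebesgue. f x) = (LINT x|lebesgue. ind {..<r} (norm (x::real^2)) * g0 (norm x))"
  unfolding set_lebesgue_integral_def
  proof (rule integral_cong_AE)
  show "(%x. ind (ball 0 r) x *\<^sub>R f x) : borel_measurable lebesgue" by (intro borel_measurable_scaleR borel_measurable_indicator fm) simp
  show "(%x::real^2. ind {..<r} (norm x) * g0 (norm x)) : borel_measurable lebesgue" by (rule measurable_completion) measurable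
  show "AE x in lebesgue. ind (ball 0 r) x *\<^sub>R f x = ind {..<r} (norm x) * g0 (norm x)"
  using AE_completion[OF f0] by eventually_elim (simp add: indicator_def)
  qed
  also have "... = (LINT x|lborel. ind {..<r} (norm (x::real^2)) * g0 (norm x))" by (rule integral_completion) measurable
  also have "... = 2 * pi * (LINT s:{0..}|lborel. s * (ind {..<r} s * g0 s))"
  by (rule radial_integral(2)[OF _ ball_int]) measurable
  \<comment> \<open>The open ball gives a half-open interval of radii; the missing end point is a
    null set.\<close>
  also have "(LINT s:{0..}|lborel. s * (ind {..<r} s * g0 s)) = (LINT s|lborel. 1/2 * (ind {0..r} s *\<^sub>R (2 * s * g0 s)))"
  unfolding set_lebesgue_integral_def
  proof (rule integral_cong_AE)
  show "AE s in lborel. ind {0..} s *\<^sub>R (s * (ind {..<r} s * g0 s)) = 1/2 * (ind {0..r} s *\<^sub>R (2 * s * g0 s))"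
  using AE_lborel_singleton[of r] by eventually_elim (auto simp: indicator_def)
  qed measurable
  also have "... = 1/2 * (LINT s:{0..r}|lborel. 2 * s * g0 s)" unfolding set_lebesgue_integral_def by (rule integral_mult_right_zero)
  also have "(LINT s:{0..r}|lborel. 2 * s * g0 s) = F r"
  unfolding F_def set_lebesgue_integral_def by (rule integral_completion[symmetric]) measurable
  finally show ?thesis by simp
 qed
 have gl: "AE r in radm. \<bar>g0 r\<bar> <= F r / r\<^sup>2"
 proof -
  have "AE r in radm. \<bar>g r\<bar> <= (1 / measure lebesgue (ball (0::real^2) r)) * (LINT x:ball 0 r|lebesgue. f x)"
  using avg unfolding AE_completion_iff AE_radm_iff .
  moreover have "AE r in radm. 0 < r" by (simp add: AE_radm_iff)
  ultimately show ?thesis using g0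
  proof eventually_elim
  case (elim r)
  show ?case using elim(1) unfolding fball[OF elim(2)] measure_ball_plane[OF less_imp_le[OF elim(2)]] elim(3) using elim(2) by simp
  qed
 qed
 have sr: "stretch_radius g r = sqrt (F r)" if "0 <= r" for r
 proof -
  \<comment> \<open>\<open>g0\<close> and \<open>g\<close> agree at almost every positive radius,
    and the integrand is 0 at the end point 0, so the two radii coincide.\<close>
  have ae: "AE s in lebesgue. ind {0..r} s *\<^sub>R (2 * s * g0 s) = ind {0..r} s *\<^sub>R (2 * s * g s)"
  proof -
  have "AE s in lebesgue. 0 < s --> g0 s = g s" using g0 unfolding AE_radm_iff AE_completion_iff .
  thus ?thesis by eventually_elim (auto simp: indicator_def)
  qed
  have m: "(%s. ind {0..r} s *\<^sub>R (2 * s * g0 s)) : borel_measurable lebesgue" by (rule measurable_completion) measurable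
  show ?thesis unfolding stretch_radius_def F_def set_lebesgue_integral_def
  by (simp only: integral_cong_AE[OF m borel_measurable_AE[OF m ae] ae])
 qed
 have "stretching_problem g0 F p f g"
 proof
  show "F 0 = 0" by (simp add: Fi)
  show "AE x in lebesgue. f x = g0 (norm x)" by (rule AE_completion[OF f0])
 qed (rule g0m F_int gl p fm sr fball H; assumption?)+
 thus ?thesis by (rule that)
qed

theorem corollary2:
  fixes p :: real
  assumes "1 \<le> p"
  shows "\<exists>C::real. \<forall>(f :: real^2 \<Rightarrow> real) (g :: real \<Rightarrow> real).
    hardy_space p f \<and> radial_with_profile f g \<and>
    (AE r in lebesgue. r > 0 \<longrightarrow>
       \<bar>g r\<bar> \<le> (1 / measure lebesgue (ball (0::real^2) r)) * (LINT x:ball 0 r|lebesgue. f x))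
    \<longrightarrow>
    homog_sobolev (2 * p) (radial_stretching g) \<and>
    (grad_norm (2 * p) (radial_stretching g))\<^sup>2 \<le> C * hardy_norm p f \<and>
    (p > 1 \<longrightarrow>
       energy_minimiser (2 * p) f (radial_stretching g) \<and>
       (\<forall>u. energy_minimiser (2 * p) f u \<longrightarrow> eq_mod_rotation u (radial_stretching g))) \<and>
    (p = 1 \<longrightarrow>
       admissible_minimiser f (radial_stretching g) \<and>
       (\<forall>u. admissible_minimiser f u \<longrightarrow> eq_mod_rotation u (radial_stretching g)))"
\<comment> \<open>The witness depends neither on \<open>f\<close> nor on \<open>p\<close>, since
  \<open>hardy_norm\<close> is built from the same maximal function for all
  \<open>p\<close>.\<close>
proof (intro exI[of _ "2 * hardy_const"] allI impI)
  fix f g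
  assume h: "hardy_space p f \<and> radial_with_profile f g \<and>
    (AE r in lebesgue. r > 0 \<longrightarrow>
       \<bar>g r\<bar> \<le> (1 / measure lebesgue (ball (0::real^2) r)) * (LINT x:ball 0 r|lebesgue. f x))"
  obtain g0 F where "stretching_problem g0 F p f g"
    by (rule stretching_problem_exists[OF assms conjunct1[OF h] conjunct1[OF conjunct2[OF h]] conjunct2[OF conjunct2[OF h]]])
  then interpret stretching_problem g0 F p f g .
  show "homog_sobolev (2 * p) (radial_stretching g) \<and>
    (grad_norm (2 * p) (radial_stretching g))\<^sup>2 \<le> 2 * hardy_const * hardy_norm p f \<and>
    (p > 1 \<longrightarrow>
       energy_minimiser (2 * p) f (radial_stretching g) \<and>
       (\<forall>u. energy_minimiser (2 * p) f u \<longrightarrow> eq_mod_rotation u (radial_stretching g))) \<and>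
    (p = 1 \<longrightarrow>
       admissible_minimiser f (radial_stretching g) \<and>
       (\<forall>u. admissible_minimiser f u \<longrightarrow> eq_mod_rotation u (radial_stretching g)))"
    using stretching_sobolev stretching_grad_norm stretching_minimiser stretching_admissible_minimiser by simp
qed

end
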